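(* Let $m\in\mathbb{N}$, let $x_0<0$, and fix $R>0$. Then for any $k\in\mathbb{N}$, $$\limsup_{t\to\infty}\Big(\log^k(t)\,\sup_{u_0,u_1}\frac{E_R^{1/2}[u](t)}{\|(u_0,u_1)\|_{D(B^k)}}\Big)>0,$$ where the supremum is over all (not both zero) $u_0,u_1\in C^\infty(M_{x_0})$ supported in $\{x_0\le x<R\}$ that vanish when $x=x_0$, and where $u$ denotes the solution of $$\Box_{\mathfrak g}u=0\ \text{ on }\mathbb{R}_+\times\{x\ge x_0\}\times\mathbb{S}^2,\qquad u(t,x_0,\omega)=0,\qquad u(0,\cdot)=u_0,\quad\partial_tu(0,\cdot)=u_1 .$$
   Context: Let $m\in\mathbb{N}$, $m\ge1$, $a(x)=(x^{2m}+1)^{1/(2m)}$, and let $(\mathbb{S}^2,d\sigma^2_{\mathbb{S}^2})$ be the round unit sphere. $M_{x_0}$ denotes $(x_0,\infty)\times\mathbb{S}^2$ with metric $dx^2+a(x)^2\,d\sigma_{\mathbb{S}^2}^2$ and volume form $dV=a(x)^2\,dx\,d\sigma_{\mathbb{S}^2}$; spatial $L^2$ norms are with respect to $dV$. Its Laplacian is $\Delta_{\mathfrak g}u=a(x)^{-2}\partial_x[a(x)^2\partial_xu]+a(x)^{-2}\Delta_{\mathbb{S}^2}u$, and $\Box_{\mathfrak g}=-\partial_t^2+\Delta_{\mathfrak g}$. $\nabla_0$ denotes the gradient tangent to the unit sphere, and $|\nabla_{\mathfrak g}f|^2=|\partial_xf|^2+a(x)^{-2}|\nabla_0f|^2$.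 The local energy is $$E_R[u](t)=\tfrac12\int_{x_0\le x\le R}|\partial_tu|^2+|\partial_xu|^2+a(x)^{-2}|\nabla_0u|^2\,dV .$$ Here $C^\infty(M_{x_0})$ means (complex-valued) functions smooth up to the boundary $\{x=x_0\}$. $\dot H^1_0(M_{x_0})$ is the completion of smooth functions compactly supported in the open set $(x_0,\infty)\times\mathbb{S}^2$ in the norm $\|\nabla_{\mathfrak g}f\|_{L^2(M_{x_0})}$. Set $H_{x_0}=\dot H_0^1(M_{x_0})\oplus L^2(M_{x_0})$ and $$B=\begin{bmatrix}0&iI\\ i\Delta_{\mathfrak g}&0\end{bmatrix},\qquad \|(u_0,u_1)\|_{D(B^k)}=\|(u_0,u_1)\|_{H_{x_0}}+\|B^k(u_0,u_1)\|_{H_{x_0}} .$$ $B$ is regarded as an unbounded operator on $H_{x_0}$ with Dirichlet boundary conditions, i.e. with domain $\{(u_0,u_1)\in H_{x_0}:\Delta_{\mathfrak g}u_0\in L^2(M_{x_0}),\ u_1\in\dot H^1_0(M_{x_0})\cap L^2(M_{x_0})\}$; if $(u_0,u_1)$ is not in the domain of $B^k$, then $\|(u_0,u_1)\|_{D(B^k)}$ is taken to be $+\infty$ (and the quotient to be $0$). *)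

theory Defs
  imports "HOL-Analysis.Analysis"
begin

section \<open>Functions on the warped product\<close>

text \<open>
  The manifold is the subset \<open>{x0<..} \<times> sphere 0 1\<close> of \<open>real \<times> real^3\<close>.  Functions on it are
  total functions on \<open>real \<times> real^3\<close>; their values off the manifold never matter.
\<close>

type_synonym point = "real \<times> (real^3)"
type_synonym state = "(point \<Rightarrow> complex) \<times> (point \<Rightarrow> complex)"

abbreviation S2 :: "(real^3) set" where
  "S2 \<equiv> sphere 0 1"

definition warp :: "nat \<Rightarrow> real \<Rightarrow> real" where
  "warp m x = root (2 * m) (x ^ (2 * m) + 1)"

fun C_k :: "nat \<Rightarrow> 'a::euclidean_space set \<Rightarrow> ('a \<Rightarrow> 'b::real_normed_vector) \<Rightarrow> bool" where
  "C_k 0 U f \<longleftrightarrow> continuous_on U f"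
| "C_k (Suc n) U f \<longleftrightarrow>
     (\<exists>D. (\<forall>p\<in>U. (f has_derivative D p) (at p)) \<and> (\<forall>v. C_k n U (\<lambda>p. D p v)))"

text \<open>Smoothness up to the boundary \<open>x = x0\<close> is smooth extendibility to an open neighbourhood
  of the closed manifold in the ambient space.\<close>

definition smooth_on_M :: "real \<Rightarrow> (point \<Rightarrow> complex) \<Rightarrow> bool" where
  "smooth_on_M x0 f \<longleftrightarrow>
     (\<exists>U g. open U \<and> {x0..} \<times> S2 \<subseteq> U \<and> (\<forall>n. C_k n U g) \<and> (\<forall>p\<in>{x0..} \<times> S2. g p = f p))"

definition supp_M :: "real \<Rightarrow> (point \<Rightarrow> complex) \<Rightarrow> point set" where
  "supp_M x0 f = closure {p \<in> {x0..} \<times> S2. f p \<noteq> 0}"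

definition test_fun :: "real \<Rightarrow> (point \<Rightarrow> complex) \<Rightarrow> bool" where
  "test_fun x0 \<phi> \<longleftrightarrow>
     smooth_on_M x0 \<phi> \<and> compact (supp_M x0 \<phi>) \<and> supp_M x0 \<phi> \<subseteq> {x0<..} \<times> S2"

definition initial_datum :: "real \<Rightarrow> real \<Rightarrow> (point \<Rightarrow> complex) \<Rightarrow> bool" where
  "initial_datum x0 R f \<longleftrightarrow>
     smooth_on_M x0 f \<and> supp_M x0 f \<subseteq> {x0..<R} \<times> S2 \<and> (\<forall>\<omega>\<in>S2. f (x0, \<omega>) = 0)"


section \<open>Classical differential operators\<close>

definition dx :: "(point \<Rightarrow> complex) \<Rightarrow> point \<Rightarrow> complex" where
  "dx f = (\<lambda>(x, \<omega>). vector_derivative (\<lambda>s. f (s, \<omega>)) (at x))"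

text \<open>
  The gradient and Laplacian of the unit sphere are those of the extension \<open>y \<mapsto> f (x, y / |y|)\<close>
  (homogeneous of degree 0) in Euclidean 3-space, evaluated on the sphere.  This gradient is
  automatically tangential.
\<close>

definition sphere_grad :: "(point \<Rightarrow> complex) \<Rightarrow> point \<Rightarrow> complex^3" where
  "sphere_grad f = (\<lambda>(x, \<omega>).
     \<chi> i. vector_derivative (\<lambda>s. f (x, sgn (\<omega> + s *\<^sub>R axis i 1))) (at 0))"

definition sphere_laplacian :: "(point \<Rightarrow> complex) \<Rightarrow> point \<Rightarrow> complex" where
  "sphere_laplacian f = (\<lambda>(x, \<omega>).
     \<Sum>i\<in>UNIV. vector_derivative
       (\<lambda>r. vector_derivative (\<lambda>s. f (x, sgn (\<omega> + s *\<^sub>R axis i 1))) (at r)) (at 0))"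

text \<open>The norm of \<open>grad m f p\<close> in the product space \<open>complex \<times> complex^3\<close> is the length of the
  Riemannian gradient of the warped product metric.\<close>

definition grad :: "nat \<Rightarrow> (point \<Rightarrow> complex) \<Rightarrow> point \<Rightarrow> complex \<times> (complex^3)" where
  "grad m f = (\<lambda>(x, \<omega>). (dx f (x, \<omega>), inverse (warp m x) *\<^sub>R sphere_grad f (x, \<omega>)))"

definition classical_laplacian :: "nat \<Rightarrow> (point \<Rightarrow> complex) \<Rightarrow> point \<Rightarrow> complex" where
  "classical_laplacian m f = (\<lambda>(x, \<omega>).
     inverse ((warp m x)\<^sup>2) *\<^sub>R
       vector_derivative (\<lambda>s. (warp m s)\<^sup>2 *\<^sub>R dx f (s, \<omega>)) (at x)
     + inverse ((warp m x)\<^sup>2) *\<^sub>R sphere_laplacian f (x, \<omega>))"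


section \<open>Volume and \<open>L\<^sup>2\<close>\<close>

text \<open>Surface measure of the unit sphere as normalized cone measure: the area of \<open>A\<close> is three
  times the volume of the cone \<open>{r \<omega> | 0 < r < 1, \<omega> \<in> A}\<close>.\<close>

definition sphere_measure :: "(real^3) measure" where
  "sphere_measure =
     scale_measure 3 (distr (restrict_space lborel (ball 0 1 - {0})) (restrict_space borel S2) sgn)"

text \<open>The Riemannian volume on \<open>I \<times> S2\<close>.  The space of this measure is exactly \<open>I \<times> S2\<close>.\<close>

definition vol :: "nat \<Rightarrow> real set \<Rightarrow> point measure" where
  "vol m I = density (restrict_space lborel I \<Otimes>\<^sub>M sphere_measure)
     (\<lambda>(x, \<omega>). ennreal ((warp m x)\<^sup>2))"

abbreviation volM :: "nat \<Rightarrow> real \<Rightarrow> point measure" where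
  "volM m x0 \<equiv> vol m {x0<..}"

definition in_L2 :: "'a measure \<Rightarrow> ('a \<Rightarrow> 'b::real_normed_vector) \<Rightarrow> bool" where
  "in_L2 M f \<longleftrightarrow> f \<in> borel_measurable M \<and> integrable M (\<lambda>p. (norm (f p))\<^sup>2)"

definition L2_norm :: "'a measure \<Rightarrow> ('a \<Rightarrow> 'b::real_normed_vector) \<Rightarrow> real" where
  "L2_norm M f = sqrt (\<integral>p. (norm (f p))\<^sup>2 \<partial>M)"


section \<open>The energy space\<close>

text \<open>
  By the Poincare inequality on \<open>{x0<..<r} \<times> S2\<close> for functions vanishing at \<open>x0\<close>, a sequence of test
  functions that is Cauchy in the gradient norm converges in \<open>L\<^sup>2\<close> of each such set, and the limit
  function determines the element of the completion.  Elements of the completion are therefore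
  represented by their limit functions \<open>f\<close> (modulo null sets); \<open>G\<close> is the limit of the gradients,
  so that the norm of \<open>f\<close> in the completion is the \<open>L\<^sup>2\<close> norm of \<open>G\<close>.
\<close>

definition has_grad :: "nat \<Rightarrow> real \<Rightarrow> (point \<Rightarrow> complex) \<Rightarrow> (point \<Rightarrow> complex \<times> (complex^3)) \<Rightarrow> bool" where
  "has_grad m x0 f G \<longleftrightarrow>
     f \<in> borel_measurable (volM m x0) \<and>
     (\<forall>r>x0. in_L2 (vol m {x0<..<r}) f) \<and>
     in_L2 (volM m x0) G \<and>
     (\<exists>\<phi>. (\<forall>n. test_fun x0 (\<phi> n)) \<and>
          (\<lambda>n. L2_norm (volM m x0) (\<lambda>p. grad m (\<phi> n) p - G p)) \<longlonglongrightarrow> 0 \<and>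
          (\<forall>r>x0. (\<lambda>n. L2_norm (vol m {x0<..<r}) (\<lambda>p. \<phi> n p - f p)) \<longlonglongrightarrow> 0))"

definition H1_0 :: "nat \<Rightarrow> real \<Rightarrow> (point \<Rightarrow> complex) set" where
  "H1_0 m x0 = {f. \<exists>G. has_grad m x0 f G}"

text \<open>The limit gradient is unique up to null sets.\<close>

definition weak_grad :: "nat \<Rightarrow> real \<Rightarrow> (point \<Rightarrow> complex) \<Rightarrow> point \<Rightarrow> complex \<times> (complex^3)" where
  "weak_grad m x0 f = (SOME G. has_grad m x0 f G)"

definition energy_space :: "nat \<Rightarrow> real \<Rightarrow> state set" where
  "energy_space m x0 = {(u0, u1). u0 \<in> H1_0 m x0 \<and> in_L2 (volM m x0) u1}"

definition energy_norm :: "nat \<Rightarrow> real \<Rightarrow> state \<Rightarrow> real" where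
  "energy_norm m x0 = (\<lambda>(u0, u1).
     sqrt ((L2_norm (volM m x0) (weak_grad m x0 u0))\<^sup>2 + (L2_norm (volM m x0) u1)\<^sup>2))"


section \<open>The generator and its powers\<close>

definition has_laplacian :: "nat \<Rightarrow> real \<Rightarrow> (point \<Rightarrow> complex) \<Rightarrow> (point \<Rightarrow> complex) \<Rightarrow> bool" where
  "has_laplacian m x0 u f \<longleftrightarrow>
     in_L2 (volM m x0) f \<and>
     (\<forall>\<phi>. test_fun x0 \<phi> \<longrightarrow>
        (\<integral>p. u p * classical_laplacian m \<phi> p \<partial>volM m x0) = (\<integral>p. f p * \<phi> p \<partial>volM m x0))"

text \<open>The distributional Laplacian, when it is in \<open>L\<^sup>2\<close>; it is unique up to null sets.\<close>

definition laplacian :: "nat \<Rightarrow> real \<Rightarrow> (point \<Rightarrow> complex) \<Rightarrow> point \<Rightarrow> complex" where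
  "laplacian m x0 u = (SOME f. has_laplacian m x0 u f)"

definition dom_B :: "nat \<Rightarrow> real \<Rightarrow> state set" where
  "dom_B m x0 = {(u0, u1) \<in> energy_space m x0.
     (\<exists>f. has_laplacian m x0 u0 f) \<and> u1 \<in> H1_0 m x0}"

definition B_op :: "nat \<Rightarrow> real \<Rightarrow> state \<Rightarrow> state" where
  "B_op m x0 = (\<lambda>(u0, u1). ((\<lambda>p. \<i> * u1 p), (\<lambda>p. \<i> * laplacian m x0 u0 p)))"

fun dom_B_pow :: "nat \<Rightarrow> real \<Rightarrow> nat \<Rightarrow> state set" where
  "dom_B_pow m x0 0 = energy_space m x0"
| "dom_B_pow m x0 (Suc k) = {U \<in> dom_B m x0. B_op m x0 U \<in> dom_B_pow m x0 k}"

definition graph_norm :: "nat \<Rightarrow> real \<Rightarrow> nat \<Rightarrow> state \<Rightarrow> ennreal" where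
  "graph_norm m x0 k U =
     (if U \<in> dom_B_pow m x0 k
      then ennreal (energy_norm m x0 U + energy_norm m x0 ((B_op m x0 ^^ k) U))
      else \<infinity>)"


section \<open>Solutions and local energy\<close>

text \<open>
  Initial data that vanish at \<open>x = x0\<close> lie in the domain of the generator but need not satisfy the
  higher compatibility conditions at the boundary, so the solution is in general not smooth up to
  the boundary.  It is the strong solution: \<open>u t\<close> has time derivative \<open>v t\<close>, and \<open>v t\<close> has time
  derivative \<open>laplacian m x0 (u t)\<close>, in the norm of the energy space; equivalently \<open>U = (u, v)\<close>
  satisfies \<open>U' = - \<i> B U\<close>.  The boundary condition is contained in the domain of the generator.
  At \<open>t = 0\<close> the derivative is one-sided.
\<close>

definition wave_solution ::
  "nat \<Rightarrow> real \<Rightarrow> (point \<Rightarrow> complex) \<Rightarrow> (point \<Rightarrow> complex) \<Rightarrow>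
   (real \<Rightarrow> point \<Rightarrow> complex) \<Rightarrow> (real \<Rightarrow> point \<Rightarrow> complex) \<Rightarrow> bool" where
  "wave_solution m x0 u0 u1 u v \<longleftrightarrow>
     (AE p in volM m x0. u 0 p = u0 p \<and> v 0 p = u1 p) \<and>
     (\<forall>t\<ge>0. (u t, v t) \<in> dom_B m x0 \<and>
        ((\<lambda>s. energy_norm m x0
            ((\<lambda>p. (u s p - u t p) /\<^sub>R (s - t) - v t p),
             (\<lambda>p. (v s p - v t p) /\<^sub>R (s - t) - laplacian m x0 (u t) p)))
          \<longlongrightarrow> 0) (at t within {0..}))"

text \<open>The null set \<open>x = x0\<close> is left out of the domain of integration because \<open>weak_grad\<close> carries
  no information there.\<close>

definition local_energy ::
  "nat \<Rightarrow> real \<Rightarrow> real \<Rightarrow> (point \<Rightarrow> complex) \<Rightarrow> (point \<Rightarrow> complex) \<Rightarrow> real" where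
  "local_energy m x0 R u ut =
     1 / 2 * (\<integral>p. (cmod (ut p))\<^sup>2 + (norm (weak_grad m x0 u p))\<^sup>2 \<partial>vol m {x0<..R})"

text \<open>The supremum ranges over data together with the solution they generate.\<close>

definition data_solutions ::
  "nat \<Rightarrow> real \<Rightarrow> real \<Rightarrow> ((point \<Rightarrow> complex) \<times> (point \<Rightarrow> complex) \<times>
     (real \<Rightarrow> point \<Rightarrow> complex) \<times> (real \<Rightarrow> point \<Rightarrow> complex)) set" where
  "data_solutions m x0 R =
     {(u0, u1, u, ut).
        initial_datum x0 R u0 \<and> initial_datum x0 R u1 \<and>
        (\<exists>p\<in>{x0..} \<times> S2. u0 p \<noteq> 0 \<or> u1 p \<noteq> 0) \<and>
        wave_solution m x0 u0 u1 u ut}"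

end

theory Submission
  imports Defs
begin

text \<open>
  For \<open>x < 0\<close> the radius \<open>a(x)\<close> of the spherical slices grows towards the boundary \<open>x = x0\<close>, so rays
  that are nearly tangent to the slices are pushed back to the wall, are reflected there, and stay near it:
  whispering gallery waves.  Such waves leak only through a barrier at the throat \<open>x = 0\<close>, at a rate that is
  exponentially small in the angular frequency \<open>n\<close>.  Logarithmic decay is the trace of this on the whole class of data.

  Take the spherical harmonic \<open>Y = (w1 + i w2)^(2n)\<close>, whose eigenvalue is \<open>L = 2n(2n+1)\<close>.  For \<open>u = (v / a) Y\<close> the wave
  equation becomes \<open>v_tt = v_xx - V v\<close> on \<open>x >= x0\<close>, \<open>v(x0) = 0\<close>, with \<open>V = L / a^2 + a'' / a\<close>.  Write \<open>A = V - d^2/dx^2\<close>.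
  A Sturm and continuity argument (\<open>eigenvalue_exists\<close>) gives an energy \<open>E\<close> of size \<open>L\<close> below the barrier
  for which a solution of \<open>A w = E w\<close> vanishes at \<open>x0\<close> and at the throat; below the barrier it decays
  exponentially towards the throat.  Cutting it off there gives (\<open>quasimodes\<close>) a function \<open>w\<close> supported in \<open>[x0,0]\<close> with
  \<open>A w = E w + O(exp(-cn))\<close> and \<open>A^j w = O(E^j)\<close>, relative to the \<open>L2\<close> norm \<open>N\<close> of \<open>w\<close>.

  The datum is \<open>u0 = (w / a) Y\<close>, \<open>u1 = 0\<close>.  As \<open>B^2\<close> acts as \<open>A\<close>, its graph norm is at most a constant times \<open>E^((k+1)/2) N\<close>
  (\<open>graph_norm_bound\<close>).  The pair \<open>sqrt E <w,v>, <w,v_t>\<close> rotates with angular velocity \<open>sqrt E\<close> up to an exponentially small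
  error, so it keeps most of its length, hence the local energy stays above a constant times \<open>E N^2\<close>,
  until \<open>t = exp(c n / 4)\<close> (\<open>wave_lower_bound\<close>).  At this time the quotient is at least a constant times
  \<open>E^(-k/2)\<close>, that is \<open>n^(-k)\<close>, that is \<open>(ln t)^(-k)\<close>.

  The rest relates these explicit functions to the abstract objects.  Green's formula (\<open>green\<close>) and the density of test
  functions (\<open>AE_zero_of_test\<close>) show that weak gradients and Laplacians are unique, so that it suffices to exhibit them:
  \<open>has_grad_mode\<close> and \<open>has_laplacian_mode\<close>.  The one-dimensional wave equation is solved in \<open>wave_exists\<close>.
\<close>

section \<open>Smooth functions\<close>

abbreviation has_d :: "(real => real) => real => real => bool" where
 "has_d f d x \<equiv> (f has_real_derivative d) (at x)"

abbreviation jcont :: "('a::topological_space => 'b::topological_space => real) => bool" where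
 "jcont f \<equiv> continuous_on UNIV (%(t, x). f t x)"

abbreviation nsq :: "point => real" where
 "nsq p \<equiv> snd p \<bullet> snd p"

lemmas BI_integrable_add = Bochner_Integration.integrable_add and BI_integrable_bound = Bochner_Integration.integrable_bound and BI_integrable_cong = Bochner_Integration.integrable_cong and BI_integrable_sum = Bochner_Integration.integrable_sum and BI_integral_add = Bochner_Integration.integral_add and BI_integral_cong = Bochner_Integration.integral_cong and BI_integral_mult_right_zero = Bochner_Integration.integral_mult_right_zero and BI_integral_sum = Bochner_Integration.integral_sum

lemmas HK_cong = Henstock_Kurzweil_Integration.integral_cong and HK_mult_right = Henstock_Kurzweil_Integration.integral_mult_right
 and HK_add = Henstock_Kurzweil_Integration.integral_add and HK_diff = Henstock_Kurzweil_Integration.integral_diff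
 and HK_combine = Henstock_Kurzweil_Integration.integral_combine

lemma C_k_SucI:
 assumes "!!p. p : U ==> (f has_derivative D p) (at p)" "!!v. C_k n U (%p. D p v)"
 shows "C_k (Suc n) U f"
 using assms by auto

lemma C_k_Suc_ex:
 "C_k (Suc n) U f ==>
  EX D. (\<forall>p\<in>U. (f has_derivative D p) (at p)) & (ALL v. C_k n U (%p. D p v))"
 by simp

lemma C_k_mono:
 assumes "C_k n U f" "V \<subseteq> U"
 shows "C_k n V f"
 using assms(1)
proof (induction n arbitrary: f)
 case 0
 thus ?case using assms(2) by (auto intro: continuous_on_subset)
next
 case (Suc n)
 from C_k_Suc_ex[OF Suc.prems] obtain D where D: "!!p. p : U ==> (f has_derivative D p) (at p)"
  "!!v. C_k n U (%p. D p v)" by blast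
 show ?case using D Suc.IH assms(2) by (intro C_k_SucI[where D=D]) auto
qed

lemma C_k_cong:
 assumes "open U" "!!p. p : U ==> f p = g p" "C_k n U f"
 shows "C_k n U g"
proof (cases n)
 case 0
 thus ?thesis using assms by (auto cong: continuous_on_cong)
next
 case (Suc k)
 from C_k_Suc_ex[OF assms(3)[unfolded Suc]] obtain D where D: "!!p. p : U ==> (f has_derivative D p) (at p)"
  "!!v. C_k k U (%p. D p v)" by blast
 show ?thesis unfolding Suc
 proof (rule C_k_SucI)
  show "(g has_derivative D p) (at p)" if "p : U" for p
   by (rule has_derivative_transform_within_open[OF D(1)[OF that] assms(1) that]) (use assms(2) in auto)
 qed (rule D)
qed

lemma C_k_SucD: "C_k (Suc n) U f ==> C_k n U f"
proof (induction n arbitrary: f)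
 case 0
 from C_k_Suc_ex[OF 0] obtain D where "!!p. p : U ==> (f has_derivative D p) (at p)" by blast
 thus ?case
  by (auto intro!: continuous_at_imp_continuous_on has_derivative_continuous)
next
 case (Suc n)
 from C_k_Suc_ex[OF Suc.prems] obtain D where D: "!!p. p : U ==> (f has_derivative D p) (at p)"
  "!!v. C_k (Suc n) U (%p. D p v)" by blast
 show ?case using D Suc.IH by (intro C_k_SucI[where D=D]) auto
qed

lemma C_k_le: "C_k n U f ==> k <= n ==> C_k k U f"
proof (induction n)
 case (Suc n)
 thus ?case using C_k_SucD[of n U f] by (cases "k = Suc n") auto
qed auto

lemma C_k_continuous: "C_k n U f ==> continuous_on U f"
 using C_k_le[of n U f 0] by simp

lemma C_k_const [simp]: "C_k n U (%p. c)"
proof (induction n arbitrary: c)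
 case (Suc n)
 show ?case by (rule C_k_SucI[where D="%p v. 0"]) (auto simp: Suc)
qed auto

lemma C_k_bounded_linear:
 assumes "bounded_linear f"
 shows "C_k n U f"
proof (cases n)
 case 0
 thus ?thesis using assms by (simp add: linear_continuous_on)
next
 case (Suc k)
 show ?thesis unfolding Suc
  by (rule C_k_SucI[where D="%p. f"]) (auto intro: bounded_linear_imp_has_derivative assms)
qed

lemma C_k_compose_linear:
 assumes "bounded_linear h" "C_k n U f"
 shows "C_k n U (%p. h (f p))"
 using assms(2)
proof (induction n arbitrary: f)
 case 0
 thus ?case by (auto intro: bounded_linear.continuous_on[OF assms(1)])
next
 case (Suc n)
 from C_k_Suc_ex[OF Suc.prems] obtain D where D: "!!p. p : U ==> (f has_derivative D p) (at p)"
  "!!v. C_k n U (%p. D p v)" by blast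
 show ?case
  by (rule C_k_SucI[where D="%p v. h (D p v)"])
    (auto intro: bounded_linear.has_derivative[OF assms(1) D(1)] Suc.IH D(2))
qed

lemma C_k_add:
 assumes "C_k n U f" "C_k n U g"
 shows "C_k n U (%p. f p + g p)"
 using assms
proof (induction n arbitrary: f g)
 case 0
 thus ?case by (auto intro: continuous_on_add)
next
 case (Suc n)
 from C_k_Suc_ex[OF Suc.prems(1)] obtain D where D: "!!p. p : U ==> (f has_derivative D p) (at p)"
  "!!v. C_k n U (%p. D p v)" by blast
 from C_k_Suc_ex[OF Suc.prems(2)] obtain E where E: "!!p. p : U ==> (g has_derivative E p) (at p)"
  "!!v. C_k n U (%p. E p v)" by blast
 show ?case
  by (rule C_k_SucI[where D="%p v. D p v + E p v"]) (auto intro: has_derivative_add D E Suc.IH)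
qed

lemma C_k_bilinear:
 assumes "bounded_bilinear pr" "C_k n U f" "C_k n U g"
 shows "C_k n U (%p. pr (f p) (g p))"
 using assms(2,3)
proof (induction n arbitrary: f g)
 case 0
 thus ?case by (auto intro: bounded_bilinear.continuous_on[OF assms(1)])
next
 case (Suc n)
 from C_k_Suc_ex[OF Suc.prems(1)] obtain D where D: "!!p. p : U ==> (f has_derivative D p) (at p)"
  "!!v. C_k n U (%p. D p v)" by blast
 from C_k_Suc_ex[OF Suc.prems(2)] obtain E where E: "!!p. p : U ==> (g has_derivative E p) (at p)"
  "!!v. C_k n U (%p. E p v)" by blast
 show ?case
  by (rule C_k_SucI[where D="%p v. pr (f p) (E p v) + pr (D p v) (g p)"])
    (auto intro!: bounded_bilinear.FDERIV[OF assms(1)] C_k_add D E Suc.IH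
       C_k_SucD[OF Suc.prems(1)] C_k_SucD[OF Suc.prems(2)])
qed

lemmas C_k_mult = C_k_bilinear[OF bounded_bilinear_mult]
lemmas C_k_scaleR = C_k_bilinear[OF bounded_bilinear_scaleR]
lemmas C_k_inner = C_k_bilinear[OF bounded_bilinear_inner]

lemma C_k_uminus: "C_k n U f ==> C_k n U (%p. - f p)"
 by (rule C_k_compose_linear[OF bounded_linear_minus[OF bounded_linear_ident]])

lemma C_k_diff: "C_k n U f ==> C_k n U g ==> C_k n U (%p. f p - g p)"
 using C_k_add[of n U f "%p. - g p"] C_k_uminus[of n U g] by simp

lemma C_k_sum: "(!!i. i : I ==> C_k n U (f i)) ==> C_k n U (%p. \<Sum>i\<in>I. f i p)"
 by (induction I rule: infinite_finite_induct) (auto intro: C_k_add)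

lemma C_k_prod:
 fixes f :: "'i => 'a::euclidean_space => 'b::real_normed_field"
 shows "(!!i. i : I ==> C_k n U (f i)) ==> C_k n U (%p. \<Prod>i\<in>I. f i p)"
 by (induction I rule: infinite_finite_induct) (auto intro: C_k_mult)

lemma C_k_power:
 fixes f :: "'a::euclidean_space => 'b::real_normed_field"
 shows "C_k n U f ==> C_k n U (%p. f p ^ k)"
 by (induction k) (auto intro: C_k_mult)

text \<open>The derivative of \<open>f o g\<close> in direction \<open>v\<close> is \<open>Df(g p)(Dg p v)\<close>, where the
  direction varies with \<open>p\<close>; expanding it in a basis reduces the induction step to sums of products.\<close>
lemma C_k_compose:
 fixes f :: "'b::euclidean_space => 'c::real_normed_vector"
 assumes "C_k n V f" "C_k n U g" "g ` U \<subseteq> V"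
 shows "C_k n U (%p. f (g p))"
 using assms(1,2)
proof (induction n arbitrary: f)
 case 0
 thus ?case using assms(3) by (auto intro: continuous_on_compose2)
next
 case (Suc n)
 from C_k_Suc_ex[OF Suc.prems(1)] obtain D where D: "!!p. p : V ==> (f has_derivative D p) (at p)"
  "!!v. C_k n V (%p. D p v)" by blast
 from C_k_Suc_ex[OF Suc.prems(2)] obtain E where E: "!!p. p : U ==> (g has_derivative E p) (at p)"
  "!!v. C_k n U (%p. E p v)" by blast
 have lin: "linear (D (g p))" if "p : U" for p
  using D(1)[of "g p"] that assms(3) by (auto intro: has_derivative_linear)
 show ?case
 proof (rule C_k_SucI)
  show "((%p. f (g p)) has_derivative
    (%v. \<Sum>b\<in>Basis. (E p v \<bullet> b) *\<^sub>R D (g p) b)) (at p)" if p: "p : U" for p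
  proof -
   have "((%p. f (g p)) has_derivative (%v. D (g p) (E p v))) (at p)"
    using has_derivative_compose[OF E(1)[OF p] D(1)] p assms(3) by auto
   moreover have "D (g p) (E p v) = (\<Sum>b\<in>Basis. (E p v \<bullet> b) *\<^sub>R D (g p) b)" for v
    by (subst euclidean_representation[of "E p v", symmetric])
      (simp add: linear_sum[OF lin[OF p]] linear_scale[OF lin[OF p]])
   ultimately show ?thesis by simp
  qed
  show "C_k n U (%p. \<Sum>b\<in>Basis. (E p v \<bullet> b) *\<^sub>R D (g p) b)" for v
   by (intro C_k_sum C_k_scaleR C_k_compose_linear[OF bounded_linear_inner_left] E(2)
      Suc.IH D(2) C_k_SucD[OF Suc.prems(2)])
 qed
qed

lemma C_k_real_Suc:
 fixes f :: "real => 'b::real_normed_vector"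
 assumes "!!x. x : U ==> (f has_vector_derivative f' x) (at x)" "C_k n U f'"
 shows "C_k (Suc n) U f"
 by (rule C_k_SucI[where D="%x v. v *\<^sub>R f' x"])
   (use assms in "auto simp: has_vector_derivative_def intro!: C_k_compose_linear[OF bounded_linear_scaleR_right]")

lemma C_k_real_SucE:
 fixes f :: "real => 'b::real_normed_vector"
 assumes "C_k (Suc n) U f"
 obtains f' where "!!x. x : U ==> (f has_vector_derivative f' x) (at x)" "C_k n U f'"
proof -
 from C_k_Suc_ex[OF assms] obtain D where D: "!!p. p : U ==> (f has_derivative D p) (at p)"
  "!!v. C_k n U (%p. D p v)" by blast
 show ?thesis
 proof (rule that)
  show "(f has_vector_derivative D x 1) (at x)" if "x : U" for x
   using D(1)[OF that] has_derivative_linear[OF D(1)[OF that]]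
   by (simp add: has_vector_derivative_def linear_scale[symmetric])
 qed (rule D(2))
qed

lemma C_k_powr: "C_k n {0<..} (%x::real. x powr r)"
proof (induction n arbitrary: r)
 case 0
 show ?case by (auto intro!: continuous_intros)
next
 case (Suc n)
 show ?case
 proof (rule C_k_real_Suc)
  show "((%x. x powr r) has_vector_derivative r * x powr (r - 1)) (at x)" if "x : {0<..}" for x
   using that by (auto intro!: derivative_eq_intros simp: has_real_derivative_iff_has_vector_derivative[symmetric])
  show "C_k n {0<..} (%x. r * x powr (r - 1))" by (intro C_k_mult C_k_const Suc)
 qed
qed

lemma C_k_compose_powr:
 fixes f :: "'a::euclidean_space => real" and r :: real
 shows "C_k n U f ==> (!!p. p : U ==> f p > 0) ==> C_k n U (%p. f p powr r)"
 by (rule C_k_compose[OF C_k_powr[of n r], where g=f]) auto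

lemma C_k_inverse:
 assumes "open U" "C_k n U f" "!!p. p : U ==> f p > (0::real)"
 shows "C_k n U (%p. inverse (f p))"
 by (rule C_k_cong[OF assms(1) _ C_k_compose_powr[OF assms(2,3), of "-1"]])
   (use assms(3) in "auto simp: powr_minus less_imp_le")

lemma C_k_sgn: "C_k n (- {0}) (sgn :: 'a::euclidean_space => 'a)"
proof (rule C_k_cong)
 show "C_k n (- {0::'a}) (%y. ((y \<bullet> y) powr (-1/2)) *\<^sub>R y)"
  by (intro C_k_scaleR C_k_compose_powr C_k_inner C_k_bounded_linear[OF bounded_linear_ident]) auto
 show "(y \<bullet> y) powr (-1/2) *\<^sub>R y = sgn y" for y :: 'a
 proof (cases "y = 0")
  case False
  have "(y \<bullet> y) powr (-1/2) = inverse ((y \<bullet> y) powr (1/2))" by (simp add: powr_minus)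
  also have "... = inverse (norm y)" by (subst powr_half_sqrt) (auto simp: norm_eq_sqrt_inner)
  finally show ?thesis by (simp add: sgn_div_norm)
 qed simp
qed auto

definition smooth :: "(real => real) => bool" where
 "smooth f \<longleftrightarrow> (ALL n. C_k n UNIV f)"

lemma smoothD: "smooth f ==> C_k n UNIV f" by (simp add: smooth_def)

lemma smooth_deriv:
 assumes "smooth f"
 shows "has_d f (deriv f x) x" "smooth (deriv f)"
proof -
 have *: "EX f'. (ALL x. (f has_vector_derivative f' x) (at x)) & C_k n UNIV f'" for n
  using C_k_real_SucE[OF smoothD[OF assms, of "Suc n"]] by (metis UNIV_I)
 hence d: "has_d f (deriv f x) x" for x
  by (metis DERIV_imp_deriv has_real_derivative_iff_has_vector_derivative)
 show "has_d f (deriv f x) x" by (rule d)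
 show "smooth (deriv f)" unfolding smooth_def
 proof
  fix n
  obtain f' where f': "!!x. (f has_vector_derivative f' x) (at x)" "C_k n UNIV f'" using * by blast
  hence "f' = deriv f"
   by (intro ext) (metis DERIV_imp_deriv has_real_derivative_iff_has_vector_derivative)
  thus "C_k n UNIV (deriv f)" using f' by simp
 qed
qed

lemma smooth_continuous: "smooth f ==> continuous_on A f"
 using C_k_continuous[OF smoothD] continuous_on_subset by blast

lemma smooth_intros:
 "smooth (%x. c)" "smooth (%x. x)"
 "smooth f ==> smooth g ==> smooth (%x. f x + g x)"
 "smooth f ==> smooth g ==> smooth (%x. f x - g x)"
 "smooth f ==> smooth g ==> smooth (%x. f x * g x)"
 "smooth f ==> smooth (%x. - f x)"
 "smooth f ==> smooth (%x. f x ^ k)"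
 "smooth f ==> smooth (deriv f)"
 unfolding smooth_def
 using smooth_deriv(2)[unfolded smooth_def, of f]
 by (blast intro: C_k_const C_k_add C_k_diff C_k_mult C_k_uminus C_k_power
   C_k_bounded_linear[OF bounded_linear_ident])+

lemma smooth_compose: "smooth f ==> smooth g ==> smooth (%x. f (g x))"
 unfolding smooth_def using C_k_compose[where V=UNIV and U=UNIV] by blast

lemma smooth_inverse: "smooth f ==> (!!x. f x > 0) ==> smooth (%x. inverse (f x))"
 by (auto simp: smooth_def intro!: C_k_inverse)

lemma DERIV_const_on_open:
 assumes "has_d f d x" "open S" "x : S" "!!y. y : S ==> f y = (c::real)"
 shows "d = 0"
proof -
 have "has_d (%_. c) d x"
  by (rule has_field_derivative_transform_within_open[OF assms(1-3)]) (use assms(4) in auto)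
 thus ?thesis using DERIV_unique DERIV_const by blast
qed

text \<open>The functions \<open>exp(-1/x) / x^k\<close>, extended by zero.  Their span is closed under differentiation, which
  makes smoothness at \<open>0\<close> an induction.\<close>
definition flat :: "nat => real => real" where
 "flat k x = (if x > 0 then exp (- 1 / x) / x ^ k else 0)"

lemma flat_le: "EX C. ALL x. \<bar>flat k x\<bar> <= C * x^2"
proof (intro exI allI)
 fix x :: real
 let ?N = "k + 2"
 show "\<bar>flat k x\<bar> <= real ?N ^ ?N * x^2"
 proof (cases "x > 0")
  case True
  have "(1 + (1/x) / real ?N) ^ ?N <= exp (1/x)"
  proof (rule exp_ge_one_plus_x_over_n_power_n)
   have "- real ?N <= 0" "0 <= 1/x" using True by auto
   thus "- real ?N <= 1/x" by linarith
  qed simp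
  moreover have "((1/x) / real ?N) ^ ?N <= (1 + (1/x) / real ?N) ^ ?N"
   using True by (intro power_mono) auto
  ultimately have "((1/x) / real ?N) ^ ?N <= exp (1/x)" by linarith
  hence "1 / (x ^ ?N * real ?N ^ ?N) <= exp (1/x)"
   by (simp only: power_divide power_one divide_divide_eq_left power_mult_distrib)
  hence "exp (- 1/x) <= x ^ ?N * real ?N ^ ?N"
   using True by (simp add: exp_minus field_simps del: power_Suc)
  also have "... = (real ?N ^ ?N * x^2) * x ^ k" by (simp add: power_add power2_eq_square)
  finally have "exp (- 1/x) / x ^ k <= real ?N ^ ?N * x^2"
   using True by (simp add: divide_le_eq)
  thus ?thesis using True by (simp add: flat_def)
 qed (simp add: flat_def)
qed

text \<open>At \<open>0\<close> the quadratic bound of \<open>flat_le\<close> gives the derivative.\<close>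
lemma flat_deriv: "has_d (flat k) (flat (k+2) x - real k * flat (k+1) x) x"
proof -
 consider "x > 0" | "x < 0" | "x = 0" by linarith
 thus ?thesis
 proof cases
  case 1
  have "has_d (%x. exp (- 1 / x) / x ^ k) (flat (k+2) x - real k * flat (k+1) x) x"
   using 1
   apply (auto intro!: derivative_eq_intros simp: flat_def)
   apply (cases k)
    apply (auto simp: field_simps power2_eq_square)
   done
  thus ?thesis
   by (rule has_field_derivative_transform_within_open[where S="{0<..}"]) (use 1 in "auto simp: flat_def")
 next
  case 2
  have "has_d (%x. 0) (flat (k+2) x - real k * flat (k+1) x) x"
   using 2 by (auto simp: flat_def)
  thus ?thesis
   by (rule has_field_derivative_transform_within_open[where S="{..<0}"]) (use 2 in "auto simp: flat_def")
 next
  case 3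
  obtain C where C: "!!x. \<bar>flat k x\<bar> <= C * x^2" using flat_le by blast
  have "((%h. (flat k (0 + h) - flat k 0) / h) \<longlongrightarrow> 0) (at 0)"
  proof (rule Lim_null_comparison)
   show "\<forall>\<^sub>F h in at 0. norm ((flat k (0 + h) - flat k 0) / h) <= C * \<bar>h\<bar>"
    unfolding eventually_at
   proof (intro exI[of _ 1] conjI ballI impI)
    fix h :: real assume "h ~= 0 & dist h 0 < 1"
    thus "norm ((flat k (0 + h) - flat k 0) / h) <= C * \<bar>h\<bar>"
     using C[of h] by (simp add: flat_def[of k 0] divide_le_eq power2_eq_square abs_mult mult.assoc)
   qed simp
   show "((%h. C * \<bar>h\<bar>) \<longlongrightarrow> 0) (at 0)" by (auto intro!: tendsto_eq_intros)
  qed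
  thus ?thesis using 3 by (simp add: DERIV_def flat_def[of _ 0])
 qed
qed

lemma smooth_flat: "smooth (flat k)"
 unfolding smooth_def
proof
 fix n
 show "C_k n UNIV (flat k)"
 proof (induction n arbitrary: k)
  case 0
  have "continuous_on UNIV (flat k)" for k
   by (auto intro!: continuous_at_imp_continuous_on DERIV_isCont[OF flat_deriv])
  thus ?case by simp
 next
  case (Suc n)
  show ?case
   by (rule C_k_real_Suc[where f'="%x. flat (k+2) x - real k * flat (k+1) x"])
     (auto intro!: C_k_diff C_k_mult Suc flat_deriv simp: has_real_derivative_iff_has_vector_derivative[symmetric] simp del: One_nat_def add_2_eq_Suc')
 qed
qed

text \<open>A smooth step from \<open>0\<close> for \<open>x <= 1\<close> to \<open>1\<close> for \<open>x >= 2\<close>; all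
  cutoffs are made from it.\<close>
definition step :: "real => real" where
 "step x = flat 0 (x - 1) * inverse (flat 0 (x - 1) + flat 0 (2 - x))"

lemma flat0: "flat 0 x >= 0" "flat 0 x > 0 \<longleftrightarrow> x > 0" by (auto simp: flat_def)

lemma step_denom: "flat 0 (x - 1) + flat 0 (2 - x) > 0"
 using flat0[of "x-1"] flat0[of "2-x"] by (cases "x > 1") (auto intro: add_pos_nonneg add_nonneg_pos)

lemma smooth_step: "smooth step"
proof -
 have "smooth (%x. flat 0 (x - 1))" "smooth (%x. flat 0 (2 - x))"
  by (intro smooth_compose[OF smooth_flat] smooth_intros)+
 thus ?thesis unfolding step_def[abs_def]
  by (intro smooth_intros smooth_inverse step_denom)
qed

lemma step_bounds: "0 <= step x" "step x <= 1" "x <= 1 ==> step x = 0" "x >= 2 ==> step x = 1"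
 using step_denom[of x] flat0[of "x-1"] flat0[of "2-x"]
 by (auto simp: step_def field_simps flat_def)

lemma deriv_step_zero: "x <= 1 ==> deriv step x = 0" "x >= 2 ==> deriv step x = 0"
proof -
 have 1: "deriv step x = 0" if "x < 1 \<or> x > 2" for x
 proof (rule DERIV_imp_deriv)
  show "has_d step 0 x"
   using that
  proof
   assume "x < 1" thus ?thesis
    by (intro has_field_derivative_transform_within_open[where S="{..<1}" and f="%x. 0", OF DERIV_const]) (auto simp: step_bounds)
  next
   assume "x > 2" thus ?thesis
    by (intro has_field_derivative_transform_within_open[where S="{2<..}" and f="%x. 1", OF DERIV_const]) (auto simp: step_bounds)
  qed
 qed
 have c: "continuous_on A (deriv step)" for A
  by (intro smooth_continuous smooth_intros smooth_step)
 have cl: "closed {x. deriv step x = 0}" by (intro closed_Collect_eq c continuous_on_const)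
 have "closure {..<1} \<subseteq> {x. deriv step x = 0}" "closure {2<..} \<subseteq> {x. deriv step x = 0}"
  using 1 by (intro closure_minimal cl; auto)+
 thus "x <= 1 ==> deriv step x = 0" "x >= 2 ==> deriv step x = 0" unfolding closure_lessThan closure_greaterThan by auto
qed

lemma deriv_step_bounded: "\<exists>C>0. ALL x. \<bar>deriv step x\<bar> <= C"
proof -
 have "bounded (deriv step ` {1..2})"
  by (intro compact_imp_bounded compact_continuous_image smooth_continuous smooth_intros smooth_step) auto
 then obtain C where C: "C > 0" "!!x. x : {1..2} ==> \<bar>deriv step x\<bar> <= C"
  unfolding bounded_pos by auto
 hence "\<bar>deriv step x\<bar> <= C" for x
  using deriv_step_zero[of x] by (cases "x : {1..2}") auto
 thus ?thesis using C(1) by blast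
qed

section \<open>The warping function\<close>

lemma warp_powr: "warp m x = (x ^ (2*m) + 1) powr (1 / real (2*m))" if "m >= 1"
proof -
 have "x ^ (2*m) + 1 > 0" by (simp add: power_mult add_nonneg_pos)
 thus ?thesis unfolding warp_def using that by (subst root_powr_inverse) auto
qed

lemma warp_pos [simp]: "m >= 1 ==> warp m x > 0"
 unfolding warp_def by (intro real_root_gt_zero) (auto simp: power_mult intro: add_nonneg_pos)

lemma warp_nz [simp]: "m >= 1 ==> warp m x ~= 0" using warp_pos[of m x] by linarith

lemma warp_power: "m >= 1 ==> warp m x ^ (2*m) = x ^ (2*m) + 1"
 unfolding warp_def by (rule real_root_pow_pos2) (auto simp: power_mult)

lemma warp_ge1: "m >= 1 ==> warp m x >= 1"
 unfolding warp_def by (rule real_root_ge_1_iff[THEN iffD2]) (auto simp: power_mult)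

lemma smooth_warp: "m >= 1 ==> smooth (warp m)"
 unfolding smooth_def
 apply (subst warp_powr[THEN ext], assumption)
 by (intro allI C_k_compose_powr C_k_add C_k_power C_k_bounded_linear[OF bounded_linear_ident] C_k_const)
   (auto simp: power_mult intro: add_nonneg_pos)

lemma warp_deriv: 
 assumes "m >= 1"
 shows "has_d (warp m) (x ^ (2*m-1) / warp m x ^ (2*m-1)) x"
proof -
 let ?d = "deriv (warp m) x"
 have d: "has_d (warp m) ?d x" using smooth_deriv smooth_warp assms by blast
 have "has_d (%x. warp m x ^ (2*m)) (real (2*m) * (?d * warp m x ^ (2*m - Suc 0))) x"
  by (rule DERIV_power[OF d])
 moreover have "has_d (%x. x ^ (2*m) + 1) (real (2*m) * x ^ (2*m - Suc 0)) x"
  by (auto intro!: derivative_eq_intros)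
 moreover have "(%x. warp m x ^ (2*m)) = (%x. x ^ (2*m) + 1)" using warp_power assms by auto
 ultimately have "real (2*m) * (?d * warp m x ^ (2*m - Suc 0)) = real (2*m) * x ^ (2*m - Suc 0)"
  by (metis DERIV_unique)
 hence "?d = x ^ (2*m-1) / warp m x ^ (2*m-1)"
  using assms by (auto simp: field_simps)
 thus ?thesis using d by simp
qed

text \<open>The quotient \<open>a'' / a\<close>, the part of the radial potential that does not depend on the angular frequency.\<close>
definition curv :: "nat => real => real" where
 "curv m x = (2 * real m - 1) * x ^ (2*m - 2) / warp m x ^ (4*m)"

lemma warp_deriv2:
 assumes "m >= 1"
 shows "has_d (%x. x ^ (2*m-1) / warp m x ^ (2*m-1)) (curv m x * warp m x) x"
proof -
 obtain j where j: "2*m - 1 = Suc j" using assms by (intro that[of "2*m-2"]) auto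
 let ?a = "warp m x"
 have m2: "2*m = Suc (Suc j)" "2*m-2 = j" "4*m = Suc (Suc j) + Suc (Suc j)" "2 * real m - 1 = real (Suc j)"
  using j assms by auto
 have pw: "?a ^ Suc (Suc j) = x ^ Suc (Suc j) + 1" using warp_power[OF assms, of x] unfolding m2(1) .
 have a: "?a ~= 0" using assms by simp
 have "((%x. x ^ Suc j / warp m x ^ Suc j) has_real_derivative
   (real (Suc j) * x ^ j * ?a ^ Suc j - x ^ Suc j * (real (Suc j) * (x ^ Suc j / ?a ^ Suc j * ?a ^ j))) / (?a ^ Suc j * ?a ^ Suc j)) (at x)"
  using DERIV_divide[OF DERIV_power[OF DERIV_ident, of "Suc j"] DERIV_power[OF warp_deriv[OF assms, of x], of "Suc j"]] a unfolding j
  by (simp add: mult.assoc)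
 moreover have "(real (Suc j) * x ^ j * ?a ^ Suc j - x ^ Suc j * (real (Suc j) * (x ^ Suc j / ?a ^ Suc j * ?a ^ j))) / (?a ^ Suc j * ?a ^ Suc j)
  = real (Suc j) * x ^ j * (?a ^ Suc (Suc j) - x ^ Suc (Suc j)) / (?a * ?a ^ Suc j * ?a ^ Suc j)"
  using a by (simp add: field_simps)
 moreover have "... = curv m x * ?a" unfolding curv_def m2 pw using a by (simp add: power_add field_simps)
 ultimately show ?thesis unfolding j by simp
qed

section \<open>The volume as an image of Lebesgue measure\<close>

lemma space_sphere_measure [simp]: "space sphere_measure = S2"
 by (simp add: sphere_measure_def space_scale_measure space_restrict_space)

lemma sets_sphere_measure [measurable_cong]: "sets sphere_measure = sets (restrict_space borel S2)"
 by (simp add: sphere_measure_def)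

lemma space_vol [simp]: "space (vol m I) = I \<times> S2"
 by (simp add: vol_def space_pair_measure space_restrict_space)

lemma sets_eqI_ident:
 assumes "space M = space N" "(%x. x) : measurable M N" "(%x. x) : measurable N M"
 shows "sets M = sets N"
proof -
 have "A : sets N'" if "(%x. x) : measurable N' M'" "space M' = space N'" "A : sets M'" for A and M' N' :: "'a measure"
  using measurable_sets[OF that(1,3)] sets.sets_into_space[OF that(3)] that(2)
  by (simp add: Int_absorb2)
 from this[OF assms(2) assms(1)[symmetric]] this[OF assms(3) assms(1)] show ?thesis by blast
qed

text \<open>It makes continuous functions on \<open>I \<times> S2\<close> measurable for the volume.\<close>
lemma sets_vol: "sets (vol m I) = sets (restrict_space borel (I \<times> S2))"
proof -
 have "sets (restrict_space lborel I \<Otimes>\<^sub>M restrict_space borel S2) = sets (restrict_space (borel :: point measure) (I \<times> S2))"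
 proof (rule sets_eqI_ident)
  show "(%x. x) : measurable (restrict_space lborel I \<Otimes>\<^sub>M restrict_space borel S2) (restrict_space (borel :: point measure) (I \<times> S2))"
  proof (rule measurable_restrict_space2)
   have "(%x. (fst x, snd x)) : measurable (restrict_space lborel I \<Otimes>\<^sub>M restrict_space borel S2) (borel \<Otimes>\<^sub>M borel :: point measure)"
   proof (rule measurable_Pair)
    have "fst : measurable (restrict_space lborel I \<Otimes>\<^sub>M restrict_space borel (S2::(real^3) set)) (restrict_space lborel I)"
     by (rule measurable_fst)
    thus "fst : measurable (restrict_space lborel I \<Otimes>\<^sub>M restrict_space borel (S2::(real^3) set)) borel"
     by (rule measurable_compose) (auto intro: measurable_restrict_space1)
    have "snd : measurable (restrict_space lborel I \<Otimes>\<^sub>M restrict_space borel (S2::(real^3) set)) (restrict_space borel S2)"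
     by (rule measurable_snd)
    thus "snd : measurable (restrict_space lborel I \<Otimes>\<^sub>M restrict_space borel (S2::(real^3) set)) borel"
     by (rule measurable_compose) (auto intro: measurable_restrict_space1)
   qed
   thus "(%x. x) : measurable (restrict_space lborel I \<Otimes>\<^sub>M restrict_space borel S2) (borel :: point measure)"
    by (simp add: borel_prod)
  qed (auto simp: space_pair_measure space_restrict_space)
  have f: "fst : measurable (restrict_space (borel::point measure) (I \<times> S2)) (borel :: real measure)"
   "snd : measurable (restrict_space (borel::point measure) (I \<times> S2)) (borel :: (real^3) measure)"
   by (auto intro!: measurable_restrict_space1 borel_measurable_continuous_onI continuous_intros)
  have "(%x. (fst x, snd x)) : measurable (restrict_space (borel::point measure) (I \<times> S2)) (restrict_space lborel I \<Otimes>\<^sub>M restrict_space borel S2)"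
   using f by (intro measurable_Pair measurable_restrict_space2) (auto simp: space_restrict_space)
  thus "(%x. x) : measurable (restrict_space (borel::point measure) (I \<times> S2)) (restrict_space lborel I \<Otimes>\<^sub>M restrict_space borel S2)"
   by simp
 qed (auto simp: space_pair_measure space_restrict_space)
 moreover have "sets (restrict_space lborel I \<Otimes>\<^sub>M sphere_measure) = sets (restrict_space lborel I \<Otimes>\<^sub>M restrict_space borel S2)"
  by (intro sets_pair_measure_cong sets_sphere_measure refl)
 ultimately show ?thesis by (simp add: vol_def)
qed

lemma measurable_vol_iff: "f : borel_measurable (vol m I) \<longleftrightarrow> f : borel_measurable (restrict_space borel (I \<times> S2))"
 by (rule arg_cong[where f="%X. f : X"]) (intro measurable_cong_sets sets_vol refl)

lemma continuous_measurable_vol: "continuous_on (I \<times> S2) f ==> f : borel_measurable (vol m I)"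
 by (simp add: measurable_vol_iff borel_measurable_continuous_on_restrict)

definition Bp :: "(real^3) set" where "Bp = ball 0 1 - {0}"

lemma Bp_sets [measurable]: "Bp : sets borel" by (simp add: Bp_def)

lemma sgn_in_S2: "y ~= 0 ==> sgn y : S2" by (simp add: norm_sgn)

lemma sgn_S2: "y : S2 ==> sgn y = y" by (simp add: sgn_div_norm)

lemma sgn_borel [measurable]: "(sgn :: 'a::euclidean_space => 'a) : borel_measurable borel"
 unfolding sgn_div_norm by measurable

lemma sgn_measurable: "sgn : measurable (restrict_space lborel Bp) (restrict_space borel S2)"
proof (rule measurable_restrict_space2)
 show "sgn : space (restrict_space lborel Bp) \<rightarrow> S2" by (auto simp: space_restrict_space Bp_def norm_sgn)
 show "sgn : restrict_space lborel Bp \<rightarrow>\<^sub>M borel"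
  by (rule measurable_restrict_space1) simp
qed

lemma nn_integral_sphere:
 assumes "f : borel_measurable (restrict_space borel S2)"
 shows "(\<integral>\<^sup>+\<omega>. f \<omega> \<partial>sphere_measure) = 3 * (\<integral>\<^sup>+y. f (sgn y) * indicator Bp y \<partial>lborel)"
proof -
 have "(\<integral>\<^sup>+\<omega>. f \<omega> \<partial>sphere_measure) = 3 * (\<integral>\<^sup>+y. f (sgn y) \<partial>restrict_space lborel Bp)"
  unfolding sphere_measure_def Bp_def[symmetric]
  by (subst nn_integral_scale_measure) (use assms in "auto simp: nn_integral_distr[OF sgn_measurable]")
 also have "... = 3 * (\<integral>\<^sup>+y. f (sgn y) * indicator Bp y \<partial>lborel)"
  by (subst nn_integral_restrict_space) auto
 finally show ?thesis .
qed

lemma finite_measure_sphere: "finite_measure sphere_measure"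
proof
 have "emeasure sphere_measure (space sphere_measure) = (\<integral>\<^sup>+\<omega>. 1 \<partial>sphere_measure)" by simp
 also have "... = 3 * (\<integral>\<^sup>+y. indicator Bp y \<partial>lborel)" by (subst nn_integral_sphere) auto
 also have "... = 3 * emeasure lborel Bp" by (simp)
 also have "... <= 3 * emeasure lborel (ball (0::real^3) 1)"
  by (intro mult_left_mono emeasure_mono) (auto simp: Bp_def)
 also have "... < \<infinity>"
  using emeasure_lborel_ball_finite[of "0::real^3" 1] by (simp add: ennreal_mult_less_top)
 finally show "emeasure sphere_measure (space sphere_measure) ~= \<infinity>" by simp
qed

interpretation sph: finite_measure sphere_measure by (rule finite_measure_sphere)

definition lift :: "point => point" where "lift p = (fst p, sgn (snd p))"

lemma lift_simps [simp]: "fst (lift p) = fst p" "snd (lift p) = sgn (snd p)" "lift (x, y) = (x, sgn y)"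
 by (auto simp: lift_def)

lemma warp_meas [measurable]: "m >= 1 ==> warp m : borel_measurable borel"
 by (intro borel_measurable_continuous_onI smooth_continuous smooth_warp)

lemma lift_borel [measurable]: "lift : borel_measurable borel"
proof -
 have "(%p. (fst p, sgn (snd p))) : borel_measurable (borel :: point measure)"
  by (intro borel_measurable_Pair measurable_compose[OF _ sgn_borel]
    borel_measurable_continuous_onI continuous_intros)
 thus ?thesis by (simp add: lift_def[abs_def])
qed

lemma fst_meas [measurable]: "(fst :: point => real) : borel_measurable borel"
 by (intro borel_measurable_continuous_onI continuous_intros)

lemma warp_fst_meas [measurable]: "m >= 1 ==> (%p::point. warp m (fst p)) : borel_measurable borel"
 by (rule measurable_compose[OF fst_meas warp_meas])

text \<open>Polar coordinates turn the volume of \<open>I \<times> S2\<close> into this absolutely continuous measure on the solid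
  \<open>I \<times> Bp\<close>, so that integrals over the manifold become Lebesgue integrals in four dimensions.\<close>
definition cone :: "nat => real set => point measure" where
 "cone m I = density (restrict_space lborel (I \<times> Bp)) (%p. ennreal (3 * (warp m (fst p))^2))"

lemma lift_cone: "lift : measurable (cone m I) (vol m I)"
proof -
 have "lift : measurable (restrict_space lborel (I \<times> Bp)) (restrict_space borel (I \<times> S2))"
 proof (rule measurable_restrict_space2)
  show "lift : space (restrict_space lborel (I \<times> Bp)) \<rightarrow> I \<times> S2"
   using sgn_in_S2 by (force simp: space_restrict_space Bp_def lift_def)
  show "lift : restrict_space lborel (I \<times> Bp) \<rightarrow>\<^sub>M borel"
   by (rule measurable_restrict_space1) simp
 qed
 thus ?thesis
  by (subst measurable_cong_sets[OF _ sets_vol]) (auto simp: cone_def)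
qed

lemma vol_distr:
 assumes m: "m >= 1" and I [measurable]: "I : sets borel"
 shows "vol m I = distr (cone m I) (vol m I) lift"
proof (rule measure_eqI)
 fix A assume A: "A : sets (vol m I)"
 let ?P = "restrict_space lborel I \<Otimes>\<^sub>M sphere_measure"
 have AP: "A : sets ?P" using A by (simp add: vol_def)
 have IB: "I \<times> Bp : sets (borel :: point measure)"
  by (metis I Bp_sets borel_prod pair_measureI)
 have Ab: "A : sets (restrict_space borel (I \<times> S2))" using A sets_vol by blast
 have "A : sets borel"
 proof -
  have "I \<times> S2 : sets (borel :: point measure)"
   by (metis I borel_prod pair_measureI borel_closed closed_sphere)
  thus ?thesis using Ab by (auto simp: sets_restrict_space)
 qed
 note this [measurable]
 have warpm [measurable]: "(%x. ennreal ((warp m x)^2)) : borel_measurable (restrict_space lborel I)"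
  using m by (intro measurable_restrict_space1) measurable
 have "emeasure (vol m I) A = (\<integral>\<^sup>+ p. indicator A p \<partial>vol m I)" using A by simp
 also have "... = (\<integral>\<^sup>+ p. (case p of (x, \<omega>) => ennreal ((warp m x)^2)) * indicator A p \<partial>?P)"
  unfolding vol_def by (subst nn_integral_density) (use AP in auto)
 also have "... = (\<integral>\<^sup>+ x. \<integral>\<^sup>+ \<omega>. ennreal ((warp m x)^2) * indicator A (x, \<omega>) \<partial>sphere_measure \<partial>restrict_space lborel I)"
  by (subst sph.nn_integral_fst[symmetric]) (use AP in "auto intro!: borel_measurable_times_ennreal")
 also have "... = (\<integral>\<^sup>+ x. \<integral>\<^sup>+ y. ennreal (3 * (warp m x)^2) * indicator A (x, sgn y) * indicator Bp y \<partial>lborel \<partial>restrict_space lborel I)"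
 proof (rule nn_integral_cong)
  fix x assume "x : space (restrict_space lborel I)"
  have mA: "(%y. indicator A (x, y) :: ennreal) : borel_measurable borel"
   by measurable
  have mA': "(%y. indicator A (x, sgn y) :: ennreal) : borel_measurable borel"
   by (rule measurable_compose[OF sgn_borel mA])
  have "(\<integral>\<^sup>+ \<omega>. ennreal ((warp m x)^2) * indicator A (x, \<omega>) \<partial>sphere_measure)
   = 3 * (\<integral>\<^sup>+ y. ennreal ((warp m x)^2) * indicator A (x, sgn y) * indicator Bp y \<partial>lborel)"
   by (rule nn_integral_sphere) (intro measurable_restrict_space1 borel_measurable_times_ennreal mA, auto)
  also have "... = (\<integral>\<^sup>+ y. 3 * (ennreal ((warp m x)^2) * indicator A (x, sgn y) * indicator Bp y) \<partial>lborel)"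
   by (rule nn_integral_cmult[symmetric]) (use mA' in measurable)
  also have "... = (\<integral>\<^sup>+ y. ennreal (3 * (warp m x)^2) * indicator A (x, sgn y) * indicator Bp y \<partial>lborel)"
   by (intro nn_integral_cong) (simp add: ennreal_mult mult.assoc)
  finally show "(\<integral>\<^sup>+ \<omega>. ennreal ((warp m x)^2) * indicator A (x, \<omega>) \<partial>sphere_measure) = ..." .
 qed
 also have "... = (\<integral>\<^sup>+ x. (\<integral>\<^sup>+ y. ennreal (3 * (warp m x)^2) * indicator A (x, sgn y) * indicator Bp y \<partial>lborel) * indicator I x \<partial>lborel)"
  by (subst nn_integral_restrict_space) auto
 also have "... = (\<integral>\<^sup>+ x. \<integral>\<^sup>+ y. ennreal (3 * (warp m x)^2) * indicator A (lift (x, y)) * indicator (I \<times> Bp) (x, y) \<partial>lborel \<partial>lborel)"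
  by (intro nn_integral_cong) (auto simp: indicator_def)
 also have "... = (\<integral>\<^sup>+ p. ennreal (3 * (warp m (fst p))^2) * indicator A (lift p) * indicator (I \<times> Bp) p \<partial>(lborel \<Otimes>\<^sub>M lborel))"
 proof -
  have "(%p. ennreal (3 * (warp m (fst p))^2) * indicator A (lift p) * indicator (I \<times> Bp) p) : borel_measurable (borel :: point measure)"
   by (intro borel_measurable_times_ennreal measurable_compose[OF _ measurable_ennreal] borel_measurable_times
      borel_measurable_power borel_measurable_const warp_fst_meas m
      measurable_compose[OF lift_borel] borel_measurable_indicator IB \<open>A : sets borel\<close>)
  hence "(%p. ennreal (3 * (warp m (fst p))^2) * indicator A (lift p) * indicator (I \<times> Bp) p) : borel_measurable (lborel \<Otimes>\<^sub>M (lborel :: (real^3) measure))"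
   by (simp add: lborel_prod)
  from lborel.nn_integral_fst[OF this] show ?thesis by simp
 qed
 also have "... = (\<integral>\<^sup>+ p. ennreal (3 * (warp m (fst p))^2) * indicator A (lift p) \<partial>restrict_space lborel (I \<times> Bp))"
  unfolding lborel_prod by (subst nn_integral_restrict_space) (use IB in auto)
 also have "... = (\<integral>\<^sup>+ p. indicator A (lift p) \<partial>cone m I)"
  unfolding cone_def
  by (subst nn_integral_density)
    (auto intro!: measurable_restrict_space1 measurable_compose[OF _ measurable_ennreal] borel_measurable_times
      borel_measurable_power borel_measurable_const warp_fst_meas m
      measurable_compose[OF lift_borel] borel_measurable_indicator \<open>A : sets borel\<close>)
 also have "... = emeasure (distr (cone m I) (vol m I) lift) A"
  using A by (subst nn_integral_distr[OF lift_cone, symmetric]) auto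
 finally show "emeasure (vol m I) A = emeasure (distr (cone m I) (vol m I) lift) A" .
qed simp

lemma integral_vol:
 fixes h :: "point => 'b::{banach,second_countable_topology}"
 assumes m: "m >= 1" and I [measurable]: "I : sets borel" and h: "h : borel_measurable (vol m I)"
 shows "integral\<^sup>L (vol m I) h =
   (\<integral>p. indicator (I \<times> Bp) p *\<^sub>R (3 * (warp m (fst p))^2) *\<^sub>R h (lift p) \<partial>lborel)"
  and "integrable (vol m I) h \<longleftrightarrow>
   integrable lborel (%p. indicator (I \<times> Bp) p *\<^sub>R (3 * (warp m (fst p))^2) *\<^sub>R h (lift p))"
proof -
 have IB: "I \<times> Bp : sets (borel :: point measure)"
  by (metis I Bp_sets borel_prod pair_measureI)
 have hl: "(%p. h (lift p)) : borel_measurable (restrict_space lborel (I \<times> Bp))"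
  using measurable_compose[OF lift_cone h] by (simp add: cone_def)
 have w: "(%p. 3 * (warp m (fst p))^2) : borel_measurable (restrict_space lborel (I \<times> Bp))"
  by (intro measurable_restrict_space1) (auto intro!: borel_measurable_times borel_measurable_power warp_fst_meas m)
 show "integral\<^sup>L (vol m I) h =
   (\<integral>p. indicator (I \<times> Bp) p *\<^sub>R (3 * (warp m (fst p))^2) *\<^sub>R h (lift p) \<partial>lborel)"
  by (subst vol_distr[OF m I], subst integral_distr[OF lift_cone h])
    (use IB in "simp add: cone_def integral_density[OF hl w] integral_restrict_space")
 show "integrable (vol m I) h \<longleftrightarrow>
   integrable lborel (%p. indicator (I \<times> Bp) p *\<^sub>R (3 * (warp m (fst p))^2) *\<^sub>R h (lift p))"
  by (subst vol_distr[OF m I], subst integrable_distr_eq[OF lift_cone h])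
    (use IB in "simp add: cone_def integrable_density[OF hl w] integrable_restrict_space")
qed

lemma emeasure_vol_bounded:
 assumes m: "m >= 1" and I [measurable]: "I : sets borel" "I \<subseteq> {a..b}"
 shows "emeasure (vol m I) (I \<times> S2) < \<infinity>"
proof -
 obtain C where C: "!!x. x : {a..b} ==> (warp m x)^2 <= C"
 proof -
  have "bounded ((%x. (warp m x)^2) ` {a..b})"
   by (intro compact_imp_bounded compact_continuous_image continuous_intros smooth_continuous smooth_warp m) auto
  then obtain B where "!!y. y : (%x. (warp m x)^2) ` {a..b} ==> norm y <= B"
   unfolding bounded_iff by blast
  thus ?thesis by (intro that[of B]) force
 qed
 have "finite_measure (restrict_space lborel I)"
 proof
  have "emeasure lborel I <= emeasure lborel {a..b}" using I by (intro emeasure_mono) auto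
  also have "... < \<infinity>" by (simp add: emeasure_lborel_Icc_eq less_top[symmetric])
  finally show "emeasure (restrict_space lborel I) (space (restrict_space lborel I)) ~= \<infinity>"
   by (simp add: space_restrict_space emeasure_restrict_space)
 qed
 then interpret r: finite_measure "restrict_space lborel I" .
 let ?P = "restrict_space lborel I \<Otimes>\<^sub>M sphere_measure"
 have warpm [measurable]: "(%x. ennreal ((warp m x)^2)) : borel_measurable (restrict_space lborel I)"
  using m by (intro measurable_restrict_space1) measurable
 have sp: "I \<times> S2 = space ?P" by (simp add: space_pair_measure space_restrict_space)
 have "emeasure (vol m I) (I \<times> S2) = (\<integral>\<^sup>+ p. 1 \<partial>vol m I)"
  using space_vol[of m I] by simp
 also have "... = (\<integral>\<^sup>+ p. (case p of (x, \<omega>) => ennreal ((warp m x)^2)) \<partial>?P)"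
  unfolding vol_def by (subst nn_integral_density) auto
 also have "... <= (\<integral>\<^sup>+ p. ennreal C \<partial>?P)"
  using I(2) by (intro nn_integral_mono) (auto simp: space_pair_measure space_restrict_space intro!: ennreal_leI C)
 also have "... = ennreal C * (emeasure (restrict_space lborel I) I * emeasure sphere_measure S2)"
 proof -
  have "emeasure ?P (I \<times> S2) = emeasure (restrict_space lborel I) I * emeasure sphere_measure S2"
  proof (rule sph.emeasure_pair_measure_Times)
   show "I : sets (restrict_space lborel I)" using sets.top[of "restrict_space lborel I"] by (simp add: space_restrict_space)
   show "S2 : sets sphere_measure" using sets.top[of sphere_measure] by simp
  qed
  thus ?thesis by (subst nn_integral_const) (simp only: sp[symmetric])
 qed
 also have "... < \<infinity>"
  using r.emeasure_finite[of I] sph.emeasure_finite[of S2] by (simp add: ennreal_mult_eq_top_iff less_top[symmetric])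
 finally show ?thesis .
qed

section \<open>Restriction of the volume to slabs\<close>

lemma Times_S2_sets: "I : sets borel ==> I \<times> S2 : sets (borel :: point measure)"
 by (metis borel_prod pair_measureI borel_closed closed_sphere)

lemma Times_Bp_sets: "I : sets borel ==> I \<times> Bp : sets (borel :: point measure)"
 by (metis borel_prod pair_measureI Bp_sets)

lemma emeasure_vol:
 assumes m: "m >= 1" and I: "I : sets borel" and A: "A : sets (vol m I)"
 shows "emeasure (vol m I) A =
  (\<integral>\<^sup>+ p. ennreal (3 * (warp m (fst p))^2) * indicator A (lift p) * indicator (I \<times> Bp) p \<partial>lborel)"
proof -
 have Ab [measurable]: "A : sets borel"
  using A Times_S2_sets[OF I] unfolding sets_vol by (auto simp: sets_restrict_space)
 have "emeasure (vol m I) A = emeasure (distr (cone m I) (vol m I) lift) A"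
  by (subst vol_distr[OF m I]) simp
 also have "... = (\<integral>\<^sup>+ p. indicator A (lift p) \<partial>cone m I)"
  using A by (subst nn_integral_distr[OF lift_cone, symmetric]) auto
 also have "... = (\<integral>\<^sup>+ p. ennreal (3 * (warp m (fst p))^2) * indicator A (lift p) \<partial>restrict_space lborel (I \<times> Bp))"
  unfolding cone_def
  by (subst nn_integral_density)
    (auto intro!: measurable_restrict_space1 measurable_compose[OF _ measurable_ennreal] borel_measurable_times
      borel_measurable_power borel_measurable_const warp_fst_meas m
      measurable_compose[OF lift_borel] borel_measurable_indicator Ab)
 also have "... = (\<integral>\<^sup>+ p. ennreal (3 * (warp m (fst p))^2) * indicator A (lift p) * indicator (I \<times> Bp) p \<partial>lborel)"
  by (subst nn_integral_restrict_space) (use Times_Bp_sets[OF I] in auto)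
 finally show ?thesis .
qed

lemma Times_S2_vol: "J : sets borel ==> J \<subseteq> I ==> J \<times> S2 : sets (vol m I)"
 unfolding sets_vol sets_restrict_space using Times_S2_sets[of J] by auto

lemma Times_S2_vol_Int: "J : sets borel ==> J \<subseteq> I ==> J \<times> S2 \<inter> I \<times> S2 : sets (vol m I)"
 using Times_S2_vol[of J I m] sets.sets_into_space[of "J \<times> S2" "vol m I"] by (simp add: Int_absorb2)

lemma vol_restrict:
 assumes m: "m >= 1" and I: "I : sets borel" "J : sets borel" "J \<subseteq> I"
 shows "vol m J = restrict_space (vol m I) (J \<times> S2)"
proof (rule measure_eqI)
 have JS: "J \<times> S2 : sets (vol m I)" by (rule Times_S2_vol[OF I(2,3)])
 have "sets (restrict_space (vol m I) (J \<times> S2)) = sets (restrict_space (restrict_space borel (I \<times> S2)) (J \<times> S2))"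
  by (intro sets_restrict_space_cong sets_vol)
 also have "... = sets (restrict_space borel ((I \<times> S2) \<inter> (J \<times> S2)))"
  by (simp add: sets_restrict_restrict_space)
 also have "(I \<times> S2) \<inter> (J \<times> S2) = J \<times> S2" using I(3) by auto
 finally show *: "sets (vol m J) = sets (restrict_space (vol m I) (J \<times> S2))" by (simp add: sets_vol)
 fix A assume A: "A : sets (vol m J)"
 hence sub: "A \<subseteq> J \<times> S2" using sets.sets_into_space by fastforce
 have AI: "A : sets (vol m I)"
  using A[unfolded *] JS by (auto simp: sets_restrict_space)
 have "emeasure (restrict_space (vol m I) (J \<times> S2)) A = emeasure (vol m I) A"
  by (rule emeasure_restrict_space) (use Times_S2_vol_Int[OF I(2,3)] sub in auto)
 also have "... = emeasure (vol m J) A"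
  unfolding emeasure_vol[OF m I(1) AI] emeasure_vol[OF m I(2) A]
  using sub I(3) by (intro nn_integral_cong) (auto simp: indicator_def lift_def)
 finally show "emeasure (vol m J) A = emeasure (restrict_space (vol m I) (J \<times> S2)) A" ..
qed

lemma AE_vol_mono:
 assumes "m >= 1" "I : sets borel" "J : sets borel" "J \<subseteq> I" "AE p in vol m I. P p"
 shows "AE p in vol m J. P p"
 unfolding vol_restrict[OF assms(1-4)]
 using assms(5) Times_S2_vol_Int[OF assms(3,4)] by (subst AE_restrict_space_iff) auto

lemma measurable_vol_mono:
 assumes "J \<subseteq> I" "f : borel_measurable (vol m I)"
 shows "f : borel_measurable (vol m J)"
proof -
 have "f : borel_measurable (restrict_space (restrict_space borel (I \<times> S2)) (J \<times> S2))"
  by (rule measurable_restrict_space1) (use assms(2) in "simp only: measurable_vol_iff")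
 moreover have "(I \<times> S2) \<inter> (J \<times> S2) = J \<times> S2" using assms(1) by auto
 moreover have "sets (restrict_space (restrict_space (borel :: point measure) (I \<times> S2)) (J \<times> S2)) = sets (restrict_space borel ((I \<times> S2) \<inter> (J \<times> S2)))"
  by (rule sets_restrict_restrict_space)
 ultimately have "f : borel_measurable (restrict_space (restrict_space borel (I \<times> S2)) (J \<times> S2))"
  and e: "sets (restrict_space (restrict_space (borel :: point measure) (I \<times> S2)) (J \<times> S2)) = sets (restrict_space borel (J \<times> S2))"
  by auto
 thus ?thesis unfolding measurable_vol_iff measurable_cong_sets[OF e refl] by blast
qed

lemma integral_vol_mono:
 fixes f :: "point => 'b::{banach,second_countable_topology}"
 assumes "m >= 1" "I : sets borel" "J : sets borel" "J \<subseteq> I"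
 shows "integral\<^sup>L (vol m J) f = (\<integral>p. indicator (J \<times> S2) p *\<^sub>R f p \<partial>vol m I)"
  "integrable (vol m J) f \<longleftrightarrow> integrable (vol m I) (%p. indicator (J \<times> S2) p *\<^sub>R f p)"
 unfolding vol_restrict[OF assms]
 using Times_S2_vol_Int[OF assms(3,4)] by (auto simp: integral_restrict_space integrable_restrict_space)

lemma integrable_vol_bounded:
 fixes h :: "point => 'b::{banach,second_countable_topology}"
 assumes m: "m >= 1" and h: "h : borel_measurable (volM m x0)"
  and b: "!!p. p : {x0<..} \<times> S2 ==> norm (h p) <= C"
  and z: "!!p. p : {x0<..} \<times> S2 ==> fst p > X ==> h p = 0"
 shows "integrable (volM m x0) h"
proof (rule integrableI_bounded_set)
 have s: "{x0<..X} \<subseteq> {x0<..}" "{x0<..X} : sets borel" "{x0<..} : sets borel" by auto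
 show "{x0<..X} \<times> S2 : sets (volM m x0)" by (rule Times_S2_vol) auto
 have "emeasure (volM m x0) ({x0<..X} \<times> S2) = emeasure (vol m {x0<..X}) ({x0<..X} \<times> S2)"
  unfolding vol_restrict[OF m s(3,2,1)]
  by (rule emeasure_restrict_space[symmetric]) (use Times_S2_vol_Int[OF s(2,1)] in auto)
 also have "... < \<infinity>" by (rule emeasure_vol_bounded[OF m s(2), of x0 X]) auto
 finally show "emeasure (volM m x0) ({x0<..X} \<times> S2) < \<infinity>" .
 show "AE p in volM m x0. p : {x0<..X} \<times> S2 --> norm (h p) <= C" using b by auto
 show "AE p in volM m x0. p \<notin> {x0<..X} \<times> S2 --> h p = 0"
  using z by (intro AE_I2) force
qed (rule h)

section \<open>Square integrable functions\<close>

lemma in_L2_meas: "in_L2 M f ==> f : borel_measurable M" by (simp add: in_L2_def)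

lemma L2_norm_nonneg [simp]: "0 <= L2_norm M f" by (simp add: L2_norm_def)

lemma L2_norm_sq: "(L2_norm M f)^2 = (\<integral>p. (norm (f p))^2 \<partial>M)"
 by (simp add: L2_norm_def)

text \<open>The Cauchy-Schwarz inequality, together with integrability of the product.\<close>
lemma L2_product:
 fixes f :: "'a => 'b::{real_normed_vector,second_countable_topology}" and g :: "'a => 'c::{real_normed_vector,second_countable_topology}"
 assumes f: "in_L2 M f" and g: "in_L2 M g"
 shows "integrable M (%p. norm (f p) * norm (g p))"
  and "(\<integral>p. norm (f p) * norm (g p) \<partial>M) <= L2_norm M f * L2_norm M g"
proof -
 have [measurable]: "f : borel_measurable M" "g : borel_measurable M" using f g by (auto simp: in_L2_def)
 have fi: "integrable M (%p. (norm (f p))^2)" and gi: "integrable M (%p. (norm (g p))^2)"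
  using f g by (auto simp: in_L2_def)
 show i: "integrable M (%p. norm (f p) * norm (g p))"
 proof (rule BI_integrable_bound[of M "%p. (norm (f p))^2 + (norm (g p))^2"])
  show "AE p in M. norm (norm (f p) * norm (g p)) <= norm ((norm (f p))^2 + (norm (g p))^2)"
  proof (rule AE_I2)
   fix p
   have "2 * (norm (f p) * norm (g p)) <= (norm (f p))^2 + (norm (g p))^2"
    using sum_squares_bound[of "norm (f p)" "norm (g p)"] by simp
   moreover have "0 <= norm (f p) * norm (g p)" by simp
   ultimately have "norm (f p) * norm (g p) <= (norm (f p))^2 + (norm (g p))^2" by linarith
   thus "norm (norm (f p) * norm (g p)) <= norm ((norm (f p))^2 + (norm (g p))^2)"
    by (simp add: abs_mult)
  qed
 qed (use fi gi in auto)
 let ?A = "L2_norm M f" and ?B = "L2_norm M g" and ?I = "\<integral>p. norm (f p) * norm (g p) \<partial>M"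
 show "?I <= ?A * ?B"
 proof (cases "?A = 0 \<or> ?B = 0")
  case True
  hence "(\<integral>p. (norm (f p))^2 \<partial>M) = 0 \<or> (\<integral>p. (norm (g p))^2 \<partial>M) = 0"
   by (auto simp: L2_norm_def)
  hence "(AE p in M. f p = 0) \<or> (AE p in M. g p = 0)"
   using fi gi by (auto simp: integral_nonneg_eq_0_iff_AE)
  hence "AE p in M. norm (f p) * norm (g p) = 0" by auto
  hence "?I = 0" by (subst integral_cong_AE[where g="%_. 0"]) auto
  thus ?thesis by simp
 next
  case False
  hence pos: "?A * ?B > 0" by (simp add: less_le)
  have "0 <= (\<integral>p. (?B * norm (f p) - ?A * norm (g p))^2 \<partial>M)" by simp
  also have "... = (\<integral>p. ?B^2 * (norm (f p))^2 - 2 * ?A * ?B * (norm (f p) * norm (g p)) + ?A^2 * (norm (g p))^2 \<partial>M)"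
   by (intro BI_integral_cong refl) (simp add: power2_eq_square algebra_simps)
  also have "... = ?B^2 * ?A^2 - 2 * ?A * ?B * ?I + ?A^2 * ?B^2"
   using fi gi i by (simp add: L2_norm_sq)
  finally have "(?A * ?B) * ?I <= (?A * ?B) * (?A * ?B)" by (simp add: power2_eq_square algebra_simps)
  thus ?thesis using pos by (simp add: mult_le_cancel_left_pos)
 qed
qed

lemma L2_bilinear:
 fixes f :: "'a => 'b::{real_normed_vector,second_countable_topology}" and g :: "'a => 'c::{real_normed_vector,second_countable_topology}"
  and h :: "'a => 'd::{banach,second_countable_topology}"
 assumes f: "in_L2 M f" and g: "in_L2 M g" and h: "h : borel_measurable M"
  and le: "!!p. p : space M ==> norm (h p) <= norm (f p) * norm (g p)"
 shows "integrable M h" "norm (integral\<^sup>L M h) <= L2_norm M f * L2_norm M g"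
proof -
 show i: "integrable M h"
  by (rule BI_integrable_bound[OF L2_product(1)[OF f g] h]) (use le in "auto simp: abs_mult")
 have "norm (integral\<^sup>L M h) <= (\<integral>p. norm (h p) \<partial>M)" by simp
 also have "... <= (\<integral>p. norm (f p) * norm (g p) \<partial>M)"
  by (intro integral_mono_AE integrable_norm i L2_product(1)[OF f g]) (use le in auto)
 also have "... <= L2_norm M f * L2_norm M g" by (rule L2_product(2)[OF f g])
 finally show "norm (integral\<^sup>L M h) <= L2_norm M f * L2_norm M g" .
qed

lemma in_L2_add:
 fixes f g :: "'a => 'b::{real_normed_vector,second_countable_topology}"
 assumes f: "in_L2 M f" and g: "in_L2 M g"
 shows "in_L2 M (%p. f p + g p)" "L2_norm M (%p. f p + g p) <= L2_norm M f + L2_norm M g"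
proof -
 have [measurable]: "f : borel_measurable M" "g : borel_measurable M" using f g by (auto simp: in_L2_def)
 let ?b = "%p. (norm (f p))^2 + 2 * (norm (f p) * norm (g p)) + (norm (g p))^2"
 have bi: "integrable M ?b" using f g L2_product(1)[OF f g] by (auto simp: in_L2_def)
 have le: "(norm (f p + g p))^2 <= ?b p" for p
 proof -
  have "(norm (f p + g p))^2 <= (norm (f p) + norm (g p))^2"
   by (intro power_mono norm_triangle_ineq) auto
  thus ?thesis by (simp add: power2_sum)
 qed
 have i: "integrable M (%p. (norm (f p + g p))^2)"
  by (rule BI_integrable_bound[OF bi]) (auto intro!: AE_I2 order_trans[OF le])
 thus "in_L2 M (%p. f p + g p)" by (simp add: in_L2_def)
 have "(L2_norm M (%p. f p + g p))^2 <= (\<integral>p. ?b p \<partial>M)"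
  unfolding L2_norm_sq by (intro integral_mono i bi le)
 also have "... = (L2_norm M f)^2 + 2 * (\<integral>p. norm (f p) * norm (g p) \<partial>M) + (L2_norm M g)^2"
  using f g L2_product(1)[OF f g] by (simp add: L2_norm_sq in_L2_def)
 also have "... <= (L2_norm M f + L2_norm M g)^2"
  using L2_product(2)[OF f g] by (simp add: power2_sum)
 finally show "L2_norm M (%p. f p + g p) <= L2_norm M f + L2_norm M g"
  by (rule power2_le_imp_le) simp
qed

lemma in_L2_uminus: "in_L2 M f ==> in_L2 M (%p. - f p)" for f :: "'a => 'b::{real_normed_vector,second_countable_topology}"
 by (auto simp: in_L2_def)

lemma L2_norm_uminus: "L2_norm M (%p. - f p) = L2_norm M f" by (simp add: L2_norm_def)

lemma in_L2_diff:
 fixes f g :: "'a => 'b::{real_normed_vector,second_countable_topology}"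
 assumes f: "in_L2 M f" and g: "in_L2 M g"
 shows "in_L2 M (%p. f p - g p)" "L2_norm M (%p. f p - g p) <= L2_norm M f + L2_norm M g"
 using in_L2_add[OF f in_L2_uminus[OF g]] by (simp_all add: L2_norm_uminus)

lemma L2_norm_cong_AE:
 fixes f g :: "'a => 'b::{real_normed_vector,second_countable_topology}"
 assumes "f : borel_measurable M" "g : borel_measurable M" "AE p in M. f p = g p"
 shows "L2_norm M f = L2_norm M g"
 unfolding L2_norm_def using assms by (intro arg_cong[where f=sqrt] integral_cong_AE) auto

lemma L2_norm_zero_AE:
 fixes f :: "'a => 'b::{real_normed_vector,second_countable_topology}"
 assumes "in_L2 M f" "L2_norm M f = 0"
 shows "AE p in M. f p = 0"
 using assms integral_nonneg_eq_0_iff_AE[of M "%p. (norm (f p))^2"] by (auto simp: in_L2_def L2_norm_def)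

lemma in_L2_vol_mono:
 fixes f :: "point => 'b::{real_normed_vector,second_countable_topology}"
 assumes "m >= 1" "I : sets borel" "J : sets borel" "J \<subseteq> I" "in_L2 (vol m I) f"
 shows "in_L2 (vol m J) f" "L2_norm (vol m J) f <= L2_norm (vol m I) f"
proof -
 have i: "integrable (vol m I) (%p. indicator (J \<times> S2) p *\<^sub>R (norm (f p))^2)"
  using assms(5) Times_S2_vol[OF assms(3,4)]
  by (intro integrable_mult_indicator) (auto simp: in_L2_def)
 show "in_L2 (vol m J) f"
  unfolding in_L2_def integral_vol_mono(2)[OF assms(1-4)]
  using assms(5) measurable_vol_mono[OF assms(4)] i by (auto simp: in_L2_def)
 show "L2_norm (vol m J) f <= L2_norm (vol m I) f"
  unfolding L2_norm_def integral_vol_mono(1)[OF assms(1-4)]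
  using assms(5) by (intro real_sqrt_le_mono integral_mono i) (auto simp: in_L2_def indicator_def)
qed

section \<open>Directional derivatives and integration by parts in Euclidean space\<close>

definition dd :: "'a::real_normed_vector => ('a => 'b::real_normed_vector) => 'a => 'b" where
 "dd v F p = vector_derivative (%s. F (p + s *\<^sub>R v)) (at 0)"

lemma has_vector_derivative_line:
 assumes "(F has_derivative D) (at (p + r *\<^sub>R v))"
 shows "((%s. F (p + s *\<^sub>R v)) has_vector_derivative D v) (at r)"
proof -
 have "((%s. p + s *\<^sub>R v) has_derivative (%s. s *\<^sub>R v)) (at r)"
  by (auto intro!: derivative_eq_intros)
 hence "((%s. F (p + s *\<^sub>R v)) has_derivative (%s. D (s *\<^sub>R v))) (at r)"
  by (rule has_derivative_compose) (rule assms)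
 thus ?thesis
  using has_derivative_linear[OF assms] by (simp add: has_vector_derivative_def linear_scale)
qed

lemma dd_eq: "(F has_derivative D) (at p) ==> dd v F p = D v"
 unfolding dd_def using has_vector_derivative_line[of F D p 0 v] by (intro vector_derivative_at) simp

lemma dd_has_derivative:
 assumes "C_k (Suc n) U F" "p : U"
 shows "(F has_derivative (%v. dd v F p)) (at p)"
proof -
 from C_k_Suc_ex[OF assms(1)] obtain D where "!!p. p : U ==> (F has_derivative D p) (at p)" by blast
 from this[OF assms(2)] have D: "(F has_derivative D p) (at p)" .
 hence "(%v. dd v F p) = D p" by (intro ext) (rule dd_eq)
 with D show ?thesis by simp
qed

lemma C_k_dd:
 assumes "open U" "C_k (Suc n) U F"
 shows "C_k n U (dd v F)"
proof -
 from C_k_Suc_ex[OF assms(2)] obtain D where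
  D: "!!p. p : U ==> (F has_derivative D p) (at p)" "!!v. C_k n U (%p. D p v)" by blast
 show ?thesis
 proof (rule C_k_cong[OF assms(1) _ D(2)])
  show "D p v = dd v F p" if "p : U" for p
   by (rule dd_eq[OF D(1)[OF that], symmetric])
 qed
qed

lemma dd_linear:
 assumes "C_k (Suc n) U F" "p : U"
 shows "dd (c *\<^sub>R v) F p = c *\<^sub>R dd v F p" "dd (v + w) F p = dd v F p + dd w F p"
  "dd (\<Sum>i\<in>I. f i) F p = (\<Sum>i\<in>I. dd (f i) F p)"
proof -
 note l = has_derivative_linear[OF dd_has_derivative[OF assms]]
 show "dd (c *\<^sub>R v) F p = c *\<^sub>R dd v F p" by (rule linear_scale[OF l])
 show "dd (v + w) F p = dd v F p + dd w F p" by (rule linear_add[OF l])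
 show "dd (\<Sum>i\<in>I. f i) F p = (\<Sum>i\<in>I. dd (f i) F p)" by (rule linear_sum[OF l])
qed

lemma dd_cong:
 assumes "open U" "p : U" "!!q. q : U ==> F q = G q" "C_k (Suc n) U F"
 shows "dd v F p = dd v G p"
proof -
 have "(G has_derivative (%v. dd v F p)) (at p)"
  by (rule has_derivative_transform_within_open[OF dd_has_derivative[OF assms(4,2)] assms(1,2,3)])
 thus ?thesis by (simp add: dd_eq)
qed

lemma dd_bilinear:
 assumes "bounded_bilinear pr" "C_k (Suc n) U F" "C_k (Suc k) U G" "p : U"
 shows "dd v (%p. pr (F p) (G p)) p = pr (F p) (dd v G p) + pr (dd v F p) (G p)"
 by (rule dd_eq[OF bounded_bilinear.FDERIV[OF assms(1) dd_has_derivative[OF assms(2,4)] dd_has_derivative[OF assms(3,4)]]])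

lemma C_k_Un:
 assumes "open U" "open V" "C_k n U f" "C_k n V f"
 shows "C_k n (U \<union> V) f"
 using assms(3,4)
proof (induction n arbitrary: f)
 case 0
 thus ?case using assms(1,2) by (simp add: continuous_on_open_Un)
next
 case (Suc n)
 show ?case
 proof (rule C_k_SucI)
  show "(f has_derivative (%v. dd v f p)) (at p)" if "p : U \<union> V" for p
   using that dd_has_derivative[OF Suc.prems(1)] dd_has_derivative[OF Suc.prems(2)] by auto
  show "C_k n (U \<union> V) (%p. dd v f p)" for v
   by (intro Suc.IH C_k_dd assms Suc.prems)
 qed
qed

text \<open>Smoothness is local: the function is \<open>C_k\<close> on \<open>U\<close> and vanishes identically on the open
  complement of \<open>K\<close>.\<close>
lemma C_k_zero_ext:
 assumes "open U" "C_k n U f" "closed K" "K \<subseteq> U" "!!p. p \<notin> K ==> f p = 0"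
 shows "C_k n UNIV f"
proof -
 have "C_k n (- K) f"
  by (rule C_k_cong[where f="%_. 0"]) (use assms in auto)
 hence "C_k n (U \<union> - K) f" using assms by (intro C_k_Un) auto
 moreover have "U \<union> - K = UNIV" using assms(4) by auto
 ultimately show ?thesis by simp
qed

text \<open>By translation invariance the integral of \<open>F (p + t v)\<close> does not depend on \<open>t\<close>;
  differentiate at \<open>t = 0\<close>.  This is the only integration by parts in several variables that is used.\<close>
lemma integral_dd_zero:
 fixes F :: "'a::euclidean_space => 'b::{banach,second_countable_topology}"
 assumes F: "C_k 1 UNIV F" and K: "compact K" "!!p. p \<notin> K ==> F p = 0"
 shows "integrable lborel (dd v F)" "(\<integral>p. dd v F p \<partial>lborel) = 0"
proof -
 have F': "C_k (Suc 0) UNIV F" using F by simp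
 have cF: "continuous_on UNIV F" using C_k_continuous[OF F] .
 have cd: "continuous_on UNIV (dd v F)" using C_k_continuous[OF C_k_dd[OF open_UNIV F']] .
 have z: "dd v F p = 0" if "p \<notin> K" for p
 proof -
  have "dd v (%_. 0) p = dd v F p"
   by (rule dd_cong[of "-K" _ _ _ 0]) (use that K compact_imp_closed in auto)
  thus ?thesis by (simp add: dd_eq[of _ "%_. 0"])
 qed
 have int: "integrable lborel g" if "continuous_on UNIV g" "!!p. p \<notin> K ==> g p = 0" for g :: "'a => 'b"
 proof -
  have "integrable lborel (%x. indicator K x *\<^sub>R g x)"
   by (rule borel_integrable_compact[OF K(1) continuous_on_subset[OF that(1)]]) simp
  moreover have "(%x. indicator K x *\<^sub>R g x) = g" using that(2) by (auto simp: indicator_def)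
  ultimately show ?thesis by simp
 qed
 show "integrable lborel (dd v F)" by (rule int[OF cd z])
 have "bounded (dd v F ` K)"
  by (intro compact_imp_bounded compact_continuous_image continuous_on_subset[OF cd] K(1)) simp
 then obtain B where B: "B > 0" "!!y. y : dd v F ` K ==> norm y <= B" unfolding bounded_pos by blast
 have B': "norm (dd v F p) <= B" for p using B z[of p] by (cases "p : K") auto
 obtain R where R: "!!p. p : K ==> norm p <= R"
  using compact_imp_bounded[OF K(1)] unfolding bounded_iff by blast
 have der: "((%s. F (p + s *\<^sub>R v)) has_vector_derivative dd v F (p + r *\<^sub>R v)) (at r)" for p r
  using has_vector_derivative_line[OF dd_has_derivative[OF F']] by simp
 have lip: "norm (F (p + h *\<^sub>R v) - F p) <= B * \<bar>h\<bar>" for p h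
 proof -
  have "norm (F (p + h *\<^sub>R v) - F (p + 0 *\<^sub>R v)) <= B * norm (h - 0)"
  proof (rule differentiable_bound[where S=UNIV and f'="%r s. s *\<^sub>R dd v F (p + r *\<^sub>R v)"])
   show "((%s. F (p + s *\<^sub>R v)) has_derivative (%s. s *\<^sub>R dd v F (p + r *\<^sub>R v))) (at r within UNIV)" for r
    using der[of p r] by (simp add: has_vector_derivative_def)
   show "onorm (%s. s *\<^sub>R dd v F (p + r *\<^sub>R v)) <= B" for r
    by (rule onorm_le) (use B'[of "p + r *\<^sub>R v"] in "auto simp: mult.commute[of B] intro: mult_left_mono")
  qed auto
  thus ?thesis by simp
 qed
 let ?h = "%n. 1 / real (Suc n)"
 let ?q = "%n p. real (Suc n) *\<^sub>R (F (p + ?h n *\<^sub>R v) - F p)"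
 have iF: "integrable lborel F" by (rule int[OF cF K(2)])
 have tr: "integrable lborel (%p. F (p + c))" "(\<integral>p. F (p + c) \<partial>lborel) = (\<integral>p. F p \<partial>lborel)" for c
 proof -
  have e: "lborel = distr lborel borel ((+) c)" by (rule lborel_distr_plus[symmetric])
  have "integrable (distr lborel borel ((+) c)) F" using iF e by simp
  thus "integrable lborel (%p. F (p + c))" by (subst (asm) integrable_distr_eq) (use iF in "auto simp: add.commute")
  have "(\<integral>p. F p \<partial>lborel) = (\<integral>p. F p \<partial>distr lborel borel ((+) c))" using e by simp
  also have "... = (\<integral>p. F (c + p) \<partial>lborel)" by (subst integral_distr) (use iF in auto)
  finally show "(\<integral>p. F (p + c) \<partial>lborel) = (\<integral>p. F p \<partial>lborel)" by (simp add: add.commute)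
 qed
 have q0: "(\<integral>p. ?q n p \<partial>lborel) = 0" for n
  using tr[of "?h n *\<^sub>R v"] iF by simp
 have "(%n. \<integral>p. ?q n p \<partial>lborel) \<longlonglongrightarrow> (\<integral>p. dd v F p \<partial>lborel)"
 proof (rule integral_dominated_convergence[where w="%p. indicator (cball 0 (R + norm v)) p * B"])
  show "dd v F : borel_measurable lborel" using borel_measurable_continuous_onI[OF cd] by simp
  have [measurable]: "F : borel_measurable borel" using borel_measurable_continuous_onI[OF cF] .
  show "?q n : borel_measurable lborel" for n by measurable
  have "integrable lborel (%p. indicator (cball 0 (R + norm v)) p *\<^sub>R B)"
   by (rule borel_integrable_compact) auto
  thus "integrable lborel (%p::'a. indicator (cball 0 (R + norm v)) p * B)" by simp
  show "AE p in lborel. (%n. ?q n p) \<longlonglongrightarrow> dd v F p"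
  proof (rule AE_I2)
   fix p
   have "((%s. F (p + s *\<^sub>R v)) has_derivative (%s. s *\<^sub>R dd v F p)) (at 0)"
    using der[of p 0] by (simp add: has_vector_derivative_def)
   hence "((%h. norm (F (p + h *\<^sub>R v) - F p - h *\<^sub>R dd v F p) / norm h) \<longlongrightarrow> 0) (at 0)"
    unfolding has_derivative_at by simp
   moreover have "filterlim ?h (at 0) sequentially"
    using LIMSEQ_inverse_real_of_nat by (auto simp: filterlim_at inverse_eq_divide)
   ultimately have "(%n. norm (F (p + ?h n *\<^sub>R v) - F p - ?h n *\<^sub>R dd v F p) / norm (?h n)) \<longlonglongrightarrow> 0"
    by (rule filterlim_compose)
   moreover have "norm (F (p + ?h n *\<^sub>R v) - F p - ?h n *\<^sub>R dd v F p) / norm (?h n) = norm (?q n p - dd v F p)" for n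
   proof -
    have "?q n p - dd v F p = real (Suc n) *\<^sub>R (F (p + ?h n *\<^sub>R v) - F p - ?h n *\<^sub>R dd v F p)"
     by (simp add: scaleR_diff_right)
    hence "norm (?q n p - dd v F p) = real (Suc n) * norm (F (p + ?h n *\<^sub>R v) - F p - ?h n *\<^sub>R dd v F p)"
     by (simp only: norm_scaleR abs_of_nat)
    thus ?thesis by (simp add: field_simps)
   qed
   ultimately have "(%n. norm (?q n p - dd v F p)) \<longlonglongrightarrow> 0" by simp
   thus "(%n. ?q n p) \<longlonglongrightarrow> dd v F p"
    by (rule LIM_zero_cancel[OF tendsto_norm_zero_cancel])
  qed
  show "AE p in lborel. norm (?q n p) <= indicator (cball 0 (R + norm v)) p * B" for n
  proof (rule AE_I2)
   fix p
   show "norm (?q n p) <= indicator (cball 0 (R + norm v)) p * B"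
   proof (cases "norm p <= R + norm v")
    case True
    have "norm (?q n p) <= real (Suc n) * (B * \<bar>?h n\<bar>)"
     unfolding norm_scaleR by (intro mult_mono lip) auto
    also have "... = B" by simp
    finally show ?thesis using True by simp
   next
    case False
    have "p \<notin> K" using R[of p] False norm_ge_zero[of v] by (metis add.right_neutral add_mono_thms_linordered_semiring(1))
    moreover have "p + ?h n *\<^sub>R v \<notin> K"
    proof
     assume "p + ?h n *\<^sub>R v : K"
     hence "norm (p + ?h n *\<^sub>R v) <= R" by (rule R)
     moreover have "norm p <= norm (p + ?h n *\<^sub>R v) + norm (?h n *\<^sub>R v)"
      by (metis add_diff_cancel norm_triangle_ineq4)
     moreover have "norm (?h n *\<^sub>R v) <= norm v" by (simp add: divide_le_eq distrib_left)
     ultimately show False using False by linarith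
    qed
    ultimately show ?thesis using K(2) False by simp
   qed
  qed
 qed
 thus "(\<integral>p. dd v F p \<partial>lborel) = 0"
  unfolding q0 using LIMSEQ_unique tendsto_const by metis
qed

abbreviation e0 :: point where "e0 \<equiv> (1, 0)"
abbreviation ei :: "3 => point" where "ei i \<equiv> (0, axis i 1)"

text \<open>The open subset of \<open>real \<times> real^3\<close> on which functions on the manifold are extended, homogeneously
  of degree \<open>0\<close>.\<close>
definition UU :: "real => point set" where "UU x0 = {x0<..} \<times> (- {0})"

lemma open_UU [simp]: "open (UU x0)" by (auto simp: UU_def intro!: open_Times)

lemma UU_iff [simp]: "(x, y) : UU x0 \<longleftrightarrow> x > x0 & y ~= 0" by (auto simp: UU_def)

lemma S2_UU: "{x0<..} \<times> S2 \<subseteq> UU x0" by auto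

lemma S2_UU_mem: "p : {x0<..} \<times> S2 ==> p : UU x0" by auto

lemma lift_S2: "p : I \<times> S2 ==> lift p = p" by (auto simp: lift_def sgn_S2)

definition ext :: "(point => complex) => point => complex" where "ext f = (%p. f (lift p))"

lemma ext_S2: "p : I \<times> S2 ==> ext f p = f p" by (simp add: ext_def lift_S2)

lemma C_k_lift: "C_k n (UU x0) lift"
proof -
 have *: "bounded_linear (%x::real. (x, 0::real^3))" "bounded_linear (%y::real^3. (0::real, y))"
  by (auto intro!: bounded_linear_Pair bounded_linear_ident bounded_linear_zero)
 have "C_k n (UU x0) (%p. (fst p, 0::real^3) + (0::real, sgn (snd p)))"
  by (intro C_k_add C_k_compose_linear[OF *(1)] C_k_compose_linear[OF *(2)]
    C_k_compose[OF C_k_sgn] C_k_bounded_linear bounded_linear_fst bounded_linear_snd)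
    (auto simp: UU_def)
 thus ?thesis by (simp add: lift_def[abs_def])
qed

lemma smooth_on_M_ext:
 assumes "smooth_on_M x0 f"
 shows "C_k n (UU x0) (ext f)"
proof -
 from assms obtain U g where U: "open U" "{x0..} \<times> S2 \<subseteq> U" "!!n. C_k n U g" "!!p. p : {x0..} \<times> S2 ==> g p = f p"
  unfolding smooth_on_M_def by blast
 have l: "lift p : {x0..} \<times> S2" if "p : UU x0" for p
  using that by (cases p) (auto simp: norm_sgn)
 have "C_k n (UU x0) (%p. g (lift p))"
  using l U(2) by (intro C_k_compose[OF U(3) C_k_lift]) blast
 thus ?thesis
  by (rule C_k_cong[OF open_UU, rotated]) (use U(4) l in "auto simp: ext_def")
qed

lemma ext_scale: "r > 0 ==> ext f (x, r *\<^sub>R y) = ext f (x, y)"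
 by (simp add: ext_def sgn_scaleR)

lemma hom_deriv:
 assumes G: "C_k (Suc n) (UU x0) G" and h: "!!x y. (x, y) : UU x0 ==> G (x, r *\<^sub>R y) = c *\<^sub>R G (x, y)"
  and r: "r > 0" and p: "(x, y) : UU x0"
 shows "dd (\<xi>, r *\<^sub>R \<eta>) G (x, r *\<^sub>R y) = c *\<^sub>R dd (\<xi>, \<eta>) G (x, y)"
proof -
 let ?S = "%p::point. (fst p, r *\<^sub>R snd p)"
 have S: "(?S has_derivative ?S) (at (x, y))"
  by (auto intro!: derivative_eq_intros)
 have "?S (x, y) : UU x0" using p r by auto
 hence GS: "((%p. G (?S p)) has_derivative (%v. dd (?S v) G (?S (x, y)))) (at (x, y))"
  by (intro has_derivative_compose[OF S] dd_has_derivative[OF G])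
 have "((%p. c *\<^sub>R G p) has_derivative (%v. c *\<^sub>R dd v G (x, y))) (at (x, y))"
  by (intro has_derivative_scaleR_right dd_has_derivative[OF G p])
 hence "((%p. G (?S p)) has_derivative (%v. c *\<^sub>R dd v G (x, y))) (at (x, y))"
  by (rule has_derivative_transform_within_open[OF _ open_UU p]) (use h in auto)
 from has_derivative_unique[OF GS this] show ?thesis by (auto dest: fun_cong[of _ _ "(\<xi>, \<eta>)"])
qed

text \<open>Homogeneity of degree \<open>0\<close>: tangential first derivatives scale with exponent \<open>-1\<close>, and the
  radial derivative vanishes (Euler).\<close>
lemma ext_hom:
 assumes F: "C_k (Suc 0) (UU x0) (ext f)" and r: "r > 0" and p: "(x, y) : UU x0"
 shows "dd e0 (ext f) (x, r *\<^sub>R y) = dd e0 (ext f) (x, y)"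
  "dd (0, \<eta>) (ext f) (x, r *\<^sub>R y) = (1/r) *\<^sub>R dd (0, \<eta>) (ext f) (x, y)"
  "dd (0, y) (ext f) (x, y) = 0"
proof -
 have h: "(x, y) : UU x0 ==> ext f (x, r *\<^sub>R y) = 1 *\<^sub>R ext f (x, y)" for x y
  using ext_scale[OF r] by simp
 show "dd e0 (ext f) (x, r *\<^sub>R y) = dd e0 (ext f) (x, y)"
  using hom_deriv[OF F h r p, of 1 0] by simp
 have "r *\<^sub>R dd (0, \<eta>) (ext f) (x, r *\<^sub>R y) = dd (0, r *\<^sub>R \<eta>) (ext f) (x, r *\<^sub>R y)"
  using dd_linear(1)[OF F, of "(x, r *\<^sub>R y)" r "(0, \<eta>)"] p r by simp
 also have "... = dd (0, \<eta>) (ext f) (x, y)"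
  using hom_deriv[OF F h r p, of 0 \<eta>] by simp
 finally show "dd (0, \<eta>) (ext f) (x, r *\<^sub>R y) = (1/r) *\<^sub>R dd (0, \<eta>) (ext f) (x, y)"
  using r by (metis (no_types) inverse_eq_divide less_irrefl scaleR_one scaleR_scaleR left_inverse)
 have "((%s. ext f ((x, y) + s *\<^sub>R (0, y))) has_vector_derivative dd (0, y) (ext f) (x, y)) (at 0)"
  using has_vector_derivative_line[of "ext f" _ "(x, y)" 0 "(0, y)"] dd_has_derivative[OF F p] by simp
 moreover have "((%s. ext f ((x, y) + s *\<^sub>R (0, y))) has_vector_derivative 0) (at 0)"
 proof (rule has_vector_derivative_transform_within_open[where S="{-1<..}" and f="%s. ext f (x, y)"])
  show "ext f (x, y) = ext f ((x, y) + s *\<^sub>R (0, y))" if "s : {-1<..}" for s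
   using ext_scale[of "1 + s" f x y] that by (simp add: scaleR_left_distrib)
 qed auto
 ultimately show "dd (0, y) (ext f) (x, y) = 0" by (rule vector_derivative_unique_at)
qed

lemma ext_hom2:
 assumes F: "C_k (Suc (Suc 0)) (UU x0) (ext f)" and r: "r > 0" and p: "(x, y) : UU x0"
 shows "dd (0, \<eta>) (dd (0, \<eta>) (ext f)) (x, r *\<^sub>R y) = (1/r^2) *\<^sub>R dd (0, \<eta>) (dd (0, \<eta>) (ext f)) (x, y)"
proof -
 let ?G = "dd (0, \<eta>) (ext f)"
 have G: "C_k (Suc 0) (UU x0) ?G" by (intro C_k_dd F) simp
 have h: "(x, y) : UU x0 ==> ?G (x, r *\<^sub>R y) = (1/r) *\<^sub>R ?G (x, y)" for x y
  by (rule ext_hom(2)[OF C_k_SucD[OF F] r])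
 have "r *\<^sub>R dd (0, \<eta>) ?G (x, r *\<^sub>R y) = dd (0, r *\<^sub>R \<eta>) ?G (x, r *\<^sub>R y)"
  using dd_linear(1)[OF G, of "(x, r *\<^sub>R y)" r "(0, \<eta>)"] p r by simp
 also have "... = (1/r) *\<^sub>R dd (0, \<eta>) ?G (x, y)"
  using hom_deriv[OF G h r p, of 0 \<eta>] by simp
 finally have "(1/r) *\<^sub>R r *\<^sub>R dd (0, \<eta>) ?G (x, r *\<^sub>R y) = (1/r) *\<^sub>R (1/r) *\<^sub>R dd (0, \<eta>) ?G (x, y)"
  by simp
 thus ?thesis using r by (simp add: power2_eq_square)
qed

section \<open>The differential operators in Euclidean coordinates\<close>

lemma dx_eq:
 assumes F: "C_k (Suc 0) (UU x0) (ext f)" and p: "p : {x0<..} \<times> S2"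
 shows "dx f p = dd e0 (ext f) p"
proof -
 obtain x \<omega> where [simp]: "p = (x, \<omega>)" by (cases p)
 have "(ext f has_derivative (%v. dd v (ext f) (x, \<omega>))) (at ((0, \<omega>) + x *\<^sub>R e0))"
  using dd_has_derivative[OF F S2_UU_mem[OF p]] by simp
 from has_vector_derivative_line[OF this]
 have "((%s. f (s, sgn \<omega>)) has_vector_derivative dd e0 (ext f) (x, \<omega>)) (at x)"
  by (simp add: ext_def)
 thus ?thesis using p by (simp add: dx_def sgn_S2 vector_derivative_at)
qed

lemma sphere_grad_eq:
 assumes F: "C_k (Suc 0) (UU x0) (ext f)" and p: "p : {x0<..} \<times> S2"
 shows "sphere_grad f p $ i = dd (ei i) (ext f) p"
 by (cases p) (simp add: sphere_grad_def dd_def ext_def)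

lemma sphere_laplacian_eq:
 assumes F: "C_k (Suc (Suc 0)) (UU x0) (ext f)" and p: "p : {x0<..} \<times> S2"
 shows "sphere_laplacian f p = (\<Sum>i\<in>UNIV. dd (ei i) (dd (ei i) (ext f)) p)"
proof -
 obtain x \<omega> where [simp]: "p = (x, \<omega>)" by (cases p)
 have "vector_derivative (%r. vector_derivative (%s. f (x, sgn (\<omega> + s *\<^sub>R axis i 1))) (at r)) (at 0)
   = dd (ei i) (dd (ei i) (ext f)) p" for i
 proof (rule vector_derivative_at)
  let ?V = "{r. \<omega> + r *\<^sub>R axis i 1 ~= (0::real^3)}"
  have "open ((%r. \<omega> + r *\<^sub>R axis i 1) -` (- {0::real^3}))"
   by (intro open_vimage continuous_intros; simp)
  hence V: "open ?V" by (simp only: vimage_def Compl_iff singleton_iff)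
  have "(dd (ei i) (ext f) has_derivative (%v. dd v (dd (ei i) (ext f)) p)) (at (p + 0 *\<^sub>R ei i))"
   using dd_has_derivative[OF C_k_dd[OF open_UU F] S2_UU_mem[OF p]] by simp
  from has_vector_derivative_line[OF this]
  show "((%r. vector_derivative (%s. f (x, sgn (\<omega> + s *\<^sub>R axis i 1))) (at r)) has_vector_derivative
    dd (ei i) (dd (ei i) (ext f)) p) (at 0)"
  proof (rule has_vector_derivative_transform_within_open[OF _ V])
   show "0 : ?V" using p by auto
   fix r assume r: "r : ?V"
   have "(ext f has_derivative (%v. dd v (ext f) (p + r *\<^sub>R ei i))) (at (p + r *\<^sub>R ei i))"
    using dd_has_derivative[OF F, of "p + r *\<^sub>R ei i"] p r by auto
   from has_vector_derivative_line[OF this]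
   have "vector_derivative (%s. ext f (p + s *\<^sub>R ei i)) (at r) = dd (ei i) (ext f) (p + r *\<^sub>R ei i)"
    by (rule vector_derivative_at)
   thus "dd (ei i) (ext f) (p + r *\<^sub>R ei i) = vector_derivative (%s. f (x, sgn (\<omega> + s *\<^sub>R axis i 1))) (at r)"
    by (simp add: ext_def)
  qed
 qed
 thus ?thesis by (simp add: sphere_laplacian_def)
qed

text \<open>The radial flux \<open>a^2 f_x\<close> of the extension.\<close>
definition Nx :: "nat => (point => complex) => point => complex" where
 "Nx m f p = (warp m (fst p))^2 *\<^sub>R dd e0 (ext f) p"

lemma C_k_warp_fst: "m >= 1 ==> C_k n U (%p::point. (warp m (fst p))^2)"
proof -
 assume m: "m >= 1"
 have "C_k n UNIV (%p::point. (warp m (fst p))^2)"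
  by (intro C_k_power C_k_compose[OF smoothD[OF smooth_warp[OF m]]] C_k_bounded_linear bounded_linear_fst) auto
 thus ?thesis by (rule C_k_mono) simp
qed

lemma C_k_Nx: "m >= 1 ==> C_k (Suc n) (UU x0) (ext f) ==> C_k n (UU x0) (Nx m f)"
 unfolding Nx_def[abs_def] by (intro C_k_scaleR C_k_warp_fst C_k_dd) auto

lemma Nx_hom:
 assumes m: "m >= 1" and F: "C_k (Suc (Suc 0)) (UU x0) (ext f)" and r: "r > 0" and p: "(x, y) : UU x0"
 shows "dd e0 (Nx m f) (x, r *\<^sub>R y) = dd e0 (Nx m f) (x, y)"
 using hom_deriv[OF C_k_Nx[OF m F] _ r p, of 1 1 0] ext_hom(1)[OF C_k_SucD[OF F] r]
 by (simp add: Nx_def)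

text \<open>On the sphere the Euclidean Laplacian of a function that is homogeneous of degree \<open>0\<close> is the spherical
  Laplacian, so all derivatives can be taken in Euclidean coordinates.\<close>
lemma classical_laplacian_eq:
 assumes m: "m >= 1" and F: "C_k (Suc (Suc 0)) (UU x0) (ext f)" and p: "p : {x0<..} \<times> S2"
 shows "classical_laplacian m f p = inverse ((warp m (fst p))^2) *\<^sub>R (dd e0 (Nx m f) p
   + (\<Sum>i\<in>UNIV. dd (ei i) (dd (ei i) (ext f)) p))"
proof -
 obtain x \<omega> where [simp]: "p = (x, \<omega>)" by (cases p)
 have "(Nx m f has_derivative (%v. dd v (Nx m f) p)) (at ((0, \<omega>) + x *\<^sub>R e0))"
  using dd_has_derivative[OF C_k_Nx[OF m F] S2_UU_mem[OF p]] by simp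
 from has_vector_derivative_line[OF this]
 have "((%s. (warp m s)^2 *\<^sub>R dx f (s, \<omega>)) has_vector_derivative dd e0 (Nx m f) p) (at x)"
 proof (rule has_vector_derivative_transform_within_open[where S="{x0<..}"])
  fix s assume "s : {x0<..}"
  thus "Nx m f ((0, \<omega>) + s *\<^sub>R e0) = (warp m s)^2 *\<^sub>R dx f (s, \<omega>)"
   using p dx_eq[OF C_k_SucD[OF F], of "(s, \<omega>)"] by (simp add: Nx_def)
 qed (use p in simp_all)
 thus ?thesis
  using sphere_laplacian_eq[OF F p] by (simp add: classical_laplacian_def vector_derivative_at scaleR_add_right)
qed

lemma grad_eq:
 assumes F: "C_k (Suc 0) (UU x0) (ext f)" and p: "p : {x0<..} \<times> S2"
 shows "grad m f p = (dd e0 (ext f) p, inverse (warp m (fst p)) *\<^sub>R (\<chi> i. dd (ei i) (ext f) p))"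
proof -
 have "sphere_grad f p = (\<chi> i. dd (ei i) (ext f) p)"
  by (simp add: vec_eq_iff sphere_grad_eq[OF F p])
 thus ?thesis using dx_eq[OF F p] by (cases p) (simp add: grad_def)
qed

lemma dd_zero_open:
 fixes F :: "'a::euclidean_space => 'b::real_normed_vector"
 assumes "open V" "p : V" "!!q. q : V ==> F q = 0"
 shows "dd v F p = 0"
proof -
 have "dd v (%_. 0) p = dd v F p"
  by (rule dd_cong[OF assms(1,2), where n=0]) (use assms(3) in auto)
 thus ?thesis by (simp add: dd_eq[of _ "%_. 0"])
qed

text \<open>Vanishing outside the slab \<open>r <= x <= s\<close>.\<close>
definition xsupp :: "real => (point => complex) => real => real => bool" where
 "xsupp x0 f r s \<longleftrightarrow> (\<forall>x \<omega>. x > x0 --> \<omega> : S2 --> x \<notin> {r..s} --> f (x, \<omega>) = 0)"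

lemma xsupp_ext:
 assumes "xsupp x0 f r s" "p : UU x0" "fst p \<notin> {r..s}"
 shows "ext f p = 0" "dd v (ext f) p = 0" "dd w (dd v (ext f)) p = 0" "dd v (Nx m f) p = 0"
proof -
 let ?V = "UU x0 \<inter> (fst -` (- {r..s}))"
 have V: "open ?V" "p : ?V" using assms by (auto intro!: open_vimage_fst open_Int)
 have 0: "ext f q = 0" if "q : ?V" for q
  using that assms(1) by (cases q) (auto simp: ext_def xsupp_def norm_sgn)
 have 1: "dd v (ext f) q = 0" if "q : ?V" for q v by (rule dd_zero_open[OF V(1) that 0])
 show "ext f p = 0" "dd v (ext f) p = 0" "dd w (dd v (ext f)) p = 0" using 0 1 V dd_zero_open[OF V 1] by auto
 show "dd v (Nx m f) p = 0" by (rule dd_zero_open[OF V]) (simp add: Nx_def 1)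
qed

lemma continuous_vanish_integrable:
 fixes h :: "point => 'b::{banach,second_countable_topology}"
 assumes m: "m >= 1" and c: "continuous_on ({x0<..} \<times> S2) h" and r: "x0 < r"
  and z: "!!x \<omega>. x > x0 ==> \<omega> : S2 ==> x \<notin> {r..s} ==> h (x, \<omega>) = 0"
 shows "integrable (volM m x0) h" "in_L2 (volM m x0) h"
  "EX C. \<forall>p\<in>{x0<..} \<times> S2. norm (h p) <= C"
proof -
 have "compact (h ` ({r..s} \<times> S2))"
  using r by (intro compact_continuous_image continuous_on_subset[OF c] compact_Times) auto
 hence "bounded (h ` ({r..s} \<times> S2))" by (rule compact_imp_bounded)
 then obtain C where "C > 0" "\<forall>y\<in>h ` ({r..s} \<times> S2). norm y <= C" unfolding bounded_pos by blast
 hence C: "C > 0" "!!p. p : {r..s} \<times> S2 ==> norm (h p) <= C" by blast+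
 have C': "norm (h p) <= C" if "p : {x0<..} \<times> S2" for p
 proof (cases "fst p : {r..s}")
  case True
  thus ?thesis using that C(2)[of p] by (auto simp: mem_Times_iff)
 next
  case False
  hence "h p = 0" using that z[of "fst p" "snd p"] by (auto simp: mem_Times_iff)
  thus ?thesis using C(1) by simp
 qed
 have z': "h p = 0" if "p : {x0<..} \<times> S2" "fst p > s" for p using that z by (cases p) auto
 have hm: "h : borel_measurable (volM m x0)" by (rule continuous_measurable_vol[OF c])
 show "integrable (volM m x0) h" by (rule integrable_vol_bounded[OF m hm C' z'])
 have "integrable (volM m x0) (%p. (norm (h p))^2)"
  by (rule integrable_vol_bounded[OF m, of _ _ "C^2" s]) (use hm C' z' in "auto intro!: power_mono")
 thus "in_L2 (volM m x0) h" using hm by (simp add: in_L2_def)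
 show "EX C. \<forall>p\<in>{x0<..} \<times> S2. norm (h p) <= C" using C' by blast
qed

text \<open>As a function of \<open>q = |y|^2\<close> these functions tend to the indicator of \<open>0 < q < 1\<close>; they
  remove the origin and the surface of the solid ball before integration by parts.\<close>
definition cutoff :: "nat => real => real" where
 "cutoff n q = step (real n * q) * step (real n * (1 - q))"

lemma smooth_cutoff: "smooth (cutoff n)"
 unfolding cutoff_def[abs_def]
 by (intro smooth_intros smooth_compose[OF smooth_step])

lemma cutoff_zero: "q <= 1 / real n \<or> q >= 1 - 1 / real n ==> n > 0 ==> cutoff n q = 0"
 by (auto simp: cutoff_def field_simps intro!: step_bounds)

lemma cutoff_01: "0 <= cutoff n q" "cutoff n q <= 1"
 by (auto simp: cutoff_def step_bounds intro!: mult_le_one)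

lemma cutoff_lim: 
 assumes "0 < q" "q < 1"
 shows "(%n. cutoff n q) \<longlonglongrightarrow> 1"
proof -
 have "\<forall>\<^sub>F n in sequentially. cutoff n q = 1"
 proof -
  obtain N :: nat where N: "2 / q < real N" using reals_Archimedean2 by blast
  obtain M :: nat where M: "2 / (1 - q) < real M" using reals_Archimedean2 by blast
  have "cutoff n q = 1" if "n >= max N M" for n
  proof -
   have "2 / q < real n" "2 / (1 - q) < real n" using N M that by auto
   hence "2 <= real n * q" "2 <= real n * (1 - q)" using assms by (auto simp: field_simps)
   thus ?thesis by (simp add: cutoff_def step_bounds)
  qed
  thus ?thesis unfolding eventually_sequentially by blast
 qed
 thus ?thesis by (rule tendsto_eventually)
qed

lemma radial_derivative:
 assumes "smooth \<theta>"
 shows "C_k n U (%p::point. \<theta> (nsq p))"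
  "dd v (%p::point. \<theta> (nsq p)) p = deriv \<theta> (nsq p) * (2 * (snd p \<bullet> snd v))"
proof -
 have "C_k n UNIV (%p::point. \<theta> (nsq p))"
  by (intro C_k_compose[OF smoothD[OF assms]] C_k_inner C_k_bounded_linear bounded_linear_snd) auto
 thus "C_k n U (%p::point. \<theta> (nsq p))" by (rule C_k_mono) simp
 have 1: "((%p::point. nsq p) has_derivative (%v. 2 * (snd p \<bullet> snd v))) (at p)"
  by (auto intro!: derivative_eq_intros simp: inner_commute)
 have "((%p::point. \<theta> (nsq p)) has_derivative (%v. deriv \<theta> (nsq p) * (2 * (snd p \<bullet> snd v)))) (at p)"
  by (rule has_derivative_compose[OF 1, of \<theta> "%h. deriv \<theta> (nsq p) * h"])
    (use smooth_deriv(1)[OF assms] in "simp add: has_field_derivative_def")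
 thus "dd v (%p::point. \<theta> (nsq p)) p = deriv \<theta> (nsq p) * (2 * (snd p \<bullet> snd v))"
  by (rule dd_eq)
qed

text \<open>The integrand is the directional derivative of the compactly supported function \<open>\<theta>(|y|^2) Q\<close>.\<close>
lemma integral_cut_dd_zero:
 fixes Q :: "point => 'c::{banach,second_countable_topology}"
 assumes n: "n > 0" and th: "smooth \<theta>" "!!q. cutoff n q = 0 ==> \<theta> q = 0"
  and Q: "C_k (Suc 0) (UU x0) Q" and r: "x0 < r"
  and z: "!!p. p : UU x0 ==> fst p \<notin> {r..s} ==> Q p = 0"
 shows "integrable lborel (%p. indicator (UU x0) p *\<^sub>R (\<theta> (nsq p) *\<^sub>R dd v Q p + (deriv \<theta> (nsq p) * (2 * (snd p \<bullet> snd v))) *\<^sub>R Q p))" (is "integrable _ ?f")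
  "(\<integral>p. indicator (UU x0) p *\<^sub>R (\<theta> (nsq p) *\<^sub>R dd v Q p + (deriv \<theta> (nsq p) * (2 * (snd p \<bullet> snd v))) *\<^sub>R Q p) \<partial>lborel) = 0"
proof -
 let ?T = "%p::point. \<theta> (nsq p)"
 let ?F = "%p. if p : UU x0 then ?T p *\<^sub>R Q p else 0"
 let ?K = "{r..s} \<times> {y::real^3. norm y <= 1 & 1 / real n <= y \<bullet> y}"
 have TQ: "C_k (Suc 0) (UU x0) (%p. ?T p *\<^sub>R Q p)"
  by (intro C_k_scaleR radial_derivative(1) th Q)
 have FU: "C_k (Suc 0) (UU x0) ?F"
  by (rule C_k_cong[OF open_UU _ TQ]) simp
 have cK: "compact ?K"
 proof (rule compact_Times)
  have "{y::real^3. norm y <= 1 & 1 / real n <= y \<bullet> y} = cball 0 1 \<inter> {y. 1 / real n <= y \<bullet> y}" by auto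
  moreover have "closed {y::real^3. 1 / real n <= y \<bullet> y}"
   by (intro closed_Collect_le continuous_intros)
  ultimately show "compact {y::real^3. norm y <= 1 & 1 / real n <= y \<bullet> y}"
   by (simp add: compact_Int_closed)
 qed simp
 have KU: "?K \<subseteq> UU x0"
 proof
  fix p assume p: "p : ?K"
  have "snd p ~= 0" using p n by (auto simp: divide_le_0_iff)
  thus "p : UU x0" using p r by (cases p) auto
 qed
 have F0: "?F p = 0" if "p \<notin> ?K" for p
 proof (cases "p : UU x0 & fst p : {r..s}")
  case True
  hence "\<not> (norm (snd p) <= 1 & 1 / real n <= nsq p)"
   using that by (cases p) auto
  moreover have "1 - 1 / real n <= nsq p" if *: "\<not> norm (snd p) <= 1"
  proof -
   from * have "1 <= norm (snd p) * norm (snd p)" using mult_mono[of 1 "norm (snd p)" 1 "norm (snd p)"] by simp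
   hence "1 <= nsq p" by (simp add: dot_square_norm power2_eq_square)
   moreover have "0 <= 1 / real n" by simp
   ultimately show ?thesis by linarith
  qed
  ultimately have "nsq p <= 1 / real n \<or> nsq p >= 1 - 1 / real n" by auto
  thus ?thesis using th(2) cutoff_zero n by auto
 next
  case False
  thus ?thesis using z by auto
 qed
 have FC: "C_k 1 UNIV ?F" unfolding One_nat_def
  by (rule C_k_zero_ext[OF open_UU FU compact_imp_closed[OF cK] KU F0])
 have e: "dd v ?F = ?f"
 proof
  fix p
  show "dd v ?F p = ?f p"
  proof (cases "p : UU x0")
   case True
   have "dd v (%p. ?T p *\<^sub>R Q p) p = dd v ?F p"
    by (rule dd_cong[OF open_UU True _ TQ]) simp
   moreover have "dd v (%p. ?T p *\<^sub>R Q p) p = ?T p *\<^sub>R dd v Q p + dd v ?T p *\<^sub>R Q p"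
    by (rule dd_bilinear[OF bounded_bilinear_scaleR radial_derivative(1)[OF th(1)] Q True])
   ultimately show ?thesis using True by (simp add: radial_derivative(2)[OF th(1)])
  next
   case False
   hence "p : - ?K" using KU by blast
   hence "dd v ?F p = 0"
    using F0 compact_imp_closed[OF cK] by (intro dd_zero_open[where V="- ?K"]) auto
   thus ?thesis using False by simp
  qed
 qed
 show "integrable lborel ?f" "(\<integral>p. ?f p \<partial>lborel) = 0"
  using integral_dd_zero[OF FC cK F0, of v] unfolding e by blast+
qed

lemma vec3_sum: "(y::real^3) = (\<Sum>i\<in>UNIV. (y $ i) *\<^sub>R axis i 1)"
 by (simp add: vec_eq_iff axis_def if_distrib[of "%x. _ * x"] cong: if_cong)

text \<open>Extend both functions homogeneously and integrate over the solid \<open>x0 < x\<close>, \<open>0 < |y| < 1\<close>.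
  The integrand is the sum of \<open>(pr \<psi> (a^2 \<phi>_x))_x\<close> and \<open>|y|^2\<close> times the divergence
  of \<open>pr \<psi> grad \<phi>\<close>.  After multiplication by a radial cutoff both integrate to zero: the
  derivative of a radial weight is radial, and the radial derivative of \<open>\<phi>\<close> vanishes.  So no boundary
  term arises when the cutoff tends to \<open>1\<close>.  The bilinear form is general in order to cover both the
  complex product of \<open>has_laplacian\<close> and the inner product.\<close>
lemma green:
 fixes pr :: "complex => complex => 'c::{banach,second_countable_topology}"
 assumes m: "m >= 1" and pr: "bounded_bilinear pr"
  and \<psi>: "C_k (Suc 0) (UU x0) (ext \<psi>)" and \<phi>: "C_k (Suc (Suc 0)) (UU x0) (ext \<phi>)"
  and r: "x0 < r" and xs: "xsupp x0 \<psi> r s \<or> xsupp x0 \<phi> r s"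
 defines "G \<equiv> %p. pr (dx \<psi> p) (dx \<phi> p) + inverse ((warp m (fst p))^2) *\<^sub>R (\<Sum>i\<in>UNIV. pr (sphere_grad \<psi> p $ i) (sphere_grad \<phi> p $ i))"
 shows "integrable (volM m x0) (%p. pr (\<psi> p) (classical_laplacian m \<phi> p))"
  "integrable (volM m x0) G"
  "(\<integral>p. pr (\<psi> p) (classical_laplacian m \<phi> p) \<partial>volM m x0) = - (\<integral>p. G p \<partial>volM m x0)"
proof -
 interpret pr: bounded_bilinear pr by (rule pr)
 let ?P = "ext \<psi>" and ?F = "ext \<phi>" and ?N = "Nx m \<phi>"
 note \<phi>1 = C_k_SucD[OF \<phi>]
 have N: "C_k (Suc 0) (UU x0) ?N" by (rule C_k_Nx[OF m \<phi>])
 have D: "C_k (Suc 0) (UU x0) (dd (ei i) ?F)" for i by (rule C_k_dd[OF open_UU \<phi>])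
 let ?lap = "%p. dd e0 ?N p + (\<Sum>i\<in>UNIV. dd (ei i) (dd (ei i) ?F) p)"
 define h1 where "h1 p = inverse ((warp m (fst p))^2) *\<^sub>R pr (?P p) (?lap p)" for p
 define h2 where "h2 p = pr (dd e0 ?P p) (dd e0 ?F p) + inverse ((warp m (fst p))^2) *\<^sub>R (\<Sum>i\<in>UNIV. pr (dd (ei i) ?P p) (dd (ei i) ?F p))" for p
 have h1: "pr (\<psi> p) (classical_laplacian m \<phi> p) = h1 p" if "p : {x0<..} \<times> S2" for p
  using classical_laplacian_eq[OF m \<phi> that] ext_S2[OF that, of \<psi>] by (simp add: h1_def pr.scaleR_right)
 have h2: "G p = h2 p" if "p : {x0<..} \<times> S2" for p
  using dx_eq[OF \<psi> that] dx_eq[OF \<phi>1 that] sphere_grad_eq[OF \<psi> that] sphere_grad_eq[OF \<phi>1 that]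
  by (simp add: G_def h2_def)
 have winv: "continuous_on A (%p::point. inverse ((warp m (fst p))^2))" for A
  using m by (intro continuous_intros continuous_on_compose2[OF smooth_continuous[OF smooth_warp[OF m], of UNIV]]) auto
 note cont = pr.continuous_on C_k_continuous[OF C_k_dd[OF open_UU N]] C_k_continuous[OF C_k_dd[OF open_UU D]]
  C_k_continuous[OF C_k_dd[OF open_UU \<psi>]] C_k_continuous[OF C_k_dd[OF open_UU \<phi>1]] C_k_continuous[OF \<psi>]
 have c1: "continuous_on (UU x0) h1" unfolding h1_def
  by (intro continuous_on_scaleR winv continuous_on_add continuous_on_sum cont)
 have c2: "continuous_on (UU x0) h2" unfolding h2_def
  by (intro continuous_on_scaleR winv continuous_on_add continuous_on_sum cont)
 have z: "pr (?P p) (?lap p) = 0 & pr (dd v ?P p) (dd w ?F p) = 0 & pr (?P p) (dd v ?F p) = 0 & pr (?P p) (?N p) = 0"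
  if "p : UU x0" "fst p \<notin> {r..s}" for p v w
  using xs by (elim disjE) (simp_all add: xsupp_ext[OF _ that] pr.zero_left pr.zero_right Nx_def)
 have h0: "h1 p = 0" "h2 p = 0" if "p : UU x0" "fst p \<notin> {r..s}" for p
  using z[OF that] by (auto simp: h1_def h2_def)
 have I1: "integrable (volM m x0) h1" and I2: "integrable (volM m x0) h2"
  by (rule continuous_vanish_integrable(1)[OF m continuous_on_subset[OF c1 S2_UU] r, of s];
    rule h0; force)
    (rule continuous_vanish_integrable(1)[OF m continuous_on_subset[OF c2 S2_UU] r, of s];
    rule h0; force)
 show "integrable (volM m x0) (%p. pr (\<psi> p) (classical_laplacian m \<phi> p))"
  by (subst BI_integrable_cong[OF refl, of _ _ h1]) (use h1 I1 in auto)
 show "integrable (volM m x0) G"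
  by (subst BI_integrable_cong[OF refl, of _ _ h2]) (use h2 I2 in auto)
 let ?h = "%p. h1 p + h2 p"
 have hm: "?h : borel_measurable (volM m x0)" using I1 I2 by auto
 define H where "H = (%p. indicator ({x0<..} \<times> Bp) p *\<^sub>R (3 * (warp m (fst p))^2) *\<^sub>R ?h (lift p))"
 have IH: "integrable lborel H"
  using integral_vol(2)[OF m _ hm] I1 I2 unfolding H_def by auto
 let ?W = "%p. (dd e0 (%p. pr (?P p) (?N p)) p) + (\<Sum>i\<in>UNIV. (nsq p) *\<^sub>R dd (ei i) (%p. pr (?P p) (dd (ei i) ?F p)) p)"
 have W: "?W p = (warp m (fst p))^2 *\<^sub>R ?h (lift p)" if "p : UU x0" for p
 proof -
  obtain x y where p: "p = (x, y)" by (cases p)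
  have y: "y ~= 0" "x > x0" using that p by auto
  define \<rho> where "\<rho> = 1 / norm y"
  have \<rho>: "\<rho> > 0" "\<rho> ~= 0" using y by (auto simp: \<rho>_def)
  have l: "lift p = (x, \<rho> *\<^sub>R y)" by (simp add: p \<rho>_def sgn_div_norm inverse_eq_divide)
  have q: "nsq p = 1 / \<rho>^2" using y by (simp add: p \<rho>_def dot_square_norm power_divide)
  note pU = that[unfolded p]
  have e1: "dd e0 ?P (lift p) = dd e0 ?P p" "dd e0 ?F (lift p) = dd e0 ?F p"
   "dd e0 ?N (lift p) = dd e0 ?N p" "?P (lift p) = ?P p"
   unfolding l unfolding p using ext_hom(1)[OF \<psi> \<rho>(1) pU] ext_hom(1)[OF \<phi>1 \<rho>(1) pU] Nx_hom[OF m \<phi> \<rho>(1) pU] ext_scale[OF \<rho>(1)]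
   by auto
  have e2: "dd (ei i) ?P (lift p) = (1/\<rho>) *\<^sub>R dd (ei i) ?P p" "dd (ei i) ?F (lift p) = (1/\<rho>) *\<^sub>R dd (ei i) ?F p"
   "dd (ei i) (dd (ei i) ?F) (lift p) = (1/\<rho>^2) *\<^sub>R dd (ei i) (dd (ei i) ?F) p" for i
   unfolding l unfolding p using ext_hom(2)[OF \<psi> \<rho>(1) pU] ext_hom(2)[OF \<phi>1 \<rho>(1) pU] ext_hom2[OF \<phi> \<rho>(1) pU] by auto
  have b1: "dd e0 (%p. pr (?P p) (?N p)) p = pr (?P p) (dd e0 ?N p) + pr (dd e0 ?P p) (?N p)"
   by (rule dd_bilinear[OF pr \<psi> N that])
  have b2: "dd (ei i) (%p. pr (?P p) (dd (ei i) ?F p)) p = pr (?P p) (dd (ei i) (dd (ei i) ?F) p) + pr (dd (ei i) ?P p) (dd (ei i) ?F p)" for i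
   by (rule dd_bilinear[OF pr \<psi> D that])
  have "(warp m x)^2 *\<^sub>R ?h (lift p) = pr (?P p) (dd e0 ?N p) + pr (dd e0 ?P p) ((warp m x)^2 *\<^sub>R dd e0 ?F p)
   + (\<Sum>i\<in>UNIV. (1/\<rho>^2) *\<^sub>R pr (?P p) (dd (ei i) (dd (ei i) ?F) p) + (1/\<rho>^2) *\<^sub>R pr (dd (ei i) ?P p) (dd (ei i) ?F p))"
  proof -
   have fl: "fst (lift p) = x" by (simp add: p)
   have ww: "(warp m x)^2 * inverse ((warp m x)^2) = 1" using m by simp
   have rr: "1 / \<rho> * (1 / \<rho>) = 1 / \<rho>^2" by (simp add: power2_eq_square)
   show ?thesis unfolding h1_def h2_def fl e1 e2 scaleR_add_right scaleR_scaleR ww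
     pr.add_right pr.scaleR_right pr.scaleR_left pr.sum_right sum.distrib rr scaleR_one
    by (simp only: add_ac)
  qed
  also have "... = ?W p"
   unfolding b1 b2 q by (simp add: p Nx_def scaleR_add_right)
  finally show ?thesis by (simp add: p)
 qed
 have step: "(\<integral>p. indicator (UU x0) p *\<^sub>R cutoff n (nsq p) *\<^sub>R ?W p \<partial>lborel) = 0" if n: "n > 0" for n
 proof -
  let ?th = "cutoff n" and ?th2 = "%q. cutoff n q * q"
  have s2: "smooth ?th2" by (intro smooth_intros smooth_cutoff)
  have Q0: "C_k (Suc 0) (UU x0) (%p. pr (?P p) (?N p))" by (rule C_k_bilinear[OF pr \<psi> N])
  have Qi: "C_k (Suc 0) (UU x0) (%p. pr (?P p) (dd (ei i) ?F p))" for i by (rule C_k_bilinear[OF pr \<psi> D])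
  note A = integral_cut_dd_zero[OF n smooth_cutoff _ Q0 r, where s=s and v=e0]
  have A0: "(\<integral>p. indicator (UU x0) p *\<^sub>R (?th (nsq p) *\<^sub>R dd e0 (%p. pr (?P p) (?N p)) p) \<partial>lborel) = 0"
   "integrable lborel (%p. indicator (UU x0) p *\<^sub>R (?th (nsq p) *\<^sub>R dd e0 (%p. pr (?P p) (?N p)) p))"
   using A z by auto
  let ?B = "%i p. indicator (UU x0) p *\<^sub>R (?th2 (nsq p) *\<^sub>R dd (ei i) (%p. pr (?P p) (dd (ei i) ?F p)) p
    + (deriv ?th2 (nsq p) * (2 * (snd p \<bullet> axis i 1))) *\<^sub>R pr (?P p) (dd (ei i) ?F p))"
  have B0: "(\<integral>p. ?B i p \<partial>lborel) = 0" "integrable lborel (?B i)" for i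
   using integral_cut_dd_zero[OF n s2 _ Qi[of i] r, where s=s and v="ei i"] z by auto
  have "(\<integral>p. indicator (UU x0) p *\<^sub>R (?th (nsq p) *\<^sub>R dd e0 (%p. pr (?P p) (?N p)) p) + (\<Sum>i\<in>UNIV. ?B i p) \<partial>lborel) = 0"
  proof -
   have "integrable lborel (%p. \<Sum>i\<in>UNIV. ?B i p)" by (rule BI_integrable_sum) (rule B0(2))
   moreover have "(\<integral>p. (\<Sum>i\<in>UNIV. ?B i p) \<partial>lborel) = (\<Sum>i\<in>UNIV. \<integral>p. ?B i p \<partial>lborel)"
    by (rule BI_integral_sum) (rule B0(2))
   ultimately show ?thesis unfolding B0(1) by (subst BI_integral_add[OF A0(2)]) (simp_all only: A0(1), simp)
  qed
  moreover have "indicator (UU x0) p *\<^sub>R (?th (nsq p) *\<^sub>R dd e0 (%p. pr (?P p) (?N p)) p) + (\<Sum>i\<in>UNIV. ?B i p)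
   = indicator (UU x0) p *\<^sub>R cutoff n (nsq p) *\<^sub>R ?W p" for p
  proof (cases "p : UU x0")
   case True
   obtain x y where p: "p = (x, y)" by (cases p)
   have "(0, y) = (\<Sum>i\<in>UNIV. (y $ i) *\<^sub>R ei i)"
    using vec3_sum[of y] by (simp add: prod_eq_iff fst_sum snd_sum)
   hence "dd (0, y) ?F p = dd (\<Sum>i\<in>UNIV. (y $ i) *\<^sub>R ei i) ?F p" by (rule arg_cong)
   also have "... = (\<Sum>i\<in>UNIV. dd ((y $ i) *\<^sub>R ei i) ?F p)" by (rule dd_linear(3)[OF \<phi>1 True])
   also have "... = (\<Sum>i\<in>UNIV. (y $ i) *\<^sub>R dd (ei i) ?F p)"
    by (intro sum.cong refl dd_linear(1)[OF \<phi>1 True])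
   finally have "(\<Sum>i\<in>UNIV. (y $ i) *\<^sub>R dd (ei i) ?F p) = dd (0, y) ?F p" ..
   also have "... = 0" using ext_hom(3)[OF \<phi>1, of 1 x y] True p by simp
   finally have eu: "(\<Sum>i\<in>UNIV. (y $ i) *\<^sub>R dd (ei i) ?F p) = 0" .
   have "(\<Sum>i\<in>UNIV. (deriv ?th2 (nsq p) * (2 * (snd p \<bullet> axis i 1))) *\<^sub>R pr (?P p) (dd (ei i) ?F p))
    = (deriv ?th2 (y \<bullet> y) * 2) *\<^sub>R pr (?P p) (\<Sum>i\<in>UNIV. (y $ i) *\<^sub>R dd (ei i) ?F p)"
    by (simp add: p pr.sum_right pr.scaleR_right scaleR_sum_right inner_axis mult.assoc)
   hence "(\<Sum>i\<in>UNIV. (deriv ?th2 (nsq p) * (2 * (snd p \<bullet> axis i 1))) *\<^sub>R pr (?P p) (dd (ei i) ?F p)) = 0"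
    unfolding eu by (simp add: pr.zero_right)
   thus ?thesis using True
    by (simp add: sum.distrib scaleR_add_right scaleR_sum_right)
  qed simp
  ultimately show ?thesis by simp
 qed
 have "(%n. \<integral>p. indicator (UU x0) p *\<^sub>R cutoff (Suc n) (nsq p) *\<^sub>R ?W p \<partial>lborel) \<longlonglongrightarrow>
   (\<integral>p. (1/3) *\<^sub>R H p \<partial>lborel)"
 proof (rule integral_dominated_convergence[where w="%p. norm (H p)"])
  show "(%p. (1/3) *\<^sub>R H p) : borel_measurable lborel" using IH by auto
  have cutm: "(%p::point. cutoff (Suc n) (nsq p)) : borel_measurable borel" for n
   by (intro borel_measurable_continuous_onI C_k_continuous[OF radial_derivative(1)[OF smooth_cutoff, of 0]])
  have eq: "indicator (UU x0) p *\<^sub>R cutoff (Suc n) (nsq p) *\<^sub>R ?W p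
   = (1/3) *\<^sub>R cutoff (Suc n) (nsq p) *\<^sub>R H p" for n p
  proof (cases "p : UU x0")
   case True
   show ?thesis
   proof (cases "snd p : Bp")
    case True2: True
    hence "p : {x0<..} \<times> Bp" using True by (cases p) auto
    thus ?thesis using True W[OF True] by (simp add: H_def)
   next
    case False
    hence "nsq p >= 1" using True
     by (cases p) (auto simp: Bp_def dot_square_norm not_less)
    hence "nsq p >= 1 - 1 / real (Suc n)" by (smt (verit) divide_nonneg_nonneg of_nat_0_le_iff)
    hence "cutoff (Suc n) (nsq p) = 0"
     by (intro cutoff_zero) auto
    thus ?thesis by simp
   qed
  next
   case False
   hence "p \<notin> {x0<..} \<times> Bp" by (cases p) (auto simp: Bp_def)
   thus ?thesis using False by (simp add: H_def)
  qed
  show "(%p. indicator (UU x0) p *\<^sub>R cutoff (Suc n) (nsq p) *\<^sub>R ?W p) : borel_measurable lborel" for n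
   unfolding eq using IH cutm by (auto intro!: borel_measurable_scaleR)
  show "integrable lborel (%p. norm (H p))" using IH by simp
  show "AE p in lborel. norm (indicator (UU x0) p *\<^sub>R cutoff (Suc n) (nsq p) *\<^sub>R ?W p) <= norm (H p)" for n
  proof (rule AE_I2)
   fix p :: point
   have "norm ((1/3) *\<^sub>R cutoff (Suc n) (nsq p) *\<^sub>R H p) = \<bar>(1/3) * cutoff (Suc n) (nsq p)\<bar> * norm (H p)"
    by (simp only: scaleR_scaleR norm_scaleR)
   also have "... <= 1 * norm (H p)"
    using cutoff_01[of "Suc n" "nsq p"] by (intro mult_right_mono) auto
   finally show "norm (indicator (UU x0) p *\<^sub>R cutoff (Suc n) (nsq p) *\<^sub>R ?W p) <= norm (H p)"
    unfolding eq by simp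
  qed
  show "AE p in lborel. (%n. indicator (UU x0) p *\<^sub>R cutoff (Suc n) (nsq p) *\<^sub>R ?W p) \<longlonglongrightarrow> (1/3) *\<^sub>R H p"
  proof (rule AE_I2)
   fix p :: point
   show "(%n. indicator (UU x0) p *\<^sub>R cutoff (Suc n) (nsq p) *\<^sub>R ?W p) \<longlonglongrightarrow> (1/3) *\<^sub>R H p"
    unfolding eq
   proof (cases "snd p : Bp")
    case True
    hence "0 < nsq p" "nsq p < 1"
     by (auto simp: Bp_def dot_square_norm power_less_one_iff)
    from LIMSEQ_Suc[OF cutoff_lim[OF this]]
    have "(%n. (1/3) *\<^sub>R cutoff (Suc n) (nsq p) *\<^sub>R H p) \<longlonglongrightarrow> (1/3) *\<^sub>R 1 *\<^sub>R H p"
     by (intro tendsto_scaleR tendsto_const)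
    thus "(%n. (1/3) *\<^sub>R cutoff (Suc n) (nsq p) *\<^sub>R H p) \<longlonglongrightarrow> (1/3) *\<^sub>R H p" by simp
   next
    case False
    hence "p \<notin> {x0<..} \<times> Bp" by (cases p) auto
    hence "H p = 0" by (simp add: H_def)
    thus "(%n. (1/3) *\<^sub>R cutoff (Suc n) (nsq p) *\<^sub>R H p) \<longlonglongrightarrow> (1/3) *\<^sub>R H p" by simp
   qed
  qed
 qed
 hence "(%n. 0) \<longlonglongrightarrow> (\<integral>p. (1/3) *\<^sub>R H p \<partial>lborel)"
  unfolding step[OF zero_less_Suc] .
 hence "(\<integral>p. (1/3) *\<^sub>R H p \<partial>lborel) = 0"
  using LIMSEQ_unique tendsto_const by blast
 hence "(\<integral>p. H p \<partial>lborel) = 0" by (simp only: integral_scaleR_right scaleR_eq_0_iff) simp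
 hence "(\<integral>p. ?h p \<partial>volM m x0) = 0"
  by (subst integral_vol(1)[OF m _ hm]) (auto simp: H_def)
 hence "(\<integral>p. h1 p \<partial>volM m x0) + (\<integral>p. h2 p \<partial>volM m x0) = 0" using I1 I2 by simp
 moreover have "(\<integral>p. pr (\<psi> p) (classical_laplacian m \<phi> p) \<partial>volM m x0) = (\<integral>p. h1 p \<partial>volM m x0)"
  by (rule BI_integral_cong) (use h1 in auto)
 moreover have "(\<integral>p. G p \<partial>volM m x0) = (\<integral>p. h2 p \<partial>volM m x0)"
  by (rule BI_integral_cong) (use h2 in auto)
 ultimately show "(\<integral>p. pr (\<psi> p) (classical_laplacian m \<phi> p) \<partial>volM m x0) = - (\<integral>p. G p \<partial>volM m x0)"
  by (simp add: eq_neg_iff_add_eq_0)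
qed

section \<open>Test functions\<close>

lemma test_fun_xsupp:
 assumes "test_fun x0 \<phi>"
 obtains r s where "x0 < r" "r < s" "xsupp x0 \<phi> r s"
proof -
 let ?K = "fst ` supp_M x0 \<phi>"
 have K: "compact ?K" "?K \<subseteq> {x0<..}"
  using assms unfolding test_fun_def by (auto intro!: compact_continuous_image continuous_intros)
 have sub: "x : ?K" if "x > x0" "\<omega> : S2" "\<phi> (x, \<omega>) ~= 0" for x \<omega>
  using that closure_subset[of "{p : {x0..} \<times> S2. \<phi> p ~= 0}"] unfolding supp_M_def
  by (intro rev_image_eqI[of "(x, \<omega>)"]) auto
 show ?thesis
 proof (cases "?K = {}")
  case True
  thus ?thesis using sub by (intro that[of "x0 + 1" "x0 + 2"]) (auto simp: xsupp_def)
 next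
  case False
  obtain a where a: "a : ?K" "!!t. t : ?K ==> a <= t" using compact_attains_inf[OF K(1) False] by blast
  obtain b where b: "b : ?K" "!!t. t : ?K ==> t <= b" using compact_attains_sup[OF K(1) False] by blast
  show ?thesis
  proof (rule that)
   show "x0 < a" using a(1) K(2) by blast
   show "a < b + 1" using a(2)[OF b(1)] by simp
   show "xsupp x0 \<phi> a (b + 1)" unfolding xsupp_def using sub a(2) b(2) by fastforce
  qed
 qed
qed

lemma test_fun_C_k: "test_fun x0 \<phi> ==> C_k n (UU x0) (ext \<phi>)"
 by (simp add: test_fun_def smooth_on_M_ext)

lemma smooth_on_M_diff:
 assumes "smooth_on_M x0 f" "smooth_on_M x0 g"
 shows "smooth_on_M x0 (%p. f p - g p)"
proof -
 from assms(1) obtain U F where F: "open U" "{x0..} \<times> S2 \<subseteq> U" "!!n. C_k n U F" "!!p. p : {x0..} \<times> S2 ==> F p = f p"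
  unfolding smooth_on_M_def by blast
 from assms(2) obtain V G where G: "open V" "{x0..} \<times> S2 \<subseteq> V" "!!n. C_k n V G" "!!p. p : {x0..} \<times> S2 ==> G p = g p"
  unfolding smooth_on_M_def by blast
 have "C_k n (U \<inter> V) (%p. F p - G p)" for n
  by (intro C_k_diff C_k_mono[OF F(3)] C_k_mono[OF G(3)]) auto
 thus ?thesis
  unfolding smooth_on_M_def using F G by (intro exI[of _ "U \<inter> V"] exI[of _ "%p. F p - G p"]) auto
qed

lemma test_fun_diff:
 assumes "test_fun x0 f" "test_fun x0 g"
 shows "test_fun x0 (%p. f p - g p)"
proof -
 have "supp_M x0 (%p. f p - g p) \<subseteq> supp_M x0 f \<union> supp_M x0 g"
  unfolding supp_M_def closure_Un[symmetric] by (intro closure_mono) auto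
 moreover have "closed (supp_M x0 (%p. f p - g p))" by (simp add: supp_M_def)
 moreover have "compact (supp_M x0 f \<union> supp_M x0 g)" using assms by (auto simp: test_fun_def)
 ultimately have "compact (supp_M x0 (%p. f p - g p))"
  by (metis compact_Int_closed inf.absorb2)
 thus ?thesis
  using \<open>supp_M x0 (%p. f p - g p) \<subseteq> _\<close> assms smooth_on_M_diff by (fastforce simp: test_fun_def)
qed

lemma test_funI:
 assumes "!!n. C_k n UNIV f" "x0 < r" "!!x \<omega>. \<omega> : S2 ==> x \<notin> {r..s} ==> f (x, \<omega>) = 0"
 shows "test_fun x0 f"
proof -
 have "{p : {x0..} \<times> S2. f p ~= 0} \<subseteq> {r..s} \<times> S2" using assms(3) by force
 hence sub: "supp_M x0 f \<subseteq> {r..s} \<times> S2"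
  unfolding supp_M_def by (rule closure_minimal) (auto intro!: closed_Times)
 have c: "closed (supp_M x0 f)" by (simp add: supp_M_def)
 have "compact ({r..s} \<times> S2 \<inter> supp_M x0 f)"
  by (intro compact_Int_closed c compact_Times) auto
 hence "compact (supp_M x0 f)" using sub by (simp add: inf.absorb2)
 moreover have "smooth_on_M x0 f"
  unfolding smooth_on_M_def using assms(1) by (intro exI[of _ UNIV] exI[of _ f]) auto
 ultimately show ?thesis using sub assms(2) by (auto simp: test_fun_def)
qed

section \<open>Uniqueness of the distributional Laplacian\<close>

text \<open>These test functions converge to the indicator of \<open>box a b\<close> on the manifold; the last two factors keep
  the support in a compact part of \<open>x > x0\<close>.\<close>
definition bump :: "real => point => point => nat => point => real" where
 "bump x0 a b n p = (\<Prod>i\<in>Basis. step (real n * (p \<bullet> i - a \<bullet> i)) * step (real n * (b \<bullet> i - p \<bullet> i)))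
   * (step (real n * (fst p - x0)) * step (real n - fst p))"

lemma step_fun_C_k:
 fixes f :: "'a::euclidean_space => real"
 assumes "C_k n UNIV f"
 shows "C_k n UNIV (%p. step (f p))"
 by (rule C_k_compose[OF smoothD[OF smooth_step] assms]) simp

lemma bump_test:
 assumes "n > 0"
 shows "test_fun x0 (%p. complex_of_real (bump x0 a b n p))"
proof (rule test_funI)
 have l: "C_k k UNIV (%p::point. p \<bullet> i)" "C_k k UNIV (%p::point. fst p)" for k i
  by (auto intro!: C_k_bounded_linear bounded_linear_inner_left bounded_linear_fst)
 show "C_k k UNIV (%p. complex_of_real (bump x0 a b n p))" for k
  unfolding bump_def
  by (intro C_k_compose_linear[OF bounded_linear_of_real] C_k_mult C_k_prod step_fun_C_k C_k_diff C_k_const l)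
 show "x0 < x0 + 1 / real n" using assms by simp
 show "complex_of_real (bump x0 a b n (x, \<omega>)) = 0" if "x \<notin> {x0 + 1 / real n..real n}" for x \<omega>
 proof -
  have "real n * (x - x0) <= 1 \<or> real n - x <= 1" using that assms by (auto simp: field_simps)
  thus ?thesis by (auto simp: bump_def step_bounds)
 qed
qed

lemma step_lim: "(%n. step (real n * t)) \<longlonglongrightarrow> (if t > 0 then 1 else 0)"
proof (cases "t > 0")
 case True
 obtain N :: nat where N: "2 / t < real N" using reals_Archimedean2 by blast
 have "step (real n * t) = 1" if "n >= N" for n
 proof -
  have "2 / t < real n" using N that by linarith
  thus ?thesis using True by (intro step_bounds) (simp add: field_simps)
 qed
 hence "\<forall>\<^sub>F n in sequentially. step (real n * t) = 1" unfolding eventually_sequentially by blast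
 thus ?thesis using True by (simp add: tendsto_eventually)
next
 case False
 hence "step (real n * t) = 0" for n
  by (intro step_bounds) (smt (verit) mult_nonneg_nonpos of_nat_0_le_iff)
 thus ?thesis using False by simp
qed

lemma bump_lim:
 assumes "fst p > x0"
 shows "(%n. bump x0 a b n p) \<longlonglongrightarrow> indicator (box a b) p"
proof -
 have 1: "(%n. step (real n - fst p)) \<longlonglongrightarrow> 1"
 proof (rule tendsto_eventually)
  obtain N :: nat where N: "fst p + 2 < real N" using reals_Archimedean2 by blast
  have "step (real n - fst p) = 1" if "n >= N" for n
   by (rule step_bounds(4)) (use N that in linarith)
  thus "\<forall>\<^sub>F n in sequentially. step (real n - fst p) = 1" unfolding eventually_sequentially by blast
 qed
 have "(%n. bump x0 a b n p) \<longlonglongrightarrow> (\<Prod>i\<in>Basis. (if p \<bullet> i - a \<bullet> i > 0 then 1 else 0) * (if b \<bullet> i - p \<bullet> i > 0 then 1 else 0))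
   * ((if fst p - x0 > 0 then 1 else 0) * 1)"
  unfolding bump_def by (intro tendsto_mult tendsto_prod step_lim 1)
 also have "(\<Prod>i\<in>Basis. (if p \<bullet> i - a \<bullet> i > 0 then 1 else 0) * (if b \<bullet> i - p \<bullet> i > 0 then 1 else (0::real)))
   = (\<Prod>i\<in>Basis. if a \<bullet> i < p \<bullet> i & p \<bullet> i < b \<bullet> i then 1 else 0)"
  by (intro prod.cong) auto
 also have "... = indicator (box a b) p"
 proof (cases "p : box a b")
  case True
  thus ?thesis by (auto simp: mem_box)
 next
  case False
  then obtain i where "i : Basis" "\<not> (a \<bullet> i < p \<bullet> i & p \<bullet> i < b \<bullet> i)" by (auto simp: mem_box)
  hence "(\<Prod>i\<in>Basis. if a \<bullet> i < p \<bullet> i & p \<bullet> i < b \<bullet> i then 1 else (0::real)) = 0"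
   by (intro prod_zero) auto
  thus ?thesis using False by simp
 qed
 finally show ?thesis using assms by simp
qed

lemma bump_bounds: "0 <= bump x0 a b n p" "bump x0 a b n p <= 1" "p \<notin> box a b ==> bump x0 a b n p = 0"
proof -
 show "0 <= bump x0 a b n p"
  unfolding bump_def by (intro mult_nonneg_nonneg prod_nonneg) (auto simp: step_bounds)
 show "bump x0 a b n p <= 1"
  unfolding bump_def by (intro mult_le_one prod_le_1 mult_nonneg_nonneg conjI prod_nonneg) (auto simp: step_bounds intro!: mult_le_one)
 assume "p \<notin> box a b"
 then obtain i where i: "i : Basis" "p \<bullet> i - a \<bullet> i <= 0 \<or> b \<bullet> i - p \<bullet> i <= 0" by (fastforce simp: mem_box)
 hence "real n * (p \<bullet> i - a \<bullet> i) <= 1 \<or> real n * (b \<bullet> i - p \<bullet> i) <= 1"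
  by (smt (verit) mult_nonneg_nonpos of_nat_0_le_iff)
 hence "step (real n * (p \<bullet> i - a \<bullet> i)) * step (real n * (b \<bullet> i - p \<bullet> i)) = 0" by (auto simp: step_bounds)
 hence "(\<Prod>i\<in>Basis. step (real n * (p \<bullet> i - a \<bullet> i)) * step (real n * (b \<bullet> i - p \<bullet> i))) = 0"
  using i(1) by (intro prod_zero) auto
 thus "bump x0 a b n p = 0" by (simp add: bump_def)
qed

lemma in_L2_integrable_slab:
 fixes d :: "point => complex"
 assumes m: "m >= 1" and d: "in_L2 (volM m x0) d"
 shows "integrable (volM m x0) (%p. indicator ({x0<..X} \<times> S2) p * norm (d p))"
proof -
 have s: "{x0<..X} \<times> S2 : sets (volM m x0)" by (rule Times_S2_vol) auto
 have i: "in_L2 (volM m x0) (indicator ({x0<..X} \<times> S2) :: point => real)"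
  unfolding in_L2_def
 proof
  show im: "(indicator ({x0<..X} \<times> S2) :: point => real) : borel_measurable (volM m x0)" using s by simp
  have e: "(%p. (norm (indicator ({x0<..X} \<times> S2) p :: real))^2) = indicator ({x0<..X} \<times> S2)"
   by (auto simp: indicator_def)
  show "integrable (volM m x0) (%p. (norm (indicator ({x0<..X} \<times> S2) p :: real))^2)"
   unfolding e by (rule integrable_vol_bounded[OF m im, of 1 X]) (auto simp: indicator_def)
 qed
 show ?thesis by (rule L2_bilinear(1)[OF i d]) (use d s in "auto simp: in_L2_def")
qed

lemma integral_box_zero:
 fixes d :: "point => complex"
 assumes m: "m >= 1" and d: "in_L2 (volM m x0) d"
  and z: "!!\<phi>. test_fun x0 \<phi> ==> (\<integral>p. d p * \<phi> p \<partial>volM m x0) = 0"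
 shows "(\<integral>p. indicator (box a b) p *\<^sub>R d p \<partial>volM m x0) = 0"
proof -
 have dm: "d : borel_measurable (volM m x0)" by (rule in_L2_meas[OF d])
 have "(%n. \<integral>p. d p * complex_of_real (bump x0 a b (Suc n) p) \<partial>volM m x0) \<longlonglongrightarrow> (\<integral>p. indicator (box a b) p *\<^sub>R d p \<partial>volM m x0)"
 proof (rule integral_dominated_convergence[where w="%p. indicator ({x0<..fst b} \<times> S2) p * norm (d p)"])
  have "indicator (box a b) : borel_measurable (volM m x0)"
   unfolding measurable_vol_iff by (intro measurable_restrict_space1) auto
  thus "(%p. indicator (box a b) p *\<^sub>R d p) : borel_measurable (volM m x0)" using dm by (intro borel_measurable_scaleR) 
  show "(%p. d p * complex_of_real (bump x0 a b (Suc n) p)) : borel_measurable (volM m x0)" for n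
  proof -
   have "C_k 0 UNIV (%p. complex_of_real (bump x0 a b (Suc n) p))"
    unfolding bump_def
    by (intro C_k_compose_linear[OF bounded_linear_of_real] C_k_mult C_k_prod step_fun_C_k C_k_diff C_k_const)
     (auto intro!: C_k_bounded_linear bounded_linear_inner_left bounded_linear_fst simp del: C_k.simps)
   hence "(%p. complex_of_real (bump x0 a b (Suc n) p)) : borel_measurable (volM m x0)"
    by (rule continuous_measurable_vol[OF continuous_on_subset[OF C_k_continuous subset_UNIV]])
   thus ?thesis using dm by simp
  qed
  show "integrable (volM m x0) (%p. indicator ({x0<..fst b} \<times> S2) p * norm (d p))"
   by (rule in_L2_integrable_slab[OF m d])
  show "AE p in volM m x0. (%n. d p * complex_of_real (bump x0 a b (Suc n) p)) \<longlonglongrightarrow> indicator (box a b) p *\<^sub>R d p"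
  proof (rule AE_I2)
   fix p assume "p : space (volM m x0)"
   hence "fst p > x0" by auto
   from LIMSEQ_Suc[OF bump_lim[OF this]]
   have "(%n. d p * complex_of_real (bump x0 a b (Suc n) p)) \<longlonglongrightarrow> d p * complex_of_real (indicator (box a b) p)"
    by (intro tendsto_intros)
   thus "(%n. d p * complex_of_real (bump x0 a b (Suc n) p)) \<longlonglongrightarrow> indicator (box a b) p *\<^sub>R d p"
    by (simp add: scaleR_conv_of_real mult.commute)
  qed
  show "AE p in volM m x0. norm (d p * complex_of_real (bump x0 a b (Suc n) p)) <= indicator ({x0<..fst b} \<times> S2) p * norm (d p)" for n
  proof (rule AE_I2)
   fix p assume p: "p : space (volM m x0)"
   show "norm (d p * complex_of_real (bump x0 a b (Suc n) p)) <= indicator ({x0<..fst b} \<times> S2) p * norm (d p)"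
   proof (cases "p : box a b")
    case True
    have "(1, 0) : (Basis :: point set)" by (simp add: Basis_prod_def)
    hence "p \<bullet> (1, 0) < b \<bullet> (1, 0)" using True by (auto simp: mem_box)
    hence "fst p < fst b" by (simp add: inner_prod_def)
    hence "p : {x0<..fst b} \<times> S2" using p by (auto simp: mem_Times_iff)
    thus ?thesis using bump_bounds(1,2)[of x0 a b "Suc n" p]
     by (simp add: norm_mult mult_left_le)
   qed (simp add: bump_bounds(3))
  qed
 qed
 hence "(%n. 0) \<longlonglongrightarrow> (\<integral>p. indicator (box a b) p *\<^sub>R d p \<partial>volM m x0)"
  unfolding z[OF bump_test[OF zero_less_Suc]] .
 thus ?thesis using LIMSEQ_unique tendsto_const by blast
qed

text \<open>Boxes are a generator of the Borel sets that is stable under intersections, so the integral of \<open>d\<close>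
  vanishes on all Borel sets of each slab.\<close>
lemma AE_zero_of_test:
 fixes d :: "point => complex"
 assumes m: "m >= 1" and d: "in_L2 (volM m x0) d"
  and z: "!!\<phi>. test_fun x0 \<phi> ==> (\<integral>p. d p * \<phi> p \<partial>volM m x0) = 0"
 shows "AE p in volM m x0. d p = 0"
proof -
 have dm: "d : borel_measurable (volM m x0)" by (rule in_L2_meas[OF d])
 have main: "AE p in volM m x0. p : {x0<..<X} \<times> S2 --> d p = 0" for X
 proof -
  let ?I = "{x0<..<X}" and ?O = "{x0<..<X} \<times> S2"
  let ?N = "vol m ?I"
  have I: "?I : sets borel" "{x0<..} : sets borel" "?I \<subseteq> {x0<..}" by auto
  have di: "integrable ?N d"
  proof -
   have "integrable (volM m x0) (%p. indicator ?O p *\<^sub>R d p)"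
    by (rule BI_integrable_bound[OF in_L2_integrable_slab[OF m d, of X]])
      (use dm Times_S2_vol[OF I(1,3)] in "auto intro!: AE_I2 simp: indicator_def")
   thus ?thesis by (simp add: integral_vol_mono(2)[OF m I(2,1,3)])
  qed
  have box: "(\<integral>p. indicator (box a b) p *\<^sub>R d p \<partial>?N) = 0" for a b
  proof -
   have "(\<integral>p. indicator (box a b) p *\<^sub>R d p \<partial>?N) = (\<integral>p. indicator (box a (min X (fst b), snd b)) p *\<^sub>R d p \<partial>volM m x0)"
    unfolding integral_vol_mono(1)[OF m I(2,1,3)]
   proof (intro BI_integral_cong refl)
    fix p assume "p : space (volM m x0)"
    hence p: "fst p > x0" "snd p : S2" by auto
    have "p : box a (min X (fst b), snd b) \<longleftrightarrow> p : box a b & fst p < X"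
     by (auto simp: mem_box Basis_prod_def inner_prod_def)
    thus "indicator ?O p *\<^sub>R indicator (box a b) p *\<^sub>R d p = indicator (box a (min X (fst b), snd b)) p *\<^sub>R d p"
     using p by (auto simp: indicator_def mem_Times_iff)
   qed
   thus ?thesis using integral_box_zero[OF m d z] by simp
  qed
  have Osp: "space ?N = ?O" by simp
  have setA: "A \<inter> ?O : sets ?N" if "A : sets borel" for A
   unfolding sets_vol sets_restrict_space using that by auto
  have A: "(LINT p:(A \<inter> ?O)|?N. d p) = 0" if "A : sets borel" for A
  proof -
   have "Int_stable (range (%(a, b). box a b :: point set))"
   proof (rule Int_stableI)
    fix A B :: "point set"
    assume A: "A : range (%(a, b). box a b)" and B: "B : range (%(a, b). box a b)"
    from A obtain a b where "A = box a b" by auto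
    moreover from B obtain c d where "B = box c d" by auto
    moreover obtain P Q where "box a b \<inter> box c d = box P Q" using box_Int_box by blast
    ultimately show "A \<inter> B : range (%(a, b). box a b)" by (intro range_eqI[of _ _ "(P, Q)"]) simp
   qed
   moreover have "range (%(a, b). box a b :: point set) \<subseteq> Pow UNIV" by auto
   moreover have "A : sigma_sets UNIV (range (%(a, b). box a b))"
    using that unfolding borel_eq_box by auto
   ultimately show ?thesis
   proof (induction rule: sigma_sets_induct_disjoint)
    case (basic A)
    then obtain a b where "A = box a b" by auto
    hence "(LINT p:(A \<inter> ?O)|?N. d p) = (\<integral>p. indicator (box a b) p *\<^sub>R d p \<partial>?N)"
     unfolding set_lebesgue_integral_def by (intro BI_integral_cong) (auto simp: indicator_def)
    thus ?case using box by simp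
   next
    case empty
    thus ?case by (simp add: set_lebesgue_integral_def)
   next
    case (compl A)
    have "A : sets borel" using compl(1) unfolding borel_eq_box by auto
    note sA = setA[OF this]
    have iA: "integrable ?N (%p. indicator (A \<inter> ?O) p *\<^sub>R d p)"
     using sA di by (rule integrable_mult_indicator)
    have "(\<integral>p. d p \<partial>?N) = (\<integral>p. indicator (box (x0 - 1, - 2 *\<^sub>R One) (X, 2 *\<^sub>R One)) p *\<^sub>R d p \<partial>?N)"
    proof (intro BI_integral_cong refl)
     fix p assume "p : space ?N"
     hence p: "x0 < fst p" "fst p < X" "norm (snd p) = 1" by auto
     have "\<bar>snd p \<bullet> i\<bar> < 2" if "i : Basis" for i using Basis_le_norm[OF that, of "snd p"] p by linarith
     hence "p : box (x0 - 1, - 2 *\<^sub>R One) (X, 2 *\<^sub>R One)"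
      using p by (auto simp: mem_box Basis_prod_def inner_prod_def abs_less_iff; force)
     thus "d p = indicator (box (x0 - 1, - 2 *\<^sub>R One) (X, 2 *\<^sub>R One)) p *\<^sub>R d p" by simp
    qed
    hence "(\<integral>p. d p \<partial>?N) = 0" using box by simp
    moreover have "(LINT p:((UNIV - A) \<inter> ?O)|?N. d p) = (\<integral>p. d p - indicator (A \<inter> ?O) p *\<^sub>R d p \<partial>?N)"
     unfolding set_lebesgue_integral_def by (intro BI_integral_cong) (auto simp: indicator_def)
    ultimately show ?case
     using compl(2) di iA by (simp add: set_lebesgue_integral_def)
   next
    case (union A)
    have bA: "A i : sets borel" for i using union(2) unfolding borel_eq_box by auto
    have "(LINT p:(\<Union>i. A i \<inter> ?O)|?N. d p) = (\<Sum>i. (LINT p:(A i \<inter> ?O)|?N. d p))"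
    proof (rule lebesgue_integral_countable_add)
     show "A i \<inter> ?O : sets ?N" for i by (rule setA[OF bA])
     show "(A i \<inter> ?O) \<inter> (A j \<inter> ?O) = {}" if "i ~= j" for i j
      using union(1) that by (auto simp: disjoint_family_on_def)
     have "(\<Union>i. A i \<inter> ?O) : sets ?N" using sets.countable_nat_UN[of "%i. A i \<inter> ?O" ?N] setA[OF bA] by blast
     thus "set_integrable ?N (\<Union>i. A i \<inter> ?O) d"
      unfolding set_integrable_def using di by (rule integrable_mult_indicator)
    qed
    thus ?case using union(3) by (simp add: Int_UN_distrib2)
   qed
  qed
  have A': "(LINT p:A|?N. d p) = 0" if "A : sets ?N" for A
  proof -
   have "A : sets borel"
    using that Times_S2_sets[OF I(1)] unfolding sets_vol by (auto simp: sets_restrict_space)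
   moreover have "A \<inter> ?O = A" using sets.sets_into_space[OF that] by auto
   ultimately show ?thesis using A by force
  qed
  have AR: "(LINT p:A|?N. Re (d p)) = 0" "(LINT p:A|?N. Im (d p)) = 0" if "A : sets ?N" for A
  proof -
   have i: "integrable ?N (%p. indicator A p *\<^sub>R d p)" using that di by (rule integrable_mult_indicator)
   show "(LINT p:A|?N. Re (d p)) = 0" "(LINT p:A|?N. Im (d p)) = 0"
    using A'[OF that] integral_Re[OF i] integral_Im[OF i] by (auto simp: set_lebesgue_integral_def)
  qed
  have "AE p in ?N. Re (d p) = 0" "AE p in ?N. Im (d p) = 0"
   using di AR by (auto intro!: density_unique_real[where f'="%_. 0"] simp: set_lebesgue_integral_def)
  hence "AE p in ?N. d p = 0" by eventually_elim (simp add: complex_eq_iff)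
  thus ?thesis
   unfolding vol_restrict[OF m I(2,1,3)]
   by (subst (asm) AE_restrict_space_iff) (use Times_S2_vol_Int[OF I(1,3)] in auto)
 qed
 have "AE p in volM m x0. \<forall>n::nat. p : {x0<..<real n} \<times> S2 --> d p = 0"
  unfolding AE_all_countable using main by blast
 moreover have "AE p in volM m x0. p : {x0<..} \<times> S2" by (rule AE_I2) simp
 ultimately show ?thesis
 proof eventually_elim
  case (elim p)
  obtain n :: nat where "fst p < real n" using reals_Archimedean2 by blast
  thus ?case using elim by (auto simp: mem_Times_iff)
 qed
qed

lemma has_laplacian_unique:
 assumes m: "m >= 1" and f: "has_laplacian m x0 u f" "has_laplacian m x0 u g"
 shows "AE p in volM m x0. f p = g p"
proof -
 have L: "in_L2 (volM m x0) f" "in_L2 (volM m x0) g" using f by (auto simp: has_laplacian_def)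
 have "AE p in volM m x0. f p - g p = 0"
 proof (rule AE_zero_of_test[OF m in_L2_diff(1)[OF L]])
  fix \<phi> assume t: "test_fun x0 \<phi>"
  obtain r s where r: "x0 < r" "xsupp x0 \<phi> r s" by (rule test_fun_xsupp[OF t])
  have "continuous_on ({x0<..} \<times> S2) (ext \<phi>)"
   by (rule continuous_on_subset[OF C_k_continuous[OF test_fun_C_k[OF t, of 0]] S2_UU])
  hence c: "continuous_on ({x0<..} \<times> S2) \<phi>"
   by (rule continuous_on_eq) (rule ext_S2)
  have \<phi>: "in_L2 (volM m x0) \<phi>"
   by (rule continuous_vanish_integrable(2)[OF m c r(1), of s]) (use r(2) in "auto simp: xsupp_def")
  have i: "integrable (volM m x0) (%p. h p * \<phi> p)" if "in_L2 (volM m x0) h" for h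
   by (rule L2_bilinear(1)[OF that \<phi>]) (use that \<phi> in "auto simp: in_L2_def norm_mult")
  have "(\<integral>p. f p * \<phi> p \<partial>volM m x0) = (\<integral>p. g p * \<phi> p \<partial>volM m x0)"
   using f t by (simp add: has_laplacian_def)
  thus "(\<integral>p. (f p - g p) * \<phi> p \<partial>volM m x0) = 0"
   using i[OF L(1)] i[OF L(2)] by (simp add: left_diff_distrib)
 qed
 thus ?thesis by simp
qed

lemma laplacian_AE:
 assumes "m >= 1" "has_laplacian m x0 u f"
 shows "has_laplacian m x0 u (laplacian m x0 u)" "AE p in volM m x0. laplacian m x0 u p = f p"
proof -
 show 1: "has_laplacian m x0 u (laplacian m x0 u)"
  unfolding laplacian_def by (rule someI[of "has_laplacian m x0 u", OF assms(2)])
 show "AE p in volM m x0. laplacian m x0 u p = f p" by (rule has_laplacian_unique[OF assms(1) 1 assms(2)])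
qed

section \<open>Uniqueness of the weak gradient\<close>

lemma xsupp_S2:
 assumes "xsupp x0 f r s" "p : {x0<..} \<times> S2" "fst p \<notin> {r..s}" "C_k (Suc 0) (UU x0) (ext f)"
 shows "f p = 0" "grad m f p = 0"
proof -
 show "f p = 0" using assms(1-3) by (cases p) (auto simp: xsupp_def)
 show "grad m f p = 0"
  unfolding grad_eq[OF assms(4,2)] xsupp_ext(2)[OF assms(1) S2_UU_mem[OF assms(2)] assms(3)]
  by (simp add: zero_prod_def zero_vec_def[symmetric])
qed

lemma continuous_grad:
 assumes m: "m >= 1" and F: "C_k (Suc 0) (UU x0) (ext f)"
 shows "continuous_on ({x0<..} \<times> S2) (grad m f)"
proof -
 have winv: "continuous_on ({x0<..} \<times> S2) (%p::point. inverse (warp m (fst p)))"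
  using m by (intro continuous_intros continuous_on_compose2[OF smooth_continuous[OF smooth_warp[OF m], of UNIV]]) auto
 have d: "continuous_on ({x0<..} \<times> S2) (dd v (ext f))" for v
  by (rule continuous_on_subset[OF C_k_continuous[OF C_k_dd[OF open_UU F]] S2_UU])
 have "continuous_on ({x0<..} \<times> S2) (%p. (dd e0 (ext f) p, inverse (warp m (fst p)) *\<^sub>R (\<chi> i. dd (ei i) (ext f) p)))"
  by (intro continuous_on_Pair continuous_on_scaleR winv d continuous_on_vec_lambda)
 thus ?thesis by (rule continuous_on_eq) (simp add: grad_eq[OF F])
qed

lemma continuous_M:
 assumes F: "C_k n (UU x0) (ext f)"
 shows "continuous_on ({x0<..} \<times> S2) f"
 by (rule continuous_on_eq[OF continuous_on_subset[OF C_k_continuous[OF F] S2_UU] ext_S2])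

lemma grad_diff:
 assumes F: "C_k (Suc 0) (UU x0) (ext f)" and G: "C_k (Suc 0) (UU x0) (ext g)" and p: "p : {x0<..} \<times> S2"
 shows "grad m (%p. f p - g p) p = grad m f p - grad m g p"
proof -
 have e: "ext (%p. f p - g p) = (%p. ext f p - ext g p)" by (simp add: ext_def)
 have "dd v (%p. ext f p - ext g p) p = dd v (ext f) p - dd v (ext g) p" for v
  by (rule dd_eq[OF has_derivative_diff[OF dd_has_derivative[OF F S2_UU_mem[OF p]] dd_has_derivative[OF G S2_UU_mem[OF p]]]])
 moreover have "C_k (Suc 0) (UU x0) (ext (%p. f p - g p))" unfolding e by (intro C_k_diff F G)
 ultimately show ?thesis
  unfolding grad_eq[OF F p] grad_eq[OF G p] grad_eq[OF \<open>C_k (Suc 0) (UU x0) (ext (%p. f p - g p))\<close> p]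
  by (simp add: e vec_eq_iff scaleR_diff_right)
qed

lemma inner_grad:
 assumes "C_k (Suc 0) (UU x0) (ext f)" "C_k (Suc 0) (UU x0) (ext g)" "p : {x0<..} \<times> S2"
 shows "grad m f p \<bullet> grad m g p = dx f p \<bullet> dx g p + inverse ((warp m (fst p))^2) *\<^sub>R (\<Sum>i\<in>UNIV. (sphere_grad f p $ i) \<bullet> (sphere_grad g p $ i))"
 by (cases p) (simp add: grad_def inner_prod_def inner_vec_def power2_eq_square sum_distrib_left mult.assoc)

lemma green_inner:
 assumes m: "m >= 1" and f: "C_k (Suc 0) (UU x0) (ext f)" and g: "C_k (Suc (Suc 0)) (UU x0) (ext g)"
  and r: "x0 < r" "xsupp x0 f r s \<or> xsupp x0 g r s"
 shows "(\<integral>p. grad m f p \<bullet> grad m g p \<partial>volM m x0) = - (\<integral>p. f p \<bullet> classical_laplacian m g p \<partial>volM m x0)"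
proof -
 have "(\<integral>p. grad m f p \<bullet> grad m g p \<partial>volM m x0) = (\<integral>p. dx f p \<bullet> dx g p + inverse ((warp m (fst p))^2) *\<^sub>R (\<Sum>i\<in>UNIV. (sphere_grad f p $ i) \<bullet> (sphere_grad g p $ i)) \<partial>volM m x0)"
  by (intro BI_integral_cong refl inner_grad[OF f C_k_SucD[OF g]]) simp
 thus ?thesis using green(3)[OF m bounded_bilinear_inner f g r] by simp
qed

lemma continuous_lap:
 assumes m: "m >= 1" and F: "C_k (Suc (Suc 0)) (UU x0) (ext f)"
 shows "continuous_on ({x0<..} \<times> S2) (classical_laplacian m f)"
proof -
 have winv: "continuous_on ({x0<..} \<times> S2) (%p::point. inverse ((warp m (fst p))^2))"
  using m by (intro continuous_intros continuous_on_compose2[OF smooth_continuous[OF smooth_warp[OF m], of UNIV]]) auto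
 have "continuous_on ({x0<..} \<times> S2) (%p. inverse ((warp m (fst p))^2) *\<^sub>R (dd e0 (Nx m f) p
   + (\<Sum>i\<in>UNIV. dd (ei i) (dd (ei i) (ext f)) p)))"
  by (intro continuous_on_scaleR winv continuous_on_add continuous_on_sum
    continuous_on_subset[OF C_k_continuous[OF C_k_dd[OF open_UU C_k_Nx[OF m F]]] S2_UU]
    continuous_on_subset[OF C_k_continuous[OF C_k_dd[OF open_UU C_k_dd[OF open_UU F]]] S2_UU])
 thus ?thesis by (rule continuous_on_eq) (simp add: classical_laplacian_eq[OF m F])
qed

lemma test_L2:
 assumes m: "m >= 1" and t: "test_fun x0 \<phi>"
 shows "in_L2 (volM m x0) \<phi>" "in_L2 (volM m x0) (grad m \<phi>)" "in_L2 (volM m x0) (classical_laplacian m \<phi>)"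
proof -
 obtain r s where r: "x0 < r" "xsupp x0 \<phi> r s" by (rule test_fun_xsupp[OF t])
 note F = test_fun_C_k[OF t]
 have lap0: "classical_laplacian m \<phi> p = 0" if "p : {x0<..} \<times> S2" "fst p \<notin> {r..s}" for p
  using classical_laplacian_eq[OF m F that(1)] xsupp_ext[OF r(2) S2_UU_mem[OF that(1)] that(2)] by simp
 show "in_L2 (volM m x0) \<phi>"
  by (rule continuous_vanish_integrable(2)[OF m continuous_M[OF F[of 0]] r(1), of s]) (use r(2) in "auto simp: xsupp_def")
 show "in_L2 (volM m x0) (grad m \<phi>)"
  by (rule continuous_vanish_integrable(2)[OF m continuous_grad[OF m F] r(1), of s])
    (rule xsupp_S2(2)[OF r(2) _ _ F]; simp)
 show "in_L2 (volM m x0) (classical_laplacian m \<phi>)"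
  by (rule continuous_vanish_integrable(2)[OF m continuous_lap[OF m F] r(1), of s]) (rule lap0; simp)
qed

lemma L2_tendsto_inner:
 fixes G :: "'a => 'b::euclidean_space"
 assumes F: "!!n. in_L2 M (F n)" and G: "in_L2 M G" and H: "in_L2 M H"
  and l: "(%n. L2_norm M (%p. F n p - G p)) \<longlonglongrightarrow> 0"
 shows "(%n. \<integral>p. F n p \<bullet> H p \<partial>M) \<longlonglongrightarrow> (\<integral>p. G p \<bullet> H p \<partial>M)"
proof -
 have [measurable]: "F n : borel_measurable M" "G : borel_measurable M" "H : borel_measurable M" for n
  using F G H by (auto simp: in_L2_def)
 have i: "integrable M (%p. K p \<bullet> H p)" "norm (\<integral>p. K p \<bullet> H p \<partial>M) <= L2_norm M K * L2_norm M H" if "in_L2 M K" for K :: "'a => 'b"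
  by (rule L2_bilinear[OF that H]; use that in "auto simp: in_L2_def Cauchy_Schwarz_ineq2")+
 have "(%n. (\<integral>p. F n p \<bullet> H p \<partial>M) - (\<integral>p. G p \<bullet> H p \<partial>M)) \<longlonglongrightarrow> 0"
 proof (rule Lim_null_comparison)
  have "(\<integral>p. F n p \<bullet> H p \<partial>M) - (\<integral>p. G p \<bullet> H p \<partial>M) = (\<integral>p. (F n p - G p) \<bullet> H p \<partial>M)" for n
   using i(1)[OF F] i(1)[OF G] by (simp add: inner_diff_left)
  hence "norm ((\<integral>p. F n p \<bullet> H p \<partial>M) - (\<integral>p. G p \<bullet> H p \<partial>M)) <= L2_norm M (%p. F n p - G p) * L2_norm M H" for n
   using i(2)[OF in_L2_diff(1)[OF F G]] by simp
  thus "\<forall>\<^sub>F n in sequentially. norm ((\<integral>p. F n p \<bullet> H p \<partial>M) - (\<integral>p. G p \<bullet> H p \<partial>M)) <= L2_norm M (%p. F n p - G p) * L2_norm M H"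
   by simp
  show "(%n. L2_norm M (%p. F n p - G p) * L2_norm M H) \<longlonglongrightarrow> 0"
   using tendsto_mult_right[OF l, of "L2_norm M H"] by simp
 qed
 thus ?thesis by (rule LIM_zero_cancel)
qed

text \<open>Let \<open>H\<close> be the difference of two limit gradients, the limit of the gradients of test functions \<open>ch
  n\<close> that tend to \<open>0\<close> locally in \<open>L2\<close>.  The inner product of \<open>H\<close> with the
  gradient of \<open>ch n\<close> is a limit over \<open>k\<close> of \<open>- (ch k, Lap (ch n))\<close>, which is
  zero.  Now let \<open>n\<close> tend to infinity.\<close>
lemma has_grad_unique:
 assumes m: "m >= 1" and f: "has_grad m x0 f G" "has_grad m x0 f G'"
 shows "AE p in volM m x0. G p = G' p"
proof -
 let ?M = "volM m x0"
 from f(1) obtain \<phi> where \<phi>: "!!n. test_fun x0 (\<phi> n)" "(%n. L2_norm ?M (%p. grad m (\<phi> n) p - G p)) \<longlonglongrightarrow> 0"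
  "!!r. r > x0 ==> (%n. L2_norm (vol m {x0<..<r}) (%p. \<phi> n p - f p)) \<longlonglongrightarrow> 0" unfolding has_grad_def by blast
 from f(2) obtain \<psi> where \<psi>: "!!n. test_fun x0 (\<psi> n)" "(%n. L2_norm ?M (%p. grad m (\<psi> n) p - G' p)) \<longlonglongrightarrow> 0"
  "!!r. r > x0 ==> (%n. L2_norm (vol m {x0<..<r}) (%p. \<psi> n p - f p)) \<longlonglongrightarrow> 0" unfolding has_grad_def by blast
 have G: "in_L2 ?M G" "in_L2 ?M G'" and fL: "!!r. r > x0 ==> in_L2 (vol m {x0<..<r}) f"
  using f by (auto simp: has_grad_def)
 define ch where "ch n p = \<phi> n p - \<psi> n p" for n p
 define H where "H p = G p - G' p" for p
 have t: "test_fun x0 (ch n)" for n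
  unfolding ch_def using \<phi>(1) \<psi>(1) by (intro test_fun_diff) auto
 have H: "in_L2 ?M H" unfolding H_def by (rule in_L2_diff(1)[OF G])
 note gL = test_L2(2)[OF m t] and lL = test_L2(3)[OF m t]
 note gp = test_L2(2)[OF m \<phi>(1)] and gq = test_L2(2)[OF m \<psi>(1)]
 have lim: "(%n. L2_norm ?M (%p. grad m (ch n) p - H p)) \<longlonglongrightarrow> 0"
 proof (rule Lim_null_comparison)
  have "L2_norm ?M (%p. grad m (ch n) p - H p) <= L2_norm ?M (%p. grad m (\<phi> n) p - G p) + L2_norm ?M (%p. grad m (\<psi> n) p - G' p)" for n
  proof -
   have "L2_norm ?M (%p. grad m (ch n) p - H p) = L2_norm ?M (%p. (grad m (\<phi> n) p - G p) - (grad m (\<psi> n) p - G' p))"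
   proof -
    have "grad m (ch n) p - H p = (grad m (\<phi> n) p - G p) - (grad m (\<psi> n) p - G' p)" if "p : space ?M" for p
     using grad_diff[OF test_fun_C_k[OF \<phi>(1)[of n]] test_fun_C_k[OF \<psi>(1)[of n]], of p m] that
     by (simp add: ch_def[abs_def] H_def)
    thus ?thesis unfolding L2_norm_def
     by (intro arg_cong[where f=sqrt] BI_integral_cong refl) simp
   qed
   also have "... <= L2_norm ?M (%p. grad m (\<phi> n) p - G p) + L2_norm ?M (%p. grad m (\<psi> n) p - G' p)"
    by (intro in_L2_diff gp gq G)
   finally show ?thesis .
  qed
  thus "\<forall>\<^sub>F n in sequentially. norm (L2_norm ?M (%p. grad m (ch n) p - H p)) <= L2_norm ?M (%p. grad m (\<phi> n) p - G p) + L2_norm ?M (%p. grad m (\<psi> n) p - G' p)"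
   by simp
  show "(%n. L2_norm ?M (%p. grad m (\<phi> n) p - G p) + L2_norm ?M (%p. grad m (\<psi> n) p - G' p)) \<longlonglongrightarrow> 0"
   using tendsto_add[OF \<phi>(2) \<psi>(2)] by simp
 qed
 have z: "(\<integral>p. H p \<bullet> grad m (ch k) p \<partial>?M) = 0" for k
 proof -
  obtain r s where r: "x0 < r" "r < s" "xsupp x0 (ch k) r s" by (rule test_fun_xsupp[OF t[of k]])
  let ?I = "{x0<..<s + 1}" let ?N = "vol m ?I"
  have I: "{x0<..} : sets borel" "?I : sets borel" "?I \<subseteq> {x0<..}" by auto
  have lN: "in_L2 ?N (classical_laplacian m (ch k))" by (rule in_L2_vol_mono(1)[OF m I lL])
  have cN: "in_L2 ?N (\<phi> n)" "in_L2 ?N (\<psi> n)" "in_L2 ?N (ch n)" for n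
   using in_L2_vol_mono(1)[OF m I test_L2(1)[OF m]] \<phi>(1) \<psi>(1) t by auto
  have fN: "in_L2 ?N f" using fL[of "s+1"] r by auto
  have e: "(\<integral>p. grad m (ch n) p \<bullet> grad m (ch k) p \<partial>?M) = - (\<integral>p. ch n p \<bullet> classical_laplacian m (ch k) p \<partial>?N)" for n
  proof -
   have "(\<integral>p. grad m (ch n) p \<bullet> grad m (ch k) p \<partial>?M) = - (\<integral>p. ch n p \<bullet> classical_laplacian m (ch k) p \<partial>?M)"
    by (rule green_inner[OF m test_fun_C_k[OF t] test_fun_C_k[OF t] r(1)]) (use r(3) in blast)
   also have "(\<integral>p. ch n p \<bullet> classical_laplacian m (ch k) p \<partial>?M) = (\<integral>p. ch n p \<bullet> classical_laplacian m (ch k) p \<partial>?N)"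
    unfolding integral_vol_mono(1)[OF m I]
   proof (intro BI_integral_cong refl)
    fix p assume "p : space ?M"
    hence p: "p : {x0<..} \<times> S2" by simp
    show "ch n p \<bullet> classical_laplacian m (ch k) p = indicator (?I \<times> S2) p *\<^sub>R (ch n p \<bullet> classical_laplacian m (ch k) p)"
    proof (cases "fst p : {r..s}")
     case True
     thus ?thesis using p by (auto simp: indicator_def mem_Times_iff)
    next
     case False
     hence "classical_laplacian m (ch k) p = 0"
      using classical_laplacian_eq[OF m test_fun_C_k[OF t] p] xsupp_ext[OF r(3) S2_UU_mem[OF p]] by simp
     thus ?thesis by simp
    qed
   qed
   finally show ?thesis .
  qed
  have "(%n. L2_norm ?N (%p. ch n p - 0)) \<longlonglongrightarrow> 0"
  proof (rule Lim_null_comparison)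
   have "L2_norm ?N (%p. ch n p - 0) <= L2_norm ?N (%p. \<phi> n p - f p) + L2_norm ?N (%p. \<psi> n p - f p)" for n
    using in_L2_diff(2)[OF in_L2_diff(1)[OF cN(1)[of n] fN] in_L2_diff(1)[OF cN(2)[of n] fN]] by (simp add: ch_def)
   thus "\<forall>\<^sub>F n in sequentially. norm (L2_norm ?N (%p. ch n p - 0)) <= L2_norm ?N (%p. \<phi> n p - f p) + L2_norm ?N (%p. \<psi> n p - f p)"
    by simp
   show "(%n. L2_norm ?N (%p. \<phi> n p - f p) + L2_norm ?N (%p. \<psi> n p - f p)) \<longlonglongrightarrow> 0"
    using tendsto_add[OF \<phi>(3)[of "s+1"] \<psi>(3)[of "s+1"]] r by simp
  qed
  from L2_tendsto_inner[OF cN(3) _ lN this]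
  have "(%n. \<integral>p. ch n p \<bullet> classical_laplacian m (ch k) p \<partial>?N) \<longlonglongrightarrow> 0"
   by (simp add: in_L2_def)
  hence "(%n. \<integral>p. grad m (ch n) p \<bullet> grad m (ch k) p \<partial>?M) \<longlonglongrightarrow> 0"
   unfolding e using tendsto_minus by fastforce
  moreover have "(%n. \<integral>p. grad m (ch n) p \<bullet> grad m (ch k) p \<partial>?M) \<longlonglongrightarrow> (\<integral>p. H p \<bullet> grad m (ch k) p \<partial>?M)"
   by (rule L2_tendsto_inner[OF gL H gL lim])
  ultimately show ?thesis by (rule LIMSEQ_unique[symmetric])
 qed
 have "(%n. \<integral>p. grad m (ch n) p \<bullet> H p \<partial>?M) \<longlonglongrightarrow> (\<integral>p. H p \<bullet> H p \<partial>?M)"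
  by (rule L2_tendsto_inner[OF gL H H lim])
 hence "(%n. 0) \<longlonglongrightarrow> (\<integral>p. H p \<bullet> H p \<partial>?M)"
  unfolding inner_commute[of "grad m _ _"] z .
 hence "(\<integral>p. H p \<bullet> H p \<partial>?M) = 0" using LIMSEQ_unique tendsto_const by blast
 hence "L2_norm ?M H = 0" by (simp add: L2_norm_def dot_square_norm)
 hence "AE p in ?M. H p = 0" by (rule L2_norm_zero_AE[OF H])
 thus ?thesis by (simp add: H_def)
qed

lemma has_grad_cong:
 assumes m: "m >= 1" and f: "has_grad m x0 f G" and g: "g : borel_measurable (volM m x0)" "AE p in volM m x0. f p = g p"
 shows "has_grad m x0 g G"
proof -
 have I: "{x0<..} : sets borel" "{x0<..<r} : sets borel" "{x0<..<r} \<subseteq> {x0<..}" for r by auto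
 have ae: "AE p in vol m {x0<..<r}. f p = g p" for r by (rule AE_vol_mono[OF m I g(2)])
 have gm: "g : borel_measurable (vol m {x0<..<r})" for r by (rule measurable_vol_mono[OF I(3) g(1)])
 have fm: "f : borel_measurable (vol m {x0<..<r})" if "r > x0" for r using f that by (auto simp: has_grad_def in_L2_def)
 have "in_L2 (vol m {x0<..<r}) g" if r: "r > x0" for r
 proof -
  have "integrable (vol m {x0<..<r}) (%p. (norm (g p))^2) \<longleftrightarrow> integrable (vol m {x0<..<r}) (%p. (norm (f p))^2)"
   using ae[of r] gm[of r] fm[OF r] by (intro integrable_cong_AE) auto
  thus ?thesis using f r gm[of r] by (auto simp: has_grad_def in_L2_def)
 qed
 moreover have "L2_norm (vol m {x0<..<r}) (%p. \<phi> p - f p) = L2_norm (vol m {x0<..<r}) (%p. \<phi> p - g p)" 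
  if r: "r > x0" and t: "test_fun x0 \<phi>" for r \<phi>
 proof (rule L2_norm_cong_AE)
  have "\<phi> : borel_measurable (vol m {x0<..<r})"
   by (rule measurable_vol_mono[OF I(3) in_L2_meas[OF test_L2(1)[OF m t]]])
  thus "(%p. \<phi> p - f p) : borel_measurable (vol m {x0<..<r})" "(%p. \<phi> p - g p) : borel_measurable (vol m {x0<..<r})"
   using gm[of r] fm[OF r] by auto
  show "AE p in vol m {x0<..<r}. \<phi> p - f p = \<phi> p - g p" using ae[of r] by auto
 qed
 ultimately show ?thesis using f g(1) unfolding has_grad_def by auto
qed

lemma weak_grad_AE:
 assumes "m >= 1" "has_grad m x0 f G"
 shows "has_grad m x0 f (weak_grad m x0 f)" "AE p in volM m x0. weak_grad m x0 f p = G p"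
proof -
 show 1: "has_grad m x0 f (weak_grad m x0 f)"
  unfolding weak_grad_def by (rule someI[of "has_grad m x0 f", OF assms(2)])
 show "AE p in volM m x0. weak_grad m x0 f p = G p" by (rule has_grad_unique[OF assms(1) 1 assms(2)])
qed

lemma weak_grad_norm:
 assumes m: "m >= 1" and f: "has_grad m x0 f G"
 shows "L2_norm (volM m x0) (weak_grad m x0 f) = L2_norm (volM m x0) G"
 by (rule L2_norm_cong_AE) (use weak_grad_AE[OF m f] f in "auto simp: has_grad_def in_L2_def")

lemma has_laplacian_cong:
 assumes m: "m >= 1" and u: "has_laplacian m x0 u f"
  and v: "u : borel_measurable (volM m x0)" "v : borel_measurable (volM m x0)" "AE p in volM m x0. u p = v p"
  and g: "g : borel_measurable (volM m x0)" "AE p in volM m x0. f p = g p"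
 shows "has_laplacian m x0 v g"
proof -
 have fm: "in_L2 (volM m x0) f" "f : borel_measurable (volM m x0)" using u by (auto simp: has_laplacian_def in_L2_def)
 have "integrable (volM m x0) (%p. (norm (g p))^2) \<longleftrightarrow> integrable (volM m x0) (%p. (norm (f p))^2)"
  using g fm by (intro integrable_cong_AE) auto
 hence "in_L2 (volM m x0) g" using fm g by (auto simp: in_L2_def)
 moreover have "(\<integral>p. v p * classical_laplacian m \<phi> p \<partial>volM m x0) = (\<integral>p. g p * \<phi> p \<partial>volM m x0)" if t: "test_fun x0 \<phi>" for \<phi>
 proof -
  have [measurable]: "\<phi> : borel_measurable (volM m x0)" "classical_laplacian m \<phi> : borel_measurable (volM m x0)"
   using test_L2[OF m t] by (auto simp: in_L2_def)
  have "(\<integral>p. v p * classical_laplacian m \<phi> p \<partial>volM m x0) = (\<integral>p. u p * classical_laplacian m \<phi> p \<partial>volM m x0)"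
   using v by (intro integral_cong_AE) auto
  moreover have "(\<integral>p. g p * \<phi> p \<partial>volM m x0) = (\<integral>p. f p * \<phi> p \<partial>volM m x0)"
   using g fm by (intro integral_cong_AE) auto
  ultimately show ?thesis using u t by (simp add: has_laplacian_def)
 qed
 ultimately show ?thesis by (simp add: has_laplacian_def)
qed

section \<open>Spherical harmonics\<close>

text \<open>The coordinate \<open>w1 + i w2\<close>; its powers are harmonic polynomials.\<close>
definition zz :: "real^3 => complex" where "zz y = of_real (y $ 1) + \<i> * of_real (y $ 2)"

definition Yl :: "nat => real^3 => complex" where "Yl n y = zz y ^ (2 * n)"

text \<open>The Euclidean gradient of \<open>zz\<close>; it is isotropic (\<open>kap_sums\<close>), which is why powers of
  \<open>zz\<close> are harmonic.\<close>
definition kap :: "3 => complex" where "kap i = (if i = 1 then 1 else if i = 2 then \<i> else 0)"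

text \<open>The tangential gradient of \<open>Yl n\<close> on the sphere.\<close>
definition SG :: "nat => real^3 => 3 => complex" where
 "SG n \<omega> i = of_nat (2 * n) * (kap i * zz \<omega> ^ (2 * n - 1) - of_real (\<omega> $ i) * zz \<omega> ^ (2 * n))"

definition Lam :: "nat => real" where "Lam n = real (2 * n) * real (2 * n + 1)"

text \<open>The factor \<open>1 / a\<close> removes the first order term from the radial Laplacian, so that the squared
  \<open>L2\<close> norm of a mode is a constant times that of \<open>g\<close> on the line.\<close>
definition mode :: "nat => nat => complex => (real => real) => point => complex" where
 "mode m n c g = (%p. c * of_real (g (fst p) / warp m (fst p)) * Yl n (snd p))"

lemma bl_zz: "bounded_linear zz"
 unfolding zz_def[abs_def]
 by (intro bounded_linear_add bounded_linear_mult_right[THEN bounded_linear_compose]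
   bounded_linear_compose[OF bounded_linear_of_real] bounded_linear_vec_nth)

lemma zz_line: "zz (\<omega> + s *\<^sub>R axis i 1) = zz \<omega> + of_real s * kap i"
proof -
 consider "i = 1" | "i = 2" | "i = 3" using exhaust_3[of i] by blast
 thus ?thesis by cases (auto simp: zz_def kap_def axis_def algebra_simps)
qed

lemma sum3: "(\<Sum>i\<in>UNIV. f (i::3)) = f 1 + f 2 + f 3" by (rule sum_3)

lemma kap_sums: "(\<Sum>i\<in>UNIV. kap i ^ 2) = 0" "(\<Sum>i\<in>UNIV. kap i * of_real (\<omega> $ i)) = zz \<omega>"
 by (simp_all add: sum3 kap_def zz_def)

text \<open>Degree \<open>2n\<close> is even, so the norm appears as a power of \<open>|y|^2\<close>, which is polynomial.\<close>
lemma Yl_sgn: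
 assumes "y ~= 0"
 shows "Yl n (sgn y) = zz y ^ (2 * n) * of_real (inverse (y \<bullet> y) ^ n)"
proof -
 have "zz (sgn y) = of_real (inverse (norm y)) * zz y"
  using linear_scale[OF bounded_linear.linear[OF bl_zz], of "inverse (norm y)" y]
  by (simp add: sgn_div_norm scaleR_conv_of_real)
 hence "Yl n (sgn y) = of_real (inverse (norm y) ^ (2 * n)) * zz y ^ (2 * n)"
  by (simp add: Yl_def power_mult_distrib)
 also have "inverse (norm y) ^ (2 * n) = inverse (y \<bullet> y) ^ n"
  by (simp add: power_mult dot_square_norm power_inverse)
 finally show ?thesis by (simp add: mult.commute)
qed

text \<open>First and second derivatives of the extension of degree \<open>0\<close> along a coordinate line, by the explicit
  formula of \<open>Yl_sgn\<close>.\<close>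
lemma Yl_line_derivs:
 assumes \<omega>: "\<omega> : S2" and n: "n >= 1"
 obtains V \<zeta>1 where "open V" "0 : V"
  "\<forall>r\<in>V. ((%s. Yl n (sgn (\<omega> + s *\<^sub>R axis i 1))) has_vector_derivative \<zeta>1 r) (at r)"
  "\<zeta>1 0 = SG n \<omega> i"
  "(\<zeta>1 has_vector_derivative
    of_nat (2*n) * of_nat (2*n - 1) * kap i ^ 2 * zz \<omega> ^ (2*n - 2)
    - of_nat (8 * n^2) * (kap i * of_real (\<omega> $ i)) * zz \<omega> ^ (2*n - 1)
    + zz \<omega> ^ (2*n) * of_real (4 * real n * (real n + 1) * (\<omega> $ i)^2 - 2 * real n)) (at 0)"
proof -
 obtain k where k: "2 * n = Suc (Suc k)" using n by (intro that[of "2*n-2"]) auto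
 have k': "2*n - 1 = Suc k" "2*n - 2 = k" using k by auto
 obtain j where j: "n = Suc j" using n by (cases n) auto
 let ?z = "zz \<omega>" and ?k = "kap i" and ?w = "\<omega> $ i"
 let ?q = "%s::real. 1 + 2 * s * ?w + s^2"
 have q: "(\<omega> + s *\<^sub>R axis i 1) \<bullet> (\<omega> + s *\<^sub>R axis i 1) = ?q s" for s
 proof -
  have ww: "\<omega> \<bullet> \<omega> = 1" using \<omega> by (simp add: dot_square_norm)
  have aa: "axis i 1 \<bullet> (axis i 1 :: real^3) = 1" by (simp add: inner_axis)
  show ?thesis by (simp only: inner_add_left inner_add_right inner_scaleR_left inner_scaleR_right ww aa
     inner_commute[of "axis i 1" \<omega>] inner_axis) (simp add: power2_eq_square algebra_simps)
 qed
 let ?V = "{r. ?q r > 0}"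
 have V: "open ?V" by (intro open_Collect_less continuous_intros)
 let ?A = "%s. (?z + of_real s * ?k)"
 let ?\<zeta> = "%s. ?A s ^ (Suc (Suc k)) * of_real (inverse (?q s) ^ n)"
 let ?r1 = "%s. - real n * inverse (?q s) ^ (Suc n) * (2 * ?w + 2 * s)"
 let ?\<zeta>1 = "%s. of_nat (Suc (Suc k)) * ?k * ?A s ^ (Suc k) * of_real (inverse (?q s) ^ n) + ?A s ^ (Suc (Suc k)) * of_real (?r1 s)"
 have Ad: "(?A has_vector_derivative ?k) (at s)" for s
  by (auto intro!: derivative_eq_intros)
 have Apow: "((%s. ?A s ^ (Suc N)) has_vector_derivative of_nat (Suc N) * ?k * ?A s ^ N) (at s)" for s N
  using field_vector_diff_chain_at[OF Ad, of "%z. z ^ Suc N" "of_nat (Suc N) * ?A s ^ N" s]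
   DERIV_power[OF DERIV_ident, of "Suc N" "?A s" UNIV]
  by (simp add: o_def mult_ac)
 have qd: "has_d ?q (2 * ?w + 2 * s) s" for s
  by (auto intro!: derivative_eq_intros)
 have ri: "has_d (%s. inverse (?q s) ^ Suc N) (- real (Suc N) * inverse (?q s) ^ Suc (Suc N) * (2 * ?w + 2 * s)) s" if "s : ?V" for s N
 proof (rule DERIV_cong[OF DERIV_power[OF DERIV_inverse_fun[OF qd]]])
  show "?q s ~= 0" using that by simp
  show "real (Suc N) * (- ((2 * ?w + 2 * s) * inverse (?q s ^ Suc (Suc 0))) * inverse (?q s) ^ (Suc N - Suc 0)) =
   - real (Suc N) * inverse (?q s) ^ Suc (Suc N) * (2 * ?w + 2 * s)"
   unfolding power_inverse[symmetric] by (simp only: power_Suc power_0 diff_Suc_Suc diff_zero mult_1_right) (simp only: mult_ac mult_minus_left mult_minus_right)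
 qed
 have rio: "((%s. complex_of_real (inverse (?q s) ^ Suc N)) has_vector_derivative complex_of_real (- real (Suc N) * inverse (?q s) ^ Suc (Suc N) * (2 * ?w + 2 * s))) (at s)" if "s : ?V" for s N
  using ri[OF that] by (intro has_vector_derivative_of_real) (simp only: has_real_derivative_iff_has_vector_derivative)
 show ?thesis
 proof (rule that[OF V])
  show "0 : ?V" by simp
  show "\<forall>r\<in>?V. ((%s. Yl n (sgn (\<omega> + s *\<^sub>R axis i 1))) has_vector_derivative ?\<zeta>1 r) (at r)"
  proof
   fix r assume r: "r : ?V"
   show "((%s. Yl n (sgn (\<omega> + s *\<^sub>R axis i 1))) has_vector_derivative ?\<zeta>1 r) (at r)"
  proof (rule has_vector_derivative_transform_within_open[OF _ V r])
   show "?\<zeta> s = Yl n (sgn (\<omega> + s *\<^sub>R axis i 1))" if "s : ?V" for s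
   proof -
    have "\<omega> + s *\<^sub>R axis i 1 ~= 0" using q[of s] that by auto
    from Yl_sgn[OF this, of n] show ?thesis unfolding q zz_line k ..
   qed
   show "(?\<zeta> has_vector_derivative ?\<zeta>1 r) (at r)"
    using has_vector_derivative_mult[OF Apow[of "Suc k" r] rio[OF r, of j]] unfolding j by (simp only: add.commute)
  qed
  qed
  have nn: "of_nat (Suc (Suc k)) = (2 * of_nat n :: complex)" using k by (metis of_nat_mult of_nat_numeral)
  have "?\<zeta>1 0 = of_nat (Suc (Suc k)) * (?k * ?z ^ Suc k - of_real ?w * ?z ^ Suc (Suc k))"
   unfolding nn by (simp add: algebra_simps)
  thus "?\<zeta>1 0 = SG n \<omega> i" unfolding SG_def k by (simp only: diff_Suc_1)
  have 0: "0 : ?V" by simp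
  have r1d: "((%s. complex_of_real (?r1 s)) has_vector_derivative
    complex_of_real (real n * (real n + 1) * (2 * ?w)^2 - 2 * real n)) (at 0)"
  proof -
   have "((%s. (- real n) * inverse (?q s) ^ Suc n * (2 * ?w + 2 * s)) has_real_derivative
     real n * (real n + 1) * (2 * ?w)^2 - 2 * real n) (at 0)"
    by (rule derivative_eq_intros ri[OF 0] refl)+ (simp add: power2_eq_square algebra_simps)
   thus ?thesis by (rule has_vector_derivative_of_real)
  qed
  have 1: "((%s. of_nat (Suc (Suc k)) * ?k * ?A s ^ Suc k * of_real (inverse (?q s) ^ n)) has_vector_derivative
    of_nat (Suc (Suc k)) * ?k * (of_nat (Suc k) * ?k * ?z ^ k) - of_nat (Suc (Suc k)) * ?k * ?z ^ Suc k * of_real (2 * real n * ?w)) (at 0)"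
   using has_vector_derivative_mult[OF has_vector_derivative_mult_right[OF Apow[of k 0], of "of_nat (Suc (Suc k)) * ?k"] rio[OF 0, of j]]
   unfolding j by (simp add: algebra_simps)
  have 2: "((%s. ?A s ^ Suc (Suc k) * of_real (?r1 s)) has_vector_derivative
    ?z ^ Suc (Suc k) * complex_of_real (real n * (real n + 1) * (2 * ?w)^2 - 2 * real n)
    - of_nat (Suc (Suc k)) * ?k * ?z ^ Suc k * of_real (2 * real n * ?w)) (at 0)"
   using has_vector_derivative_mult[OF Apow[of "Suc k" 0] r1d]
   by (simp add: algebra_simps)
  have "(?\<zeta>1 has_vector_derivative
    (of_nat (Suc (Suc k)) * ?k * (of_nat (Suc k) * ?k * ?z ^ k) - of_nat (Suc (Suc k)) * ?k * ?z ^ Suc k * of_real (2 * real n * ?w))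
    + (?z ^ Suc (Suc k) * complex_of_real (real n * (real n + 1) * (2 * ?w)^2 - 2 * real n)
    - of_nat (Suc (Suc k)) * ?k * ?z ^ Suc k * of_real (2 * real n * ?w))) (at 0)"
   by (rule has_vector_derivative_add[OF 1 2])
  also have "(of_nat (Suc (Suc k)) * ?k * (of_nat (Suc k) * ?k * ?z ^ k) - of_nat (Suc (Suc k)) * ?k * ?z ^ Suc k * of_real (2 * real n * ?w))
    + (?z ^ Suc (Suc k) * complex_of_real (real n * (real n + 1) * (2 * ?w)^2 - 2 * real n)
    - of_nat (Suc (Suc k)) * ?k * ?z ^ Suc k * of_real (2 * real n * ?w))
   = of_nat (2*n) * of_nat (2*n - 1) * ?k ^ 2 * ?z ^ (2*n - 2)
    - of_nat (8 * n^2) * (?k * of_real ?w) * ?z ^ (2*n - 1)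
    + ?z ^ (2*n) * of_real (4 * real n * (real n + 1) * ?w^2 - 2 * real n)"
   unfolding k' k nn by (simp add: power2_eq_square algebra_simps)
  finally show "(?\<zeta>1 has_vector_derivative
   of_nat (2*n) * of_nat (2*n - 1) * ?k ^ 2 * ?z ^ (2*n - 2)
    - of_nat (8 * n^2) * (?k * of_real ?w) * ?z ^ (2*n - 1)
    + ?z ^ (2*n) * of_real (4 * real n * (real n + 1) * ?w^2 - 2 * real n)) (at 0)" .
 qed
qed

lemma sphere_grad_mode:
 assumes "\<omega> : S2" "n >= 1"
 shows "sphere_grad (mode m n c g) (x, \<omega>) = (\<chi> i. c * of_real (g x / warp m x) * SG n \<omega> i)"
proof -
 have "vector_derivative (%s. mode m n c g (x, sgn (\<omega> + s *\<^sub>R axis i 1))) (at 0) = c * of_real (g x / warp m x) * SG n \<omega> i" for i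
 proof -
  obtain \<zeta>1 V where "open V" "0 : V" "\<forall>r\<in>V. ((%s. Yl n (sgn (\<omega> + s *\<^sub>R axis i 1))) has_vector_derivative \<zeta>1 r) (at r)"
   "\<zeta>1 0 = SG n \<omega> i" using Yl_line_derivs[OF assms, of i] by metis
  hence "((%s. Yl n (sgn (\<omega> + s *\<^sub>R axis i 1))) has_vector_derivative SG n \<omega> i) (at 0)" by metis
  thus ?thesis unfolding mode_def fst_conv snd_conv
   by (intro vector_derivative_at has_vector_derivative_mult_right)
 qed
 thus ?thesis by (simp add: sphere_grad_def)
qed

text \<open>Summing the second derivatives over the axes, isotropy of \<open>kap\<close> and Euler's identity leave
  \<open>-2n(2n+1) Y\<close>.\<close>
lemma sphere_laplacian_mode:
 assumes "\<omega> : S2" "n >= 1"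
 shows "sphere_laplacian (mode m n c g) (x, \<omega>) = - of_real (Lam n) * mode m n c g (x, \<omega>)"
proof -
 let ?C = "c * of_real (g x / warp m x)"
 let ?D = "%i. of_nat (2*n) * of_nat (2*n - 1) * kap i ^ 2 * zz \<omega> ^ (2*n - 2)
    - of_nat (8 * n^2) * (kap i * of_real (\<omega> $ i)) * zz \<omega> ^ (2*n - 1)
    + zz \<omega> ^ (2*n) * of_real (4 * real n * (real n + 1) * (\<omega> $ i)^2 - 2 * real n)"
 have d: "vector_derivative (%r. vector_derivative (%s. mode m n c g (x, sgn (\<omega> + s *\<^sub>R axis i 1))) (at r)) (at 0) = ?C * ?D i" for i
 proof (rule vector_derivative_at)
  obtain \<zeta>1 V where V: "open V" "0 : V" "\<forall>r\<in>V. ((%s. Yl n (sgn (\<omega> + s *\<^sub>R axis i 1))) has_vector_derivative \<zeta>1 r) (at r)"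
   "\<zeta>1 0 = SG n \<omega> i" "(\<zeta>1 has_vector_derivative ?D i) (at 0)" by (rule Yl_line_derivs[OF assms, of i])
  have "((%r. ?C * \<zeta>1 r) has_vector_derivative ?C * ?D i) (at 0)"
   by (rule has_vector_derivative_mult_right[OF V(5)])
  thus "((%r. vector_derivative (%s. mode m n c g (x, sgn (\<omega> + s *\<^sub>R axis i 1))) (at r)) has_vector_derivative ?C * ?D i) (at 0)"
  proof (rule has_vector_derivative_transform_within_open[OF _ V(1,2)])
   show "?C * \<zeta>1 r = vector_derivative (%s. mode m n c g (x, sgn (\<omega> + s *\<^sub>R axis i 1))) (at r)" if "r : V" for r
    unfolding mode_def fst_conv snd_conv
    by (intro vector_derivative_at[symmetric] has_vector_derivative_mult_right V(3)[rule_format, OF that])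
  qed
 qed
 have sq: "(\<Sum>i\<in>UNIV. (\<omega> $ i)^2) = 1"
  using assms(1) dot_square_norm[of \<omega>] by (simp add: inner_vec_def power2_eq_square)
 have "(\<Sum>i\<in>UNIV. ?D i) = of_nat (2*n) * of_nat (2*n - 1) * zz \<omega> ^ (2*n - 2) * (\<Sum>i\<in>UNIV. kap i ^ 2)
   - of_nat (8 * n^2) * zz \<omega> ^ (2*n - 1) * (\<Sum>i\<in>UNIV. kap i * of_real (\<omega> $ i))
   + zz \<omega> ^ (2*n) * of_real (4 * real n * (real n + 1) * (\<Sum>i\<in>UNIV. (\<omega> $ i)^2) - 6 * real n)"
  unfolding sum3 by (simp add: algebra_simps)
 also have "... = zz \<omega> ^ (2*n) * of_real (4 * real n * (real n + 1) - 6 * real n - 8 * (real n)^2)"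
 proof -
  have "zz \<omega> ^ (2*n - 1) * zz \<omega> = zz \<omega> ^ (2*n)" using assms(2) by (metis mult_eq_0_iff not_one_le_zero power_minus_mult zero_less_iff_neq_zero zero_neq_numeral)
  thus ?thesis unfolding kap_sums sq by (simp add: algebra_simps power2_eq_square)
 qed
 also have "4 * real n * (real n + 1) - 6 * real n - 8 * (real n)^2 = - Lam n"
  by (simp add: Lam_def algebra_simps power2_eq_square)
 finally have S: "(\<Sum>i\<in>UNIV. ?D i) = - of_real (Lam n) * zz \<omega> ^ (2*n)" by simp
 have "sphere_laplacian (mode m n c g) (x, \<omega>) = (\<Sum>i\<in>UNIV. ?C * ?D i)"
  by (simp add: sphere_laplacian_def d)
 also have "... = ?C * (\<Sum>i\<in>UNIV. ?D i)" by (simp only: sum_distrib_left)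
 finally show ?thesis unfolding S by (simp add: mode_def Yl_def)
qed

section \<open>Separation of variables\<close>

definition pot :: "nat => nat => real => real" where
 "pot m n x = Lam n / (warp m x)^2 + curv m x"

text \<open>The derivative of \<open>warp\<close>.\<close>
definition adot :: "nat => real => real" where "adot m x = x ^ (2*m-1) / warp m x ^ (2*m-1)"

lemma adot_derivs:
 assumes "m >= 1"
 shows "has_d (warp m) (adot m x) x" "has_d (adot m) (curv m x * warp m x) x"
 using warp_deriv[OF assms] warp_deriv2[OF assms] by (auto simp: adot_def[abs_def])

lemma dx_mode:
 assumes m: "m >= 1" and g: "has_d g g1 x"
 shows "dx (mode m n c g) (x, \<omega>) = c * of_real ((g1 * warp m x - g x * adot m x) / (warp m x)^2) * Yl n \<omega>"
proof -
 have "has_d (%x. g x / warp m x) ((g1 * warp m x - g x * adot m x) / (warp m x)^2) x"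
  using DERIV_divide[OF g adot_derivs(1)[OF m]] m by (simp add: power2_eq_square)
 hence "((%s. complex_of_real (g s / warp m s)) has_vector_derivative complex_of_real ((g1 * warp m x - g x * adot m x) / (warp m x)^2)) (at x)"
  by (intro has_vector_derivative_of_real) (simp only: has_real_derivative_iff_has_vector_derivative)
 from has_vector_derivative_mult_left[OF has_vector_derivative_mult_right[OF this, of c], of "Yl n \<omega>"]
 show ?thesis unfolding dx_def mode_def case_prod_conv fst_conv snd_conv by (rule vector_derivative_at)
qed

lemma classical_laplacian_mode:
 assumes m: "m >= 1" and n: "n >= 1" and \<omega>: "\<omega> : S2"
  and g: "!!x. has_d g (g1 x) x" "has_d g1 g2 x"
 shows "classical_laplacian m (mode m n c g) (x, \<omega>) = mode m n c (%x. g2 - pot m n x * g x) (x, \<omega>)"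
proof -
 let ?a = "warp m x"
 have a: "?a ~= 0" using m by simp
 have e: "(warp m s)^2 *\<^sub>R dx (mode m n c g) (s, \<omega>) = c * of_real (g1 s * warp m s - g s * adot m s) * Yl n \<omega>" for s
  unfolding dx_mode[OF m g(1)] using m by (simp add: scaleR_conv_of_real)
 have "has_d (%s. g1 s * warp m s - g s * adot m s) ((g2 - curv m x * g x) * ?a) x"
  by (auto intro!: derivative_eq_intros g adot_derivs[OF m] simp: algebra_simps)
 hence "((%s. complex_of_real (g1 s * warp m s - g s * adot m s)) has_vector_derivative complex_of_real ((g2 - curv m x * g x) * ?a)) (at x)"
  by (intro has_vector_derivative_of_real) (simp only: has_real_derivative_iff_has_vector_derivative)
 from has_vector_derivative_mult_left[OF has_vector_derivative_mult_right[OF this, of c], of "Yl n \<omega>"]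
 have "vector_derivative (%s. (warp m s)^2 *\<^sub>R dx (mode m n c g) (s, \<omega>)) (at x) = c * of_real ((g2 - curv m x * g x) * ?a) * Yl n \<omega>"
  unfolding e by (rule vector_derivative_at)
 hence "classical_laplacian m (mode m n c g) (x, \<omega>) = inverse (?a^2) *\<^sub>R (c * of_real ((g2 - curv m x * g x) * ?a) * Yl n \<omega>)
  + inverse (?a^2) *\<^sub>R (- of_real (Lam n) * mode m n c g (x, \<omega>))"
  using sphere_laplacian_mode[OF \<omega> n] by (simp add: classical_laplacian_def)
 also have "... = c * of_real (inverse (?a^2) * ((g2 - curv m x * g x) * ?a) - inverse (?a^2) * (Lam n * (g x / ?a))) * Yl n \<omega>"
  by (simp add: mode_def scaleR_conv_of_real algebra_simps)
 also have "inverse (?a^2) * ((g2 - curv m x * g x) * ?a) - inverse (?a^2) * (Lam n * (g x / ?a)) = (g2 - pot m n x * g x) / ?a"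
  using a by (simp add: pot_def field_simps power2_eq_square)
 finally show ?thesis by (simp add: mode_def)
qed

lemma C_k_mode:
 assumes m: "m >= 1" and g: "C_k k UNIV g"
 shows "C_k k UNIV (mode m n c g)"
proof -
 have 1: "C_k k UNIV (%p::point. g (fst p) * inverse (warp m (fst p)))"
  by (intro C_k_mult C_k_compose[OF g] C_k_inverse C_k_compose[OF smoothD[OF smooth_warp[OF m]]]
    C_k_bounded_linear bounded_linear_fst) (use m in auto)
 have 2: "C_k k UNIV (%p::point. zz (snd p) ^ (2 * n))"
  by (intro C_k_power C_k_bounded_linear bounded_linear_compose[OF bl_zz bounded_linear_snd])
 have "C_k k UNIV (%p. c * of_real (g (fst p) * inverse (warp m (fst p))) * zz (snd p) ^ (2 * n))"
  by (intro C_k_mult C_k_const C_k_compose_linear[OF bounded_linear_of_real] 1 2)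
 thus ?thesis by (simp add: mode_def[abs_def] Yl_def divide_inverse)
qed

lemma C_k_ext_mode:
 assumes m: "m >= 1" and g: "C_k k UNIV g"
 shows "C_k k (UU x0) (ext (mode m n c g))"
 unfolding ext_def by (rule C_k_compose[OF C_k_mode[OF m g] C_k_lift]) simp

section \<open>Integrals of products\<close>

lemma sphere_continuous_meas: "continuous_on S2 K ==> K : borel_measurable sphere_measure"
 by (subst measurable_cong_sets[OF sets_sphere_measure refl]) (rule borel_measurable_continuous_on_restrict)

lemma sphere_integrable:
 fixes K :: "real^3 => 'b::{banach,second_countable_topology}"
 assumes "continuous_on S2 K"
 shows "integrable sphere_measure K"
proof -
 have "bounded (K ` S2)" by (intro compact_imp_bounded compact_continuous_image assms) simp
 then obtain B where B: "!!\<omega>. \<omega> : S2 ==> norm (K \<omega>) <= B" unfolding bounded_iff by blast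
 show ?thesis
  by (rule sph.integrable_const_bound[of _ B]) (use B sphere_continuous_meas[OF assms] in "auto intro!: AE_I2")
qed

lemma compact_continuous_bound:
 assumes "compact S" "continuous_on S f"
 obtains B where "B > 0" "\<forall>x\<in>S. norm (f x) <= B"
 using compact_imp_bounded[OF compact_continuous_image[OF assms(2,1)]] unfolding bounded_pos by blast

lemma integral_product:
 fixes h :: "real => real" and K :: "real^3 => real"
 assumes m: "m >= 1" and X: "x0 <= X" and h: "continuous_on {x0..X} h" and K: "continuous_on S2 K"
 shows "(\<integral>p. h (fst p) * K (snd p) \<partial>vol m {x0<..X}) = integral {x0..X} (%x. (warp m x)^2 * h x) * (\<integral>\<omega>. K \<omega> \<partial>sphere_measure)"
  "integrable (vol m {x0<..X}) (%p. h (fst p) * K (snd p))"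
proof -
 let ?I = "{x0<..X}" let ?R = "restrict_space lborel ?I" let ?P = "?R \<Otimes>\<^sub>M sphere_measure"
 have cf: "continuous_on (?I \<times> S2) (%p. h (fst p) * K (snd p))"
  by (intro continuous_intros continuous_on_compose2[OF h] continuous_on_compose2[OF K]) auto
 have fm: "(%p. h (fst p) * K (snd p)) : borel_measurable (vol m ?I)" by (rule continuous_measurable_vol[OF cf])
 have fmP: "(%p. h (fst p) * K (snd p)) : borel_measurable ?P" using fm by (simp add: vol_def)
 have wm: "(%p. (warp m (fst p))^2) : borel_measurable ?P"
 proof -
  have "continuous_on (?I \<times> S2) (%p::point. (warp m (fst p))^2)"
   by (intro continuous_intros continuous_on_compose2[OF smooth_continuous[OF smooth_warp[OF m], of UNIV]]) auto
  from continuous_measurable_vol[OF this, of m] show ?thesis by (simp add: vol_def)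
 qed
 have vd: "vol m ?I = density ?P (%p. ennreal ((warp m (fst p))^2))" by (simp add: vol_def split_beta')
 have emf: "emeasure (vol m ?I) (?I \<times> S2) < \<infinity>" by (rule emeasure_vol_bounded[OF m, of _ x0 X]) auto
 obtain B where B: "B > 0" "\<forall>x\<in>{x0..X}. norm (h x) <= B"
  by (rule compact_continuous_bound[OF compact_Icc h])
 obtain C where C: "C > 0" "\<forall>\<omega>\<in>S2. norm (K \<omega>) <= C"
  by (rule compact_continuous_bound[OF compact_sphere K])
 show i: "integrable (vol m ?I) (%p. h (fst p) * K (snd p))"
 proof (rule integrableI_bounded_set[where A="?I \<times> S2" and B="\<bar>B\<bar> * \<bar>C\<bar>"])
  show "?I \<times> S2 : sets (vol m ?I)" by (rule Times_S2_vol) auto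
  show "AE p in vol m ?I. p : ?I \<times> S2 --> norm (h (fst p) * K (snd p)) <= \<bar>B\<bar> * \<bar>C\<bar>"
  proof (rule AE_I2, rule impI)
   fix p assume "p : ?I \<times> S2"
   hence "norm (h (fst p)) <= B" "norm (K (snd p)) <= C" using B C by auto
   hence "norm (h (fst p)) * norm (K (snd p)) <= \<bar>B\<bar> * \<bar>C\<bar>" by (intro mult_mono) auto
   thus "norm (h (fst p) * K (snd p)) <= \<bar>B\<bar> * \<bar>C\<bar>" unfolding norm_mult .
  qed
 qed (use fm emf in auto)
 have iP: "integrable ?P (%p. (warp m (fst p))^2 *\<^sub>R (h (fst p) * K (snd p)))"
  using i unfolding vd by (subst (asm) integrable_density) (use fmP wm in auto)
 interpret R: sigma_finite_measure ?R by (rule sigma_finite_measure_restrict_space[OF lborel.sigma_finite_measure_axioms]) auto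
 interpret pair_sigma_finite ?R sphere_measure ..
 have "(\<integral>p. h (fst p) * K (snd p) \<partial>vol m ?I) = (\<integral>p. (warp m (fst p))^2 *\<^sub>R (h (fst p) * K (snd p)) \<partial>?P)"
  unfolding vd by (rule integral_density) (use fmP wm in auto)
 also have "... = (\<integral>x. (\<integral>\<omega>. (warp m x)^2 *\<^sub>R (h x * K \<omega>) \<partial>sphere_measure) \<partial>?R)"
  using integral_fst'[OF iP] by simp
 also have "... = (\<integral>x. (warp m x)^2 * h x \<partial>?R) * (\<integral>\<omega>. K \<omega> \<partial>sphere_measure)"
 proof -
  have "(\<integral>\<omega>. (warp m x)^2 *\<^sub>R (h x * K \<omega>) \<partial>sphere_measure) = ((warp m x)^2 * h x) * (\<integral>\<omega>. K \<omega> \<partial>sphere_measure)" for x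
   by simp
  thus ?thesis by (simp only: Bochner_Integration.integral_mult_left_zero)
 qed
 also have "(\<integral>x. (warp m x)^2 * h x \<partial>?R) = (\<integral>x. indicator ?I x *\<^sub>R ((warp m x)^2 * h x) \<partial>lborel)"
  by (subst integral_restrict_space) auto
 also have "... = (\<integral>x. indicator {x0..X} x *\<^sub>R ((warp m x)^2 * h x) \<partial>lborel)"
 proof (rule integral_cong_AE)
  have c: "continuous_on {x0..X} (%x. (warp m x)^2 * h x)"
   by (intro continuous_intros h smooth_continuous[OF smooth_warp[OF m]])
  thus "(%x. indicator {x0..X} x *\<^sub>R ((warp m x)^2 * h x)) : borel_measurable lborel"
   using borel_measurable_continuous_on_indicator[OF _ c] by simp
  show "(%x. indicator ?I x *\<^sub>R ((warp m x)^2 * h x)) : borel_measurable lborel"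
   using borel_measurable_continuous_on_indicator[OF _ continuous_on_subset[OF c], of ?I] by force
  show "AE x in lborel. indicator ?I x *\<^sub>R ((warp m x)^2 * h x) = indicator {x0..X} x *\<^sub>R ((warp m x)^2 * h x)"
   using AE_lborel_singleton[of x0] by eventually_elim (auto simp: indicator_def)
 qed
 also have "... = integral {x0..X} (%x. (warp m x)^2 * h x)"
 proof -
  have c: "continuous_on {x0..X} (%x. (warp m x)^2 * h x)"
   by (intro continuous_intros h smooth_continuous[OF smooth_warp[OF m]])
  from set_borel_integral_eq_integral(2)[OF borel_integrable_atLeastAtMost'[OF c]]
  show ?thesis by (simp add: set_lebesgue_integral_def)
 qed
 finally show "(\<integral>p. h (fst p) * K (snd p) \<partial>vol m ?I) = integral {x0..X} (%x. (warp m x)^2 * h x) * (\<integral>\<omega>. K \<omega> \<partial>sphere_measure)" .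
qed

lemma integral_volM_cut:
 fixes f :: "point => 'b::{banach,second_countable_topology}"
 assumes m: "m >= 1" and f: "!!p. p : {x0<..} \<times> S2 ==> fst p > X ==> f p = 0"
 shows "integral\<^sup>L (volM m x0) f = integral\<^sup>L (vol m {x0<..X}) f"
proof -
 have I: "{x0<..} : sets borel" "{x0<..X} : sets borel" "{x0<..X} \<subseteq> {x0<..}" by auto
 show ?thesis unfolding integral_vol_mono(1)[OF m I]
 proof (intro BI_integral_cong refl)
  fix p assume "p : space (volM m x0)"
  hence p: "p : {x0<..} \<times> S2" by simp
  show "f p = indicator ({x0<..X} \<times> S2) p *\<^sub>R f p"
   using p f[OF p] by (cases "fst p > X") (auto simp: indicator_def mem_Times_iff)
 qed
qed

section \<open>Norms of the spherical harmonic and its gradient\<close>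

definition NY :: "nat => real" where "NY n = (\<integral>\<omega>. (cmod (Yl n \<omega>))^2 \<partial>sphere_measure)"

lemma continuous_Yl: "continuous_on A (Yl n)" and continuous_SG: "continuous_on A (%\<omega>. SG n \<omega> i)"
proof -
 have z: "continuous_on A zz" for A using bl_zz by (rule linear_continuous_on)
 show "continuous_on A (Yl n)" unfolding Yl_def[abs_def] by (intro continuous_intros z)
 show "continuous_on A (%\<omega>. SG n \<omega> i)" unfolding SG_def[abs_def]
  by (intro continuous_intros z)
qed

text \<open>Green's formula for the harmonic itself, constant in \<open>x\<close>, against its product with a radial bump: no
  radial derivative survives, and the angular parts give the eigenvalue.\<close>
lemma SG_norm:
 assumes n: "n >= 1"
 shows "(\<integral>\<omega>. (\<Sum>i\<in>UNIV. (cmod (SG n \<omega> i))^2) \<partial>sphere_measure) = Lam n * NY n"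
proof -
 define x0 :: real where "x0 = 0"
 define m :: nat where "m = 1"
 have m: "m >= 1" by (simp add: m_def)
 define h where "h x = step (x - x0) * step (5 + x0 - x)" for x
 let ?g = "%x. h x * warp m x"
 have hs: "smooth h" unfolding h_def[abs_def]
  by (intro smooth_intros smooth_compose[OF smooth_step])
 have gs: "C_k k UNIV ?g" for k using smooth_intros(5)[OF hs smooth_warp[OF m]] by (rule smoothD)
 have as: "C_k k UNIV (warp m)" for k by (rule smoothD[OF smooth_warp[OF m]])
 have h0: "h x = 0" if "x \<notin> {x0 + 1..x0 + 4}" for x using that by (auto simp: h_def step_bounds)
 have xs: "xsupp x0 (mode m n 1 ?g) (x0 + 1) (x0 + 4)" using h0 by (auto simp: xsupp_def mode_def)
 let ?f = "mode m n 1 ?g" and ?Y = "mode m n 1 (warp m)"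
 let ?S = "%\<omega>. \<Sum>i\<in>UNIV. (cmod (SG n \<omega> i))^2"
 have G: "(\<integral>p. grad m ?f p \<bullet> grad m ?Y p \<partial>volM m x0) = - (\<integral>p. ?f p \<bullet> classical_laplacian m ?Y p \<partial>volM m x0)"
  by (rule green_inner[OF m C_k_ext_mode[OF m gs] C_k_ext_mode[OF m as], where r="x0+1" and s="x0+4"]) (use xs in auto)
 have e1: "grad m ?f p \<bullet> grad m ?Y p = h (fst p) / (warp m (fst p))^2 * ?S (snd p)" if "p : {x0<..} \<times> S2" for p
 proof -
  obtain x \<omega> where p: "p = (x, \<omega>)" by (cases p)
  hence \<omega>: "\<omega> : S2" using that by auto
  have 0: "dx ?Y (x, \<omega>) = 0" unfolding dx_mode[OF m adot_derivs(1)[OF m]] by simp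
  have "SG n \<omega> i \<bullet> SG n \<omega> i = (cmod (SG n \<omega> i))^2" for i by (simp add: dot_square_norm)
  moreover have "(complex_of_real (h x) * SG n \<omega> i) \<bullet> SG n \<omega> i = h x * (SG n \<omega> i \<bullet> SG n \<omega> i)" for i
   by (metis inner_scaleR_left scaleR_conv_of_real)
  ultimately show ?thesis
   using m by (simp add: grad_def p 0 sphere_grad_mode[OF \<omega> n] inner_prod_def inner_vec_def power2_eq_square
     sum_distrib_left sum_divide_distrib divide_inverse mult_ac)
 qed
 have e2: "?f p \<bullet> classical_laplacian m ?Y p = - Lam n * (h (fst p) / (warp m (fst p))^2 * (cmod (Yl n (snd p)))^2)" if "p : {x0<..} \<times> S2" for p
 proof -
  obtain x \<omega> where p: "p = (x, \<omega>)" by (cases p)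
  hence \<omega>: "\<omega> : S2" using that by auto
  have "classical_laplacian m ?Y (x, \<omega>) = mode m n 1 (%x. curv m x * warp m x - pot m n x * warp m x) (x, \<omega>)"
   using classical_laplacian_mode[OF m n \<omega> adot_derivs(1)[OF m] adot_derivs(2)[OF m], of 1 x]
   by (simp add: mode_def)
  also have "... = (- Lam n / (warp m x)^2) *\<^sub>R Yl n \<omega>"
  proof -
   have "(curv m x * warp m x - pot m n x * warp m x) / warp m x = - Lam n / (warp m x)^2"
    using m by (simp add: pot_def field_simps)
   thus ?thesis unfolding mode_def fst_conv snd_conv by (simp only: scaleR_conv_of_real mult_1_left)
  qed
  finally have "classical_laplacian m ?Y (x, \<omega>) = (- Lam n / (warp m x)^2) *\<^sub>R Yl n \<omega>" .
  moreover have "?f (x, \<omega>) = h x *\<^sub>R Yl n \<omega>" using m by (simp add: mode_def scaleR_conv_of_real)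
  ultimately show ?thesis by (simp add: p dot_square_norm)
 qed
 let ?X = "x0 + 5"
 have cut: "integral\<^sup>L (volM m x0) (%p. h (fst p) / (warp m (fst p))^2 * K (snd p)) = integral {x0..?X} h * (\<integral>\<omega>. K \<omega> \<partial>sphere_measure)"
  if K: "continuous_on S2 K" for K :: "real^3 => real"
 proof -
  have "integral\<^sup>L (volM m x0) (%p. h (fst p) / (warp m (fst p))^2 * K (snd p)) = integral\<^sup>L (vol m {x0<..?X}) (%p. h (fst p) / (warp m (fst p))^2 * K (snd p))"
   by (rule integral_volM_cut[OF m]) (simp add: h0)
  also have "... = integral {x0..?X} (%x. (warp m x)^2 * (h x / (warp m x)^2)) * (\<integral>\<omega>. K \<omega> \<partial>sphere_measure)"
   by (rule integral_product(1)[OF m _ _ K]) (use m in "auto intro!: continuous_on_divide continuous_on_power smooth_continuous[OF hs] smooth_continuous[OF smooth_warp]")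
  also have "(%x. (warp m x)^2 * (h x / (warp m x)^2)) = h" using m by auto
  finally show ?thesis .
 qed
 have "integral {x0..?X} h * (\<integral>\<omega>. ?S \<omega> \<partial>sphere_measure) = (\<integral>p. grad m ?f p \<bullet> grad m ?Y p \<partial>volM m x0)"
  by (subst cut[symmetric]) (auto intro!: continuous_intros continuous_SG BI_integral_cong simp: e1)
 also have "... = - (\<integral>p. - Lam n * (h (fst p) / (warp m (fst p))^2 * (cmod (Yl n (snd p)))^2) \<partial>volM m x0)"
  unfolding G by (intro arg_cong[where f=uminus] BI_integral_cong refl e2) simp
 also have "... = Lam n * (\<integral>p. h (fst p) / (warp m (fst p))^2 * (cmod (Yl n (snd p)))^2 \<partial>volM m x0)"
  by (simp only: BI_integral_mult_right_zero)
 also have "... = Lam n * (integral {x0..?X} h * NY n)"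
  unfolding NY_def by (subst cut[symmetric]) (auto intro!: continuous_intros continuous_Yl)
 finally have eq: "integral {x0..?X} h * (\<integral>\<omega>. ?S \<omega> \<partial>sphere_measure) = integral {x0..?X} h * (Lam n * NY n)" by simp
 have "integral {x0+2..x0+3} (%x. 1) <= integral {x0..?X} h"
 proof -
  have ic: "h integrable_on {a..b}" for a b by (intro integrable_continuous_real smooth_continuous hs)
  have "integral {x0+2..x0+3} (%x. 1) = integral {x0+2..x0+3} h"
   by (intro HK_cong) (auto simp: h_def step_bounds)
  also have "... <= integral {x0..?X} h"
   by (intro integral_subset_le ic) (auto simp: h_def step_bounds)
  finally show ?thesis .
 qed
 hence "integral {x0..?X} h > 0" by simp
 thus ?thesis using eq by simp
qed

text \<open>Otherwise the harmonic would vanish almost everywhere, but its zeros in the ball are those of \<open>zz\<close>.\<close>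
lemma NY_pos: "NY n > 0"
proof (rule ccontr)
 assume neg: "\<not> NY n > 0"
 have "NY n >= 0" by (simp add: NY_def)
 hence 0: "NY n = 0" using neg by simp
 have i: "integrable sphere_measure (%\<omega>. (cmod (Yl n \<omega>))^2)"
  by (intro sphere_integrable continuous_intros continuous_Yl)
 have "AE \<omega> in sphere_measure. (cmod (Yl n \<omega>))^2 = 0"
  using 0 integral_nonneg_eq_0_iff_AE[OF i] by (simp add: NY_def)
 hence "(\<integral>\<^sup>+\<omega>. ennreal ((cmod (Yl n \<omega>))^2) \<partial>sphere_measure) = (\<integral>\<^sup>+\<omega>. 0 \<partial>sphere_measure)"
  by (intro nn_integral_cong_AE) auto
 hence "3 * (\<integral>\<^sup>+y. ennreal ((cmod (Yl n (sgn y)))^2) * indicator Bp y \<partial>lborel) = 0"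
  by (subst nn_integral_sphere[symmetric])
    (auto intro!: measurable_compose[OF _ measurable_ennreal] borel_measurable_continuous_on_restrict continuous_intros continuous_Yl)
 hence z: "(\<integral>\<^sup>+y. ennreal ((cmod (Yl n (sgn y)))^2) * indicator Bp y \<partial>lborel) = 0" by simp
 have Ym: "Yl n : borel_measurable borel" by (intro borel_measurable_continuous_onI continuous_Yl)
 have "(%y. ennreal ((cmod (Yl n (sgn y)))^2) * indicator Bp y) : borel_measurable lborel"
  using measurable_compose[OF sgn_borel Ym] by simp
 hence "AE y in lborel. ennreal ((cmod (Yl n (sgn y)))^2) * indicator Bp y = 0"
  using z by (simp add: nn_integral_0_iff_AE)
 (* Oo is a nonempty open set on which the integrand is positive *)
 moreover define Oo where "Oo = {y. zz y ~= 0} \<inter> ball 0 1"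
 have zc: "continuous_on UNIV zz" using bl_zz by (rule linear_continuous_on)
 have "open {y. zz y ~= 0}" by (intro open_Collect_neq zc continuous_on_const)
 hence oOo: "open Oo" by (auto simp: Oo_def)
 have "AE y in lborel. y \<notin> Oo"
  using calculation
 proof eventually_elim
  case (elim y)
  show ?case
  proof
   assume y: "y : Oo"
   hence "y ~= 0" "y : Bp" using linear_0[OF bounded_linear.linear[OF bl_zz]] by (auto simp: Oo_def Bp_def)
   hence "(cmod (Yl n (sgn y)))^2 <= 0" using elim by (simp add: ennreal_eq_0_iff)
   thus False using Yl_sgn[OF \<open>y ~= 0\<close>, of n] y \<open>y ~= 0\<close> by (simp add: Oo_def)
  qed
 qed
 hence "Oo : null_sets lborel" using oOo by (subst AE_iff_null_sets) auto
 hence "negligible Oo" using null_sets_completionI negligible_iff_null_sets by blast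
 moreover have "(1/2) *\<^sub>R axis 1 1 : Oo" by (auto simp: Oo_def zz_def axis_def norm_eq_sqrt_inner inner_axis[unfolded axis_def] inner_vec_def sum3)
 ultimately show False using open_not_negligible[OF oOo] by auto
qed

text \<open>The gradient of \<open>mode m n c g\<close>, with \<open>g1\<close> the derivative of \<open>g\<close>; as an explicit
  formula it also makes sense for \<open>C^1\<close> profiles.\<close>
definition gmode :: "nat => nat => complex => (real => real) => (real => real) => point => complex \<times> (complex^3)" where
 "gmode m n c g g1 = (%p.
   (c * of_real ((g1 (fst p) * warp m (fst p) - g (fst p) * adot m (fst p)) / (warp m (fst p))^2) * Yl n (snd p),
   inverse (warp m (fst p)) *\<^sub>R (\<chi> i. c * of_real (g (fst p) / warp m (fst p)) * SG n (snd p) i)))"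

lemma grad_mode:
 assumes "m >= 1" "n >= 1" "p : I \<times> S2" "has_d g (g1 (fst p)) (fst p)"
 shows "grad m (mode m n c g) p = gmode m n c g g1 p"
 using assms by (cases p) (auto simp: grad_def gmode_def dx_mode sphere_grad_mode)

lemma gmode_diff: "gmode m n c g g1 p - gmode m n c k k1 p = gmode m n c (%x. g x - k x) (%x. g1 x - k1 x) p"
proof -
 have 1: "((g1 x - k1 x) * a - (g x - k x) * d) / b = (g1 x * a - g x * d) / b - (k1 x * a - k x * d) / b" for x a d b
  by (simp add: algebra_simps diff_divide_distrib add_divide_distrib)
 have 2: "(g x - k x) / a = g x / a - k x / a" for x a by (rule diff_divide_distrib)
 show ?thesis unfolding gmode_def 1 2 of_real_diff by (simp add: vec_eq_iff algebra_simps)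
qed

lemma mode_diff: "mode m n c g p - mode m n c k p = mode m n c (%x. g x - k x) p"
 by (simp add: mode_def algebra_simps diff_divide_distrib)

lemma gmode_bound:
 assumes m: "m >= 1"
 obtains C where "C > 0" "!!p g g1. p : {x0..X} \<times> S2 ==> norm (gmode m n c g g1 p) <= C * (\<bar>g (fst p)\<bar> + \<bar>g1 (fst p)\<bar>)"
  "!!p g. p : {x0..X} \<times> S2 ==> norm (mode m n c g p) <= C * \<bar>g (fst p)\<bar>"
proof -
 have "continuous_on {x0..X} (adot m)"
  by (intro continuous_at_imp_continuous_on ballI DERIV_isCont[OF adot_derivs(2)[OF m]])
 then obtain A where A: "A > 0" "\<forall>x\<in>{x0..X}. norm (adot m x) <= A" by (rule compact_continuous_bound[OF compact_Icc])
 obtain B where B: "B > 0" "\<forall>\<omega>\<in>S2. norm (Yl n \<omega>) <= B" by (rule compact_continuous_bound[OF compact_sphere continuous_Yl])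
 have "continuous_on S2 (%\<omega>. \<Sum>i\<in>UNIV. norm (SG n \<omega> i))" by (intro continuous_intros continuous_SG)
 then obtain D where D: "D > 0" "\<forall>\<omega>\<in>S2. norm (\<Sum>i\<in>UNIV. norm (SG n \<omega> i)) <= D" by (rule compact_continuous_bound[OF compact_sphere])
 let ?C = "cmod c * ((1 + A) * B + D + B) + 1"
 show ?thesis
 proof (rule that[of ?C])
  show "?C > 0" using A B D by (intro add_nonneg_pos mult_nonneg_nonneg) auto
  fix p g g1 assume p: "p : {x0..X} \<times> S2"
  let ?x = "fst p" and ?w = "snd p" let ?a = "warp m ?x"
  have a1: "?a >= 1" by (rule warp_ge1[OF m])
  hence a0: "?a > 0" by linarith
  have Ax: "\<bar>adot m ?x\<bar> <= A" and Bx: "cmod (Yl n ?w) <= B" and Dx: "(\<Sum>i\<in>UNIV. norm (SG n ?w i)) <= D"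
  proof -
   have "norm (\<Sum>i\<in>UNIV. norm (SG n ?w i)) <= D" using D(2) p by (auto simp only: mem_Times_iff)
   thus "(\<Sum>i\<in>UNIV. norm (SG n ?w i)) <= D" by (simp only: real_norm_def abs_le_iff)
  qed (use A(2) B(2) p in "auto simp: mem_Times_iff")
  have r1: "\<bar>(g1 ?x * ?a - g ?x * adot m ?x) / ?a^2\<bar> <= (1 + A) * (\<bar>g ?x\<bar> + \<bar>g1 ?x\<bar>)"
  proof -
   have "\<bar>(g1 ?x * ?a - g ?x * adot m ?x) / ?a^2\<bar> <= (\<bar>g1 ?x\<bar> * ?a + \<bar>g ?x\<bar> * \<bar>adot m ?x\<bar>) / ?a^2"
    using a0 abs_triangle_ineq4[of "g1 ?x * ?a" "g ?x * adot m ?x"] by (simp add: abs_mult divide_right_mono)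
   also have "... <= (\<bar>g1 ?x\<bar> * ?a^2 + \<bar>g ?x\<bar> * A * ?a^2) / ?a^2"
   proof (intro divide_right_mono add_mono)
    show "\<bar>g1 ?x\<bar> * ?a <= \<bar>g1 ?x\<bar> * ?a^2" using a1 by (intro mult_left_mono) (auto simp: power2_eq_square)
    have "\<bar>g ?x\<bar> * \<bar>adot m ?x\<bar> * 1 <= \<bar>g ?x\<bar> * A * ?a^2"
     using a1 Ax A(1) by (intro mult_mono mult_left_mono) auto
    thus "\<bar>g ?x\<bar> * \<bar>adot m ?x\<bar> <= \<bar>g ?x\<bar> * A * ?a^2" by simp
   qed simp
   also have "... = \<bar>g1 ?x\<bar> + A * \<bar>g ?x\<bar>" using a0 by (simp add: field_simps)
   also have "... <= (1 + A) * (\<bar>g ?x\<bar> + \<bar>g1 ?x\<bar>)" using A(1) by (simp add: algebra_simps)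
   finally show ?thesis .
  qed
  have r2: "\<bar>g ?x / ?a\<bar> <= \<bar>g ?x\<bar>" using a1 a0 mult_left_mono[OF a1, of "\<bar>g ?x\<bar>"] by (simp add: divide_le_eq)
  let ?F = "fst (gmode m n c g g1 p)" and ?S = "snd (gmode m n c g g1 p)"
  have F: "norm ?F <= cmod c * ((1 + A) * (\<bar>g ?x\<bar> + \<bar>g1 ?x\<bar>)) * B"
   unfolding gmode_def fst_conv norm_mult norm_of_real using r1 Bx A(1) by (intro mult_mono mult_left_mono mult_nonneg_nonneg) auto
  have "norm ?S = inverse ?a * norm (\<chi> i. c * of_real (g ?x / ?a) * SG n ?w i)"
   using a0 by (simp add: gmode_def)
  also have "... <= 1 * (\<Sum>i\<in>UNIV. norm (c * of_real (g ?x / ?a) * SG n ?w i))"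
  proof (intro mult_mono)
   show "inverse ?a <= 1" using a1 by (simp add: inverse_le_1_iff)
   show "norm (\<chi> i. c * of_real (g ?x / ?a) * SG n ?w i) <= (\<Sum>i\<in>UNIV. norm (c * of_real (g ?x / ?a) * SG n ?w i))"
    unfolding norm_vec_def by (rule order_trans[OF L2_set_le_sum]) auto
  qed auto
  also have "... = cmod c * \<bar>g ?x / ?a\<bar> * (\<Sum>i\<in>UNIV. norm (SG n ?w i))"
   by (simp only: norm_mult norm_of_real sum_distrib_left mult_1)
  also have "... <= cmod c * \<bar>g ?x\<bar> * D"
   using r2 Dx by (intro mult_mono) (auto intro: sum_nonneg)
  finally have S: "norm ?S <= cmod c * \<bar>g ?x\<bar> * D" .
  have "norm (gmode m n c g g1 p) <= norm ?F + norm ?S"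
   by (metis norm_Pair_le prod.collapse)
  also have "... <= cmod c * ((1 + A) * (\<bar>g ?x\<bar> + \<bar>g1 ?x\<bar>)) * B + cmod c * (\<bar>g ?x\<bar> + \<bar>g1 ?x\<bar>) * D"
  proof (intro add_mono F order_trans[OF S])
   show "cmod c * \<bar>g ?x\<bar> * D <= cmod c * (\<bar>g ?x\<bar> + \<bar>g1 ?x\<bar>) * D"
    using D(1) by (intro mult_right_mono mult_left_mono) auto
  qed
  also have "... = cmod c * ((1 + A) * B + D) * (\<bar>g ?x\<bar> + \<bar>g1 ?x\<bar>)" by (simp add: algebra_simps)
  also have "... <= ?C * (\<bar>g ?x\<bar> + \<bar>g1 ?x\<bar>)"
   using B(1) by (intro mult_right_mono) (auto simp: algebra_simps intro!: add_nonneg_nonneg mult_nonneg_nonneg)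
  finally show "norm (gmode m n c g g1 p) <= ?C * (\<bar>g ?x\<bar> + \<bar>g1 ?x\<bar>)" .
  have "norm (mode m n c g p) <= cmod c * \<bar>g ?x\<bar> * B"
   unfolding mode_def norm_mult norm_of_real using r2 Bx by (intro mult_mono) auto
  also have "... = cmod c * B * \<bar>g ?x\<bar>" by simp
  also have "... <= ?C * \<bar>g ?x\<bar>"
   using A(1) B(1) D(1) by (intro mult_right_mono) (auto simp: algebra_simps intro!: add_nonneg_nonneg mult_nonneg_nonneg)
  finally show "norm (mode m n c g p) <= ?C * \<bar>g ?x\<bar>" .
 qed
qed

lemma continuous_mode_M:
 assumes m: "m >= 1" and g: "continuous_on UNIV g"
 shows "continuous_on A (mode m n c g)"
proof -
 have w: "continuous_on A (%p::point. warp m (fst p))"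
  by (intro continuous_on_compose2[OF smooth_continuous[OF smooth_warp[OF m], of UNIV]] continuous_intros) auto
 have gc: "continuous_on A (%p::point. g (fst p))"
  by (intro continuous_on_compose2[OF g] continuous_intros) auto
 have y: "continuous_on A (%p::point. Yl n (snd p))"
  by (intro continuous_on_compose2[OF continuous_Yl[of UNIV]] continuous_intros) auto
 show ?thesis unfolding mode_def using m by (intro continuous_intros w gc y) auto
qed

lemma continuous_gmode_M:
 assumes m: "m >= 1" and g: "continuous_on UNIV g" "continuous_on UNIV g1"
 shows "continuous_on A (gmode m n c g g1)"
proof -
 have w: "continuous_on A (%p::point. warp m (fst p))"
  by (intro continuous_on_compose2[OF smooth_continuous[OF smooth_warp[OF m], of UNIV]] continuous_intros) auto
 have "continuous_on UNIV (adot m)"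
  by (intro continuous_at_imp_continuous_on ballI DERIV_isCont[OF adot_derivs(2)[OF m]])
 hence ad: "continuous_on A (%p::point. adot m (fst p))"
  by (rule continuous_on_compose2[OF _ continuous_on_fst[OF continuous_on_id]]) simp
 have gc: "continuous_on A (%p::point. g (fst p))" "continuous_on A (%p::point. g1 (fst p))"
  by (intro continuous_on_compose2[OF g(1)] continuous_on_compose2[OF g(2)] continuous_intros; auto)+
 have y: "continuous_on A (%p::point. Yl n (snd p))" "continuous_on A (%p::point. SG n (snd p) i)" for i
  by (intro continuous_on_compose2[OF continuous_Yl[of UNIV]] continuous_on_compose2[OF continuous_SG[of UNIV]] continuous_intros; auto)+
 show ?thesis unfolding gmode_def using m by (intro continuous_intros w ad gc y continuous_on_vec_lambda) auto
qed

lemma in_L2_bounded: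
 fixes h :: "point => 'b::{banach,second_countable_topology}"
 assumes m: "m >= 1" and h: "h : borel_measurable (volM m x0)"
  and b: "!!p. p : {x0<..} \<times> S2 ==> norm (h p) <= C"
  and z: "!!p. p : {x0<..} \<times> S2 ==> fst p > X ==> h p = 0"
 shows "in_L2 (volM m x0) h"
proof -
 have "integrable (volM m x0) (%p. (norm (h p))^2)"
  by (rule integrable_vol_bounded[OF m, of _ _ "C^2" X]) (use h b z in "auto intro!: power_mono")
 thus ?thesis using h by (simp add: in_L2_def)
qed

lemma L2_dominated:
 fixes F :: "nat => point => 'b::{banach,second_countable_topology}"
 assumes m: "m >= 1" and h: "!!n. F n : borel_measurable (volM m x0)" "G : borel_measurable (volM m x0)"
  and b: "!!p n. p : {x0<..} \<times> S2 ==> norm (F n p - G p) <= C"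
  and z: "!!p n. p : {x0<..} \<times> S2 ==> fst p > X ==> F n p - G p = 0"
  and l: "!!p. p : {x0<..} \<times> S2 ==> (%n. F n p) \<longlonglongrightarrow> G p"
 shows "(%n. L2_norm (volM m x0) (%p. F n p - G p)) \<longlonglongrightarrow> 0"
proof -
 let ?w = "%p. indicator ({x0<..X} \<times> S2) p * C^2"
 have s: "{x0<..X} \<times> S2 : sets (volM m x0)" by (rule Times_S2_vol) auto
 have "(%n. \<integral>p. (norm (F n p - G p))^2 \<partial>volM m x0) \<longlonglongrightarrow> (\<integral>p. 0 \<partial>volM m x0)"
 proof (rule integral_dominated_convergence[where w="?w"])
  show "integrable (volM m x0) ?w"
   by (rule integrable_vol_bounded[OF m, of _ _ "C^2" X]) (use s in "auto simp: indicator_def")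
  show "AE p in volM m x0. (%n. (norm (F n p - G p))^2) \<longlonglongrightarrow> 0"
  proof (rule AE_I2)
   fix p assume "p : space (volM m x0)"
   hence "p : {x0<..} \<times> S2" by simp
   from tendsto_power[OF tendsto_norm[OF LIM_zero[OF l[OF this]]], of 2]
   show "(%n. (norm (F n p - G p))^2) \<longlonglongrightarrow> 0" by simp
  qed
  show "AE p in volM m x0. norm ((norm (F n p - G p))^2) <= ?w p" for n
  proof (rule AE_I2)
   fix p assume "p : space (volM m x0)"
   hence p: "p : {x0<..} \<times> S2" by simp
   show "norm ((norm (F n p - G p))^2) <= ?w p"
   proof (cases "fst p > X")
    case True thus ?thesis using z[OF p True] by simp
   next
    case False
    hence "p : {x0<..X} \<times> S2" using p by (auto simp: mem_Times_iff)
    thus ?thesis using power_mono[OF b[OF p, of n], of 2] by simp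
   qed
  qed
 qed (use h in auto)
 hence "(%n. sqrt (\<integral>p. (norm (F n p - G p))^2 \<partial>volM m x0)) \<longlonglongrightarrow> sqrt 0"
  by (intro tendsto_real_sqrt) simp
 thus ?thesis by (simp add: L2_norm_def)
qed

lemma has_laplacian_mode:
 assumes m: "m >= 1" and n: "n >= 1"
  and g: "!!x. has_d g (g1 x) x" "!!x. has_d g1 (g2 x) x" "continuous_on UNIV g2"
  and X: "!!x. x > X ==> g x = 0"
 shows "has_laplacian m x0 (mode m n c g) (mode m n c (%x. g2 x - pot m n x * g x))"
proof -
 have g1X: "g1 x = 0" "g2 x = 0" if "x > X" for x
 proof -
  have 1: "g1 x = 0" if "x > X" for x
  proof -
   have "has_d (%_. 0) (g1 x) x"
    by (rule has_field_derivative_transform_within_open[OF g(1), of "{X<..}"]) (use that X in auto)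
   thus ?thesis using DERIV_unique DERIV_const by blast
  qed
  have "has_d (%_. 0) (g2 x) x"
   by (rule has_field_derivative_transform_within_open[OF g(2), of "{X<..}"]) (use that 1 in auto)
  thus "g2 x = 0" using DERIV_unique DERIV_const by blast
  show "g1 x = 0" by (rule 1[OF that])
 qed
 have cg: "continuous_on UNIV g" by (intro continuous_at_imp_continuous_on ballI DERIV_isCont[OF g(1)])
 have potc: "continuous_on UNIV (pot m n)"
  unfolding pot_def curv_def using m by (intro continuous_intros smooth_continuous[OF smooth_warp]) auto
 have G2: "C_k (Suc (Suc 0)) UNIV g"
 proof (rule C_k_real_Suc[where f'=g1])
  show "C_k (Suc 0) UNIV g1"
   by (rule C_k_real_Suc[where f'=g2]) (use g in "auto simp: has_real_derivative_iff_has_vector_derivative")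
 qed (use g in "auto simp: has_real_derivative_iff_has_vector_derivative")
 let ?u = "mode m n c g" and ?f = "mode m n c (%x. g2 x - pot m n x * g x)"
 have cf: "continuous_on A ?f" for A
  by (intro continuous_mode_M[OF m] continuous_intros g(3) potc cg)
 have fL: "in_L2 (volM m x0) ?f"
 proof -
  obtain C where C: "C > 0" "\<forall>p\<in>{x0..X} \<times> S2. norm (?f p) <= C"
   by (rule compact_continuous_bound[OF compact_Times[OF compact_Icc compact_sphere] cf])
  show ?thesis
  proof (rule in_L2_bounded[OF m continuous_measurable_vol[OF cf]])
   show z: "?f p = 0" if "fst p > X" for p using that X g1X by (simp add: mode_def)
   show "norm (?f p) <= C" if "p : {x0<..} \<times> S2" for p
   proof (cases "fst p > X")
    case False
    hence "p : {x0..X} \<times> S2" using that by (auto simp: mem_Times_iff)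
    thus ?thesis using C(2) by blast
   qed (use z C(1) in simp)
  qed
 qed
 moreover have "(\<integral>p. ?u p * classical_laplacian m \<phi> p \<partial>volM m x0) = (\<integral>p. ?f p * \<phi> p \<partial>volM m x0)" if t: "test_fun x0 \<phi>" for \<phi>
 proof -
  obtain r s where r: "x0 < r" "xsupp x0 \<phi> r s" by (rule test_fun_xsupp[OF t])
  note F = test_fun_C_k[OF t]
  note U = C_k_ext_mode[OF m G2, of x0 n c]
  have "(\<integral>p. ?u p * classical_laplacian m \<phi> p \<partial>volM m x0) = (\<integral>p. \<phi> p * classical_laplacian m ?u p \<partial>volM m x0)"
   using green(3)[OF m bounded_bilinear_mult C_k_SucD[OF U] F r(1) disjI2[OF r(2)]] green(3)[OF m bounded_bilinear_mult C_k_SucD[OF F] U r(1) disjI1[OF r(2)]]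
   by (simp add: mult.commute)
  also have "... = (\<integral>p. ?f p * \<phi> p \<partial>volM m x0)"
  proof (intro BI_integral_cong refl)
   fix p assume "p : space (volM m x0)"
   hence "snd p : S2" by auto
   from classical_laplacian_mode[OF m n this g(1) g(2), of c "fst p"]
   have "classical_laplacian m ?u p = ?f p" by (simp add: mode_def)
   thus "\<phi> p * classical_laplacian m ?u p = ?f p * \<phi> p" by simp
  qed
  finally show ?thesis .
 qed
 ultimately show ?thesis by (simp add: has_laplacian_def)
qed

section \<open>Weak gradients of modes\<close>

lemma polynomial_antiderivative:
 assumes "real_polynomial_function P"
 obtains Q where "smooth Q" "ALL x. has_d Q (P x) x" "Q x0 = 0"
proof -
 from assms obtain a N where P: "P = (%x. \<Sum>i\<le>N. a i * x ^ i)"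
  unfolding real_polynomial_function_iff_sum by blast
 define R where "R x = (\<Sum>i\<le>N. a i / real (Suc i) * x ^ Suc i)" for x
 have R: "has_d R (P x) x" for x
  unfolding R_def[abs_def] P by (rule derivative_eq_intros refl)+ (auto intro!: sum.cong)
 have sR: "smooth R" unfolding smooth_def R_def[abs_def]
  by (intro allI C_k_sum C_k_mult C_k_const C_k_power C_k_bounded_linear bounded_linear_ident)
 show ?thesis
 proof (rule that[of "%x. R x - R x0"])
  show "smooth (%x. R x - R x0)" by (intro smooth_intros sR)
  show "ALL x. has_d (%x. R x - R x0) (P x) x"
   using DERIV_diff[OF R DERIV_const] by simp
 qed simp
qed

lemma in_L2_vanishing:
 fixes f :: "point => 'b::{banach,second_countable_topology}"
 assumes m: "m >= 1" and f: "continuous_on UNIV f" "!!p. fst p > X ==> f p = 0"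
 shows "in_L2 (volM m x0) f"
proof -
 have "compact ({x0..X} \<times> S2)" by (intro compact_Times) auto
 then obtain B where B: "B > 0" "\<forall>p\<in>{x0..X} \<times> S2. norm (f p) <= B"
  using compact_continuous_bound[OF _ continuous_on_subset[OF f(1) subset_UNIV]] by metis
 show ?thesis
 proof (rule in_L2_bounded[OF m continuous_measurable_vol[OF continuous_on_subset[OF f(1) subset_UNIV]] _ f(2)])
  show "norm (f p) <= B" if "p : {x0<..} \<times> S2" for p
   using B f(2)[of p] that by (cases p, cases "fst p > X") auto
 qed
qed

text \<open>Test functions that approximate a profile which is only \<open>C^1\<close> and vanishes at \<open>x0\<close>:
  approximate \<open>g1\<close> uniformly by polynomials, integrate from \<open>x0\<close>, and cut off near
  \<open>x0\<close> and beyond \<open>X\<close>.  The cutoff near \<open>x0\<close> has derivative of size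
  \<open>N\<close> on a set of width \<open>2 / N\<close> where the profile is \<open>O(1 / N)\<close>; so the
  derivatives stay bounded, and dominated convergence applies.\<close>
lemma has_grad_mode:
 assumes m: "m >= 1" and n: "n >= 1"
  and g: "!!x. has_d g (g1 x) x" "continuous_on UNIV g1"
  and X: "x0 < X" "!!x. x > X ==> g x = 0" and g0: "g x0 = 0"
 shows "has_grad m x0 (mode m n c g) (gmode m n c g g1)"
proof -
 have g1X: "g1 x = 0" if "x > X" for x
  by (rule DERIV_const_on_open[where S="{X<..}" and c=0, OF g(1)]) (use that X in auto)
 have cg: "continuous_on UNIV g" by (intro continuous_at_imp_continuous_on ballI DERIV_isCont[OF g(1)])
 let ?Y = "X + 1"
 have ex: "EX P Q. smooth Q & (ALL x. has_d Q (P x) x) & Q x0 = 0 & (\<forall>x\<in>{x0..?Y}. \<bar>g1 x - P x\<bar> < 1 / real (Suc N))" for N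
 proof -
  have "EX P. real_polynomial_function P & (\<forall>x\<in>{x0..?Y}. \<bar>g1 x - P x\<bar> < 1 / real (Suc N))"
   using Stone_Weierstrass_real_polynomial_function[OF compact_Icc continuous_on_subset[OF g(2) subset_UNIV], of "1 / real (Suc N)" x0 ?Y]
   by (metis of_nat_0_less_iff zero_less_Suc zero_less_divide_1_iff)
  then obtain P where P: "real_polynomial_function P" "\<forall>x\<in>{x0..?Y}. \<bar>g1 x - P x\<bar> < 1 / real (Suc N)" by blast
  obtain Q where "smooth Q" "ALL x. has_d Q (P x) x" "Q x0 = 0"
   by (rule polynomial_antiderivative[OF P(1), of x0])
  thus ?thesis using P(2) by blast
 qed
 then obtain P Q where Q: "!!N. smooth (Q N)" "!!N x. has_d (Q N) (P N x) x" "!!N. Q N x0 = 0"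
  and P: "!!N x. x : {x0..?Y} ==> \<bar>g1 x - P N x\<bar> < 1 / real (Suc N)" by metis
 have Qg: "\<bar>g x - Q N x\<bar> <= (x - x0) / real (Suc N)" if x: "x : {x0..?Y}" for x N
 proof -
  have "norm ((g x - Q N x) - (g x0 - Q N x0)) <= 1 / real (Suc N) * norm (x - x0)"
  proof (rule field_differentiable_bound[of "{x0..?Y}" "%x. g x - Q N x" "%x. g1 x - P N x"])
   show "((%x. g x - Q N x) has_field_derivative g1 z - P N z) (at z within {x0..?Y})" for z
    by (intro DERIV_subset[OF DERIV_diff[OF g(1) Q(2)]]) simp
   show "norm (g1 z - P N z) <= 1 / real (Suc N)" if "z : {x0..?Y}" for z
    using P[OF that, of N] by simp
  qed (use x X in auto)
  thus ?thesis using g0 Q(3) x by simp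
 qed
 obtain B where B: "B > 0" "\<forall>x\<in>{x0..?Y}. norm (g1 x) <= B"
  by (rule compact_continuous_bound[OF compact_Icc continuous_on_subset[OF g(2)]]) auto
 obtain D where D: "D > 0" "ALL x. \<bar>deriv step x\<bar> <= D" using deriv_step_bounded by blast
 have PB: "\<bar>P N x\<bar> <= B + 1" if "x : {x0..?Y}" for x N
 proof -
  have "\<bar>P N x\<bar> <= \<bar>g1 x\<bar> + \<bar>g1 x - P N x\<bar>" by linarith
  moreover have "1 / real (Suc N) <= 1" by simp
  moreover have "\<bar>g1 x\<bar> <= B" using B(2)[rule_format, OF that] by simp
  ultimately show ?thesis using P[OF that, of N] by linarith
 qed
 have QB: "\<bar>Q N x\<bar> <= (B + 1) * (x - x0)" if x: "x : {x0..?Y}" for x N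
 proof -
  have "norm (Q N x - Q N x0) <= (B + 1) * norm (x - x0)"
  proof (rule field_differentiable_bound[of "{x0..?Y}" "Q N" "P N"])
   show "(Q N has_field_derivative P N z) (at z within {x0..?Y})" for z
    by (rule DERIV_subset[OF Q(2)]) simp
   show "norm (P N z) <= B + 1" if "z : {x0..?Y}" for z using PB[OF that] by simp
  qed (use x X in auto)
  thus ?thesis using Q(3) x by simp
 qed
 let ?s = "%N x. step (real (Suc N) * (x - x0))" and ?c = "%x. step (?Y + 1 - x)"
 define k where "k N x = ?s N x * (?c x * Q N x)" for N x
 define k1 where "k1 N x = real (Suc N) * deriv step (real (Suc N) * (x - x0)) * (?c x * Q N x)
   + ?s N x * (- deriv step (?Y + 1 - x) * Q N x + ?c x * P N x)" for N x
 have ks: "smooth (k N)" for N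
  unfolding k_def[abs_def] by (intro smooth_intros smooth_compose[OF smooth_step] Q)
 have kd: "has_d (k N) (k1 N x) x" for N x
 proof -
  have 1: "has_d (%x. ?s N x) (deriv step (real (Suc N) * (x - x0)) * real (Suc N)) x"
   by (rule DERIV_chain2[OF smooth_deriv(1)[OF smooth_step]]) (auto intro!: derivative_eq_intros)
  have 2: "has_d (%x. ?c x) (deriv step (?Y + 1 - x) * (-1)) x"
   by (rule DERIV_chain2[OF smooth_deriv(1)[OF smooth_step]]) (auto intro!: derivative_eq_intros)
  show ?thesis unfolding k_def[abs_def] k1_def
   by (rule DERIV_cong[OF DERIV_mult[OF 1 DERIV_mult[OF 2 Q(2)]]]) (simp add: algebra_simps)
 qed
 have k1c: "continuous_on UNIV (k1 N)" for N
 proof -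
  have "k1 N = deriv (k N)" using kd by (intro ext) (metis DERIV_imp_deriv)
  thus ?thesis using smooth_continuous[OF smooth_deriv(2)[OF ks]] by simp
 qed
 have kz: "k N x = 0" "k1 N x = 0" if "x > ?Y" for N x
  using that by (auto simp: k_def k1_def step_bounds deriv_step_zero)
 have kz0: "k N x = 0" if "x \<notin> {x0 + 1 / real (Suc N) .. ?Y}" for N x
 proof (cases "x > ?Y")
  case False
  hence "x < x0 + 1 / real (Suc N)" using that by auto
  hence "real (Suc N) * (x - x0) <= 1" by (simp add: field_simps)
  thus ?thesis by (simp add: k_def step_bounds)
 qed (rule kz)
 define M where "M = (B + 1) * (?Y - x0)"
 have M0: "M >= 0" using B(1) X by (simp add: M_def)
 have QM: "\<bar>Q N x\<bar> <= M" if "x : {x0..?Y}" for N x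
 proof -
  have "(B + 1) * (x - x0) <= M" unfolding M_def using that B(1) by (intro mult_left_mono) auto
  thus ?thesis using QB[OF that, of N] by linarith
 qed
 have kB: "\<bar>k N x\<bar> <= M" if "x >= x0" for N x
 proof (cases "x > ?Y")
  case False
  have "\<bar>k N x\<bar> = ?s N x * (?c x * \<bar>Q N x\<bar>)" by (simp add: k_def abs_mult step_bounds)
  also have "... <= 1 * (1 * M)"
   using False that M0 by (intro mult_mono QM) (auto simp: step_bounds)
  finally show ?thesis by simp
 qed (use kz M0 in auto)
 define M1 where "M1 = 2 * D * (B + 1) + (D * M + (B + 1))"
 have k1B: "\<bar>k1 N x\<bar> <= M1" if x: "x >= x0" for N x
 proof (cases "x > ?Y")
  case True
  thus ?thesis using kz(2) B D M0 by (simp add: M1_def)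
 next
  case False
  hence xI: "x : {x0..?Y}" using x by auto
  have "\<bar>real (Suc N) * deriv step (real (Suc N) * (x - x0)) * (?c x * Q N x)\<bar> <= 2 * D * (B + 1)"
  proof (cases "real (Suc N) * (x - x0) >= 2")
   case True
   thus ?thesis using deriv_step_zero(2)[OF True] D B by simp
  next
   case False
   have "\<bar>real (Suc N) * deriv step (real (Suc N) * (x - x0)) * (?c x * Q N x)\<bar>
    = \<bar>deriv step (real (Suc N) * (x - x0))\<bar> * (?c x * (real (Suc N) * \<bar>Q N x\<bar>))"
    by (simp add: abs_mult step_bounds)
   also have "... <= D * (1 * (real (Suc N) * ((B + 1) * (x - x0))))"
    using D QB[OF xI, of N] B(1) x by (intro mult_mono mult_left_mono) (auto simp: step_bounds)
   also have "... = D * (B + 1) * (real (Suc N) * (x - x0))" by simp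
   also have "... <= D * (B + 1) * 2" using False D B by (intro mult_left_mono) auto
   finally show ?thesis by simp
  qed
  moreover have "\<bar>?s N x * (- deriv step (?Y + 1 - x) * Q N x + ?c x * P N x)\<bar> <= 1 * (D * M + 1 * (B + 1))"
   unfolding abs_mult
  proof (intro mult_mono)
   have "\<bar>- deriv step (?Y + 1 - x) * Q N x + ?c x * P N x\<bar> <= \<bar>deriv step (?Y + 1 - x)\<bar> * \<bar>Q N x\<bar> + ?c x * \<bar>P N x\<bar>"
    using abs_triangle_ineq[of "- deriv step (?Y + 1 - x) * Q N x" "?c x * P N x"] by (simp add: abs_mult step_bounds)
   also have "... <= D * M + 1 * (B + 1)"
    using D QM[OF xI] PB[OF xI] M0 B by (intro add_mono mult_mono) (auto simp: step_bounds)
   finally show "\<bar>- deriv step (?Y + 1 - x) * Q N x + ?c x * P N x\<bar> <= D * M + 1 * (B + 1)" .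
  qed (auto simp: step_bounds)
  ultimately show ?thesis unfolding k1_def M1_def mult_1_left
   by (intro order_trans[OF abs_triangle_ineq] add_mono)
 qed
 have lim: "(%N. k N x) \<longlonglongrightarrow> g x" "(%N. k1 N x) \<longlonglongrightarrow> g1 x" if x: "x > x0" for x
 proof -
   consider "x > ?Y" | "x : {x0..?Y}" using x by fastforce
   hence "(%N. k N x) \<longlonglongrightarrow> g x & (%N. k1 N x) \<longlonglongrightarrow> g1 x"
   proof cases
    case 1
    thus ?thesis using kz X(2) g1X by simp
   next
    case 2
    have inv: "(%N. c / real (Suc N)) \<longlonglongrightarrow> 0" for c :: real
     by (rule LIMSEQ_Suc[OF lim_const_over_n])
    have QL: "(%N. Q N x) \<longlonglongrightarrow> g x"
    proof -
     have "(%N. g x - Q N x) \<longlonglongrightarrow> 0"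
      by (rule Lim_null_comparison[OF always_eventually inv[of "x - x0"]]) (use Qg[OF 2] in simp)
     from tendsto_diff[OF tendsto_const[of "g x"] this] show ?thesis by simp
    qed
    have PL: "(%N. P N x) \<longlonglongrightarrow> g1 x"
    proof -
     have "(%N. g1 x - P N x) \<longlonglongrightarrow> 0"
      by (rule Lim_null_comparison[OF always_eventually inv[of 1]]) (use P[OF 2] in "auto intro: less_imp_le")
     from tendsto_diff[OF tendsto_const[of "g1 x"] this] show ?thesis by simp
    qed
    obtain N0 :: nat where N0: "2 / (x - x0) < real N0" using reals_Archimedean2 by blast
    have big: "real (Suc N) * (x - x0) >= 2" if "N >= N0" for N
    proof -
     have "2 / (x - x0) < real (Suc N)" using N0 that by linarith
     thus ?thesis using x by (simp add: field_simps)
    qed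
    have ev: "\<forall>\<^sub>F N in sequentially. k N x = ?c x * Q N x"
     "\<forall>\<^sub>F N in sequentially. k1 N x = - deriv step (?Y + 1 - x) * Q N x + ?c x * P N x"
     unfolding eventually_sequentially using big
     by (auto simp: k_def k1_def step_bounds deriv_step_zero intro!: exI[of _ N0])
    have l1: "(%N. ?c x * Q N x) \<longlonglongrightarrow> ?c x * g x"
     "(%N. - deriv step (?Y + 1 - x) * Q N x + ?c x * P N x) \<longlonglongrightarrow> - deriv step (?Y + 1 - x) * g x + ?c x * g1 x"
     by (intro tendsto_intros QL PL)+
    have e: "?c x * g x = g x" "- deriv step (?Y + 1 - x) * g x + ?c x * g1 x = g1 x"
     using X(2)[of x] g1X[of x] by (cases "x > X"; auto simp: step_bounds deriv_step_zero)+
    show ?thesis using l1 ev unfolding e by (auto intro: tendsto_cong[THEN iffD2])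
   qed
   thus "(%N. k N x) \<longlonglongrightarrow> g x" "(%N. k1 N x) \<longlonglongrightarrow> g1 x" by auto
 qed
 define \<phi> where "\<phi> N = mode m n c (k N)" for N
 have t: "test_fun x0 (\<phi> N)" for N
 proof (rule test_funI)
  show "C_k j UNIV (\<phi> N)" for j unfolding \<phi>_def by (rule C_k_mode[OF m smoothD[OF ks]])
  show "x0 < x0 + 1 / real (Suc N)" by simp
  show "\<phi> N (x, \<omega>) = 0" if "x \<notin> {x0 + 1 / real (Suc N) .. ?Y}" for x \<omega>
   using kz0[OF that] by (simp add: \<phi>_def mode_def)
 qed
 have gr: "grad m (\<phi> N) p = gmode m n c (k N) (k1 N) p" if "p : {x0<..} \<times> S2" for N p
  unfolding \<phi>_def using grad_mode[OF m n that, of "k N" "k1 N" c] kd by simp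
 obtain C where C: "C > 0" "!!p g g1. p : {x0..?Y} \<times> S2 ==> norm (gmode m n c g g1 p) <= C * (\<bar>g (fst p)\<bar> + \<bar>g1 (fst p)\<bar>)"
  "!!p g. p : {x0..?Y} \<times> S2 ==> norm (mode m n c g p) <= C * \<bar>g (fst p)\<bar>" using gmode_bound[OF m] by metis
 obtain Bg where Bg: "Bg > 0" "\<forall>x\<in>{x0..?Y}. norm (g x) <= Bg"
  by (rule compact_continuous_bound[OF compact_Icc continuous_on_subset[OF cg]]) auto
 have mg: "mode m n c g : borel_measurable (volM m x0)" "gmode m n c g g1 : borel_measurable (volM m x0)"
  by (intro continuous_measurable_vol continuous_mode_M continuous_gmode_M m cg g(2))+
 have mz: "mode m n c h p = 0" if "h (fst p) = 0" for h p using that by (simp add: mode_def)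
 have gz: "gmode m n c h h1 p = 0" if "h (fst p) = 0" "h1 (fst p) = 0" for h h1 p
  using that by (simp add: gmode_def zero_prod_def vec_eq_iff)
 have slab: "p : {x0..?Y} \<times> S2" if "p : {x0<..} \<times> S2" "\<not> fst p > ?Y" for p
  using that by (auto simp: mem_Times_iff)
 have L2f: "in_L2 (volM m x0) (mode m n c g)"
  by (rule in_L2_vanishing[OF m continuous_mode_M[OF m cg], where X=X]) (use X(2) in "auto intro!: mz")
 have L2G: "in_L2 (volM m x0) (gmode m n c g g1)"
  by (rule in_L2_vanishing[OF m continuous_gmode_M[OF m cg g(2)], where X=X]) (use X(2) g1X in "auto intro!: gz")
 have lim1: "(%N. L2_norm (volM m x0) (%p. \<phi> N p - mode m n c g p)) \<longlonglongrightarrow> 0"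
 proof (rule L2_dominated[OF m _ mg(1), of _ "C * (M + Bg)" ?Y])
  show "\<phi> N : borel_measurable (volM m x0)" for N using test_L2(1)[OF m t] by (rule in_L2_meas)
  show "norm (\<phi> N p - mode m n c g p) <= C * (M + Bg)" if p: "p : {x0<..} \<times> S2" for N p
  proof (cases "fst p > ?Y")
   case True
   thus ?thesis using C Bg M0 kz X(2) by (simp add: \<phi>_def mz)
  next
   case False
   note s = slab[OF p False]
   have "norm (\<phi> N p - mode m n c g p) <= C * \<bar>k N (fst p) - g (fst p)\<bar>"
    unfolding \<phi>_def mode_diff by (rule C(3)[OF s])
   also have "... <= C * (M + Bg)"
   proof (intro mult_left_mono)
    have "\<bar>k N (fst p)\<bar> <= M" using s by (intro kB) auto
    moreover have "\<bar>g (fst p)\<bar> <= Bg" using s Bg(2) by auto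
    ultimately show "\<bar>k N (fst p) - g (fst p)\<bar> <= M + Bg" by linarith
   qed (use C in simp)
   finally show ?thesis .
  qed
  show "\<phi> N p - mode m n c g p = 0" if "fst p > ?Y" for N p
   using that kz X(2) by (simp add: \<phi>_def mz)
  show "(%N. \<phi> N p) \<longlonglongrightarrow> mode m n c g p" if "p : {x0<..} \<times> S2" for p
   unfolding \<phi>_def mode_def using that m by (intro tendsto_intros lim) auto
 qed
 have lim2: "(%N. L2_norm (volM m x0) (%p. grad m (\<phi> N) p - gmode m n c g g1 p)) \<longlonglongrightarrow> 0"
 proof (rule L2_dominated[OF m _ mg(2), of _ "C * ((M + Bg) + (M1 + B))" ?Y])
  show "grad m (\<phi> N) : borel_measurable (volM m x0)" for N using test_L2(2)[OF m t] by (rule in_L2_meas)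
  have M1: "M1 >= 0" using k1B[of x0 0] by (meson abs_ge_zero order_refl order_trans)
  show "norm (grad m (\<phi> N) p - gmode m n c g g1 p) <= C * ((M + Bg) + (M1 + B))" if p: "p : {x0<..} \<times> S2" for N p
  proof (cases "fst p > ?Y")
   case True
   thus ?thesis using C Bg M0 M1 B kz X(2) g1X by (simp add: gr[OF p] gz)
  next
   case False
   note s = slab[OF p False]
   have "norm (grad m (\<phi> N) p - gmode m n c g g1 p) <= C * (\<bar>k N (fst p) - g (fst p)\<bar> + \<bar>k1 N (fst p) - g1 (fst p)\<bar>)"
    unfolding gr[OF p] gmode_diff by (rule C(2)[OF s])
   also have "... <= C * ((M + Bg) + (M1 + B))"
   proof (intro mult_left_mono add_mono)
    have "\<bar>k N (fst p)\<bar> <= M" "\<bar>k1 N (fst p)\<bar> <= M1" using s by (auto intro!: kB k1B)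
    moreover have "\<bar>g (fst p)\<bar> <= Bg" "\<bar>g1 (fst p)\<bar> <= B" using s Bg(2) B(2) by auto
    ultimately show "\<bar>k N (fst p) - g (fst p)\<bar> <= M + Bg" "\<bar>k1 N (fst p) - g1 (fst p)\<bar> <= M1 + B" by linarith+
   qed (use C in simp)
   finally show ?thesis .
  qed
  show "grad m (\<phi> N) p - gmode m n c g g1 p = 0" if "p : {x0<..} \<times> S2" "fst p > ?Y" for N p
   using that kz X(2) g1X by (simp add: gr gz)
  show "(%N. grad m (\<phi> N) p) \<longlonglongrightarrow> gmode m n c g g1 p" if p: "p : {x0<..} \<times> S2" for p
   unfolding gr[OF p] gmode_def using p m by (intro tendsto_intros lim tendsto_vec_lambda) auto
 qed
 show ?thesis unfolding has_grad_def
 proof (intro conjI allI impI exI[of _ \<phi>])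
  have I: "{x0<..} : sets borel" "{x0<..<r} : sets borel" "{x0<..<r} \<subseteq> {x0<..}" for r by auto
  show "in_L2 (vol m {x0<..<r}) (mode m n c g)" for r by (rule in_L2_vol_mono(1)[OF m I L2f])
  show "(%N. L2_norm (vol m {x0<..<r}) (%p. \<phi> N p - mode m n c g p)) \<longlonglongrightarrow> 0" for r
   by (rule Lim_null_comparison[OF always_eventually lim1])
     (use in_L2_vol_mono(2)[OF m I in_L2_diff(1)[OF test_L2(1)[OF m t] L2f]] in simp)
 qed (use mg L2G t lim2 in auto)
qed

lemma mode_norm_sq: "(norm (mode m n c g p))^2 = (cmod c)^2 * ((g (fst p) / warp m (fst p))^2 * (cmod (Yl n (snd p)))^2)"
 by (simp add: mode_def norm_mult power_mult_distrib power_divide norm_divide)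

lemma gmode_norm_sq:
 "(norm (gmode m n c g g1 p))^2 = (cmod c)^2 *
   (((g1 (fst p) * warp m (fst p) - g (fst p) * adot m (fst p)) / (warp m (fst p))^2)^2 * (cmod (Yl n (snd p)))^2
   + (g (fst p) / (warp m (fst p))^2)^2 * (\<Sum>i\<in>UNIV. (cmod (SG n (snd p) i))^2))"
proof -
 let ?a = "warp m (fst p)"
 have v: "(norm (inverse ?a *\<^sub>R (\<chi> i. c * of_real (g (fst p) / ?a) * SG n (snd p) i)))^2
   = (cmod c)^2 * ((g (fst p) / ?a^2)^2 * (\<Sum>i\<in>UNIV. (cmod (SG n (snd p) i))^2))"
 proof -
  have "(norm (\<chi> i. c * of_real (g (fst p) / ?a) * SG n (snd p) i))^2 = (\<Sum>i\<in>UNIV. (norm (c * of_real (g (fst p) / ?a) * SG n (snd p) i))^2)"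
   by (simp add: norm_vec_def L2_set_def sum_nonneg)
  also have "... = (cmod c)^2 * ((g (fst p) / ?a)^2 * (\<Sum>i\<in>UNIV. (cmod (SG n (snd p) i))^2))"
   unfolding norm_mult norm_of_real power_mult_distrib power2_abs sum_distrib_left by (simp only: mult.assoc)
  finally show ?thesis
   by (simp only: norm_scaleR power_mult_distrib power2_abs)
     (simp add: power2_eq_square divide_inverse mult_ac)
 qed
 have f: "(norm (c * of_real ((g1 (fst p) * ?a - g (fst p) * adot m (fst p)) / ?a^2) * Yl n (snd p)))^2
   = (cmod c)^2 * (((g1 (fst p) * ?a - g (fst p) * adot m (fst p)) / ?a^2)^2 * (cmod (Yl n (snd p)))^2)"
  unfolding norm_mult norm_of_real power_mult_distrib power2_abs by (simp only: mult.assoc)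
 show ?thesis
  unfolding gmode_def norm_prod_def fst_conv snd_conv v f by (simp add: sum_nonneg distrib_left)
qed

lemma has_integral_deriv:
 assumes "a <= b" "!!x. has_d F (f x) x"
 shows "(f has_integral (F b - F a)) {a..b}"
 by (rule fundamental_theorem_of_calculus[OF assms(1)])
   (use assms(2) in "auto simp: has_real_derivative_iff_has_vector_derivative[symmetric] intro: has_field_derivative_at_within")

lemma pot_continuous: "m >= 1 ==> continuous_on A (pot m n)"
 unfolding pot_def curv_def by (intro continuous_intros smooth_continuous[OF smooth_warp]) auto

lemma adot_continuous: "m >= 1 ==> continuous_on A (adot m)"
 by (intro continuous_at_imp_continuous_on ballI DERIV_isCont[OF adot_derivs(2)])

lemma warp_continuous: "m >= 1 ==> continuous_on A (warp m)"
 by (intro smooth_continuous smooth_warp)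

lemma L2_mode:
 assumes m: "m >= 1" and X: "x0 <= X" "!!x. x > X ==> g x = 0" and g: "continuous_on UNIV g"
 shows "(L2_norm (volM m x0) (mode m n c g))^2 = (cmod c)^2 * NY n * integral {x0..X} (%x. (g x)^2)"
proof -
 have "(L2_norm (volM m x0) (mode m n c g))^2 = (\<integral>p. (cmod c)^2 * ((g (fst p) / warp m (fst p))^2 * (cmod (Yl n (snd p)))^2) \<partial>volM m x0)"
  unfolding L2_norm_sq mode_norm_sq ..
 also have "... = (\<integral>p. (cmod c)^2 * ((g (fst p) / warp m (fst p))^2 * (cmod (Yl n (snd p)))^2) \<partial>vol m {x0<..X})"
  by (rule integral_volM_cut[OF m]) (use X in auto)
 also have "... = (cmod c)^2 * (\<integral>p. (g (fst p) / warp m (fst p))^2 * (cmod (Yl n (snd p)))^2 \<partial>vol m {x0<..X})"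
  by (rule BI_integral_mult_right_zero)
 also have "(\<integral>p. (g (fst p) / warp m (fst p))^2 * (cmod (Yl n (snd p)))^2 \<partial>vol m {x0<..X})
  = integral {x0..X} (%x. (warp m x)^2 * (g x / warp m x)^2) * (\<integral>\<omega>. (cmod (Yl n \<omega>))^2 \<partial>sphere_measure)"
  by (rule integral_product(1)[OF m X(1)])
    (use m in "auto intro!: continuous_intros warp_continuous continuous_on_subset[OF g] continuous_Yl")
 also have "(%x. (warp m x)^2 * (g x / warp m x)^2) = (%x. (g x)^2)" using m by (simp add: power_divide)
 finally show ?thesis by (simp add: NY_def)
qed

lemma integral_gmode:
 assumes m: "m >= 1" and n: "n >= 1" and X: "x0 <= X" and g: "continuous_on UNIV g" "continuous_on UNIV g1"
 shows "(\<integral>p. (norm (gmode m n c g g1 p))^2 \<partial>vol m {x0<..X}) = (cmod c)^2 * NY n *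
   (integral {x0..X} (%x. (g1 x - g x * adot m x / warp m x)^2) + integral {x0..X} (%x. Lam n / (warp m x)^2 * (g x)^2))"
  "integrable (vol m {x0<..X}) (%p. (norm (gmode m n c g g1 p))^2)"
proof -
 let ?h1 = "%x. ((g1 x * warp m x - g x * adot m x) / (warp m x)^2)^2" and ?h2 = "%x. (g x / (warp m x)^2)^2"
 let ?S = "%\<omega>. \<Sum>i\<in>UNIV. (cmod (SG n \<omega> i))^2"
 have c: "continuous_on {x0..X} ?h1" "continuous_on {x0..X} ?h2"
  using m by (auto intro!: continuous_intros warp_continuous adot_continuous continuous_on_subset[OF g(1)] continuous_on_subset[OF g(2)])
 have cS: "continuous_on S2 (%\<omega>. (cmod (Yl n \<omega>))^2)" "continuous_on S2 ?S"
  by (intro continuous_intros continuous_Yl continuous_SG)+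
 note A = integral_product[OF m X c(1) cS(1)] and B = integral_product[OF m X c(2) cS(2)]
 show "integrable (vol m {x0<..X}) (%p. (norm (gmode m n c g g1 p))^2)"
  unfolding gmode_norm_sq using A(2) B(2) by (intro integrable_mult_right BI_integrable_add)
 have "(\<integral>p. (norm (gmode m n c g g1 p))^2 \<partial>vol m {x0<..X})
   = (cmod c)^2 * ((\<integral>p. ?h1 (fst p) * (cmod (Yl n (snd p)))^2 \<partial>vol m {x0<..X}) + (\<integral>p. ?h2 (fst p) * ?S (snd p) \<partial>vol m {x0<..X}))"
  unfolding gmode_norm_sq Bochner_Integration.integral_mult_right_zero
  by (subst BI_integral_add[OF A(2) B(2)]) simp
 also have "(\<integral>p. ?h1 (fst p) * (cmod (Yl n (snd p)))^2 \<partial>vol m {x0<..X}) = integral {x0..X} (%x. (g1 x - g x * adot m x / warp m x)^2) * NY n"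
 proof -
  have "(warp m x)^2 * ?h1 x = (g1 x - g x * adot m x / warp m x)^2" for x
   using m by (simp add: power2_eq_square field_simps)
  thus ?thesis unfolding A(1) NY_def by simp
 qed
 also have "(\<integral>p. ?h2 (fst p) * ?S (snd p) \<partial>vol m {x0<..X}) = integral {x0..X} (%x. Lam n / (warp m x)^2 * (g x)^2) * NY n"
 proof -
  have "(warp m x)^2 * ?h2 x = (g x)^2 / (warp m x)^2" for x
   using m by (simp add: power2_eq_square field_simps)
  hence "(\<integral>p. ?h2 (fst p) * ?S (snd p) \<partial>vol m {x0<..X}) = integral {x0..X} (%x. (g x)^2 / (warp m x)^2) * (Lam n * NY n)"
   unfolding B(1) SG_norm[OF n] by simp
  also have "... = (Lam n * integral {x0..X} (%x. (g x)^2 / (warp m x)^2)) * NY n" by simp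
  also have "Lam n * integral {x0..X} (%x. (g x)^2 / (warp m x)^2) = integral {x0..X} (%x. Lam n * ((g x)^2 / (warp m x)^2))"
   by (rule HK_mult_right[symmetric])
  finally show ?thesis by simp
 qed
 finally show "(\<integral>p. (norm (gmode m n c g g1 p))^2 \<partial>vol m {x0<..X}) = (cmod c)^2 * NY n *
   (integral {x0..X} (%x. (g1 x - g x * adot m x / warp m x)^2) + integral {x0..X} (%x. Lam n / (warp m x)^2 * (g x)^2))"
  by (simp add: algebra_simps)
qed

text \<open>The first order terms form the exact derivative of \<open>g^2 a' / a\<close>, which vanishes at both ends; what is
  left is the potential.\<close>
lemma L2_gmode:
 assumes m: "m >= 1" and n: "n >= 1" and X: "x0 <= X" "!!x. x >= X ==> g x = 0" and g0: "g x0 = 0"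
  and g: "!!x. has_d g (g1 x) x" "continuous_on UNIV g1"
 shows "(L2_norm (volM m x0) (gmode m n c g g1))^2 = (cmod c)^2 * NY n * integral {x0..X} (%x. (g1 x)^2 + pot m n x * (g x)^2)"
proof -
 have cg: "continuous_on UNIV g" by (intro continuous_at_imp_continuous_on ballI DERIV_isCont[OF g(1)])
 have g1X: "g1 x = 0" if "x > X" for x
  by (rule DERIV_const_on_open[where S="{X<..}" and c=0, OF g(1)]) (use that X in auto)
 have "(L2_norm (volM m x0) (gmode m n c g g1))^2 = (\<integral>p. (norm (gmode m n c g g1 p))^2 \<partial>vol m {x0<..X})"
  unfolding L2_norm_sq by (rule integral_volM_cut[OF m]) (use X g1X in "auto simp: gmode_norm_sq")
 also have "... = (cmod c)^2 * NY n *
   (integral {x0..X} (%x. (g1 x - g x * adot m x / warp m x)^2) + integral {x0..X} (%x. Lam n / (warp m x)^2 * (g x)^2))"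
  by (rule integral_gmode(1)[OF m n X(1) cg g(2)])
 also have "integral {x0..X} (%x. (g1 x - g x * adot m x / warp m x)^2) + integral {x0..X} (%x. Lam n / (warp m x)^2 * (g x)^2)
   = integral {x0..X} (%x. (g1 x)^2 + pot m n x * (g x)^2)"
 proof -
  let ?d = "%x. 2 * g x * g1 x * (adot m x / warp m x) + (g x)^2 * (curv m x - (adot m x / warp m x)^2)"
  have w: "warp m x ~= 0" for x using m by simp
  have q: "has_d (%x. adot m x / warp m x) (curv m x - (adot m x / warp m x)^2) x" for x
   by (rule DERIV_cong[OF DERIV_divide[OF adot_derivs(2)[OF m] adot_derivs(1)[OF m] w]])
     (use w[of x] in "simp add: field_simps power2_eq_square")
  have d: "has_d (%x. (g x)^2 * (adot m x / warp m x)) (?d x) x" for x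
   by (rule DERIV_cong[OF DERIV_mult[OF DERIV_power[OF g(1), of 2] q]]) (simp add: mult_ac)
  have "(?d has_integral ((g X)^2 * (adot m X / warp m X) - (g x0)^2 * (adot m x0 / warp m x0))) {x0..X}"
   by (rule has_integral_deriv[OF X(1) d])
  hence d0: "(?d has_integral 0) {x0..X}" using X(2)[of X] g0 by simp
  have i: "h integrable_on {x0..X}" if "continuous_on {x0..X} h" for h :: "real => real" by (rule integrable_continuous_real[OF that])
  have c: "continuous_on {x0..X} (%x. (g1 x - g x * adot m x / warp m x)^2)" "continuous_on {x0..X} (%x. Lam n / (warp m x)^2 * (g x)^2)"
   "continuous_on {x0..X} (%x. (g1 x)^2 + pot m n x * (g x)^2)"
   using m by (auto intro!: continuous_intros warp_continuous adot_continuous pot_continuous continuous_on_subset[OF cg] continuous_on_subset[OF g(2)])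
  have "integral {x0..X} (%x. (g1 x - g x * adot m x / warp m x)^2) + integral {x0..X} (%x. Lam n / (warp m x)^2 * (g x)^2)
   = integral {x0..X} (%x. (g1 x - g x * adot m x / warp m x)^2 + Lam n / (warp m x)^2 * (g x)^2)"
   by (rule HK_add[symmetric]) (intro i c)+
  also have "... = integral {x0..X} (%x. ((g1 x)^2 + pot m n x * (g x)^2) - ?d x)"
   by (intro HK_cong) (simp add: pot_def power2_eq_square algebra_simps)
  also have "... = integral {x0..X} (%x. (g1 x)^2 + pot m n x * (g x)^2) - integral {x0..X} ?d"
   by (rule HK_diff[OF i[OF c(3)]]) (use d0 in blast)
  finally show ?thesis using d0 by (simp add: integral_unique)
 qed
 finally show ?thesis .
qed

section \<open>Volterra equations\<close>

text \<open>Picard iteration in the norm weighted by \<open>exp(- M t)\<close>, for which \<open>F\<close> is a contraction.  The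
  convergence of the iterates from \<open>0\<close> transfers symmetries and supports to the limit.\<close>
lemma volterra_fixed_point:
 fixes F :: "(real => real => real) => (real => real => real)"
 assumes cont: "!!u. jcont u ==> jcont (F u)"
  and contr: "!!u w C. jcont u ==> jcont w ==> C >= 0
    ==> (!!t y. \<bar>u t y - w t y\<bar> <= C * exp (M * max 0 t)) ==> (!!t y. \<bar>F u t y - F w t y\<bar> <= C / 2 * exp (M * max 0 t))"
  and init: "!!t y. \<bar>F (%_ _. 0) t y\<bar> <= C0 * exp (M * max 0 t)"
 obtains v where "jcont v" "ALL t y. F v t y = v t y"
  "ALL t y. (%n. (F ^^ n) (%_ _. 0) t y) \<longlonglongrightarrow> v t y"
proof -
 define u where "u n = (F ^^ n) (%_ _. 0)" for n
 have u0: "u 0 = (%_ _. 0)" and uS: "u (Suc n) = F (u n)" for n by (auto simp: u_def)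
 have uc: "jcont (u n)" for n
 proof (induction n)
  case (Suc n)
  thus ?case using cont[OF Suc] by (simp add: uS)
 qed (simp add: u0)
 let ?W = "%t. exp (M * max 0 t)"
 have W: "?W t > 0" for t by simp
 have C0: "C0 >= 0"
 proof -
  have "0 <= C0 * ?W 0" using init[of 0 0] abs_ge_zero order_trans by blast
  thus ?thesis by simp
 qed
 have du: "\<bar>u (Suc n) t y - u n t y\<bar> <= C0 * (1/2)^n * ?W t" for n t y
 proof (induction n arbitrary: t y)
  case 0 thus ?case using init by (simp add: u0 uS)
 next
  case (Suc n)
  have "\<bar>F (u (Suc n)) t y - F (u n) t y\<bar> <= C0 * (1/2)^n / 2 * ?W t"
   by (rule contr[OF uc uc _ Suc]) (use C0 in simp)
  thus ?case by (simp add: uS)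
 qed
 let ?g = "%n p. (u (Suc n) (fst p) (snd p) - u n (fst p) (snd p)) / ?W (fst p)"
 have gb: "norm (?g n p) <= C0 * (1/2)^n" for n p
  using du[of n "fst p" "snd p"] W by (simp add: divide_le_eq)
 have sg: "summable (%n. C0 * (1/2::real)^n)" by (intro summable_mult summable_geometric) auto
 have ul: "uniform_limit UNIV (%n p. \<Sum>i<n. ?g i p) (%p. \<Sum>i. ?g i p) sequentially"
  by (rule Weierstrass_m_test[OF _ sg]) (use gb in auto)
 define v where "v t y = ?W t * (\<Sum>i. ?g i (t, y))" for t y
 have part: "(\<Sum>i<n. ?g i p) = u n (fst p) (snd p) / ?W (fst p)" for n p
  by (induction n) (auto simp: u0 add_divide_distrib[symmetric])
 have Wc: "continuous_on UNIV (%p::real\<times>real. ?W (fst p))" by (intro continuous_intros)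
 have lc: "continuous_on UNIV (%p. \<Sum>i. ?g i p)"
 proof (rule uniform_limit_theorem[OF _ ul])
  show "\<forall>\<^sub>F n in sequentially. continuous_on UNIV (%p. \<Sum>i<n. ?g i p)"
   unfolding part using uc by (intro always_eventually allI continuous_on_divide Wc) (auto simp: case_prod_beta')
 qed simp
 have vc: "jcont v"
  unfolding v_def case_prod_beta' by (intro continuous_on_mult Wc) (use lc in "simp")
 have lim: "(%n. u n t y) \<longlonglongrightarrow> v t y" for t y
 proof -
  have "(%n. \<Sum>i<n. ?g i (t, y)) \<longlonglongrightarrow> (\<Sum>i. ?g i (t, y))"
   using tendsto_uniform_limitI[OF ul, of "(t, y)"] by simp
  hence "(%n. ?W t * (u n t y / ?W t)) \<longlonglongrightarrow> v t y"
   unfolding part v_def by (intro tendsto_mult tendsto_const) simp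
  thus ?thesis by simp
 qed
 have dist: "\<bar>v t y - u n t y\<bar> <= 2 * C0 * (1/2)^n * ?W t" for n t y
 proof -
  have "\<bar>u (n + k) t y - u n t y\<bar> <= 2 * C0 * (1/2)^n * (1 - (1/2)^k) * ?W t" for k
  proof (induction k)
   case (Suc k)
   have "\<bar>u (n + Suc k) t y - u n t y\<bar> <= \<bar>u (Suc (n + k)) t y - u (n + k) t y\<bar> + \<bar>u (n + k) t y - u n t y\<bar>" by simp
   also have "... <= C0 * (1/2)^(n+k) * ?W t + 2 * C0 * (1/2)^n * (1 - (1/2)^k) * ?W t"
    by (intro add_mono du Suc)
   also have "... = 2 * C0 * (1/2)^n * (1 - (1/2)^Suc k) * ?W t" by (simp add: power_add algebra_simps)
   finally show ?case .
  qed simp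
  moreover have "2 * C0 * (1/2)^n * (1 - (1/2)^k) * ?W t <= 2 * C0 * (1/2)^n * 1 * ?W t" for k
   using C0 by (intro mult_right_mono mult_left_mono) auto
  ultimately have b: "\<bar>u (n + k) t y - u n t y\<bar> <= 2 * C0 * (1/2)^n * ?W t" for k
   unfolding mult_1_right by (rule order_trans)
  have "(%k. \<bar>u (n + k) t y - u n t y\<bar>) \<longlonglongrightarrow> \<bar>v t y - u n t y\<bar>"
   using LIMSEQ_ignore_initial_segment[OF lim[of t y], of n] by (intro tendsto_intros) (simp add: add.commute)
  thus ?thesis by (rule LIMSEQ_le_const2) (use b in blast)
 qed
 have fixp: "F v t y = v t y" for t y
 proof -
  have "(%n. F v t y - u (Suc n) t y) \<longlonglongrightarrow> 0"
  proof (rule Lim_null_comparison)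
   have "\<bar>F v t y - F (u n) t y\<bar> <= (2 * C0 * (1/2)^n) / 2 * ?W t" for n
    by (rule contr[OF vc uc _ dist]) (use C0 in simp)
   thus "\<forall>\<^sub>F n in sequentially. norm (F v t y - u (Suc n) t y) <= (1/2)^n * (C0 * ?W t)"
    by (simp add: uS mult_ac)
   show "(%n. (1/2)^n * (C0 * ?W t)) \<longlonglongrightarrow> 0"
    using tendsto_mult_right[OF LIMSEQ_realpow_zero[of "1/2"], of "C0 * ?W t"] by simp
  qed
  moreover have "(%n. F v t y - u (Suc n) t y) \<longlonglongrightarrow> F v t y - v t y"
   by (intro tendsto_intros LIMSEQ_Suc lim)
  ultimately show ?thesis using LIMSEQ_unique by fastforce
 qed
 show ?thesis by (rule that[of v]) (use vc fixp lim in "auto simp: u_def")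
qed

section \<open>Antiderivatives along characteristics\<close>

text \<open>The antiderivative with value \<open>0\<close> at \<open>0\<close>, on the whole line.\<close>
definition AI :: "(real => real) => real => real" where
 "AI h r = (if r >= 0 then integral {0..r} h else - integral {r..0} h)"

lemma AI_0 [simp]: "AI h 0 = 0" by (simp add: AI_def)

lemma AI_deriv:
 assumes "continuous_on UNIV h"
 shows "has_d (AI h) (h r) r"
proof -
 define K where "K = \<bar>r\<bar> + 1"
 have K0: "K > 0" by (simp add: K_def)
 have i: "h integrable_on {a..b}" for a b by (intro integrable_continuous_real continuous_on_subset[OF assms]) simp
 have e: "AI h x = integral {-K..x} h - integral {-K..0} h" if "x : {-K<..<K}" for x
 proof (cases "x >= 0")
  case True
  thus ?thesis using HK_combine[where a="-K" and c=0 and b=x and f=h] i K0 by (auto simp: AI_def)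
 next
  case False
  thus ?thesis using HK_combine[where a="-K" and c=x and b=0 and f=h] i that K0 by (auto simp: AI_def)
 qed
 have "((%x. integral {-K..x} h) has_real_derivative h r) (at r within {-K..K})"
  by (rule integral_has_real_derivative[OF continuous_on_subset[OF assms]]) (auto simp: K_def)
 hence "has_d (%x. integral {-K..x} h) (h r) r"
  by (subst (asm) at_within_interior) (auto simp: K_def)
 hence "has_d (%x. integral {-K..x} h - integral {-K..0} h) (h r) r"
  by (auto intro!: derivative_eq_intros)
 thus ?thesis
  by (rule has_field_derivative_transform_within_open[of _ _ _ "{-K<..<K}"]) (use e in "auto simp: K_def")
qed

lemma AI_scaled:
 assumes "continuous_on UNIV h"
 shows "AI h r = r * integral {0..1} (%\<sigma>. h (r * \<sigma>))"
proof -
 have "((%\<sigma>. AI h (r * \<sigma>)) has_real_derivative r * h (r * \<sigma>)) (at \<sigma> within {0..1})" for \<sigma>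
  by (rule DERIV_subset[OF DERIV_cong[OF DERIV_chain2[OF AI_deriv[OF assms]]]]) (auto intro!: derivative_eq_intros)
 hence "((%\<sigma>. r * h (r * \<sigma>)) has_integral (AI h (r * 1) - AI h (r * 0))) {0..1}"
  by (intro fundamental_theorem_of_calculus) (auto simp: has_real_derivative_iff_has_vector_derivative)
 hence "integral {0..1} (%\<sigma>. r * h (r * \<sigma>)) = AI h (r * 1) - AI h (r * 0)" by (rule integral_unique)
 thus ?thesis by simp
qed

lemma AI_continuous_param:
 fixes h :: "'a::euclidean_space => real => real"
 assumes h: "jcont h" and r: "continuous_on UNIV r"
 shows "continuous_on UNIV (%p. AI (h p) (r p))"
proof -
 have hc: "continuous_on UNIV (h p)" for p
  using continuous_on_compose2[OF h, of UNIV "%s. (p, s)"] by (simp add: continuous_intros)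
 have "continuous_on UNIV (%p. r p * integral (cbox 0 1) (%\<sigma>. h p (r p * \<sigma>)))"
 proof (intro continuous_on_mult r integral_continuous_on_param)
  show "continuous_on (UNIV \<times> cbox 0 1) (%(p, \<sigma>). h p (r p * \<sigma>))"
  proof -
   have "continuous_on (UNIV \<times> cbox 0 1) (%x::'a \<times> real. (fst x, r (fst x) * snd x))"
    by (intro continuous_on_Pair continuous_on_mult continuous_on_compose2[OF r] continuous_on_fst continuous_on_snd continuous_on_id) auto
   from continuous_on_compose2[OF h this] show ?thesis by (simp add: case_prod_beta')
  qed
 qed
 thus ?thesis by (simp add: AI_scaled[OF hc])
qed

lemma AI_odd:
 assumes "continuous_on UNIV h" "!!r. h (- r) = - h r"
 shows "AI h (- r) = AI h r"
 unfolding AI_scaled[OF assms(1)] using assms(2) by simp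


lemma cont2D:
 assumes "jcont G" "continuous_on A f" "continuous_on A g"
 shows "continuous_on A (%x. G (f x) (g x))"
 using continuous_on_compose2[OF assms(1), of A "%x. (f x, g x)"] assms(2,3) by (simp add: continuous_intros)

text \<open>Integration along a characteristic \<open>y + e (t - s)\<close> with \<open>e = 1\<close> or \<open>-1\<close>;
  \<open>c = y + e t\<close> is constant on it.\<close>
definition KK :: "real => (real => real => real) => real => real => real" where
 "KK e G t c = AI (%s. G s (c - e * s)) t"

lemma KK_continuous:
 assumes "jcont G"
 shows "jcont (KK e G)"
 unfolding KK_def case_prod_beta'
 by (rule AI_continuous_param) (auto simp: case_prod_beta' intro!: cont2D[OF assms] continuous_intros)

lemma KK_derivs:
 assumes G: "jcont G" and Gy: "jcont Gy"
  and d: "!!s r. has_d (%r. G s r) (Gy s r) r"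
 shows "has_d (%t. KK e G t (y + e * t)) (G t y + e * KK e Gy t (y + e * t)) t"
  "has_d (%y. KK e G t (y + e * t)) (KK e Gy t (y + e * t)) y"
proof -
 have Gs: "continuous_on UNIV (%s. G s (c - e * s))" "continuous_on UNIV (%s. Gy s (c - e * s))" for c
  by (intro cont2D[OF G] cont2D[OF Gy] continuous_intros)+
 have dt: "has_d (%t. KK e G t c) (G t (c - e * t)) t" for t c
  unfolding KK_def by (rule AI_deriv[OF Gs(1)])
 have dc: "has_d (%c. KK e G t c) (KK e Gy t c) c" for t c
 proof -
  have "((%c. integral (cbox 0 1) (%\<sigma>. G (t * \<sigma>) (c - e * (t * \<sigma>)))) has_field_derivative
    integral (cbox 0 1) (%\<sigma>. Gy (t * \<sigma>) (c - e * (t * \<sigma>)))) (at c within UNIV)"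
  proof (rule leibniz_rule_field_derivative)
   show "((%c. G (t * \<sigma>) (c - e * (t * \<sigma>))) has_field_derivative Gy (t * \<sigma>) (c - e * (t * \<sigma>))) (at c within UNIV)" for c \<sigma>
    by (rule DERIV_cong[OF DERIV_chain2[OF d]]) (auto intro!: derivative_eq_intros)
   show "(%\<sigma>. G (t * \<sigma>) (c - e * (t * \<sigma>))) integrable_on cbox 0 1" for c
    by (intro integrable_continuous cont2D[OF G] continuous_intros)
   show "continuous_on (UNIV \<times> cbox 0 1) (%(c, \<sigma>). Gy (t * \<sigma>) (c - e * (t * \<sigma>)))"
    unfolding case_prod_beta' by (intro cont2D[OF Gy] continuous_intros)
  qed auto
  from DERIV_cmult[OF this, of t]
  show ?thesis unfolding KK_def AI_scaled[OF Gs(1)] AI_scaled[OF Gs(2)] by simp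
 qed
 show "has_d (%y. KK e G t (y + e * t)) (KK e Gy t (y + e * t)) y"
  by (rule DERIV_cong[OF DERIV_chain2[OF dc]]) (auto intro!: derivative_eq_intros)
 have tot: "((%(t, c). KK e G t c) has_derivative (%(tt, tc). (G t (c - e * t)) * tt + blinfun_apply (blinfun_scaleR_left (KK e Gy t c)) tc)) (at (t, c) within UNIV \<times> UNIV)" for t c
 proof (rule has_derivative_partialsI)
  show "((%t. KK e G t c) has_derivative (*) (G t (c - e * t))) (at t within UNIV)"
   using dt[of c t] by (simp add: has_field_derivative_def)
  show "((%c. KK e G t c) has_derivative blinfun_apply (blinfun_scaleR_left (KK e Gy t c))) (at c within UNIV)" for t c
   using dc[of t c] by (simp add: has_field_derivative_def mult_commute_abs)
  have "continuous_on UNIV (%(t, c). blinfun_scaleR_left (KK e Gy t c))"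
   using KK_continuous[OF Gy, of e] unfolding case_prod_beta' by (intro bounded_linear.continuous_on[OF bounded_linear_blinfun_scaleR_left])
  thus "continuous (at (t, c) within UNIV \<times> UNIV) (%(t, c). blinfun_scaleR_left (KK e Gy t c))"
   by (simp add: continuous_on_eq_continuous_within)
 qed auto
 have "((%t. (t, y + e * t)) has_derivative (%h. (h, e * h))) (at t)"
  by (auto intro!: derivative_eq_intros)
 from has_derivative_compose[OF this tot[of t "y + e * t", unfolded UNIV_Times_UNIV]]
 have cmp: "((%t. (case (t, y + e * t) of (t, c) => KK e G t c)) has_derivative
  (%h. case (h, e * h) of (tt, tc) => (G t (y + e * t - e * t)) * tt + blinfun_apply (blinfun_scaleR_left (KK e Gy t (y + e * t))) tc)) (at t)" .
 have "(%h. case (h, e * h) of (tt, tc) => (G t (y + e * t - e * t)) * tt + blinfun_apply (blinfun_scaleR_left (KK e Gy t (y + e * t))) tc)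
   = (*) (G t y + e * KK e Gy t (y + e * t))"
  by (simp add: fun_eq_iff algebra_simps)
 with cmp have "((%t. KK e G t (y + e * t)) has_derivative (*) (G t y + e * KK e Gy t (y + e * t))) (at t)" by simp
 thus "has_d (%t. KK e G t (y + e * t)) (G t y + e * KK e Gy t (y + e * t)) t"
  by (simp only: has_field_derivative_def)
qed

section \<open>Odd and even reflection\<close>

lemma odd_ext_deriv:
 fixes h h1 :: "real => real"
 assumes d: "!!y. has_d h (h1 y) y" and 0: "h 0 = 0"
 shows "has_d (%y. sgn y * h \<bar>y\<bar>) (h1 \<bar>y\<bar>) y"
proof -
 consider "y > 0" | "y < 0" | "y = 0" by linarith
 thus ?thesis
 proof cases
  case 1
  have "has_d h (h1 \<bar>y\<bar>) y" using d[of y] 1 by simp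
  thus ?thesis
   by (rule has_field_derivative_transform_within_open[where S="{0<..}"]) (use 1 in auto)
 next
  case 2
  have "has_d (%y. - h (- y)) (h1 \<bar>y\<bar>) y"
   by (rule DERIV_cong[OF DERIV_minus[OF DERIV_chain2[OF d]]]) (use 2 in "auto intro!: derivative_eq_intros")
  thus ?thesis
   by (rule has_field_derivative_transform_within_open[where S="{..<0}"]) (use 2 in auto)
 next
  case 3
  have "((%k. (h (0 + k) - h 0) / k) \<longlongrightarrow> h1 0) (at 0)" using d[of 0] unfolding DERIV_def .
  moreover have "filterlim (%k::real. \<bar>k\<bar>) (at 0) (at 0)"
   unfolding filterlim_at by (auto intro!: tendsto_eq_intros simp: eventually_at intro: exI[of _ 1])
  ultimately have "((%k. (h (0 + \<bar>k\<bar>) - h 0) / \<bar>k\<bar>) \<longlongrightarrow> h1 0) (at 0)" by (rule filterlim_compose)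
  moreover have "(h (0 + \<bar>k\<bar>) - h 0) / \<bar>k\<bar> = (sgn (0 + k) * h \<bar>0 + k\<bar> - sgn 0 * h \<bar>0\<bar>) / k" for k
   using 0 by (cases "k > 0"; cases "k = 0") auto
  ultimately show ?thesis unfolding DERIV_def 3 by simp
 qed
qed

lemma even_ext_deriv:
 fixes h h1 :: "real => real"
 assumes d: "!!y. has_d h (h1 y) y" and 0: "h1 0 = 0"
 shows "has_d (%y. h \<bar>y\<bar>) (sgn y * h1 \<bar>y\<bar>) y"
proof -
 consider "y > 0" | "y < 0" | "y = 0" by linarith
 thus ?thesis
 proof cases
  case 1
  have "has_d h (sgn y * h1 \<bar>y\<bar>) y" using d[of y] 1 by simp
  thus ?thesis
   by (rule has_field_derivative_transform_within_open[where S="{0<..}"]) (use 1 in auto)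
 next
  case 2
  have "has_d (%y. h (- y)) (sgn y * h1 \<bar>y\<bar>) y"
   by (rule DERIV_cong[OF DERIV_chain2[OF d]]) (use 2 in "auto intro!: derivative_eq_intros")
  thus ?thesis
   by (rule has_field_derivative_transform_within_open[where S="{..<0}"]) (use 2 in auto)
 next
  case 3
  have "((%k. (h (0 + k) - h 0) / k) \<longlongrightarrow> 0) (at 0)" using d[of 0] 0 unfolding DERIV_def by simp
  moreover have "filterlim (%k::real. \<bar>k\<bar>) (at 0) (at 0)"
   unfolding filterlim_at by (auto intro!: tendsto_eq_intros simp: eventually_at intro: exI[of _ 1])
  ultimately have "((%k. (h (0 + \<bar>k\<bar>) - h 0) / \<bar>k\<bar>) \<longlongrightarrow> 0) (at 0)" by (rule filterlim_compose)
  hence "((%k. \<bar>(h (0 + \<bar>k\<bar>) - h 0) / \<bar>k\<bar>\<bar>) \<longlongrightarrow> 0) (at 0)" by (rule tendsto_rabs_zero)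
  hence "((%k. \<bar>(h \<bar>0 + k\<bar> - h \<bar>0\<bar>) / k\<bar>) \<longlongrightarrow> 0) (at 0)" by (simp add: abs_divide)
  hence "((%k. (h \<bar>0 + k\<bar> - h \<bar>0\<bar>) / k) \<longlongrightarrow> 0) (at 0)" by (rule tendsto_rabs_zero_cancel)
  thus ?thesis unfolding DERIV_def 3 by simp
 qed
qed

section \<open>Duhamel integral and the wave equation with Dirichlet condition\<close>

definition Gam :: "(real => real => real) => real => real => real" where "Gam G s r = AI (G s) r"

text \<open>Duhamel's integral of the source \<open>G\<close>: half the integral over the backward light cone of \<open>(t,
  y)\<close>.\<close>
definition Dh :: "(real => real => real) => real => real => real" where
 "Dh G t y = (KK 1 (Gam G) t (y + 1 * t) - KK (-1) (Gam G) t (y + (-1) * t)) / 2"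

lemma cont_slice: "jcont G ==> continuous_on UNIV (G s)"
 by (rule cont2D) (auto intro: continuous_intros)

lemma Gam_continuous:
 assumes "jcont G"
 shows "jcont (Gam G)"
 unfolding Gam_def case_prod_beta'
 by (rule AI_continuous_param) (auto simp: case_prod_beta' intro!: cont2D[OF assms] continuous_intros)

lemma Gam_deriv: "jcont G ==> has_d (%r. Gam G s r) (G s r) r"
 unfolding Gam_def by (rule AI_deriv[OF cont_slice])

lemma Dh_derivs:
 assumes G: "jcont G"
 shows "has_d (%y. Dh G t y) ((KK 1 G t (y + 1 * t) - KK (-1) G t (y + (-1) * t)) / 2) y"
  "has_d (%t. Dh G t y) ((KK 1 G t (y + 1 * t) + KK (-1) G t (y + (-1) * t)) / 2) t"
proof -
 note K = KK_derivs[OF Gam_continuous[OF G] G Gam_deriv[OF G]]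
 show "has_d (%y. Dh G t y) ((KK 1 G t (y + 1 * t) - KK (-1) G t (y + (-1) * t)) / 2) y"
  unfolding Dh_def by (intro DERIV_cdivide DERIV_diff K(2))
 show "has_d (%t. Dh G t y) ((KK 1 G t (y + 1 * t) + KK (-1) G t (y + (-1) * t)) / 2) t"
  unfolding Dh_def by (rule DERIV_cong[OF DERIV_cdivide[OF DERIV_diff[OF K(1) K(1)]]]) simp
qed

lemma KK_cont:
 assumes "jcont G"
 shows "continuous_on UNIV (%(t, y). KK e G t (y + c * t))"
 unfolding case_prod_beta' by (rule cont2D[OF KK_continuous[OF assms]]) (auto intro!: continuous_intros)

lemma Dh_continuous:
 assumes "jcont G"
 shows "jcont (Dh G)"
 unfolding Dh_def case_prod_beta'
 using KK_cont[OF Gam_continuous[OF assms], of 1 1] KK_cont[OF Gam_continuous[OF assms], of "-1" "-1"]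
 by (intro continuous_on_divide continuous_on_diff continuous_on_const) (auto simp: case_prod_beta')

lemma Dh_bound:
 assumes G: "jcont G" and t: "t >= 0" and b: "continuous_on UNIV b"
  and B: "!!s r. s : {0..t} ==> \<bar>r - y\<bar> <= t - s ==> \<bar>G s r\<bar> <= b s"
 shows "\<bar>Dh G t y\<bar> <= integral {0..t} (%s. (t - s) * b s)"
proof -
 note GG = Gam_continuous[OF G]
 have c: "continuous_on UNIV (%s. Gam G s (y + 1 * t - 1 * s))" "continuous_on UNIV (%s. Gam G s (y + (-1) * t - (-1) * s))"
  by (intro cont2D[OF GG] continuous_intros)+
 have i: "h integrable_on {0..t}" if "continuous_on UNIV h" for h :: "real => real"
  by (intro integrable_continuous_real continuous_on_subset[OF that]) simp
 have e: "Dh G t y = integral {0..t} (%s. (Gam G s (y + 1 * t - 1 * s) - Gam G s (y + (-1) * t - (-1) * s)) / 2)"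
  using t by (simp add: Dh_def KK_def AI_def HK_diff[OF i[OF c(1)] i[OF c(2)], simplified])
 show ?thesis unfolding e real_norm_def[symmetric]
 proof (rule integral_norm_bound_integral)
  show "(%s. (Gam G s (y + 1 * t - 1 * s) - Gam G s (y + (-1) * t - (-1) * s)) / 2) integrable_on {0..t}"
   by (intro i continuous_intros c) auto
  show "(%s. (t - s) * b s) integrable_on {0..t}" by (intro i continuous_intros b)
  show "norm ((Gam G s (y + 1 * t - 1 * s) - Gam G s (y + (-1) * t - (-1) * s)) / 2) <= (t - s) * b s" if s: "s : {0..t}" for s
  proof -
   let ?I = "{y - (t - s)..y + (t - s)}"
   have "norm (Gam G s (y + (t - s)) - Gam G s (y - (t - s))) <= b s * norm ((y + (t - s)) - (y - (t - s)))"
   proof (rule field_differentiable_bound[of ?I])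
    show "(Gam G s has_field_derivative G s z) (at z within ?I)" for z
     by (rule DERIV_subset[OF Gam_deriv[OF G]]) simp
    show "norm (G s z) <= b s" if "z : ?I" for z
     using B[OF s, of z] that by (auto simp: abs_le_iff)
   qed (use s in auto)
   thus ?thesis using s by (simp add: algebra_simps)
  qed
 qed
qed

lemma exp_moment:
 fixes M t B :: real
 assumes "M > 0" "t >= 0"
 shows "integral {0..t} (%s. (t - s) * (B * exp (M * s))) = B * (exp (M * t) / M^2 - (t / M + 1 / M^2))"
proof -
 have "((%s. (t - s) * (B * exp (M * s))) has_integral
   (B * ((t - t) * exp (M * t) / M + exp (M * t) / M^2) - B * ((t - 0) * exp (M * 0) / M + exp (M * 0) / M^2))) {0..t}"
 proof (rule fundamental_theorem_of_calculus[where f="%s. B * ((t - s) * exp (M * s) / M + exp (M * s) / M^2)"])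
  fix s
  have "((%s. B * ((t - s) * exp (M * s) / M + exp (M * s) / M^2)) has_real_derivative (t - s) * (B * exp (M * s))) (at s within {0..t})"
   using assms(1) by (auto intro!: derivative_eq_intros simp: field_simps power2_eq_square)
  thus "((%s. B * ((t - s) * exp (M * s) / M + exp (M * s) / M^2)) has_vector_derivative (t - s) * (B * exp (M * s))) (at s within {0..t})"
   by (simp add: has_real_derivative_iff_has_vector_derivative)
 qed (use assms in simp)
 from integral_unique[OF this] show ?thesis by (simp add: algebra_simps)
qed

lemma AI_diff:
 assumes "continuous_on UNIV h" "continuous_on UNIV k"
 shows "AI (%x. h x - k x) r = AI h r - AI k r"
proof -
 have i: "h integrable_on {a..b}" "k integrable_on {a..b}" for a b
  by (intro integrable_continuous_real continuous_on_subset[OF assms(1)] continuous_on_subset[OF assms(2)]; simp)+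
 show ?thesis by (simp add: AI_def HK_diff[OF i])
qed

lemma Dh_diff:
 assumes G: "jcont G" and H: "jcont H"
 shows "Dh (%s r. G s r - H s r) t y = Dh G t y - Dh H t y"
proof -
 have g: "Gam (%s r. G s r - H s r) s r = Gam G s r - Gam H s r" for s r
  unfolding Gam_def by (rule AI_diff[OF cont_slice[OF G] cont_slice[OF H]])
 have kk: "KK e (Gam (%s r. G s r - H s r)) t c = KK e (Gam G) t c - KK e (Gam H) t c" for e c
  unfolding KK_def g
  by (rule AI_diff; intro cont2D[OF Gam_continuous[OF G]] cont2D[OF Gam_continuous[OF H]] continuous_intros)
 show ?thesis unfolding Dh_def kk by (simp add: diff_divide_distrib)
qed

lemma Dh_odd:
 assumes G: "jcont G" and o: "!!s r. G s (- r) = - G s r"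
 shows "Dh G t (- y) = - Dh G t y"
proof -
 have g: "Gam G s (- r) = Gam G s r" for s r unfolding Gam_def by (rule AI_odd[OF cont_slice[OF G] o])
 have 1: "Gam G s (- y + 1 * t - 1 * s) = Gam G s (y + (-1) * t - (-1) * s)" for s
  using g[of s "- y + 1 * t - 1 * s"] by (simp add: algebra_simps)
 have 2: "Gam G s (- y + (-1) * t - (-1) * s) = Gam G s (y + 1 * t - 1 * s)" for s
  using g[of s "- y + (-1) * t - (-1) * s"] by (simp add: algebra_simps)
 show ?thesis unfolding Dh_def KK_def 1 2 by (simp add: field_simps)
qed

text \<open>Solutions with all derivatives that the energy estimates differentiate under the integral; the derivatives exist on
  the whole plane, the equation and the boundary condition are for \<open>t >= 0\<close>.\<close>
definition c2_wave :: "(real => real) => real => (real => real) => (real => real => real) => (real => real => real) =>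
  (real => real => real) => (real => real => real) => (real => real => real) => (real => real => real) => bool" where
 "c2_wave V x0 w v vt vx vtt vtx vxx \<longleftrightarrow>
  (ALL t x. has_d (%t. v t x) (vt t x) t) & (ALL t x. has_d (%t. vt t x) (vtt t x) t) &
  (ALL t x. has_d (%t. vx t x) (vtx t x) t) & (ALL t x. has_d (%x. v t x) (vx t x) x) &
  (ALL t x. has_d (%x. vx t x) (vxx t x) x) & (ALL t x. has_d (%x. vt t x) (vtx t x) x) &
  jcont v & jcont vt & jcont vx &
  jcont vtt & jcont vtx & jcont vxx &
  (ALL t x. t >= 0 --> x >= x0 --> vtt t x = vxx t x - V x * v t x) &
  (ALL t. t >= 0 --> v t x0 = 0) & (\<forall>x\<ge>x0. v 0 x = w x) & (ALL x. vt 0 x = 0) &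
  (ALL t x. t >= 0 --> x >= t --> v t x = 0)"

text \<open>Reflect oddly about \<open>x0\<close>: the Dirichlet condition becomes oddness, and d'Alembert's formula on the whole
  line turns the equation into the Volterra equation \<open>v = (f(y+t) + f(y-t)) / 2 + Dh (- q v)\<close>.  Because
  \<open>w\<close> and \<open>w''\<close> vanish at \<open>x0\<close>, the reflected datum is \<open>C^2\<close> with an
  odd second derivative, so that the solution is \<open>C^2\<close> without further compatibility conditions.\<close>
lemma wave_exists:
 fixes V V1 w w1 w2 w3 :: "real => real"
 assumes V: "!!x. has_d V (V1 x) x" "continuous_on UNIV V1" "!!x. x >= x0 ==> \<bar>V x\<bar> <= Q"
  and w: "!!x. has_d w (w1 x) x" "!!x. has_d w1 (w2 x) x" "!!x. has_d w2 (w3 x) x"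
  and w0: "w x0 = 0" "w2 x0 = 0" and xz: "x0 <= 0" "!!x. x >= 0 ==> w x = 0"
 obtains v vt vx vtt vtx vxx where "c2_wave V x0 w v vt vx vtt vtx vxx"
proof -
 define f where "f y = sgn y * w (x0 + \<bar>y\<bar>)" for y
 define f1 where "f1 y = w1 (x0 + \<bar>y\<bar>)" for y
 define f2 where "f2 y = sgn y * w2 (x0 + \<bar>y\<bar>)" for y
 define q where "q y = V (x0 + \<bar>y\<bar>)" for y
 have sh: "has_d (%y. h (x0 + y)) (h1 (x0 + y)) y" if "!!x. has_d h (h1 x) x" for h h1 :: "real => real" and y
  by (rule DERIV_cong[OF DERIV_chain2[OF that]]) (auto intro!: derivative_eq_intros)
 have fd: "has_d f (f1 y) y" for y
  unfolding f_def[abs_def] f1_def using odd_ext_deriv[OF sh[OF w(1)], of y] w0(1) by simp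
 have f1d: "has_d f1 (f2 y) y" for y
  unfolding f1_def[abs_def] f2_def using even_ext_deriv[OF sh[OF w(2)], of y] w0(2) by simp
 have f2d: "has_d f2 (w3 (x0 + \<bar>y\<bar>)) y" for y
  unfolding f2_def[abs_def] using odd_ext_deriv[OF sh[OF w(3)], of y] w0(2) by simp
 have fc: "continuous_on A f" "continuous_on A f1" "continuous_on A f2" for A
  using fd f1d f2d by (auto intro!: continuous_at_imp_continuous_on DERIV_isCont)
 have Vc: "continuous_on A V" for A using V(1) by (auto intro!: continuous_at_imp_continuous_on DERIV_isCont)
 have qc: "continuous_on A q" for A
  unfolding q_def by (rule continuous_on_compose2[OF Vc[of UNIV]]) (auto intro!: continuous_intros)
 have qb: "\<bar>q y\<bar> <= Q" for y unfolding q_def by (rule V(3)) simp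
 have Q0: "Q >= 0" using qb[of 0] by linarith
 have fodd: "f (- y) = - f y" for y by (simp add: f_def sgn_minus)
 let ?r = "- x0"
 have fz: "f y = 0" if "\<bar>y\<bar> >= ?r" for y unfolding f_def using xz(2)[of "x0 + \<bar>y\<bar>"] that by simp
 obtain Cf where Cf: "Cf > 0" "!!y. \<bar>f y\<bar> <= Cf"
 proof -
  obtain B where B: "B > 0" "\<forall>y\<in>{-?r..?r}. norm (f y) <= B" by (rule compact_continuous_bound[OF compact_Icc fc(1)])
  have "\<bar>f y\<bar> <= B" for y
  proof (cases "\<bar>y\<bar> >= ?r")
   case True
   thus ?thesis using fz[OF True] B(1) by simp
  next
   case False
   hence "y : {-?r..?r}" unfolding atLeastAtMost_iff by linarith
   thus ?thesis using B(2) by simp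
  qed
  thus ?thesis using B(1) that by blast
 qed
 define GG where "GG u s r = - (q r * u s r)" for u :: "real => real => real" and s r
 have GGc: "jcont (GG u)" if "jcont u" for u
 proof -
  have "continuous_on UNIV (%p::real\<times>real. q (snd p))" by (rule continuous_on_compose2[OF qc[of UNIV]]) (auto intro!: continuous_intros)
  thus ?thesis using that unfolding GG_def case_prod_beta' by (intro continuous_intros)
 qed
 define F where "F u t y = (f (y + max 0 t) + f (y - max 0 t)) / 2 + Dh (GG u) (max 0 t) y" for u t y
 define M where "M = sqrt (2 * Q) + 1"
 have M: "M > 0" "2 * Q <= M^2"
 proof -
  show "M > 0" using Q0 by (simp add: M_def add_nonneg_pos)
  have "2 * Q = (sqrt (2 * Q))^2" using Q0 by simp
  also have "... <= M^2" unfolding M_def using Q0 by (intro power_mono) auto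
  finally show "2 * Q <= M^2" .
 qed
 have Dhb: "\<bar>Dh G t y\<bar> <= B * exp (M * t) / M^2" if G: "jcont G" and t: "t >= 0" and B: "B >= 0"
  and b: "!!s r. s >= 0 ==> \<bar>G s r\<bar> <= B * exp (M * s)" for G t y B
 proof -
  have "\<bar>Dh G t y\<bar> <= integral {0..t} (%s. (t - s) * (B * exp (M * s)))"
   by (rule Dh_bound[OF G t]) (auto intro!: continuous_intros b)
  also have "... = B * (exp (M * t) / M^2 - (t / M + 1 / M^2))" by (rule exp_moment[OF M(1) t])
  also have "... <= B * (exp (M * t) / M^2)"
  proof -
   have "0 <= t / M" "0 <= 1 / M^2" using M t by auto
   thus ?thesis using B by (intro mult_left_mono) linarith+
  qed
  finally show ?thesis by simp
 qed
 have Fcont: "jcont (F u)" if u: "jcont u" for u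
  unfolding F_def case_prod_beta'
  by (intro continuous_intros cont2D[OF Dh_continuous[OF GGc[OF u]]] continuous_on_compose2[OF fc(1)[of UNIV]]) auto
 obtain v0 where v0: "jcont v0" "ALL t y. F v0 t y = v0 t y"
  "ALL t y. (%n. (F ^^ n) (%_ _. 0) t y) \<longlonglongrightarrow> v0 t y"
 proof (rule volterra_fixed_point[of F M Cf])
  fix u w :: "real => real => real" and C t y
  assume u: "jcont u" and w: "jcont w" and C: "C >= 0"
   and le: "!!t y. \<bar>u t y - w t y\<bar> <= C * exp (M * max 0 t)"
  have "F u t y - F w t y = Dh (%s r. GG u s r - GG w s r) (max 0 t) y"
   unfolding F_def Dh_diff[OF GGc[OF u] GGc[OF w]] by simp
  also have "\<bar>...\<bar> <= (Q * C) * exp (M * max 0 t) / M^2"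
  proof (rule Dhb)
   show "continuous_on UNIV (%(s, r). GG u s r - GG w s r)"
    using continuous_on_diff[OF GGc[OF u] GGc[OF w]] by (simp add: case_prod_beta')
   fix s r :: real assume s: "s >= 0"
   have "\<bar>GG u s r - GG w s r\<bar> = \<bar>q r\<bar> * \<bar>u s r - w s r\<bar>"
    unfolding GG_def by (simp add: abs_mult[symmetric] right_diff_distrib)
   also have "... <= Q * (C * exp (M * s))"
    using le[of s r] s qb Q0 by (intro mult_mono) auto
   finally show "\<bar>GG u s r - GG w s r\<bar> <= Q * C * exp (M * s)" by simp
  qed (use Q0 C in auto)
  also have "... = (Q / M^2) * (C * exp (M * max 0 t))" by simp
  also have "... <= (1/2) * (C * exp (M * max 0 t))"
   using M C by (intro mult_right_mono) (auto simp: divide_le_eq)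
  finally show "\<bar>F u t y - F w t y\<bar> <= C / 2 * exp (M * max 0 t)" by simp
 next
  fix t y
  have "Dh (GG (%_ _. 0)) (max 0 t) y = 0"
   using Dhb[of "GG (%_ _. 0)" "max 0 t" 0 y] GGc[of "%_ _. 0"] by (simp add: GG_def)
  hence "\<bar>F (%_ _. 0) t y\<bar> = \<bar>(f (y + max 0 t) + f (y - max 0 t)) / 2\<bar>" by (simp add: F_def)
  also have "... <= Cf"
  proof -
   have "\<bar>(a + b) / 2\<bar> <= c" if "\<bar>a\<bar> <= c" "\<bar>b\<bar> <= c" for a b c :: real using that by (simp add: abs_le_iff)
   thus ?thesis using Cf(2) by blast
  qed
  also have "... <= Cf * exp (M * max 0 t)" using Cf(1) M(1) by simp
  finally show "\<bar>F (%_ _. 0) t y\<bar> <= Cf * exp (M * max 0 t)" .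
 qed (use Fcont in auto)
 have inv: "continuous_on UNIV (%(t, y). (F ^^ n) (%_ _. 0) t y) & (ALL t y. (F ^^ n) (%_ _. 0) t (- y) = - (F ^^ n) (%_ _. 0) t y)
   & (ALL t y. \<bar>y\<bar> >= ?r + max 0 t --> (F ^^ n) (%_ _. 0) t y = 0)" for n
 proof (induction n)
  case (Suc n)
  let ?u = "(F ^^ n) (%_ _. 0)"
  have u: "jcont ?u" "!!t y. ?u t (- y) = - ?u t y"
   "!!t y. \<bar>y\<bar> >= ?r + max 0 t ==> ?u t y = 0" using Suc by auto
  have "F ?u t (- y) = - F ?u t y" for t y
  proof -
   have "Dh (GG ?u) (max 0 t) (- y) = - Dh (GG ?u) (max 0 t) y"
    by (rule Dh_odd[OF GGc[OF u(1)]]) (simp add: GG_def q_def u(2))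
   moreover have "f (- y + max 0 t) = - f (y - max 0 t)" "f (- y - max 0 t) = - f (y + max 0 t)"
    using fodd[of "y - max 0 t"] fodd[of "y + max 0 t"] by (simp_all add: algebra_simps)
   ultimately show ?thesis unfolding F_def by (simp add: field_simps)
  qed
  moreover have "F ?u t y = 0" if y: "\<bar>y\<bar> >= ?r + max 0 t" for t y
  proof -
   have "\<bar>Dh (GG ?u) (max 0 t) y\<bar> <= integral {0..max 0 t} (%s. (max 0 t - s) * 0)"
   proof (rule Dh_bound[OF GGc[OF u(1)]])
    fix s r assume s: "s : {0..max 0 t}" "\<bar>r - y\<bar> <= max 0 t - s"
    have "\<bar>r\<bar> >= ?r + max 0 s" using s y by (auto simp: abs_if split: if_splits)
    thus "\<bar>GG ?u s r\<bar> <= 0" using u(3) by (simp add: GG_def)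
   qed auto
   moreover have "f (y + max 0 t) = 0" "f (y - max 0 t) = 0"
    using y by (auto intro!: fz simp: abs_if split: if_splits)
   ultimately show ?thesis by (simp add: F_def)
  qed
  ultimately show ?case using Fcont[OF u(1)] by simp
 qed simp
 have vodd: "v0 t (- y) = - v0 t y" for t y
 proof -
  have "(%n. (F ^^ n) (%_ _. 0) t (- y)) \<longlonglongrightarrow> - v0 t y"
   using tendsto_minus[OF v0(3)[rule_format, of t y]] inv by simp
  thus ?thesis using v0(3)[rule_format, of t "- y"] LIMSEQ_unique by blast
 qed
 have vsupp: "v0 t y = 0" if "\<bar>y\<bar> >= ?r + max 0 t" for t y
 proof -
  have "(%n. (F ^^ n) (%_ _. 0) t y) \<longlonglongrightarrow> 0" using inv that by simp
  thus ?thesis using v0(3)[rule_format, of t y] LIMSEQ_unique by blast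
 qed
 let ?G = "GG v0"
 note Gc = GGc[OF v0(1)]
 define z where "z t y = (f (y + t) + f (y - t)) / 2 + Dh ?G t y" for t y
 define zy where "zy t y = (f1 (y + t) + f1 (y - t)) / 2 + (KK 1 ?G t (y + 1 * t) - KK (-1) ?G t (y + (-1) * t)) / 2" for t y
 define zt where "zt t y = (f1 (y + t) - f1 (y - t)) / 2 + (KK 1 ?G t (y + 1 * t) + KK (-1) ?G t (y + (-1) * t)) / 2" for t y
 have v0z: "v0 t y = z (max 0 t) y" for t y
  using v0(2)[rule_format, of t y] unfolding z_def F_def by simp
 have shy: "has_d (%y. h (y + c)) (h1 (y + c)) y" "has_d (%t. h (y + t)) (h1 (y + t)) t"
  "has_d (%y. h (y - c)) (h1 (y - c)) y" "has_d (%t. h (y - t)) (- h1 (y - t)) t"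
  if "!!x. has_d h (h1 x) x" for h h1 :: "real => real" and y t c
 proof -
  have "has_d (%t. y - t) (-1) t" by (auto intro!: derivative_eq_intros)
  from DERIV_chain2[OF that this] show "has_d (%t. h (y - t)) (- h1 (y - t)) t" by simp
 qed (rule DERIV_cong[OF DERIV_chain2[OF that]]; auto intro!: derivative_eq_intros)+
 have zd: "has_d (%y. z t y) (zy t y) y" "has_d (%t. z t y) (zt t y) t" for t y
  unfolding z_def zy_def zt_def
  by (rule DERIV_cong[OF DERIV_add[OF DERIV_cdivide[OF DERIV_add[OF shy(1)[OF fd] shy(3)[OF fd]]] Dh_derivs(1)[OF Gc]]], simp)
    (rule DERIV_cong[OF DERIV_add[OF DERIV_cdivide[OF DERIV_add[OF shy(2)[OF fd] shy(4)[OF fd]]] Dh_derivs(2)[OF Gc]]], simp)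
 have cf: "continuous_on UNIV (%p::real\<times>real. h (snd p + fst p))" "continuous_on UNIV (%p::real\<times>real. h (snd p - fst p))"
  if "continuous_on UNIV h" for h :: "real => real"
  by (rule continuous_on_compose2[OF that]; auto intro!: continuous_intros)+
 have KKc: "continuous_on UNIV (%p. KK 1 G (fst p) (snd p + 1 * fst p))" "continuous_on UNIV (%p. KK (-1) G (fst p) (snd p + (-1) * fst p))"
  if "jcont G" for G
  using KK_cont[OF that, of 1 1] KK_cont[OF that, of "-1" "-1"] by (simp_all add: case_prod_beta')
 have zc: "jcont z"
  unfolding z_def case_prod_beta' using Dh_continuous[OF Gc] by (intro continuous_intros cf fc) (simp_all add: case_prod_beta')
 have zyc: "jcont zy" and ztc: "jcont zt"
  unfolding zy_def zt_def case_prod_beta' by (intro continuous_intros cf fc KKc Gc; simp)+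
 define vy where "vy t y = zy (max 0 t) y" for t y
 have vyd: "has_d (%y. v0 t y) (vy t y) y" for t y
  unfolding v0z vy_def by (rule zd(1))
 have vyc: "jcont vy"
  unfolding vy_def case_prod_beta' by (rule cont2D[OF zyc]) (auto intro!: continuous_intros)
 define Gy where "Gy t y = - (V1 (x0 + \<bar>y\<bar>) * v0 t \<bar>y\<bar> + V (x0 + \<bar>y\<bar>) * vy t \<bar>y\<bar>)" for t y
 have v00: "v0 t 0 = 0" for t using vodd[of t 0] by simp
 have Gd: "has_d (%y. ?G t y) (Gy t y) y" for t y
 proof -
  have 1: "has_d (%y. - (V (x0 + y) * v0 t y)) (- (V1 (x0 + y) * v0 t y + V (x0 + y) * vy t y)) y" for y
   by (rule DERIV_cong[OF DERIV_minus[OF DERIV_mult[OF sh[OF V(1)] vyd]]]) simp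
  have "has_d (%y. sgn y * - (V (x0 + \<bar>y\<bar>) * v0 t \<bar>y\<bar>)) (Gy t y) y"
   unfolding Gy_def by (rule odd_ext_deriv[OF 1]) (simp add: v00)
  moreover have "sgn y * - (V (x0 + \<bar>y\<bar>) * v0 t \<bar>y\<bar>) = ?G t y" for y
  proof -
   have "v0 t y = sgn y * v0 t \<bar>y\<bar>"
    using vodd[of t "- y"] v00[of t] by (cases "y > 0"; cases "y = 0") auto
   thus ?thesis by (simp add: GG_def q_def)
  qed
  ultimately show ?thesis by simp
 qed
 have Gyc: "jcont Gy"
  unfolding Gy_def case_prod_beta'
  by (intro continuous_intros cont2D[OF v0(1)] cont2D[OF vyc] continuous_on_compose2[OF V(2)] continuous_on_compose2[OF Vc[of UNIV]]) auto
 note KD = KK_derivs[OF Gc Gyc Gd]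
 define zyy where "zyy t y = (f2 (y + t) + f2 (y - t)) / 2 + (KK 1 Gy t (y + 1 * t) - KK (-1) Gy t (y + (-1) * t)) / 2" for t y
 define zty where "zty t y = (f2 (y + t) - f2 (y - t)) / 2 + (KK 1 Gy t (y + 1 * t) + KK (-1) Gy t (y + (-1) * t)) / 2" for t y
 define ztt where "ztt t y = zyy t y + ?G t y" for t y
 have d1: "has_d (%y. zy t y) (zyy t y) y" for t y
  unfolding zy_def zyy_def
  by (rule DERIV_cong[OF DERIV_add[OF DERIV_cdivide[OF DERIV_add[OF shy(1)[OF f1d] shy(3)[OF f1d]]] DERIV_cdivide[OF DERIV_diff[OF KD(2) KD(2)]]]]) simp
 have d2: "has_d (%y. zt t y) (zty t y) y" for t y
  unfolding zt_def zty_def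
  by (rule DERIV_cong[OF DERIV_add[OF DERIV_cdivide[OF DERIV_diff[OF shy(1)[OF f1d] shy(3)[OF f1d]]] DERIV_cdivide[OF DERIV_add[OF KD(2) KD(2)]]]]) simp
 have d3: "has_d (%t. zy t y) (zty t y) t" for t y
  unfolding zy_def zty_def
  by (rule DERIV_cong[OF DERIV_add[OF DERIV_cdivide[OF DERIV_add[OF shy(2)[OF f1d] shy(4)[OF f1d]]] DERIV_cdivide[OF DERIV_diff[OF KD(1) KD(1)]]]]) simp
 have d4: "has_d (%t. zt t y) (ztt t y) t" for t y
  unfolding zt_def ztt_def zyy_def
  by (rule DERIV_cong[OF DERIV_add[OF DERIV_cdivide[OF DERIV_diff[OF shy(2)[OF f1d] shy(4)[OF f1d]]] DERIV_cdivide[OF DERIV_add[OF KD(1) KD(1)]]]]) (simp add: field_simps)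
 have zyyc: "jcont zyy" and ztyc: "jcont zty"
  unfolding zyy_def zty_def case_prod_beta' by (intro continuous_intros cf fc KKc Gyc; simp)+
 have zttc: "jcont ztt"
  using continuous_on_add[OF zyyc Gc] by (simp add: ztt_def case_prod_beta')
 have shift: "has_d (%x. h (x - x0)) (h' (x - x0)) x" if "!!y. has_d h (h' y) y" for h h' :: "real => real" and x
  by (rule DERIV_cong[OF DERIV_chain2[OF that]]) (auto intro!: derivative_eq_intros)
 have cs: "continuous_on UNIV (%(t, x). h t (x - x0))" if "jcont h" for h :: "real => real => real"
  unfolding case_prod_beta' by (rule cont2D[OF that]) (auto intro!: continuous_intros)
 show ?thesis
 proof (rule that[of "%t x. z t (x - x0)" "%t x. zt t (x - x0)" "%t x. zy t (x - x0)" "%t x. ztt t (x - x0)" "%t x. zty t (x - x0)" "%t x. zyy t (x - x0)"], unfold c2_wave_def, intro conjI)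
  show "ALL t x. t >= 0 --> x >= x0 --> ztt t (x - x0) = zyy t (x - x0) - V x * z t (x - x0)"
   using v0z by (auto simp: ztt_def GG_def q_def)
  show "\<forall>t\<ge>0. z t (x0 - x0) = 0" using v0z v00 by (metis diff_self max_absorb2)
  have D0: "Dh ?G 0 y = 0" for y by (simp add: Dh_def KK_def)
  show "\<forall>x\<ge>x0. z 0 (x - x0) = w x"
   using w0(1) by (auto simp: z_def D0 f_def sgn_if)
  show "ALL x. zt 0 (x - x0) = 0" by (simp add: zt_def KK_def)
  show "ALL t x. t >= 0 --> x >= t --> z t (x - x0) = 0"
  proof (intro allI impI)
   fix t x :: real assume "t >= 0" "x >= t"
   thus "z t (x - x0) = 0" using vsupp[of t "x - x0"] v0z[of t "x - x0"] by simp
  qed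
 qed (use zd d1 d2 d3 d4 shift[OF zd(1)] shift[OF d1] shift[OF d2] cs[OF zc] cs[OF zyc] cs[OF ztc] cs[OF zyyc] cs[OF ztyc] cs[OF zttc] in blast)+
qed

section \<open>Eigenfunctions in the well\<close>

lemma AI_bound_exp:
 assumes h: "continuous_on UNIV h" and t: "t >= 0" and M: "M > 0" and B: "B >= 0"
  and b: "!!s. s : {0..t} ==> \<bar>h s\<bar> <= B * exp (M * s)"
 shows "\<bar>AI h t\<bar> <= B * exp (M * t) / M"
proof -
 have i: "((%s. B * exp (M * s)) has_integral (B * exp (M * t) / M - B * exp (M * 0) / M)) {0..t}"
  by (rule has_integral_deriv[where F="%s. B * exp (M * s) / M", OF t]) (use M in "auto intro!: derivative_eq_intros")
 have "norm (integral {0..t} h) <= integral {0..t} (%s. B * exp (M * s))"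
  by (rule integral_norm_bound_integral)
    (use i b in "auto intro: integrable_continuous_real continuous_on_subset[OF h] has_integral_integrable")
 also have "... = B * exp (M * t) / M - B * exp (M * 0) / M" by (rule integral_unique[OF i])
 also have "... <= B * exp (M * t) / M" using B M by simp
 finally show ?thesis using t by (simp add: AI_def)
qed

text \<open>The solutions with \<open>W 0 = 0\<close>, \<open>W' 0 = 1\<close>, jointly continuous in the energy.  Clamping the
  energy to \<open>[0, Em]\<close> makes the Volterra equation uniform in it; for even \<open>V\<close> the odd
  reflection solves the equation for negative times.\<close>
lemma ode_exists:
 fixes V :: "real => real"
 assumes V: "continuous_on UNIV V" "!!x. \<bar>V x\<bar> <= Q" "!!x. V (- x) = V x" and Em: "Em >= 0"
 obtains W W1 where
  "\<forall>E\<in>{0..Em}. ALL t. has_d (W E) (W1 E t) t"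
  "\<forall>E\<in>{0..Em}. ALL t. has_d (W1 E) ((V t - E) * W E t) t"
  "ALL E. W E 0 = 0" "ALL E. W1 E 0 = 1" "continuous_on ({0..Em} \<times> {0..}) (%(E, t). W E t)"
  "ALL E t. W E (- t) = - W E t"
proof -
 define cl where "cl E = max 0 (min Em E)" for E
 have cl: "cl E = E" if "E : {0..Em}" for E using that by (auto simp: cl_def)
 have clb: "\<bar>V x - cl E\<bar> <= Q + Em" for x E
 proof -
  have "0 <= cl E" "cl E <= Em" using Em by (auto simp: cl_def)
  thus ?thesis using V(2)[of x] by linarith
 qed
 have Q0: "Q >= 0" using V(2)[of 0] by linarith
 have clc: "continuous_on A cl" for A unfolding cl_def by (intro continuous_intros)
 define HH where "HH u E s = (V s - cl E) * u s E" for u :: "real => real => real" and E s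
 have HHc: "jcont (HH u)" if "jcont u" for u
  unfolding HH_def case_prod_beta'
  by (intro continuous_intros cont2D[OF that] continuous_on_compose2[OF V(1)] continuous_on_compose2[OF clc[of UNIV]]) auto
 define I1 where "I1 u E t = AI (HH u E) t" for u E t
 have I1c: "jcont (I1 u)" if "jcont u" for u
  unfolding I1_def case_prod_beta'
  by (rule AI_continuous_param) (auto simp: case_prod_beta' intro!: cont2D[OF HHc[OF that]] continuous_intros)
 define I2 where "I2 u E t = AI (I1 u E) t" for u E t
 have I2c: "jcont (I2 u)" if "jcont u" for u
  unfolding I2_def case_prod_beta'
  by (rule AI_continuous_param) (auto simp: case_prod_beta' intro!: cont2D[OF I1c[OF that]] continuous_intros)
 define F where "F u t E = max 0 t + I2 u E (max 0 t)" for u t E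
 (* chosen so that two integrations of (V - E) u gain a factor 1/2 in the weighted norm *)
 define M where "M = sqrt (2 * (Q + Em)) + 1"
 have M: "M >= 1" "M > 0" "2 * (Q + Em) <= M^2"
 proof -
  show "M >= 1" "M > 0" using Q0 Em by (auto simp: M_def intro: add_nonneg_pos)
  have "2 * (Q + Em) = (sqrt (2 * (Q + Em)))^2" using Q0 Em by simp
  also have "... <= M^2" unfolding M_def using Q0 Em by (intro power_mono) auto
  finally show "2 * (Q + Em) <= M^2" .
 qed
 note sl = cont_slice
 obtain v where v: "jcont v" "ALL t E. F v t E = v t E"
 proof (rule volterra_fixed_point[of F M 1])
  show "jcont (F u)" if "jcont u" for u
   unfolding F_def case_prod_beta' by (intro continuous_intros cont2D[OF I2c[OF that]])
  fix u w :: "real => real => real" and C t E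
  assume u: "jcont u" and w: "jcont w" and C: "C >= 0"
   and le: "!!t E. \<bar>u t E - w t E\<bar> <= C * exp (M * max 0 t)"
  let ?d = "%s. HH u E s - HH w E s"
  have d1: "I1 u E r - I1 w E r = AI ?d r" for r
   unfolding I1_def by (rule AI_diff[OF sl[OF HHc[OF u]] sl[OF HHc[OF w]], symmetric])
  have d2: "I2 u E r - I2 w E r = AI (%r. I1 u E r - I1 w E r) r" for r
   unfolding I2_def by (rule AI_diff[OF sl[OF I1c[OF u]] sl[OF I1c[OF w]], symmetric])
  have b1: "\<bar>I1 u E r - I1 w E r\<bar> <= (Q + Em) * C * exp (M * r) / M" if r: "r >= 0" for r
   unfolding d1
  proof (rule AI_bound_exp[OF _ r M(2)])
   show "continuous_on UNIV ?d" by (intro continuous_intros sl[OF HHc[OF u]] sl[OF HHc[OF w]])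
   show "\<bar>?d s\<bar> <= (Q + Em) * C * exp (M * s)" if s: "s : {0..r}" for s
   proof -
    have "\<bar>?d s\<bar> = \<bar>V s - cl E\<bar> * \<bar>u s E - w s E\<bar>" by (simp add: HH_def abs_mult[symmetric] right_diff_distrib)
    also have "... <= (Q + Em) * (C * exp (M * s))"
     using le[of s E] s Q0 Em by (intro mult_mono clb) auto
    finally show ?thesis by simp
   qed
  qed (use Q0 Em C in auto)
  have "\<bar>F u t E - F w t E\<bar> = \<bar>AI (%r. I1 u E r - I1 w E r) (max 0 t)\<bar>" by (simp add: F_def d2[symmetric])
  also have "... <= ((Q + Em) * C / M) * exp (M * max 0 t) / M"
  proof (rule AI_bound_exp)
   show "continuous_on UNIV (%r. I1 u E r - I1 w E r)" by (intro continuous_intros sl[OF I1c[OF u]] sl[OF I1c[OF w]])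
   show "\<bar>I1 u E s - I1 w E s\<bar> <= ((Q + Em) * C / M) * exp (M * s)" if "s : {0..max 0 t}" for s
    using b1[of s] that by simp
  qed (use M Q0 Em C in auto)
  also have "... = ((Q + Em) / M^2) * (C * exp (M * max 0 t))" by (simp add: power2_eq_square)
  also have "... <= (1/2) * (C * exp (M * max 0 t))"
   using M C by (intro mult_right_mono) (auto simp: divide_le_eq)
  finally show "\<bar>F u t E - F w t E\<bar> <= C / 2 * exp (M * max 0 t)" by simp
 next
  fix t E
  have H0: "HH (%_ _. 0) E = (%_. 0)" by (simp add: HH_def fun_eq_iff)
  have A0: "AI (%_. 0) = (%_. 0)" by (simp add: AI_def fun_eq_iff)
  have "\<bar>F (%_ _. 0) t E\<bar> = max 0 t" by (simp add: F_def I2_def I1_def[abs_def] H0 A0)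
  also have "... <= M * max 0 t" using M(1) by (simp add: mult_le_cancel_right1)
  also have "... <= exp (M * max 0 t)" using exp_ge_add_one_self[of "M * max 0 t"] by linarith
  finally show "\<bar>F (%_ _. 0) t E\<bar> <= 1 * exp (M * max 0 t)" by simp
 qed
 define z where "z E t = t + I2 v E t" for E t
 define z1 where "z1 E t = 1 + I1 v E t" for E t
 have vz: "v t E = z E (max 0 t)" for t E using v(2)[rule_format, of t E] by (simp add: F_def z_def)
 have zd: "has_d (z E) (z1 E t) t" for E t
  unfolding z_def[abs_def] z1_def I2_def
  by (intro DERIV_add DERIV_ident AI_deriv sl[OF I1c[OF v(1)]])
 have z1d: "has_d (z1 E) (HH v E t) t" for E t
  unfolding z1_def[abs_def] I1_def using DERIV_add[OF DERIV_const AI_deriv[OF sl[OF HHc[OF v(1)]]]] by simp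
 define W where "W E t = sgn t * z E \<bar>t\<bar>" for E t
 define W1 where "W1 E t = z1 E \<bar>t\<bar>" for E t
 have z0: "z E 0 = 0" for E by (simp add: z_def I2_def)
 have v0: "v 0 E = 0" for E using vz[of 0 E] z0 by simp
 show ?thesis
 proof (rule that[of W W1])
  show "\<forall>E\<in>{0..Em}. ALL t. has_d (W E) (W1 E t) t"
   unfolding W_def[abs_def] W1_def using odd_ext_deriv[OF zd z0] by blast
  show "\<forall>E\<in>{0..Em}. ALL t. has_d (W1 E) ((V t - E) * W E t) t"
  proof (intro ballI allI)
   fix E t assume E: "E : {0..Em}"
   have "HH v E 0 = 0" by (simp add: HH_def v0)
   from even_ext_deriv[OF z1d this, of t]
   have "has_d (W1 E) (sgn t * HH v E \<bar>t\<bar>) t" by (simp add: W1_def[abs_def])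
   moreover have "V \<bar>t\<bar> = V t" using V(3)[of t] by (cases "t >= 0") auto
   ultimately show "has_d (W1 E) ((V t - E) * W E t) t"
    by (simp add: HH_def cl[OF E] W_def vz mult_ac)
  qed
  show "ALL E. W E 0 = 0" by (simp add: W_def)
  show "ALL E. W1 E 0 = 1" by (simp add: W1_def z1_def I1_def)
  show "ALL E t. W E (- t) = - W E t" by (simp add: W_def sgn_minus)
  have "continuous_on ({0..Em} \<times> {0..}) (%p. v (snd p) (fst p))"
   by (intro cont2D[OF v(1)] continuous_intros)
  thus "continuous_on ({0..Em} \<times> {0..}) (%(E, t). W E t)"
  proof (rule continuous_on_eq)
   fix p :: "real \<times> real" assume "p : {0..Em} \<times> {0..}"
   thus "v (snd p) (fst p) = (case p of (E, t) => W E t)"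
    using z0 by (cases "snd p > 0") (auto simp: vz W_def case_prod_beta')
  qed
 qed
qed

text \<open>Below the barrier, that is for \<open>g >= \<mu>^2\<close>, the quantity \<open>exp(\<mu> t) (W' - \<mu> W)\<close>
  does not decrease, hence \<open>W' >= \<mu> W\<close>.\<close>
lemma ode_growth:
 fixes W W1 g :: "real => real"
 assumes W: "!!t. has_d W (W1 t) t" "!!t. has_d W1 (g t * W t) t"
  and 0: "W 0 = 0" "W1 0 = 1" and g: "!!t. t : {0..\<tau>} ==> g t >= \<mu>^2" and \<mu>: "\<mu> >= 0"
 shows "t : {0<..\<tau>} ==> W t > 0" "t : {0..\<tau>} ==> W1 t >= 0"
  "0 <= s ==> s <= t ==> t <= \<tau> ==> W s * exp (\<mu> * (t - s)) <= W t"
  "0 <= s ==> h > 0 ==> s + h <= \<tau> ==> W1 s <= W (s + h) / h"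
proof -
 have WW1: "W t * W1 t >= 0" if "t : {0..\<tau>}" for t
 proof -
  have "W 0 * W1 0 <= W t * W1 t"
  proof (rule DERIV_nonneg_imp_nondecreasing[where f="%t. W t * W1 t"])
   fix x assume x: "0 <= x" "x <= t"
   have "has_d (%t. W t * W1 t) (W1 x * W1 x + g x * W x * W x) x"
    by (rule DERIV_mult[OF W])
   moreover have "W1 x * W1 x + g x * W x * W x >= 0"
   proof -
    have "x : {0..\<tau>}" using x that by simp
    hence "0 <= g x" by (rule order_trans[OF zero_le_power2 g])
    thus ?thesis by (simp add: mult.assoc)
   qed
   ultimately show "EX y. has_d (%t. W t * W1 t) y x & 0 <= y" by blast
  qed (use that in simp)
  thus ?thesis using 0 by simp
 qed
 have mono: "(W s)^2 <= (W t)^2" if "0 <= s" "s <= t" "t <= \<tau>" for s t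
 proof (rule DERIV_nonneg_imp_nondecreasing[OF that(2)])
  fix x assume x: "s <= x" "x <= t"
  have "has_d (%t. (W t)^2) (2 * (W x * W1 x)) x"
   by (rule DERIV_cong[OF DERIV_power[OF W(1)]]) simp
  moreover have "2 * (W x * W1 x) >= 0" using WW1[of x] x that by simp
  ultimately show "EX y. has_d (%t. (W t)^2) y x & 0 <= y" by blast
 qed
 obtain d where d: "d > 0" "!!h. 0 < h ==> h < d ==> 0 < W h"
  using DERIV_pos_inc_right[OF W(1)[of 0]] 0 by auto
 have nz: "W t ~= 0" if t: "t : {0<..\<tau>}" for t
 proof
  assume z: "W t = 0"
  define s where "s = min (d/2) t"
  have s: "0 < s" "s < d" "s <= t" using d(1) t by (auto simp: s_def)
  hence "(W s)^2 <= 0" using mono[of s t] t z by auto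
  thus False using d(2)[OF s(1,2)] by simp
 qed
 show pos: "W t > 0" if t: "t : {0<..\<tau>}" for t
 proof (rule ccontr)
  assume "\<not> W t > 0"
  hence neg: "W t <= 0" by simp
  define s where "s = min (d/2) t"
  have s: "0 < s" "s < d" "s <= t" using d(1) t by (auto simp: s_def)
  have "EX x. s <= x & x <= t & W x = 0"
   using IVT2[of W t 0 s] neg d(2)[OF s(1,2)] s(3) DERIV_isCont[OF W(1)] by (auto intro: less_imp_le)
  thus False using nz s t by fastforce
 qed
 have key: "W1 t >= \<mu> * W t" if t: "t : {0..\<tau>}" for t
 proof -
  have "exp (\<mu> * 0) * (W1 0 - \<mu> * W 0) <= exp (\<mu> * t) * (W1 t - \<mu> * W t)"
  proof (rule DERIV_nonneg_imp_nondecreasing[where f="%t. exp (\<mu> * t) * (W1 t - \<mu> * W t)"])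
   fix x assume x: "0 <= x" "x <= t"
   have "has_d (%t. exp (\<mu> * t) * (W1 t - \<mu> * W t)) (exp (\<mu> * x) * ((g x - \<mu>^2) * W x)) x"
    by (auto intro!: derivative_eq_intros W simp: algebra_simps power2_eq_square)
   moreover have "exp (\<mu> * x) * ((g x - \<mu>^2) * W x) >= 0"
   proof (cases "x = 0")
    case False
    hence "W x > 0" using pos[of x] x t by auto
    thus ?thesis using g[of x] x t by simp
   qed (simp add: 0)
   ultimately show "EX y. has_d (%t. exp (\<mu> * t) * (W1 t - \<mu> * W t)) y x & 0 <= y"
    by blast
  qed (use t in simp)
  hence "1 <= exp (\<mu> * t) * (W1 t - \<mu> * W t)" using 0 by simp
  hence "0 < W1 t - \<mu> * W t" by (meson exp_gt_zero less_le_trans zero_less_mult_pos zero_less_one)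
  thus ?thesis by simp
 qed
 have Wn: "W t >= 0" if "t : {0..\<tau>}" for t using pos[of t] 0 that by (cases "t = 0") auto
 show W1n: "W1 t >= 0" if t: "t : {0..\<tau>}" for t
  using key[OF t] Wn[OF t] \<mu> mult_nonneg_nonneg order_trans by blast
 show "W s * exp (\<mu> * (t - s)) <= W t" if st: "0 <= s" "s <= t" "t <= \<tau>" for s t
 proof -
  have "W s * exp (- \<mu> * s) <= W t * exp (- \<mu> * t)"
  proof (rule DERIV_nonneg_imp_nondecreasing[OF st(2)])
   fix x assume x: "s <= x" "x <= t"
   have "has_d (%t. W t * exp (- \<mu> * t)) ((W1 x - \<mu> * W x) * exp (- \<mu> * x)) x"
    by (auto intro!: derivative_eq_intros W simp: algebra_simps)
   moreover have "(W1 x - \<mu> * W x) * exp (- \<mu> * x) >= 0" using key[of x] x st by simp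
   ultimately show "EX y. has_d (%t. W t * exp (- \<mu> * t)) y x & 0 <= y" by blast
  qed
  hence "W s * exp (- \<mu> * s) * exp (\<mu> * t) <= W t * exp (- \<mu> * t) * exp (\<mu> * t)" by simp
  thus ?thesis by (simp add: mult.assoc exp_add[symmetric] algebra_simps)
 qed
 show "W1 s <= W (s + h) / h" if sh: "0 <= s" "h > 0" "s + h <= \<tau>" for s h
 proof -
  have m1: "W1 s <= W1 r" if "s <= r" "r <= \<tau>" for r
  proof (rule DERIV_nonneg_imp_nondecreasing[OF that(1)])
   fix x assume x: "s <= x" "x <= r"
   have "x : {0..\<tau>}" using x that sh by simp
   hence "0 <= g x" by (rule order_trans[OF zero_le_power2 g])
   hence "g x * W x >= 0" using Wn[of x] x that sh by simp
   thus "EX y. has_d W1 y x & 0 <= y" using W(2)[of x] by blast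
  qed
  obtain z where z: "s < z" "z < s + h" "W (s + h) - W s = (s + h - s) * W1 z"
   using MVT2[of s "s + h" W W1] W(1) sh by auto
  have "h * W1 s <= h * W1 z" using m1[of z] z sh by (intro mult_left_mono) auto
  also have "... <= W (s + h)" using z(3) Wn[of s] sh by simp
  finally show ?thesis using sh by (simp add: field_simps)
 qed
qed

text \<open>\<open>(W^2 + W'^2) exp((1 + K) t)\<close> does not decrease.\<close>
lemma ode_no_double_zero:
 fixes W W1 g :: "real => real"
 assumes W: "!!t. has_d W (W1 t) t" "!!t. has_d W1 (g t * W t) t"
  and 0: "W 0 = 0" "W1 0 = 1" and g: "!!t. \<bar>g t\<bar> <= K" and t: "t >= 0" "W t = 0"
 shows "W1 t ~= 0"
proof
 assume z: "W1 t = 0"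
 have K: "K >= 0" using g[of 0] by linarith
 have "((W 0)^2 + (W1 0)^2) * exp ((1 + K) * 0) <= ((W t)^2 + (W1 t)^2) * exp ((1 + K) * t)"
 proof (rule DERIV_nonneg_imp_nondecreasing[OF t(1)])
  fix x
  have d: "((%t. ((W t)^2 + (W1 t)^2) * exp ((1 + K) * t)) has_real_derivative
    (2 * (1 + g x) * (W x * W1 x) + (1 + K) * ((W x)^2 + (W1 x)^2)) * exp ((1 + K) * x)) (at x)"
   by (auto intro!: derivative_eq_intros W simp: algebra_simps power2_eq_square)
  have "\<bar>2 * (1 + g x) * (W x * W1 x)\<bar> = \<bar>1 + g x\<bar> * (2 * \<bar>W x\<bar> * \<bar>W1 x\<bar>)" unfolding abs_mult by simp
  also have "... <= (1 + K) * ((W x)^2 + (W1 x)^2)"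
  proof (intro mult_mono)
   show "\<bar>1 + g x\<bar> <= 1 + K" using g[of x] by linarith
   show "2 * \<bar>W x\<bar> * \<bar>W1 x\<bar> <= (W x)^2 + (W1 x)^2" using sum_squares_bound[of "\<bar>W x\<bar>" "\<bar>W1 x\<bar>"] by simp
  qed (use K in auto)
  finally have "0 <= 2 * (1 + g x) * (W x * W1 x) + (1 + K) * ((W x)^2 + (W1 x)^2)" by linarith
  thus "EX y. has_d (%t. ((W t)^2 + (W1 t)^2) * exp ((1 + K) * t)) y x & 0 <= y"
   by (intro exI[of _ "(2 * (1 + g x) * (W x * W1 x) + (1 + K) * ((W x)^2 + (W1 x)^2)) * exp ((1 + K) * x)"] conjI d mult_nonneg_nonneg) auto
 qed
 thus False using 0 t z by simp
qed

text \<open>Comparison with \<open>sin(k (t - a))\<close>, \<open>k = pi / (b - a)\<close>: were \<open>W\<close> positive, the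
  Wronskian could not decrease, but it changes sign.\<close>
lemma sturm_zero:
 fixes W W1 g :: "real => real"
 assumes W: "!!t. has_d W (W1 t) t" "!!t. has_d W1 (g t * W t) t"
  and ab: "a < b" and g: "!!t. t : {a..b} ==> g t <= - ((pi / (b - a))^2)"
 shows "\<exists>t\<in>{a..b}. W t <= 0"
proof (rule ccontr)
 assume "\<not> (\<exists>t\<in>{a..b}. W t <= 0)"
 hence pos: "!!t. t : {a..b} ==> W t > 0" by force
 define k where "k = pi / (b - a)"
 have k: "k > 0" "k * (b - a) = pi" using ab by (auto simp: k_def)
 let ?J = "%t. W t * (k * cos (k * (t - a))) - W1 t * sin (k * (t - a))"
 have "?J a <= ?J b"
 proof (rule DERIV_nonneg_imp_nondecreasing[where f="?J"])
  fix x assume x: "a <= x" "x <= b"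
  have s: "sin (k * (x - a)) >= 0"
  proof (rule sin_ge_zero)
   have "k * (x - a) <= k * (b - a)" using x k(1) by (intro mult_left_mono) auto
   thus "k * (x - a) <= pi" using k(2) by simp
  qed (use x k in simp)
  have "has_d ?J (W x * sin (k * (x - a)) * (- (k^2) - g x)) x"
   by (auto intro!: derivative_eq_intros W simp: algebra_simps power2_eq_square)
  moreover have "W x * sin (k * (x - a)) * (- (k^2) - g x) >= 0"
   using s pos[of x] g[of x] x by (intro mult_nonneg_nonneg) (auto simp: k_def intro: less_imp_le)
  ultimately show "EX y. has_d ?J y x & 0 <= y" by blast
 qed (use ab in simp)
 hence "W a * k <= - (W b * k)" by (simp add: k(2))
 moreover have "W a * k > 0" "W b * k > 0" using pos ab k(1) by auto
 ultimately show False by linarith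
qed

text \<open>At \<open>E = E2\<close> the solution has a zero in the well by Sturm comparison, at \<open>E = E1\<close> it has
  none.  Take the smallest energy for which \<open>W\<close> is somewhere \<open><= 0\<close>, by compactness.  There
  \<open>W >= 0\<close>, and a zero inside the well would be a double zero; so the zero is at \<open>\<tau>0\<close>.\<close>
lemma eigenvalue_exists:
 fixes V :: "real => real"
 assumes V: "continuous_on UNIV V" "!!x. \<bar>V x\<bar> <= Q" "!!x. V (- x) = V x"
  and E: "0 <= E1" "E1 <= E2" and \<tau>: "0 < \<tau>2" "\<tau>2 <= \<tau>1" "\<tau>1 < \<tau>0" and \<mu>: "\<mu> >= 0"
  and b1: "!!t. t : {0..\<tau>2} ==> V t >= E2 + \<mu>^2" and b2: "!!t. t : {0..\<tau>0} ==> V t >= E1"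
  and b3: "!!t. t : {\<tau>1..\<tau>0} ==> V t <= E2 - (pi / (\<tau>0 - \<tau>1))^2"
 obtains E W W1 where "E : {E1..E2}" "ALL t. has_d W (W1 t) t"
  "ALL t. has_d W1 ((V t - E) * W t) t" "W 0 = 0" "W1 0 = 1" "W \<tau>0 = 0"
  "ALL t. W (- t) = - W t"
proof -
 obtain W W1 where W: "\<forall>E\<in>{0..E2}. ALL t. has_d (W E) (W1 E t) t"
  "\<forall>E\<in>{0..E2}. ALL t. has_d (W1 E) ((V t - E) * W E t) t"
  "ALL E. W E 0 = 0" "ALL E. W1 E 0 = 1" "continuous_on ({0..E2} \<times> {0..}) (%(E, t). W E t)"
  "ALL E t. W E (- t) = - W E t"
  using ode_exists[OF V order_trans[OF E]] .
 have D: "has_d (W E) (W1 E t) t" "has_d (W1 E) ((V t - E) * W E t) t"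
  if "E : {E1..E2}" for E t using that W(1,2) E by auto
 let ?R = "{E1..E2} \<times> {\<tau>2..\<tau>0}"
 have cR: "continuous_on ?R (%(E, t). W E t)" by (rule continuous_on_subset[OF W(5)]) (use E \<tau> in auto)
 define Z where "Z = ?R \<inter> (%(E, t). W E t) -` {..0}"
 have "closed Z" unfolding Z_def by (rule continuous_closed_preimage[OF cR]) (auto intro: closed_Times)
 moreover have "compact ?R" by (intro compact_Times) auto
 ultimately have cZ: "compact Z" by (metis Z_def compact_Int_closed inf_left_idem)
 have "E2 : {E1..E2}" using E by simp
 note DE2 = D[OF this]
 have "\<exists>t\<in>{\<tau>1..\<tau>0}. W E2 t <= 0"
 proof (rule sturm_zero[OF DE2 \<tau>(3)])
  show "V t - E2 <= - ((pi / (\<tau>0 - \<tau>1))^2)" if "t : {\<tau>1..\<tau>0}" for t using b3[OF that] by linarith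
 qed
 then obtain t2 where "t2 : {\<tau>1..\<tau>0}" "W E2 t2 <= 0" ..
 hence "(E2, t2) : Z" using \<tau> E by (simp add: Z_def)
 hence Zne: "Z ~= {}" by auto
 have "compact (fst ` Z)" by (intro compact_continuous_image continuous_intros cZ)
 then obtain Es where Es: "Es : fst ` Z" "!!E. E : fst ` Z ==> Es <= E"
  using compact_attains_inf[of "fst ` Z"] Zne by auto
 then obtain ts where ts: "(Es, ts) : Z" by auto
 hence EI: "Es : {E1..E2}" and tI: "ts : {\<tau>2..\<tau>0}" and le: "W Es ts <= 0" by (auto simp: Z_def)
 have "W E1 t > 0" if "t : {0<..\<tau>0}" for t
 proof (rule ode_growth(1)[of "W E1" "W1 E1" "%t. V t - E1" \<tau>0 0])
  show "V t - E1 >= 0^2" if "t : {0..\<tau>0}" for t using b2[OF that] by simp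
 qed (use D[of E1] that E W(3,4) in auto)
 from this[of ts] have "Es ~= E1" using le tI \<tau> by auto
 hence EsE1: "E1 < Es" using EI by auto
 have nonneg: "W Es t >= 0" if t: "t : {\<tau>2..\<tau>0}" for t
 proof -
  have "continuous_on {E1..Es} (%E. (E, t))" by (intro continuous_intros)
  hence "continuous_on {E1..Es} (%E. case (E, t) of (E, t) => W E t)"
   by (rule continuous_on_compose2[OF cR]) (use t EI in auto)
  hence "continuous_on {E1..Es} (%E. W E t)" by simp
  moreover have "closure {E1..<Es} = {E1..Es}" using EsE1 by simp
  moreover have "W E t >= 0" if "E : {E1..<Es}" for E
  proof (rule ccontr)
   assume "\<not> W E t >= 0"
   hence "(E, t) : Z" using that t EI by (auto simp: Z_def)
   hence "Es <= E" using Es(2) by force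
   thus False using that by simp
  qed
  ultimately show ?thesis using continuous_ge_on_closure[of "{E1..<Es}" "%E. W E t" Es 0] EsE1 by auto
 qed
 have Ws0: "W Es ts = 0" using nonneg[OF tI] le by simp
 have gp: "W Es t > 0" if "t : {0<..\<tau>2}" for t
 proof (rule ode_growth(1)[OF D[OF EI]])
  show "V t - Es >= \<mu>^2" if "t : {0..\<tau>2}" for t using b1[OF that] EI by auto
 qed (use that W(3,4) \<mu> in auto)
 have "ts ~= \<tau>2" using gp[of \<tau>2] Ws0 \<tau> by auto
 have "ts = \<tau>0"
 proof (rule ccontr)
  assume "ts ~= \<tau>0"
  hence int: "\<tau>2 < ts" "ts < \<tau>0" using tI \<open>ts ~= \<tau>2\<close> by auto
  have "W1 Es ts = 0"
  proof (rule DERIV_local_min[OF D(1)[OF EI]])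
   show "0 < min (ts - \<tau>2) (\<tau>0 - ts)" using int by simp
   show "ALL y. \<bar>ts - y\<bar> < min (ts - \<tau>2) (\<tau>0 - ts) --> W Es ts <= W Es y"
    using nonneg Ws0 by (auto simp: abs_if split: if_splits)
  qed
  moreover have "W1 Es ts ~= 0"
  proof (rule ode_no_double_zero[OF D[OF EI]])
   show "\<bar>V t - Es\<bar> <= Q + \<bar>Es\<bar>" for t using V(2)[of t] by linarith
  qed (use W(3,4) Ws0 int \<tau> in auto)
  ultimately show False by simp
 qed
 thus ?thesis using that[of Es "W Es" "W1 Es"] EI D[OF EI] W(3,4,6) Ws0 by blast
qed

section \<open>Quasimodes\<close>

text \<open>The radial operator; the Laplacian of a mode with profile \<open>g\<close> is minus the mode with profile \<open>Aop m
  n g\<close>.\<close>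
definition Aop :: "nat => nat => (real => real) => real => real" where
 "Aop m n g = (%x. pot m n x * g x - deriv (deriv g) x)"

lemma smooth_curv: "m >= 1 ==> smooth (curv m)"
proof -
 assume m: "m >= 1"
 have "smooth (%x. (2 * real m - 1) * x ^ (2*m - 2) * inverse (warp m x ^ (4*m)))"
  by (intro smooth_intros smooth_inverse smooth_warp m zero_less_power warp_pos)
 thus ?thesis by (simp add: curv_def[abs_def] divide_inverse)
qed

lemma smooth_nu: "m >= 1 ==> smooth (%x. inverse ((warp m x)^2))"
 by (intro smooth_intros smooth_inverse smooth_warp zero_less_power warp_pos)

lemma pot_eq: "pot m n x = Lam n * inverse ((warp m x)^2) + curv m x"
 by (simp add: pot_def divide_inverse)

lemma smooth_pot: "m >= 1 ==> smooth (pot m n)"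
proof -
 assume m: "m >= 1"
 have "smooth (%x. Lam n * inverse ((warp m x)^2) + curv m x)"
  by (intro smooth_intros smooth_nu smooth_curv m)
 thus ?thesis by (simp add: pot_eq[abs_def])
qed

lemma smooth_Aop: "m >= 1 ==> smooth g ==> smooth (Aop m n g)"
 unfolding Aop_def by (intro smooth_intros smooth_pot)

lemma smooth_Aop_pow: "m >= 1 ==> smooth g ==> smooth ((Aop m n ^^ j) g)"
 by (induction j) (auto intro: smooth_Aop)

text \<open>Coefficients that are polynomials in \<open>L\<close> and \<open>E\<close> over the smooth functions of
  \<open>x\<close>.  They are closed under \<open>d/dx\<close> and bounded by powers of \<open>L\<close>, which any
  exponential gain absorbs.\<close>
inductive PB :: "(real => real => real => real) => bool" where
 PB_fun: "smooth c ==> PB (%L E x. c x)"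
| PB_L: "PB (%L E x. L)"
| PB_E: "PB (%L E x. E)"
| PB_add: "PB f ==> PB g ==> PB (%L E x. f L E x + g L E x)"
| PB_mult: "PB f ==> PB g ==> PB (%L E x. f L E x * g L E x)"

lemma PB_const: "PB (%L E x. c)" by (intro PB_fun smooth_intros)

lemma PB_diff:
 assumes "PB f" "PB g" shows "PB (%L E x. f L E x - g L E x)"
proof -
 have "PB (%L E x. f L E x + (- 1) * g L E x)" by (rule PB_add[OF assms(1) PB_mult[OF PB_const assms(2)]])
 thus ?thesis by simp
qed

lemma PB_deriv: "PB f ==> EX f'. PB f' & (ALL L E x. has_d (f L E) (f' L E x) x)"
proof (induction rule: PB.induct)
 case (PB_fun c)
 show ?case by (rule exI[of _ "%L E. deriv c"]) (use PB_fun in "auto intro: PB.PB_fun smooth_deriv")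
next
 case PB_L
 show ?case by (rule exI[of _ "%L E x. 0"]) (auto intro: PB_const)
next
 case PB_E
 show ?case by (rule exI[of _ "%L E x. 0"]) (auto intro: PB_const)
next
 case (PB_add f g)
 then obtain f' g' where d: "PB f'" "PB g'" "!!L E x. has_d (f L E) (f' L E x) x"
  "!!L E x. has_d (g L E) (g' L E x) x" by blast
 show ?case
  by (rule exI[of _ "%L E x. f' L E x + g' L E x"]) (intro conjI allI PB.PB_add DERIV_add d)
next
 case (PB_mult f g)
 then obtain f' g' where d: "PB f'" "PB g'" "!!L E x. has_d (f L E) (f' L E x) x"
  "!!L E x. has_d (g L E) (g' L E x) x" by blast
 show ?case
  by (rule exI[of _ "%L E x. f' L E x * g L E x + g' L E x * f L E x"])
    (intro conjI allI PB.PB_add PB.PB_mult DERIV_mult d PB_mult.hyps)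
qed

lemma PB_bound:
 "PB f ==> \<exists>C\<ge>0. EX N. ALL L E x. L >= 1 --> 0 <= E --> E <= L --> x : {a..b} --> \<bar>f L E x\<bar> <= C * L ^ N"
proof (induction rule: PB.induct)
 case (PB_fun c)
 obtain B where B: "B > 0" "\<forall>x\<in>{a..b}. norm (c x) <= B"
  using compact_continuous_bound[of "{a..b}" c] smooth_continuous[OF PB_fun] by auto
 show ?case
 proof (intro exI conjI allI impI)
  show "0 <= B" using B by simp
  fix L E x :: real assume "x : {a..b}"
  thus "\<bar>c x\<bar> <= B * L ^ 0" using B by auto
 qed
next
 case PB_L
 show ?case by (rule exI[of _ 1], rule conjI, simp, rule exI[of _ 1]) auto
next
 case PB_E
 show ?case by (rule exI[of _ 1], rule conjI, simp, rule exI[of _ 1]) auto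
next
 case (PB_add f g)
 then obtain C N D K where f: "C >= 0" "!!L E x. L >= 1 ==> 0 <= E ==> E <= L ==> x : {a..b} ==> \<bar>f L E x\<bar> <= C * L ^ N"
  and g: "D >= 0" "!!L E x. L >= 1 ==> 0 <= E ==> E <= L ==> x : {a..b} ==> \<bar>g L E x\<bar> <= D * L ^ K" by metis
 show ?case
 proof (intro exI conjI allI impI)
  show "0 <= C + D" using f g by simp
  fix L E x :: real assume a: "1 <= L" "0 <= E" "E <= L" "x : {a..b}"
  have "C * L ^ N <= C * L ^ (N + K)" "D * L ^ K <= D * L ^ (N + K)"
   using a f g by (auto intro!: mult_left_mono power_increasing)
  thus "\<bar>f L E x + g L E x\<bar> <= (C + D) * L ^ (N + K)"
   using f(2)[OF a] g(2)[OF a] unfolding distrib_right by linarith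
 qed
next
 case (PB_mult f g)
 then obtain C N D K where f: "C >= 0" "!!L E x. L >= 1 ==> 0 <= E ==> E <= L ==> x : {a..b} ==> \<bar>f L E x\<bar> <= C * L ^ N"
  and g: "D >= 0" "!!L E x. L >= 1 ==> 0 <= E ==> E <= L ==> x : {a..b} ==> \<bar>g L E x\<bar> <= D * L ^ K" by metis
 show ?case
 proof (intro exI conjI allI impI)
  show "0 <= C * D" using f g by simp
  fix L E x :: real assume a: "1 <= L" "0 <= E" "E <= L" "x : {a..b}"
  have "\<bar>f L E x * g L E x\<bar> <= (C * L ^ N) * (D * L ^ K)"
   unfolding abs_mult using f g a by (intro mult_mono) auto
  thus "\<bar>f L E x * g L E x\<bar> <= C * D * L ^ (N + K)" by (simp add: power_add mult_ac)
 qed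
qed

text \<open>Since \<open>w'' = (V - E) w\<close>, every \<open>A^j (s w)\<close> is a combination of \<open>w\<close> and
  \<open>w'\<close>.  Where \<open>s\<close> is constant the coefficients are those of \<open>E^j w\<close> or of
  \<open>0\<close>, so deviations occur only in the transition region of \<open>s\<close>.\<close>
lemma Aop_pow_coeff:
 assumes m: "m >= 1" and s: "smooth s" "!!x. x < b ==> s x = 1" "!!x. x > c ==> s x = 0"
 shows "\<exists>\<alpha> \<beta>. PB \<alpha> & PB \<beta> & (ALL L E x. x < b --> \<alpha> L E x = E ^ j & \<beta> L E x = 0) &
  (ALL L E x. x > c --> \<alpha> L E x = 0 & \<beta> L E x = 0) &
  (ALL n E w w1. (ALL x. has_d w (w1 x) x) --> (ALL x. has_d w1 ((pot m n x - E) * w x) x) -->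
   (ALL x. (Aop m n ^^ j) (%x. s x * w x) x = \<alpha> (Lam n) E x * w x + \<beta> (Lam n) E x * w1 x))"
proof (induction j)
 case 0
 show ?case
  by (rule exI[of _ "%L E. s"], rule exI[of _ "%L E x. 0"]) (use s PB_fun PB_const in auto)
next
 case (Suc j)
 then obtain \<alpha> \<beta> where ab: "PB \<alpha>" "PB \<beta>"
  and one': "ALL L E x. x < b --> \<alpha> L E x = E ^ j & \<beta> L E x = 0"
  and zero': "ALL L E x. x > c --> \<alpha> L E x = 0 & \<beta> L E x = 0"
  and eq': "ALL n E w w1. (ALL x. has_d w (w1 x) x) --> (ALL x. has_d w1 ((pot m n x - E) * w x) x) -->
   (ALL x. (Aop m n ^^ j) (%x. s x * w x) x = \<alpha> (Lam n) E x * w x + \<beta> (Lam n) E x * w1 x)"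
  by (elim exE conjE) (rule that)
 have one: "\<alpha> L E x = E ^ j" "\<beta> L E x = 0" if "x < b" for L E x using one' that by auto
 have zero: "\<alpha> L E x = 0" "\<beta> L E x = 0" if "x > c" for L E x using zero' that by auto
 have eq: "(Aop m n ^^ j) (%x. s x * w x) x = \<alpha> (Lam n) E x * w x + \<beta> (Lam n) E x * w1 x"
  if "ALL x. has_d w (w1 x) x" "ALL x. has_d w1 ((pot m n x - E) * w x) x" for n E w w1 x
  using eq'[rule_format, OF that[rule_format]] .
 obtain a1 where a1: "PB a1" "!!L E x. has_d (\<alpha> L E) (a1 L E x) x" using PB_deriv[OF ab(1)] by blast
 obtain a2 where a2: "PB a2" "!!L E x. has_d (a1 L E) (a2 L E x) x" using PB_deriv[OF a1(1)] by blast
 obtain b1 where b1: "PB b1" "!!L E x. has_d (\<beta> L E) (b1 L E x) x" using PB_deriv[OF ab(2)] by blast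
 obtain b2 where b2: "PB b2" "!!L E x. has_d (b1 L E) (b2 L E x) x" using PB_deriv[OF b1(1)] by blast
 define V where "V L E x = L * inverse ((warp m x)^2) + curv m x" for L E x :: real
 have V: "PB V" unfolding V_def[abs_def] by (intro PB_add PB_mult PB_L PB_fun smooth_nu smooth_curv m)
 have Vp: "V (Lam n) E = pot m n" for n E by (simp add: V_def pot_eq fun_eq_iff)
 obtain V1 where V1: "PB V1" "!!L E x. has_d (V L E) (V1 L E x) x" using PB_deriv[OF V] by blast
 have d0: "a1 L E x = 0" "a2 L E x = 0" "b1 L E x = 0" "b2 L E x = 0" if "x < b" for L E x
 proof -
  have A: "a1 L E y = 0" "b1 L E y = 0" if "y < b" for y
   using DERIV_const_on_open[OF a1(2)[of L E y], of "{..<b}"] DERIV_const_on_open[OF b1(2)[of L E y], of "{..<b}"] that one by auto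
  thus "a1 L E x = 0" "b1 L E x = 0" "a2 L E x = 0" "b2 L E x = 0"
   using DERIV_const_on_open[OF a2(2)[of L E x], of "{..<b}"] DERIV_const_on_open[OF b2(2)[of L E x], of "{..<b}"] that by auto
 qed
 have e0: "a1 L E x = 0" "a2 L E x = 0" "b1 L E x = 0" "b2 L E x = 0" if "x > c" for L E x
 proof -
  have A: "a1 L E y = 0" "b1 L E y = 0" if "y > c" for y
   using DERIV_const_on_open[OF a1(2)[of L E y], of "{c<..}"] DERIV_const_on_open[OF b1(2)[of L E y], of "{c<..}"] that zero by auto
  thus "a1 L E x = 0" "b1 L E x = 0" "a2 L E x = 0" "b2 L E x = 0"
   using DERIV_const_on_open[OF a2(2)[of L E x], of "{c<..}"] DERIV_const_on_open[OF b2(2)[of L E x], of "{c<..}"] that by auto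
 qed
 define \<alpha>' where "\<alpha>' L E x = E * \<alpha> L E x - a2 L E x - 2 * b1 L E x * (V L E x - E) - \<beta> L E x * V1 L E x" for L E x
 define \<beta>' where "\<beta>' L E x = E * \<beta> L E x - 2 * a1 L E x - b2 L E x" for L E x
 show ?case
 proof (intro exI conjI allI impI)
  show "PB \<alpha>'" unfolding \<alpha>'_def[abs_def] by (intro PB_diff PB_mult PB_E PB_const ab a2 b1 V V1)
  show "PB \<beta>'" unfolding \<beta>'_def[abs_def] by (intro PB_diff PB_mult PB_E PB_const ab a1 b2)
  show "\<alpha>' L E x = E ^ Suc j" "\<beta>' L E x = 0" if "x < b" for L E x
   using that by (auto simp: \<alpha>'_def \<beta>'_def d0 one)
  show "\<alpha>' L E x = 0" "\<beta>' L E x = 0" if "x > c" for L E x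
   using that by (auto simp: \<alpha>'_def \<beta>'_def e0 zero)
  fix n E w w1 x assume w: "ALL x. has_d w (w1 x) x" "ALL x. has_d w1 ((pot m n x - E) * w x) x"
  let ?L = "Lam n"
  let ?G = "(Aop m n ^^ j) (%x. s x * w x)"
  have G: "?G = (%x. \<alpha> ?L E x * w x + \<beta> ?L E x * w1 x)" using eq[OF w] by blast
  let ?G1 = "%x. (a1 ?L E x + \<beta> ?L E x * (V ?L E x - E)) * w x + (\<alpha> ?L E x + b1 ?L E x) * w1 x"
  note dw = w[rule_format, unfolded Vp[of n E, symmetric]]
  have "has_d ?G (?G1 x) x" for x
   unfolding G
   by (rule DERIV_cong[OF DERIV_add[OF DERIV_mult[OF a1(2) dw(1)] DERIV_mult[OF b1(2) dw(2)]]]) (simp add: algebra_simps)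
  hence dG: "deriv ?G = ?G1" by (intro ext DERIV_imp_deriv)
  let ?G2 = "(a2 ?L E x + b1 ?L E x * (V ?L E x - E) + \<beta> ?L E x * V1 ?L E x + (\<alpha> ?L E x + b1 ?L E x) * (V ?L E x - E)) * w x
    + (2 * a1 ?L E x + \<beta> ?L E x * (V ?L E x - E) + b2 ?L E x) * w1 x"
  have "has_d ?G1 ?G2 x"
   by (rule DERIV_cong[OF DERIV_add[OF DERIV_mult[OF DERIV_add[OF a2(2) DERIV_mult[OF b1(2) DERIV_diff[OF V1(2) DERIV_const]]] dw(1)]
      DERIV_mult[OF DERIV_add[OF a1(2) b2(2)] dw(2)]]]) (simp add: algebra_simps)
  hence ddG: "deriv (deriv ?G) x = ?G2" unfolding dG by (rule DERIV_imp_deriv)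
  have "(Aop m n ^^ Suc j) (%x. s x * w x) x = V ?L E x * ?G x - deriv (deriv ?G) x" by (simp add: Aop_def Vp)
  also have "... = \<alpha>' ?L E x * w x + \<beta>' ?L E x * w1 x"
   unfolding ddG by (simp add: G \<alpha>'_def \<beta>'_def algebra_simps)
  finally show "(Aop m n ^^ Suc j) (%x. s x * w x) x = \<alpha>' ?L E x * w x + \<beta>' ?L E x * w1 x" .
 qed
qed

lemma power_le_fact_exp: "z >= 0 ==> (z::real) ^ k <= fact k * exp z"
proof -
 assume z: "z >= 0"
 have "z ^ k /\<^sub>R fact k <= (\<Sum>i. z ^ i /\<^sub>R fact i)"
  using sum_le_suminf[OF summable_exp_generic[of z], of "{k}"] z by simp
 thus ?thesis by (simp add: exp_def field_simps)
qed

lemma poly_exp_bound: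
 fixes k1 h C :: real
 assumes "k1 > 0" "h > 0" "C >= 0"
 shows "\<exists>D\<ge>0. \<forall>\<mu>\<ge>0. C * (\<mu>^2 / k1) ^ N * exp (- \<mu> * h) <= D * exp (- \<mu> * h / 2)"
proof (intro exI conjI allI impI)
 let ?D = "C / k1 ^ N * (2 / h) ^ (2 * N) * fact (2 * N)"
 show "0 <= ?D" using assms by simp
 fix \<mu> :: real assume \<mu>: "\<mu> >= 0"
 let ?z = "\<mu> * h / 2"
 have "C * (\<mu>^2 / k1) ^ N = C / k1 ^ N * (2 / h) ^ (2 * N) * ?z ^ (2 * N)"
  using assms by (simp add: power_divide power_mult_distrib power_mult[symmetric])
 also have "... <= C / k1 ^ N * (2 / h) ^ (2 * N) * (fact (2 * N) * exp ?z)"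
  using assms \<mu> by (intro mult_left_mono power_le_fact_exp) auto
 finally have "C * (\<mu>^2 / k1) ^ N * exp (- \<mu> * h) <= C / k1 ^ N * (2 / h) ^ (2 * N) * (fact (2 * N) * exp ?z) * exp (- \<mu> * h)"
  by (rule mult_right_mono) simp
 also have "... = ?D * (exp ?z * exp (- \<mu> * h))" by (simp add: mult_ac)
 also have "exp ?z * exp (- \<mu> * h) = exp (- \<mu> * h / 2)" by (simp add: exp_add[symmetric])
 finally show "C * (\<mu>^2 / k1) ^ N * exp (- \<mu> * h) <= ?D * exp (- \<mu> * h / 2)" .
qed

lemma curv_bounds: assumes "m >= 1" shows "0 <= curv m x" "curv m x <= 2 * real m - 1"
proof -
 have e: "x ^ (2*m - 2) = (x^2) ^ (m - 1)" by (simp add: power_mult[symmetric] right_diff_distrib')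
 have "(x^2) ^ (m - 1) <= (x^2) ^ m + 1"
 proof (cases "x^2 <= 1")
  case True
  have "(x^2) ^ (m - 1) <= 1" by (rule power_le_one[OF zero_le_power2 True])
  thus ?thesis by (smt (verit) zero_le_power zero_le_power2)
 next
  case False
  hence "(x^2) ^ (m - 1) <= (x^2) ^ m" by (intro power_increasing) auto
  thus ?thesis by simp
 qed
 also have "... = warp m x ^ (2*m)" using warp_power[OF assms, of x] by (simp add: power_mult)
 also have "... <= warp m x ^ (4*m)" using warp_ge1[OF assms, of x] by (intro power_increasing) auto
 finally have le: "x ^ (2*m - 2) <= warp m x ^ (4*m)" unfolding e .
 have p: "warp m x ^ (4*m) > 0" using assms by simp
 have n: "x ^ (2*m - 2) >= 0" unfolding e by simp
 show "0 <= curv m x" unfolding curv_def using n p assms by (intro divide_nonneg_pos mult_nonneg_nonneg) auto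
 have "curv m x = (2 * real m - 1) * (x ^ (2*m - 2) / warp m x ^ (4*m))" by (simp add: curv_def)
 also have "... <= (2 * real m - 1) * 1" using le p assms by (intro mult_left_mono) (auto simp: divide_le_eq)
 finally show "curv m x <= 2 * real m - 1" by simp
qed

lemma even_warp: "warp m (- x) = warp m x" "curv m (- x) = curv m x"
proof -
 show 1: "warp m (- x) = warp m x" for m x by (simp add: warp_def)
 have "(- x) ^ (2*m - 2) = x ^ (2*m - 2)" by (intro power_minus_even) simp
 thus "curv m (- x) = curv m x" by (simp add: curv_def 1)
qed

lemma warp_strict_mono: "m >= 1 ==> 0 <= s ==> s < t ==> warp m s < warp m t"
 unfolding warp_def by (intro real_root_less_mono) (auto intro!: power_strict_mono)

lemma nu_less: "m >= 1 ==> 0 <= s ==> s < t ==> inverse ((warp m t)^2) < inverse ((warp m s)^2)"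
 using warp_strict_mono[of m s t] warp_pos[of m s] by (intro less_imp_inverse_less) (auto intro!: power_strict_mono less_imp_le)

lemma nu_le: "m >= 1 ==> 0 <= s ==> s <= t ==> inverse ((warp m t)^2) <= inverse ((warp m s)^2)"
 using nu_less[of m s t] by (cases "s = t") auto

lemma nu_bounds: assumes "m >= 1" shows "0 < inverse ((warp m x)^2)" "inverse ((warp m x)^2) <= 1"
 using warp_ge1[OF assms, of x] assms by (auto simp: inverse_le_1_iff)

lemma Lam_ge: "real n <= Lam n" "0 <= Lam n" "4 * (real n)^2 <= Lam n"
proof -
 show "0 <= Lam n" by (simp add: Lam_def)
 show 2: "4 * (real n)^2 <= Lam n" by (simp add: Lam_def power2_eq_square algebra_simps)
 show "real n <= Lam n" by (simp add: Lam_def algebra_simps)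
qed

text \<open>On \<open>[-5h/2, 0]\<close> the function and its derivative are smaller than \<open>M\<close> by a tunnelling factor;
  \<open>Lam n * k1\<close> stands for the height of the barrier above the energy.\<close>
definition damped :: "real => real => nat => real => (real => real) => (real => real) => real => bool" where
 "damped h k1 n E w w1 M \<longleftrightarrow> n >= 1 & 0 <= E & E <= Lam n & M >= 0 & continuous_on UNIV w & continuous_on UNIV w1 &
  (\<forall>x\<in>{- 5/2 * h..0}. \<bar>w x\<bar> <= (1 + 4 / h) * exp (- sqrt (Lam n * k1) * h / 4) * M &
    \<bar>w1 x\<bar> <= (1 + 4 / h) * exp (- sqrt (Lam n * k1) * h / 4) * M)"

definition well_state :: "nat => real => real => nat => real => (real => real) => (real => real) => bool" where
 "well_state m h k1 n E w w1 \<longleftrightarrow> 1 <= E &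
  (ALL x. has_d w (w1 x) x) & (ALL x. has_d w1 ((pot m n x - E) * w x) x) &
  w (- 10 * h) = 0 & w (- 3 * h) ~= 0 & (\<forall>x\<in>{- 4 * h..- 3 * h}. \<bar>w (- 3 * h)\<bar> <= \<bar>w x\<bar>) &
  damped h k1 n E w w1 \<bar>w (- 3 * h)\<bar>"

text \<open>With \<open>x0 = - 10 h\<close> the barrier covers \<open>|x| <= 5h\<close> and energies range up to \<open>L /
  a(6h)^2\<close>; on \<open>[7h, 10h]\<close> the well is then deep enough for a half wave as soon as \<open>n\<close>
  is large.  The variable of the eigenvalue problem is \<open>t = - x\<close>, with \<open>t = 0\<close> at the throat;
  evenness of the potential makes the passage harmless.\<close>
lemma eigen_pair:
 assumes m: "m >= 1" and h: "h > 0"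
 defines "k1 \<equiv> inverse ((warp m (5*h))^2) - inverse ((warp m (6*h))^2)"
 obtains N0 where "N0 >= (1::nat)" "\<forall>n\<ge>N0. EX E w w1. well_state m h k1 n E w w1"
proof -
 let ?\<nu> = "%x. inverse ((warp m x)^2)"
 define d where "d = ?\<nu> (6*h) - ?\<nu> (7*h)"
 have d: "d > 0" unfolding d_def using nu_less[OF m, of "6*h" "7*h"] h by simp
 have k1: "k1 > 0" unfolding k1_def using nu_less[OF m, of "5*h" "6*h"] h by simp
 (* L >= K gives room for a half wave of length 3 h in the well, and makes all energies at least 1 *)
 define K where "K = ((2 * real m - 1) + (pi / (3 * h))^2) / d + 1 / ?\<nu> (10*h)"
 define N0 where "N0 = Suc (nat \<lceil>K\<rceil>)"
 have K0: "K >= 0" unfolding K_def using d m nu_bounds[OF m, of "10*h"] by (intro add_nonneg_nonneg divide_nonneg_pos) auto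
 show ?thesis
 proof (rule that[of N0])
  show "N0 >= 1" by (simp add: N0_def)
  show "\<forall>n\<ge>N0. EX E w w1. well_state m h k1 n E w w1"
  proof (intro allI impI)
   fix n assume n: "N0 <= n"
   let ?L = "Lam n"
   have LK: "?L >= K"
   proof -
    have "K <= real (nat \<lceil>K\<rceil>)" by (rule real_nat_ceiling_ge)
    also have "... <= real n" using n unfolding N0_def by (intro of_nat_mono) linarith
    finally show ?thesis using Lam_ge(1)[of n] by linarith
   qed
   have L0: "?L >= 0" by (rule Lam_ge)
   have Ld: "(2 * real m - 1) + (pi / (3 * h))^2 <= ?L * d"
   proof -
    have "((2 * real m - 1) + (pi / (3 * h))^2) / d <= K" using nu_bounds[OF m, of "10*h"] by (simp add: K_def)
    thus ?thesis using LK d by (simp add: divide_le_eq) (meson d mult_right_mono order_trans less_imp_le divide_le_eq)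
   qed
   have L1: "1 <= ?L * ?\<nu> (10*h)"
   proof -
    have "((2 * real m - 1) + (pi / (3 * h))^2) / d >= 0" using d m by (intro divide_nonneg_pos) auto
    hence "1 / ?\<nu> (10*h) <= ?L" using LK unfolding K_def by linarith
    thus ?thesis using nu_bounds(1)[OF m, of "10*h"] by (simp add: divide_le_eq)
   qed
   define \<mu> where "\<mu> = sqrt (?L * k1)"
   have \<mu>: "\<mu> >= 0" "\<mu>^2 = ?L * k1" using L0 k1 by (auto simp: \<mu>_def)
   have potle: "?L * ?\<nu> x <= pot m n x" "pot m n x <= ?L * ?\<nu> x + (2 * real m - 1)" for x
    using curv_bounds[OF m, of x] by (auto simp: pot_eq)
   obtain E W W1 where E: "E : {?L * ?\<nu> (10*h)..?L * ?\<nu> (6*h)}" and W: "ALL t. has_d W (W1 t) t"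
    "ALL t. has_d W1 ((pot m n t - E) * W t) t" and W0: "W 0 = 0" "W1 0 = 1" "W (10*h) = 0"
    "ALL t. W (- t) = - W t"
   proof (rule eigenvalue_exists)
    show "continuous_on UNIV (pot m n)" by (rule pot_continuous[OF m])
    show "\<bar>pot m n x\<bar> <= ?L + (2 * real m - 1)" for x
    proof -
     have "0 <= ?L * ?\<nu> x" "?L * ?\<nu> x <= ?L * 1"
      by (rule mult_nonneg_nonneg[OF L0 less_imp_le[OF nu_bounds(1)[OF m]]], rule mult_left_mono[OF nu_bounds(2)[OF m] L0])
     thus ?thesis using potle[of x] by linarith
    qed
    show "pot m n (- x) = pot m n x" for x by (simp add: pot_eq even_warp)
    show "0 <= ?L * ?\<nu> (10*h)" using L1 by simp
    show "?L * ?\<nu> (10*h) <= ?L * ?\<nu> (6*h)" using L0 h by (intro mult_left_mono nu_le m) auto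
    show "0 < 5*h" "5*h <= 7*h" "7*h < 10*h" using h by auto
    show "0 <= \<mu>" by (rule \<mu>)
    show "?L * ?\<nu> (6*h) + \<mu>^2 <= pot m n t" if "t : {0..5*h}" for t
    proof -
     have "?L * ?\<nu> (6*h) + \<mu>^2 = ?L * ?\<nu> (5*h)" by (simp add: \<mu>(2) k1_def algebra_simps)
     also have "... <= ?L * ?\<nu> t" using L0 that by (intro mult_left_mono nu_le m) auto
     finally show ?thesis using potle(1)[of t] by linarith
    qed
    show "?L * ?\<nu> (10*h) <= pot m n t" if "t : {0..10*h}" for t
    proof -
     have "?L * ?\<nu> (10*h) <= ?L * ?\<nu> t" using L0 that by (intro mult_left_mono nu_le m) auto
     thus ?thesis using potle(1)[of t] by linarith
    qed
    show "pot m n t <= ?L * ?\<nu> (6*h) - (pi / (10*h - 7*h))^2" if "t : {7*h..10*h}" for t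
    proof -
     have "?L * ?\<nu> t <= ?L * ?\<nu> (7*h)" using L0 that h by (intro mult_left_mono nu_le m) auto
     moreover have "?L * ?\<nu> (7*h) + ?L * d = ?L * ?\<nu> (6*h)" by (simp add: d_def algebra_simps)
     moreover have "10*h - 7*h = 3*h" by simp
     ultimately show ?thesis using potle(2)[of t] Ld by simp
    qed
   qed
   have Em: "pot m n t - E >= \<mu>^2" if "t : {0..5*h}" for t
   proof -
    have "?L * ?\<nu> (6*h) + \<mu>^2 = ?L * ?\<nu> (5*h)" by (simp add: \<mu>(2) k1_def algebra_simps)
    also have "... <= ?L * ?\<nu> t" using L0 that by (intro mult_left_mono nu_le m) auto
    finally show ?thesis using potle(1)[of t] E by auto
   qed
   have gr1: "W t > 0" if "t : {0<..5*h}" for t by (rule ode_growth(1)[OF W[rule_format] W0(1,2) Em \<mu>(1) that])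
   have gr2: "W1 t >= 0" if "t : {0..5*h}" for t by (rule ode_growth(2)[OF W[rule_format] W0(1,2) Em \<mu>(1) that])
   have gr3: "W s * exp (\<mu> * (t - s)) <= W t" if "0 <= s" "s <= t" "t <= 5*h" for s t
    by (rule ode_growth(3)[OF W[rule_format] W0(1,2) Em \<mu>(1) that])
   have gr4: "W1 s <= W (s + r) / r" if "0 <= s" "r > 0" "s + r <= 5*h" for s r
    by (rule ode_growth(4)[OF W[rule_format] W0(1,2) Em \<mu>(1) that])
   have W1e: "W1 (- t) = W1 t" for t
   proof -
    have "has_d (%t. W (- t)) (W1 (- t) * (- 1)) t"
     by (rule DERIV_chain2[OF W(1)[rule_format]]) (auto intro!: derivative_eq_intros)
    moreover have "has_d (%t. W (- t)) (- W1 t) t"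
     using DERIV_minus[OF W(1)[rule_format, of t]] W0(4) by simp
    ultimately show ?thesis using DERIV_unique by fastforce
   qed
   let ?A = "W (3*h)"
   have A: "?A > 0" using gr1[of "3*h"] h by simp
   have absW: "\<bar>W x\<bar> = W (- x)" if "x <= 0" "- 5 * h <= x" for x
   proof (cases "x = 0")
    case False
    hence "W (- x) > 0" using gr1[of "- x"] that by auto
    thus ?thesis using W0(4)[rule_format, of x] by simp
   qed (simp add: W0)
   have b: "W t <= exp (- \<mu> * h / 4) * ?A" if "t : {0..11/4*h}" for t
   proof -
    have "\<bar>W (- t)\<bar> = W t" using absW[of "- t"] that h by simp
    hence p: "W t >= 0" using abs_ge_zero[of "W (- t)"] by simp
    have "\<mu> * (h / 4) <= \<mu> * (3*h - t)" using that \<mu>(1) by (intro mult_left_mono) auto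
    hence "exp (\<mu> * (h / 4)) <= exp (\<mu> * (3*h - t))" by simp
    hence "W t * exp (\<mu> * (h / 4)) <= W t * exp (\<mu> * (3*h - t))" using p by (rule mult_left_mono)
    also have "... <= ?A" by (rule gr3) (use that h in auto)
    finally have "W t * exp (\<mu> * (h / 4)) * exp (- (\<mu> * (h/4))) <= ?A * exp (- (\<mu> * (h/4)))" by (rule mult_right_mono) simp
    hence "W t <= ?A * exp (- (\<mu> * (h/4)))" unfolding mult.assoc exp_minus_inverse by simp
    thus ?thesis by (simp add: mult.commute)
   qed
   let ?e = "exp (- \<mu> * h / 4)"
   have Wc: "continuous_on UNIV W" "continuous_on UNIV W1"
    using W by (auto intro!: continuous_at_imp_continuous_on intro: DERIV_isCont)
   show "EX E w w1. well_state m h k1 n E w w1"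
    unfolding well_state_def damped_def \<mu>_def[symmetric]
   proof (intro exI conjI ballI)
    show "1 <= n" using n N0_def by simp
    show "0 <= E" using E L1 by simp
    show "continuous_on UNIV W" "continuous_on UNIV W1" by (rule Wc)+
    show "0 <= \<bar>W (- 3 * h)\<bar>" by simp
    show "1 <= E" using L1 E by simp
    have "?L * ?\<nu> (6*h) <= ?L * 1" using nu_bounds[OF m] L0 by (intro mult_left_mono) auto
    thus "E <= ?L" using E by simp
    show "ALL x. has_d W (W1 x) x" "ALL x. has_d W1 ((pot m n x - E) * W x) x" by (rule W)+
    show "W (- 10 * h) = 0" using W0(3) W0(4)[rule_format, of "10*h"] by simp
    have a3: "\<bar>W (- 3 * h)\<bar> = ?A" using absW[of "- 3 * h"] h by simp
    thus "W (- 3 * h) ~= 0" using A by auto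
    fix x
    {
     assume x: "x : {- 4 * h..- 3 * h}"
     have "?A * exp 0 <= ?A * exp (\<mu> * (- x - 3*h))" using A x \<mu>(1) by (intro mult_left_mono) auto
     also have "... <= W (- x)" by (rule gr3) (use x h in auto)
     finally show "\<bar>W (- 3 * h)\<bar> <= \<bar>W x\<bar>" using a3 absW[of x] x h by simp
    }
    assume x: "x : {- 5/2 * h..0}"
    have eA: "?e * ?A >= 0" using A by simp
    have "\<bar>W x\<bar> <= ?e * ?A" using absW[of x] b[of "- x"] x h by simp
    also have "... <= (1 + 4 / h) * (?e * ?A)" using eA h by (simp add: mult_le_cancel_right1)
    finally show "\<bar>W x\<bar> <= (1 + 4 / h) * ?e * \<bar>W (- 3 * h)\<bar>" unfolding a3 mult.assoc .
    have "W1 (- x) >= 0" by (rule gr2) (use x h in auto)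
    hence "\<bar>W1 x\<bar> = W1 (- x)" unfolding W1e by simp
    also have "... <= W (- x + h / 4) / (h / 4)" by (rule gr4) (use x h in auto)
    also have "... <= ?e * ?A / (h / 4)" using b[of "- x + h / 4"] x h by (intro divide_right_mono) auto
    also have "... = 4 / h * (?e * ?A)" by simp
    also have "... <= (1 + 4 / h) * (?e * ?A)" using eA by (intro mult_right_mono) auto
    finally show "\<bar>W1 x\<bar> <= (1 + 4 / h) * ?e * \<bar>W (- 3 * h)\<bar>" unfolding a3 mult.assoc .
   qed
  qed
 qed
qed

lemma PB_continuous: "PB f ==> continuous_on A (f L E)"
 using PB_deriv[of f] by (meson DERIV_isCont continuous_at_imp_continuous_on)

lemma PB_integral_bound:
 assumes ab: "PB \<alpha>" "PB \<beta>" and h: "h > 0" "k1 > 0"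
 shows "\<exists>D\<ge>0. ALL n E w w1 M. damped h k1 n E w w1 M -->
  integral {- 5/2 * h..0} (%x. (\<alpha> (Lam n) E x * w x + \<beta> (Lam n) E x * w1 x)^2) <= D * exp (- (sqrt k1 * h / 2) * real n) * (h * M^2)"
proof -
 obtain Ca Na Cb Nb where a: "Ca >= 0" "!!L E x. L >= 1 ==> 0 <= E ==> E <= L ==> x : {- 5/2 * h..0} ==> \<bar>\<alpha> L E x\<bar> <= Ca * L ^ Na"
  and b: "Cb >= 0" "!!L E x. L >= 1 ==> 0 <= E ==> E <= L ==> x : {- 5/2 * h..0} ==> \<bar>\<beta> L E x\<bar> <= Cb * L ^ Nb"
  using PB_bound[OF ab(1), of "- 5/2 * h" 0] PB_bound[OF ab(2), of "- 5/2 * h" 0] by metis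
 define N where "N = Na + Nb"
 define K where "K = (Ca + Cb) * (1 + 4 / h)"
 have K: "K >= 0" using a b h by (simp add: K_def)
 obtain D where D: "D >= 0" "\<forall>\<mu>\<ge>0. 5/2 * K^2 * (\<mu>^2 / k1) ^ (2 * N) * exp (- \<mu> * (h / 2)) <= D * exp (- \<mu> * (h / 2) / 2)"
  using poly_exp_bound[of k1 "h / 2" "5/2 * K^2" "2 * N"] h by auto
 show ?thesis
 proof (rule exI[of _ D], intro conjI allI impI)
  show "0 <= D" by (rule D)
  fix n :: nat and E M :: real and w w1 :: "real => real"
  let ?L = "Lam n" and ?J = "{- 5/2 * h..0}"
  define e where "e = exp (- sqrt (?L * k1) * h / 4)"
  assume "damped h k1 n E w w1 M"
  hence n: "1 <= n" and E: "0 <= E" "E <= ?L" and M: "0 <= M" and c: "continuous_on UNIV w" "continuous_on UNIV w1"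
   and bd: "\<forall>x\<in>?J. \<bar>w x\<bar> <= (1 + 4 / h) * exp (- sqrt (?L * k1) * h / 4) * M & \<bar>w1 x\<bar> <= (1 + 4 / h) * exp (- sqrt (?L * k1) * h / 4) * M"
   by (simp_all add: damped_def)
  have L1: "?L >= 1" using Lam_ge(1)[of n] n by linarith
  let ?G = "%x. \<alpha> ?L E x * w x + \<beta> ?L E x * w1 x"
  let ?B = "K * ?L ^ N * e * M"
  have e0: "e > 0" by (simp add: e_def)
  have G: "(?G x)^2 <= ?B^2" if x: "x : ?J" for x
  proof -
   have "\<bar>\<alpha> ?L E x\<bar> <= Ca * ?L ^ N" "\<bar>\<beta> ?L E x\<bar> <= Cb * ?L ^ N"
    by (rule order_trans[OF a(2)[OF L1 E x]], use a L1 in "auto simp: N_def intro!: mult_left_mono power_increasing")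
      (rule order_trans[OF b(2)[OF L1 E x]], use b L1 in "auto simp: N_def intro!: mult_left_mono power_increasing")
   hence "\<bar>\<alpha> ?L E x * w x\<bar> <= (Ca * ?L ^ N) * ((1 + 4 / h) * e * M)" "\<bar>\<beta> ?L E x * w1 x\<bar> <= (Cb * ?L ^ N) * ((1 + 4 / h) * e * M)"
    unfolding abs_mult using bd x a b L1 by (auto simp: e_def intro!: mult_mono)
   hence "\<bar>?G x\<bar> <= (Ca * ?L ^ N) * ((1 + 4 / h) * e * M) + (Cb * ?L ^ N) * ((1 + 4 / h) * e * M)" by linarith
   also have "... = ?B" by (simp add: K_def algebra_simps add_divide_distrib)
   finally have "\<bar>?G x\<bar> <= ?B" .
   hence "\<bar>?G x\<bar>^2 <= ?B^2" by (intro power_mono) auto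
   thus ?thesis by simp
  qed
  have "continuous_on ?J (%x. (?G x)^2)"
   by (intro continuous_on_power continuous_on_add continuous_on_mult PB_continuous[OF ab(1)] PB_continuous[OF ab(2)]
     continuous_on_subset[OF c(1)] continuous_on_subset[OF c(2)] subset_UNIV)
  hence "integral ?J (%x. (?G x)^2) <= integral ?J (%x. ?B^2)"
   using G by (intro integral_le integrable_continuous_real continuous_on_const) auto
  also have "... = 5/2 * h * ?B^2" using h by simp
  also have "... = (5/2 * K^2 * ?L ^ (2 * N) * e^2) * (h * M^2)"
   by (simp add: power_mult_distrib power_mult[symmetric] mult_ac)
  also have "5/2 * K^2 * ?L ^ (2 * N) * e^2 <= D * exp (- (sqrt k1 * h / 2) * real n)"
  proof -
   define \<mu> where "\<mu> = sqrt (?L * k1)"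
   have \<mu>: "\<mu> >= 0" "?L = \<mu>^2 / k1" using L1 h by (auto simp: \<mu>_def)
   have e2: "e^2 = exp (- \<mu> * (h / 2))" by (simp add: e_def \<mu>_def power2_eq_square exp_add[symmetric])
   have "5/2 * K^2 * ?L ^ (2 * N) * e^2 <= D * exp (- \<mu> * (h / 2) / 2)"
    unfolding e2 using D(2)[rule_format, OF \<mu>(1)] \<mu>(2) by simp
   also have "... <= D * exp (- (sqrt k1 * h / 2) * real n)"
   proof (intro mult_left_mono D)
    have "sqrt (4 * (real n)^2) <= sqrt ?L" using Lam_ge(3)[of n] by (rule real_sqrt_le_mono)
    hence "2 * real n <= sqrt ?L" by (simp add: real_sqrt_mult)
    hence "2 * real n * sqrt k1 <= \<mu>" unfolding \<mu>_def real_sqrt_mult using h by (intro mult_right_mono) auto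
    hence "2 * real n * sqrt k1 * (h / 4) <= \<mu> * (h / 4)" using h by (intro mult_right_mono) auto
    thus "exp (- \<mu> * (h / 2) / 2) <= exp (- (sqrt k1 * h / 2) * real n)" by (simp add: mult_ac)
   qed
   finally show ?thesis .
  qed
  finally show "integral ?J (%x. (?G x)^2) <= D * exp (- (sqrt k1 * h / 2) * real n) * (h * M^2)"
   using h by (simp add: mult_right_mono)
 qed
qed

lemma smooth_of_ode:
 assumes "!!x. has_d w (w1 x) x" "!!x. has_d w1 (q x * w x) x" "smooth q"
 shows "smooth w"
proof -
 have v: "!!x. (w has_vector_derivative w1 x) (at x)" "!!x. (w1 has_vector_derivative q x * w x) (at x)"
  using assms by (auto simp: has_real_derivative_iff_has_vector_derivative)
 have "C_k n UNIV w & C_k n UNIV w1" for n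
 proof (induction n)
  case 0
  thus ?case using assms by (auto intro!: continuous_at_imp_continuous_on intro: DERIV_isCont)
 next
  case (Suc n)
  hence "C_k n UNIV (%x. q x * w x)" by (intro C_k_mult[OF smoothD[OF assms(3)]]) auto
  hence "C_k (Suc n) UNIV w1" by (rule C_k_real_Suc[OF v(2)])
  moreover have "C_k (Suc n) UNIV w" by (rule C_k_real_Suc[OF v(1)]) (use Suc in simp)
  ultimately show ?case by (rule conjI[rotated])
 qed
 thus ?thesis by (simp add: smooth_def)
qed

text \<open>Profiles on which all powers of the generator act classically: with all \<open>A^j g\<close> they vanish at
  \<open>x0\<close> and for \<open>x >= 0\<close>.\<close>
definition core_fun :: "nat => nat => real => (real => real) => bool" where
 "core_fun m n x0 g \<longleftrightarrow> smooth g & (ALL j. (Aop m n ^^ j) g x0 = 0) & (ALL j. \<forall>x\<ge>0. (Aop m n ^^ j) g x = 0)"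

text \<open>All bounds are relative to the \<open>L2\<close> norm of \<open>w\<close>, with constants that do not depend on
  \<open>n\<close>.\<close>
definition quasimode :: "nat => real => real => real => (nat => real) => nat => real => (real => real) => bool" where
 "quasimode m x0 c C D n E w \<longleftrightarrow> core_fun m n x0 w & E <= Lam n & 1 <= E &
   0 < integral {x0..0} (%x. (w x)^2) &
   (ALL j. integral {x0..0} (%x. ((Aop m n ^^ j) w x)^2) <= D j * E ^ (2 * j) * integral {x0..0} (%x. (w x)^2)) &
   integral {x0..0} (%x. (Aop m n w x - E * w x)^2) <= C * exp (- c * real n) * integral {x0..0} (%x. (w x)^2)"

text \<open>Cut the eigenfunction off between \<open>-2h\<close> and \<open>-h\<close>, inside the barrier.  There it is
  exponentially small compared with its size on \<open>[-4h, -3h]\<close>, which bounds the \<open>L2\<close> norm from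
  below.\<close>
lemma quasimodes:
 assumes m: "m >= 1" and x0: "x0 < 0"
 obtains c C D N0 where "c > 0" "C >= 0" "N0 >= 1" "ALL j. D j >= 0" "\<forall>n\<ge>N0. EX E w. quasimode m x0 c C D n E w"
proof -
 define h where "h = - x0 / 10"
 have h: "h > 0" "x0 = - 10 * h" using x0 by (auto simp: h_def)
 define k1 where "k1 = inverse ((warp m (5*h))^2) - inverse ((warp m (6*h))^2)"
 have k1: "k1 > 0" unfolding k1_def using nu_less[OF m, of "5*h" "6*h"] h by simp
 obtain N0 where N0: "N0 >= (1::nat)" and ep: "\<forall>n\<ge>N0. EX E w w1. well_state m h k1 n E w w1"
  by (rule eigen_pair[OF m h(1), folded k1_def])
 (* equals 1 for x <= -2 h and 0 for x >= -h *)
 define s where "s x = step (- (1 / h) * x)" for x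
 have ss: "smooth s" unfolding s_def[abs_def] by (rule smooth_compose[OF smooth_step]) (intro smooth_intros)
 have s1: "s x = 1" if "x < - 2 * h" for x
  unfolding s_def by (rule step_bounds(4)) (use that h in "simp add: field_simps")
 have s0: "s x = 0" if "x > - h" for x
  unfolding s_def by (rule step_bounds(3)) (use that h in "simp add: field_simps")
 define P where "P j \<alpha> \<beta> \<longleftrightarrow> PB \<alpha> & PB \<beta> & (ALL L E x. x < - 2 * h --> \<alpha> L E x = E ^ j & \<beta> L E x = 0) &
  (ALL L E x. x > - h --> \<alpha> L E x = 0 & \<beta> L E x = 0) &
  (ALL n E w w1. (ALL x. has_d w (w1 x) x) --> (ALL x. has_d w1 ((pot m n x - E) * w x) x) -->
   (ALL x. (Aop m n ^^ j) (%x. s x * w x) x = \<alpha> (Lam n) E x * w x + \<beta> (Lam n) E x * w1 x))" for j \<alpha> \<beta>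
 have "ALL j. \<exists>\<alpha> \<beta>. P j \<alpha> \<beta>" unfolding P_def by (intro allI Aop_pow_coeff[OF m ss s1 s0])
 then obtain \<alpha> \<beta> where P: "!!j. P j (\<alpha> j) (\<beta> j)" by metis
 have PBab: "PB (\<alpha> j)" "PB (\<beta> j)" for j using P[of j] by (auto simp: P_def)
 define c where "c = sqrt k1 * h / 2"
 have c: "c > 0" using k1 h by (simp add: c_def)
 let ?J = "{- 5/2 * h..0}"
 have IB: "\<exists>D\<ge>0. ALL n E w w1 M. damped h k1 n E w w1 M -->
  integral ?J (%x. (a (Lam n) E x * w x + b (Lam n) E x * w1 x)^2) <= D * exp (- c * real n) * (h * M^2)" if "PB a" "PB b" for a b
  unfolding c_def by (rule PB_integral_bound[OF that h(1) k1])
 have "ALL j. \<exists>D\<ge>0. ALL n E w w1 M. damped h k1 n E w w1 M -->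
  integral ?J (%x. (\<alpha> j (Lam n) E x * w x + \<beta> j (Lam n) E x * w1 x)^2) <= D * exp (- c * real n) * (h * M^2)"
  by (intro allI IB PBab)
 from choice[OF this] obtain D0 where "ALL j. D0 j >= 0 & (ALL n E w w1 M. damped h k1 n E w w1 M -->
  integral ?J (%x. (\<alpha> j (Lam n) E x * w x + \<beta> j (Lam n) E x * w1 x)^2) <= D0 j * exp (- c * real n) * (h * M^2))"
  by (elim exE) (rule that)
 hence D0: "!!j. D0 j >= 0" "!!j n E w w1 M. damped h k1 n E w w1 M ==>
  integral ?J (%x. (\<alpha> j (Lam n) E x * w x + \<beta> j (Lam n) E x * w1 x)^2) <= D0 j * exp (- c * real n) * (h * M^2)"
  by blast+
 have "PB (%L E x. \<alpha> 1 L E x - E * s x)" by (intro PB_diff PB_mult PB_E PBab PB_fun ss)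
 from IB[OF this PBab(2)[of 1]] obtain C where C: "C >= 0" "!!n E w w1 M. damped h k1 n E w w1 M ==>
  integral ?J (%x. ((\<alpha> 1 (Lam n) E x - E * s x) * w x + \<beta> 1 (Lam n) E x * w1 x)^2) <= C * exp (- c * real n) * (h * M^2)"
  by blast
 show ?thesis
 proof (rule that[of c C N0 "%j. 1 + D0 j"])
  show "c > 0" "C >= 0" "N0 >= 1" "ALL j. 1 + D0 j >= 0" using c C N0 D0(1) by (auto intro: add_nonneg_nonneg)
  show "\<forall>n\<ge>N0. EX E w. quasimode m x0 c C (%j. 1 + D0 j) n E w"
  proof (intro allI impI)
   fix n assume n: "N0 <= n"
   obtain E w w1 where ws: "well_state m h k1 n E w w1" using ep n by blast
   hence E: "1 <= E"
    and w: "ALL x. has_d w (w1 x) x" "ALL x. has_d w1 ((pot m n x - E) * w x) x"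
    and w0: "w (- 10 * h) = 0" "w (- 3 * h) ~= 0" and w3: "\<forall>x\<in>{- 4 * h..- 3 * h}. \<bar>w (- 3 * h)\<bar> <= \<bar>w x\<bar>"
    and dw: "damped h k1 n E w w1 \<bar>w (- 3 * h)\<bar>"
    unfolding well_state_def by blast+
   define M where "M = \<bar>w (- 3 * h)\<bar>"
   have M: "M > 0" using w0(2) by (simp add: M_def)
   have Qn: "damped h k1 n E w w1 M" using dw by (simp add: M_def)
   hence cw: "continuous_on UNIV w" "continuous_on UNIV w1" and EL: "E <= Lam n" by (auto simp: damped_def)
   let ?w = "%x. s x * w x"
   have sq: "smooth (%x. pot m n x - E)" by (intro smooth_intros smooth_pot m)
   have sw: "smooth ?w" by (intro smooth_intros ss smooth_of_ode[OF w[rule_format] sq])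
   have cA: "continuous_on A ((Aop m n ^^ j) ?w)" for A j by (intro smooth_continuous smooth_Aop_pow m sw)
   have eq: "(Aop m n ^^ j) ?w x = \<alpha> j (Lam n) E x * w x + \<beta> j (Lam n) E x * w1 x" for j x
    using P[of j] w unfolding P_def by blast
   have one: "\<alpha> j L E x = E ^ j" "\<beta> j L E x = 0" if "x < - 2 * h" for j L E x using P[of j] that unfolding P_def by blast+
   have zero: "\<alpha> j L E x = 0" "\<beta> j L E x = 0" if "x > - h" for j L E x using P[of j] that unfolding P_def by blast+
   let ?I = "integral {x0..0} (%x. (?w x)^2)"
   have io: "f integrable_on {a..b}" if "continuous_on UNIV f" for f :: "real => real" and a b
    by (rule integrable_continuous_real[OF continuous_on_subset[OF that]]) simp
   have cw2: "continuous_on UNIV (%x. (?w x)^2)" by (intro continuous_intros smooth_continuous[OF sw])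
   have split: "integral {x0..0} f = integral {x0..- 5/2 * h} f + integral ?J f" if "continuous_on UNIV f" for f :: "real => real"
    by (rule HK_combine[symmetric]) (use h io[OF that] in auto)
   have IM: "h * M^2 <= ?I"
   proof -
    have "h * M^2 = integral {- 4 * h..- 3 * h} (%x. M^2)" using h by simp
    also have "... <= integral {- 4 * h..- 3 * h} (%x. (?w x)^2)"
    proof (rule integral_le[OF _ io[OF cw2]])
     fix x assume x: "x : {- 4 * h..- 3 * h}"
     hence "M <= \<bar>w x\<bar>" using w3 by (simp add: M_def)
     hence "M^2 <= \<bar>w x\<bar>^2" using M by (intro power_mono) auto
     thus "M^2 <= (?w x)^2" using s1[of x] x h by simp
    qed (rule io[OF continuous_on_const])
    also have "... <= ?I" by (rule integral_subset_le) (use h io[OF cw2] in auto)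
    finally show ?thesis .
   qed
   have I0: "0 < ?I" using IM h M by (smt (verit) mult_pos_pos zero_less_power)
   show "EX E w. quasimode m x0 c C (%j. 1 + D0 j) n E w"
   proof (rule exI[of _ E], rule exI[of _ ?w], unfold quasimode_def core_fun_def, intro conjI allI impI)
    show "smooth ?w" by (rule sw)
    show "E <= Lam n" "1 <= E" "0 < ?I" by fact+
    show "(Aop m n ^^ j) ?w x0 = 0" for j unfolding eq using one[of x0 j] h w0(1) by simp
    show "(Aop m n ^^ j) ?w x = 0" if "x >= 0" for j x unfolding eq using zero[of x j] h that by simp
    show "integral {x0..0} (%x. ((Aop m n ^^ j) ?w x)^2) <= (1 + D0 j) * E ^ (2 * j) * ?I" for j
    proof -
     have cj: "continuous_on UNIV (%x. ((Aop m n ^^ j) ?w x)^2)" by (intro continuous_intros cA)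
     have "integral {x0..- 5/2 * h} (%x. ((Aop m n ^^ j) ?w x)^2) = integral {x0..- 5/2 * h} (%x. E ^ (2 * j) * (?w x)^2)"
      by (rule HK_cong)
        (use h in "auto simp: eq one s1 power_mult_distrib power_mult[symmetric] mult.commute")
     also have "... <= integral {x0..0} (%x. E ^ (2 * j) * (?w x)^2)"
      by (rule integral_subset_le) (use h E cw2 in "auto intro!: io continuous_intros")
     also have "... = E ^ (2 * j) * ?I" by simp
     finally have A: "integral {x0..- 5/2 * h} (%x. ((Aop m n ^^ j) ?w x)^2) <= E ^ (2 * j) * ?I" .
     have "integral ?J (%x. ((Aop m n ^^ j) ?w x)^2) <= D0 j * exp (- c * real n) * (h * M^2)"
      unfolding eq by (rule D0(2)[OF Qn])
     also have "... <= D0 j * E ^ (2 * j) * ?I"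
     proof (rule mult_mono[OF mult_left_mono IM])
      have "exp (- c * real n) <= 1" using c by simp
      also have "... <= E ^ (2 * j)" using E by (rule one_le_power)
      finally show "exp (- c * real n) <= E ^ (2 * j)" .
     qed (use D0(1)[of j] h E in auto)
     finally show ?thesis unfolding split[OF cj] using A by (simp add: algebra_simps)
    qed
    show "integral {x0..0} (%x. (Aop m n ?w x - E * ?w x)^2) <= C * exp (- c * real n) * ?I"
    proof -
     have e: "Aop m n ?w x - E * ?w x = (\<alpha> 1 (Lam n) E x - E * s x) * w x + \<beta> 1 (Lam n) E x * w1 x" for x
      using eq[of 1 x] by (simp add: algebra_simps)
     have ce: "continuous_on UNIV (%x. (Aop m n ?w x - E * ?w x)^2)"
      by (intro continuous_intros smooth_continuous[OF sw] smooth_continuous[OF smooth_Aop[OF m sw]] smooth_continuous[OF ss] cw)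
     have "integral {x0..- 5/2 * h} (%x. (Aop m n ?w x - E * ?w x)^2) = integral {x0..- 5/2 * h} (%x. 0)"
      by (rule HK_cong) (unfold e, use h in "simp add: one s1")
     hence "integral {x0..0} (%x. (Aop m n ?w x - E * ?w x)^2) = integral ?J (%x. (Aop m n ?w x - E * ?w x)^2)"
      unfolding split[OF ce] by simp
     also have "... <= C * exp (- c * real n) * (h * M^2)" unfolding e by (rule C(2)[OF Qn])
     also have "... <= C * exp (- c * real n) * ?I" using C(1) by (intro mult_left_mono IM) auto
     finally show ?thesis .
    qed
   qed
  qed
 qed
qed

section \<open>Energy estimates for the wave equation on the half-line\<close>

lemma leibniz_interval:
 fixes f f' :: "real => real => real"
 assumes "!!t x. has_d (%t. f t x) (f' t x) t"
  "jcont f" "jcont f'"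
 shows "has_d (%t. integral {a..b} (f t)) (integral {a..b} (f' t)) t"
proof -
 have "((%t. integral (cbox a b) (f t)) has_field_derivative integral (cbox a b) (f' t)) (at t within UNIV)"
 proof (rule leibniz_rule_field_derivative)
  show "f s integrable_on cbox a b" for s
   unfolding cbox_interval by (intro integrable_continuous_real continuous_on_subset[OF cont_slice[OF assms(2)]]) simp
  show "continuous_on (UNIV \<times> cbox a b) (%(x, t). f' x t)" by (rule continuous_on_subset[OF assms(3)]) simp
 qed (use assms(1) in auto)
 thus ?thesis by simp
qed

lemma integral_Cauchy_Schwarz:
 fixes f g :: "real => real"
 assumes f: "continuous_on {a..b} f" and g: "continuous_on {a..b} g"
 shows "(integral {a..b} (%x. f x * g x))^2 <= integral {a..b} (%x. (f x)^2) * integral {a..b} (%x. (g x)^2)"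
proof -
 define A B C where "A = integral {a..b} (%x. (f x)^2)" and "B = integral {a..b} (%x. f x * g x)" and "C = integral {a..b} (%x. (g x)^2)"
 have i: "(%x. (f x)^2) integrable_on {a..b}" "(%x. f x * g x) integrable_on {a..b}" "(%x. (g x)^2) integrable_on {a..b}"
  by (intro integrable_continuous_real continuous_intros f g)+
 have q: "0 <= A - 2 * s * B + s^2 * C" for s
 proof -
  have "((%x. (f x)^2) has_integral A) {a..b}" unfolding A_def by (rule integrable_integral[OF i(1)])
  moreover have "((%x. 2 * s * (f x * g x)) has_integral 2 * s * B) {a..b}"
   unfolding B_def by (rule has_integral_mult_right) (rule integrable_integral[OF i(2)])
  ultimately have fg: "((%x. (f x)^2 - 2 * s * (f x * g x)) has_integral A - 2 * s * B) {a..b}" by (rule has_integral_diff)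
  have "((%x. s^2 * (g x)^2) has_integral s^2 * C) {a..b}"
   unfolding C_def by (rule has_integral_mult_right) (rule integrable_integral[OF i(3)])
  note has_integral_add[OF fg this]
  moreover have "(%x. (f x)^2 - 2 * s * (f x * g x) + s^2 * (g x)^2) = (%x. (f x - s * g x)^2)"
   by (rule ext) (simp add: power2_diff power_mult_distrib)
  ultimately have "((%x. (f x - s * g x)^2) has_integral A - 2 * s * B + s^2 * C) {a..b}" by simp
  thus ?thesis by (rule has_integral_nonneg) simp
 qed
 have C0: "C >= 0" unfolding C_def by (rule integral_nonneg[OF i(3)]) simp
 have "B^2 <= A * C"
 proof (cases "C = 0")
  case True
  have "B = 0"
  proof (rule ccontr)
   assume "B ~= 0"
   hence "2 * ((A + 1) / (2 * B)) * B = A + 1" by simp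
   thus False using q[of "(A + 1) / (2 * B)"] True by simp
  qed
  thus ?thesis using True by simp
 next
  case False
  define r where "r = B / C"
  have rC: "r * C = B" using False by (simp add: r_def)
  have "0 <= C * (A - 2 * r * B + r^2 * C)" by (rule mult_nonneg_nonneg[OF C0 q])
  also have "... = A * C - 2 * (r * C) * B + (r * C)^2" by (simp add: algebra_simps power2_eq_square)
  finally show ?thesis unfolding rC by (simp add: power2_eq_square)
 qed
 thus ?thesis by (simp add: A_def B_def C_def)
qed

lemma deriv_zero_right:
 assumes "has_d w d a" "!!x. x >= a ==> w x = (0::real)"
 shows "d = 0"
proof (rule tendsto_unique[OF trivial_limit_at_right_real])
 show "((%y. (w y - w a) / (y - a)) \<longlongrightarrow> d) (at_right a)"
  using assms(1) unfolding has_field_derivative_iff by (rule filterlim_mono) (auto simp: at_le)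
 show "((%y. (w y - w a) / (y - a)) \<longlongrightarrow> 0) (at_right a)"
  by (rule tendsto_eventually) (use assms(2) in "auto simp: eventually_at_filter")
qed

lemma c2_waveD:
 assumes "c2_wave V x0 w v vt vx vtt vtx vxx"
 shows "has_d (%t. v t x) (vt t x) t" "has_d (%t. vt t x) (vtt t x) t"
  "has_d (%t. vx t x) (vtx t x) t" "has_d (%x. v t x) (vx t x) x"
  "has_d (%x. vx t x) (vxx t x) x" "has_d (%x. vt t x) (vtx t x) x"
  "jcont v" "jcont vt" "jcont vx"
  "jcont vtt" "jcont vtx" "jcont vxx"
  "t >= 0 ==> x >= x0 ==> vtt t x = vxx t x - V x * v t x"
  "t >= 0 ==> v t x0 = 0" "x >= x0 ==> v 0 x = w x" "vt 0 x = 0" "t >= 0 ==> x >= t ==> v t x = 0"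
 using assms unfolding c2_wave_def by simp_all

lemma c2_wave_boundary:
 assumes W: "c2_wave V x0 w v vt vx vtt vtx vxx" and t: "t >= 0"
 shows "vt t x0 = 0" "x >= t ==> vt t x = 0"
proof -
 show "vt t x0 = 0"
 proof (cases "t = 0")
  case False
  show ?thesis by (rule DERIV_const_on_open[OF c2_waveD(1)[OF W], of "{0<..}" t x0]) (use False t c2_waveD(14)[OF W] in auto)
 qed (simp add: c2_waveD(16)[OF W])
 show "vt t x = 0" if x: "x >= t"
 proof (cases "t = 0")
  case False
  have z: "vt t y = 0" if "y > t" for y
   by (rule DERIV_const_on_open[OF c2_waveD(1)[OF W], of "{0<..<y}" t y]) (use False t that c2_waveD(17)[OF W] in auto)
  have "closed {y. vt t y = 0}" using cont_slice[OF c2_waveD(8)[OF W], of t]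
   by (intro closed_Collect_eq continuous_on_const) auto
  hence "closure {t<..} \<subseteq> {y. vt t y = 0}" using z by (intro closure_minimal) auto
  thus ?thesis using x by auto
 qed (simp add: c2_waveD(16)[OF W])
qed

text \<open>The time derivative of the energy density is the \<open>x\<close>-derivative of \<open>2 v_t v_x\<close>, and
  \<open>v_t\<close> vanishes at \<open>x0\<close> and beyond the light cone.\<close>
lemma energy_conserved:
 assumes W: "c2_wave V x0 w v vt vx vtt vtx vxx" and V: "continuous_on UNIV V" and t: "0 <= t" and X: "x0 <= X" "t + 1 <= X"
 shows "integral {x0..X} (%x. (vt t x)^2 + ((vx t x)^2 + V x * (v t x)^2)) = integral {x0..X} (%x. (vx 0 x)^2 + V x * (v 0 x)^2)"
proof -
 note D = c2_waveD[OF W]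
 let ?f = "%t x. (vt t x)^2 + ((vx t x)^2 + V x * (v t x)^2)"
 let ?f' = "%t x. 2 * (vt t x * vtt t x) + (2 * (vx t x * vtx t x) + V x * (2 * (v t x * vt t x)))"
 have d: "has_d (%t. integral {x0..X} (?f t)) (integral {x0..X} (?f' s)) s" for s
 proof (rule leibniz_interval)
  show "has_d (%t. ?f t x) (?f' t x) t" for t x
   by (auto intro!: derivative_eq_intros D(1-3))
  show "jcont ?f" "jcont ?f'"
   unfolding case_prod_beta'
   by (intro continuous_intros cont2D[OF D(7)] cont2D[OF D(8)] cont2D[OF D(9)] cont2D[OF D(10)] cont2D[OF D(11)]
     continuous_on_compose2[OF V] subset_UNIV)+
 qed
 have z: "integral {x0..X} (?f' s) = 0" if s: "0 <= s" "s <= t" for s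
 proof -
  have "integral {x0..X} (?f' s) = integral {x0..X} (%x. 2 * (vtx s x * vx s x + vxx s x * vt s x))"
  proof (rule HK_cong)
   fix x assume "x : {x0..X}"
   hence "vxx s x = vtt s x + V x * v s x" using D(13)[of s x] s by simp
   thus "?f' s x = 2 * (vtx s x * vx s x + vxx s x * vt s x)" by (simp add: algebra_simps)
  qed
  also have "... = 2 * (vt s X * vx s X) - 2 * (vt s x0 * vx s x0)"
   by (rule integral_unique[OF has_integral_deriv[OF X(1) DERIV_cmult[OF DERIV_mult[OF D(6) D(5)]]]])
  also have "... = 0" using c2_wave_boundary[OF W s(1)] X s by simp
  finally show ?thesis .
 qed
 have "integral {x0..X} (?f t) = integral {x0..X} (?f 0)"
 proof (cases "t = 0")
  case False
  show ?thesis
  (* the derivative is known to vanish for nonnegative times only *)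
  proof (rule DERIV_isconst2[of 0 t "%t. integral {x0..X} (?f t)"])
   show "continuous_on {0..t} (%t. integral {x0..X} (?f t))"
    by (intro continuous_at_imp_continuous_on ballI DERIV_isCont[OF d])
   show "has_d (%t. integral {x0..X} (?f t)) 0 s" if "0 < s" "s < t" for s
    using d[of s] z[of s] that by simp
  qed (use False t in auto)
 qed simp
 thus ?thesis by (simp add: D(16))
qed

lemma initial_energy:
 assumes W: "c2_wave V x0 w v vt vx vtt vtx vxx" and V: "continuous_on UNIV V" and x0: "x0 < 0" and X: "0 <= X"
  and w: "!!x. has_d w (w1 x) x" "!!x. has_d w1 (w2 x) x" "continuous_on UNIV w2"
  and w0: "w x0 = 0" "!!x. x >= 0 ==> w x = 0"
 shows "integral {x0..X} (%x. (vx 0 x)^2 + V x * (v 0 x)^2) = integral {x0..0} (%x. w x * (V x * w x - w2 x))"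
proof -
 note D = c2_waveD[OF W]
 have "continuous_on A w" "continuous_on A w1" for A
  by (intro continuous_at_imp_continuous_on ballI DERIV_isCont[OF w(1)] DERIV_isCont[OF w(2)])+
 note cw = this continuous_on_subset[OF w(3) subset_UNIV] continuous_on_subset[OF V subset_UNIV]
 have vw: "vx 0 x = w1 x" if "x > x0" for x
 proof -
  have "has_d (%x. v 0 x - w x) (vx 0 x - w1 x) x" by (rule DERIV_diff[OF D(4) w(1)])
  hence "vx 0 x - w1 x = 0" by (rule DERIV_const_on_open[where S="{x0<..}" and c=0]) (use that D(15) in auto)
  thus ?thesis by simp
 qed
 have "integral {x0..X} (%x. (vx 0 x)^2 + V x * (v 0 x)^2) = integral {x0..X} (%x. (w1 x)^2 + V x * (w x)^2)"
  by (rule integral_spike[of "{x0}"]) (use vw D(15) in auto)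
 also have "... = integral {x0..0} (%x. (w1 x)^2 + V x * (w x)^2) + integral {0..X} (%x. (w1 x)^2 + V x * (w x)^2)"
  by (rule HK_combine[symmetric])
    (use x0 X in "auto intro!: integrable_continuous_real continuous_intros cw")
 also have "integral {0..X} (%x. (w1 x)^2 + V x * (w x)^2) = integral {0..X} (%x. 0)"
  by (rule HK_cong) (use w0 deriv_zero_right[OF w(1)] in force)
 also have "integral {x0..0} (%x. (w1 x)^2 + V x * (w x)^2) = integral {x0..0} (%x. w x * (V x * w x - w2 x) + (w1 x * w1 x + w2 x * w x))"
  by (rule HK_cong) (simp add: power2_eq_square algebra_simps)
 also have "... = integral {x0..0} (%x. w x * (V x * w x - w2 x)) + integral {x0..0} (%x. w1 x * w1 x + w2 x * w x)"
  by (rule HK_add) (intro integrable_continuous_real continuous_intros cw)+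
 also have "integral {x0..0} (%x. w1 x * w1 x + w2 x * w x) = w 0 * w1 0 - w x0 * w1 x0"
  by (rule integral_unique[OF has_integral_deriv[OF less_imp_le[OF x0] DERIV_mult[OF w(1,2)]]])
 finally show ?thesis using w0 by simp
qed

text \<open>Put \<open>a = sqrt E <w, v>\<close> and \<open>b = <w, v_t>\<close>.  Then \<open>a' = sqrt E b\<close> and \<open>b'
  = - sqrt E a - <A w - E w, v>\<close>, so \<open>a^2 + b^2\<close> changes at a rate that is bounded by
  \<open>\<delta>\<close> and the conserved energy.  By Cauchy-Schwarz \<open>a^2 + b^2\<close> is at most
  \<open>N\<close> times the right-hand side, and at time \<open>0\<close> it equals \<open>E N^2\<close>.\<close>
lemma wave_lower_bound:
 assumes W: "c2_wave V x0 w v vt vx vtt vtx vxx" and V: "continuous_on UNIV V" "!!x. V x >= 0"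
  and x0: "x0 < 0" and Vq: "!!x. x : {x0..0} ==> V x >= q * E" and q: "q > 0" and E: "E >= 1"
  and w: "!!x. has_d w (w1 x) x" "!!x. has_d w1 (w2 x) x" "continuous_on UNIV w2"
  and w0: "w x0 = 0" "!!x. x >= 0 ==> w x = 0"
  and N: "N = integral {x0..0} (%x. (w x)^2)" "N > 0"
  and DE: "integral {x0..0} (%x. (V x * w x - w2 x)^2) <= D * E^2 * N" "D >= 0"
  and er: "integral {x0..0} (%x. (V x * w x - w2 x - E * w x)^2) <= \<delta>^2 * N" "\<delta> >= 0"
  and t: "t >= 0" "4 * t * \<delta> * sqrt (D / q) <= 1"
 shows "E * N / 2 <= E * integral {x0..0} (%x. (v t x)^2) + integral {x0..0} (%x. (vt t x)^2)"
proof -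
 note Dw = c2_waveD[OF W]
 let ?J = "{x0..0}"
 have "continuous_on A w" "continuous_on A w1" for A
  by (intro continuous_at_imp_continuous_on ballI DERIV_isCont[OF w(1)] DERIV_isCont[OF w(2)])+
 note cw = this continuous_on_subset[OF w(3) subset_UNIV] continuous_on_subset[OF V(1) subset_UNIV]
 have cv: "continuous_on A (v s)" "continuous_on A (vt s)" "continuous_on A (vx s)" "continuous_on A (vxx s)" for A s
  by (rule continuous_on_subset[OF cont_slice[OF Dw(7)]] continuous_on_subset[OF cont_slice[OF Dw(8)]]
    continuous_on_subset[OF cont_slice[OF Dw(9)]] continuous_on_subset[OF cont_slice[OF Dw(12)]], simp)+
 let ?e = "%x. V x * w x - w2 x - E * w x"
 define F where "F = integral ?J (%x. w x * (V x * w x - w2 x))"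
 have F: "F <= sqrt D * E * N"
 proof -
  have "F^2 <= N * integral ?J (%x. (V x * w x - w2 x)^2)"
   unfolding F_def N(1) by (intro integral_Cauchy_Schwarz continuous_intros cw)
  also have "... <= N * (D * E^2 * N)" using N(2) DE(1) by (intro mult_left_mono) auto
  also have "... = (sqrt D * E * N)^2" using DE(2) by (simp add: power_mult_distrib power2_eq_square)
  finally show ?thesis using power2_le_imp_le DE(2) E N(2) by (metis mult_nonneg_nonneg real_sqrt_ge_zero less_imp_le order_trans zero_le_one)
 qed
 have io: "f integrable_on {a..b}" if "continuous_on {a..b} f" for f :: "real => real" and a b
  by (rule integrable_continuous_real[OF that])
 have en: "integral ?J (%x. (vt s x)^2) <= F" "integral ?J (%x. (v s x)^2) <= F / (q * E)" if s: "s >= 0" for s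
 proof -
  let ?f = "%x. (vt s x)^2 + ((vx s x)^2 + V x * (v s x)^2)"
  have i: "?f integrable_on {a..b}" "(%x. (vt s x)^2) integrable_on {a..b}" "(%x. (v s x)^2) integrable_on {a..b}" for a b
   by (intro io continuous_intros cv cw)+
  have f0: "?f x >= 0" for x using V(2)[of x] by simp
  have "integral ?J ?f <= integral {x0..s + 1} ?f" by (rule integral_subset_le) (use s x0 i f0 in auto)
  also have "... = integral {x0..s + 1} (%x. (vx 0 x)^2 + V x * (v 0 x)^2)"
   by (rule energy_conserved[OF W V(1) s]) (use x0 s in auto)
  also have "... = F" unfolding F_def by (rule initial_energy[OF W V(1) x0 _ w w0]) (use s in auto)
  finally have J: "integral ?J ?f <= F" .
  have "integral ?J (%x. (vt s x)^2) <= integral ?J ?f" by (rule integral_le[OF i(2) i(1)]) (use V(2) in simp)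
  thus "integral ?J (%x. (vt s x)^2) <= F" using J by linarith
  have "integral ?J (%x. q * E * (v s x)^2) <= integral ?J ?f"
  proof (rule integral_le[OF _ i(1)])
   fix x assume "x : ?J"
   hence "q * E * (v s x)^2 <= V x * (v s x)^2" by (intro mult_right_mono Vq) auto
   thus "q * E * (v s x)^2 <= ?f x" by (simp add: add_increasing)
  qed (intro io continuous_intros cv)
  hence "q * E * integral ?J (%x. (v s x)^2) <= F" using J by simp
  thus "integral ?J (%x. (v s x)^2) <= F / (q * E)" using q E by (simp add: field_simps)
 qed
 have "0 <= integral ?J (%x. (vt 0 x)^2)" by (rule integral_nonneg[OF io]) (auto intro: continuous_on_power cv)
 hence F0: "F >= 0" using en(1)[of 0] by linarith
 define a where "a s = sqrt E * integral ?J (%x. w x * v s x)" for s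
 define b where "b s = integral ?J (%x. w x * vt s x)" for s
 define ep where "ep s = integral ?J (%x. ?e x * v s x)" for s
 have da: "has_d a (sqrt E * b s) s" for s
  unfolding a_def b_def
 proof (rule DERIV_cmult[OF leibniz_interval])
  show "has_d (%t. w x * v t x) (w x * vt t x) t" for t x by (rule DERIV_cmult[OF Dw(1)])
  show "continuous_on UNIV (%(t, x). w x * v t x)" "continuous_on UNIV (%(t, x). w x * vt t x)"
   unfolding case_prod_beta'
   by (intro continuous_intros cont2D[OF Dw(7)] cont2D[OF Dw(8)] continuous_on_compose2[OF cw(1)[of UNIV]] subset_UNIV)+
 qed
 have db: "has_d b (- (sqrt E * a s) - ep s) s" if s: "s >= 0" for s
 proof -
  have "has_d b (integral ?J (%x. w x * vtt s x)) s"
   unfolding b_def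
  proof (rule leibniz_interval)
   show "has_d (%t. w x * vt t x) (w x * vtt t x) t" for t x by (rule DERIV_cmult[OF Dw(2)])
   show "continuous_on UNIV (%(t, x). w x * vt t x)" "continuous_on UNIV (%(t, x). w x * vtt t x)"
    unfolding case_prod_beta'
    by (intro continuous_intros cont2D[OF Dw(10)] cont2D[OF Dw(8)] continuous_on_compose2[OF cw(1)[of UNIV]] subset_UNIV)+
  qed
  also have "integral ?J (%x. w x * vtt s x) =
   integral ?J (%x. (w1 x * vx s x + vxx s x * w x - (w2 x * v s x + vx s x * w1 x)) - (E * (w x * v s x) + ?e x * v s x))"
  proof (rule HK_cong)
   fix x assume "x : ?J"
   hence "vxx s x = vtt s x + V x * v s x" using Dw(13)[of s x] s by simp
   thus "w x * vtt s x = (w1 x * vx s x + vxx s x * w x - (w2 x * v s x + vx s x * w1 x)) - (E * (w x * v s x) + ?e x * v s x)"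
    by (simp add: algebra_simps)
  qed
  also have "... = integral ?J (%x. w1 x * vx s x + vxx s x * w x - (w2 x * v s x + vx s x * w1 x)) - (E * integral ?J (%x. w x * v s x) + ep s)"
   unfolding ep_def
   by (subst HK_diff, (intro io continuous_intros cw cv)+,
     subst HK_add, (intro io continuous_intros cw cv)+) simp
  also have "integral ?J (%x. w1 x * vx s x + vxx s x * w x - (w2 x * v s x + vx s x * w1 x)) = (w 0 * vx s 0 - w1 0 * v s 0) - (w x0 * vx s x0 - w1 x0 * v s x0)"
   by (rule integral_unique[OF has_integral_deriv[OF less_imp_le[OF x0] DERIV_diff[OF DERIV_mult[OF w(1) Dw(5)] DERIV_mult[OF w(2) Dw(4)]]]])
  also have "... = 0" using w0 deriv_zero_right[OF w(1) w0(2)] Dw(14)[OF s] by simp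
  also have "E * integral ?J (%x. w x * v s x) = sqrt E * a s" using E by (simp add: a_def)
  finally show ?thesis by simp
 qed
 (* twice this number bounds the rate of change of a^2 + b^2 *)
 define B where "B = N * (\<delta> * (F / sqrt (q * E)))"
 have bep: "\<bar>b s * ep s\<bar> <= B" if s: "s >= 0" for s
 proof -
  have b2: "(b s)^2 <= N * F"
  proof -
   have "(b s)^2 <= N * integral ?J (%x. (vt s x)^2)" unfolding b_def N(1) by (intro integral_Cauchy_Schwarz cw cv)
   also have "... <= N * F" using N(2) en(1)[OF s] by (intro mult_left_mono) auto
   finally show ?thesis .
  qed
  have e2: "(ep s)^2 <= (\<delta>^2 * N) * (F / (q * E))"
  proof -
   have "(ep s)^2 <= integral ?J (%x. (?e x)^2) * integral ?J (%x. (v s x)^2)"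
    unfolding ep_def by (intro integral_Cauchy_Schwarz continuous_intros cw cv)
   also have "... <= (\<delta>^2 * N) * (F / (q * E))"
    using er(1) en(2)[OF s] N(2) by (intro mult_mono) (auto intro!: integral_nonneg io continuous_intros cw cv)
   finally show ?thesis .
  qed
  have "\<bar>b s * ep s\<bar>^2 = (b s)^2 * (ep s)^2" by (simp add: power_mult_distrib)
  also have "... <= (N * F) * ((\<delta>^2 * N) * (F / (q * E)))" using b2 e2 N(2) F0 by (intro mult_mono) auto
  also have "... = B^2" using q E by (simp add: B_def power_mult_distrib power_divide power2_eq_square)
  finally show ?thesis by (rule power2_le_imp_le) (use N F0 er(2) q E in "simp add: B_def")
 qed
 have BE: "2 * t * B <= E * N^2 / 2"
 proof -
  have "F / sqrt (q * E) <= sqrt D * E * N / sqrt (q * E)" using F q E by (intro divide_right_mono) auto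
  also have "... = sqrt (D / q) * sqrt E * N"
  proof -
   have "sqrt D * (r * r) * N / (sqrt q * r) = sqrt D / sqrt q * r * N" if r: "r > 0" for r using r by simp
   note this[of "sqrt E", OF real_sqrt_gt_zero[OF less_le_trans[OF zero_less_one E]]]
   moreover have "sqrt E * sqrt E = E" using E by simp
   ultimately show ?thesis by (simp only: real_sqrt_mult real_sqrt_divide)
  qed
  also have "... <= sqrt (D / q) * E * N"
  proof -
   have "sqrt E <= E" using E by (simp add: real_le_lsqrt real_sqrt_le_iff power2_eq_square sqrt_le_D)
   thus ?thesis using DE(2) q N by (intro mult_right_mono mult_left_mono) auto
  qed
  finally have "t * (N * \<delta>) * (F / sqrt (q * E)) <= t * (N * \<delta>) * (sqrt (D / q) * E * N)"
   using t N er(2) by (intro mult_left_mono) auto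
  also have "... = (4 * t * \<delta> * sqrt (D / q)) * (E * N^2 / 4)" by (simp add: power2_eq_square)
  also have "... <= 1 * (E * N^2 / 4)" using t(2) E by (intro mult_right_mono) auto
  finally have "t * (N * \<delta>) * (F / sqrt (q * E)) <= E * N^2 / 4" by simp
  moreover have "2 * t * B = 2 * (t * (N * \<delta>) * (F / sqrt (q * E)))" by (simp add: B_def)
  ultimately show ?thesis by linarith
 qed
 have "(a 0)^2 + (b 0)^2 + 2 * B * 0 <= (a t)^2 + (b t)^2 + 2 * B * t"
 proof (rule DERIV_nonneg_imp_nondecreasing[where f="%s. (a s)^2 + (b s)^2 + 2 * B * s", OF t(1)])
  fix s assume s: "0 <= s" "s <= t"
  have "has_d (%s. (a s)^2 + (b s)^2 + 2 * B * s) (2 * (B - b s * ep s)) s"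
   by (rule DERIV_cong[OF DERIV_add[OF DERIV_add[OF DERIV_power[OF da] DERIV_power[OF db[OF s(1)]]] DERIV_cmult[OF DERIV_ident]]])
     (simp add: algebra_simps)
  moreover have "2 * (B - b s * ep s) >= 0" using bep[OF s(1)] by simp
  ultimately show "EX y. has_d (%s. (a s)^2 + (b s)^2 + 2 * B * s) y s & 0 <= y" by blast
 qed
 moreover have "a 0 = sqrt E * N"
  unfolding a_def N(1) using Dw(15) by (auto intro!: HK_cong simp: power2_eq_square)
 moreover have "b 0 = 0" by (simp add: b_def Dw(16))
 ultimately have ab: "E * N^2 / 2 <= (a t)^2 + (b t)^2" using BE E by (simp add: power_mult_distrib algebra_simps)
 have "(a t)^2 <= E * (N * integral ?J (%x. (v t x)^2))"
  unfolding a_def N(1) power_mult_distrib real_sqrt_pow2[OF order_trans[OF zero_le_one E]]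
  using E by (intro mult_left_mono integral_Cauchy_Schwarz cw cv) auto
 moreover have "(b t)^2 <= N * integral ?J (%x. (vt t x)^2)" unfolding b_def N(1) by (intro integral_Cauchy_Schwarz cw cv)
 ultimately have "N * (E * N / 2) <= N * (E * integral ?J (%x. (v t x)^2) + integral ?J (%x. (vt t x)^2))"
  using ab by (simp add: algebra_simps power2_eq_square)
 thus ?thesis using N(2) by simp
qed

lemma dq_uniform:
 fixes f f' :: "real => real => real"
 assumes d: "!!t x. has_d (%t. f t x) (f' t x) t" and c: "jcont f'" and e: "e > 0"
 shows "\<exists>d>0. ALL s x. s ~= t --> \<bar>s - t\<bar> < d --> x : {a..b} --> \<bar>(f s x - f t x) / (s - t) - f' t x\<bar> < e"
proof -
 let ?K = "{t - 1..t + 1} \<times> {a..b}"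
 have "uniformly_continuous_on ?K (%(t, x). f' t x)"
  by (intro compact_uniformly_continuous continuous_on_subset[OF c] compact_Times compact_Icc) auto
 then obtain r where r: "r > 0" "!!p p'. p : ?K ==> p' : ?K ==> dist p' p < r ==> dist (case p' of (t, x) => f' t x) (case p of (t, x) => f' t x) < e"
  unfolding uniformly_continuous_on_def using e by metis
 show ?thesis
 proof (intro exI conjI allI impI)
  show "min r 1 > 0" using r by simp
  fix s x assume s: "s ~= t" "\<bar>s - t\<bar> < min r 1" and x: "x : {a..b}"
  obtain z where z: "\<bar>z - t\<bar> < \<bar>s - t\<bar>" "f s x - f t x = (s - t) * f' z x"
  proof (cases "s < t")
   case True
   obtain z where "s < z" "z < t" "f t x - f s x = (t - s) * f' z x" using MVT2[OF True, of "%t. f t x" "%t. f' t x"] d by blast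
   thus ?thesis by (intro that[of z]) (auto simp: algebra_simps)
  next
   case False
   hence "t < s" using s by simp
   then obtain z where "t < z" "z < s" "f s x - f t x = (s - t) * f' z x" using MVT2[of t s "%t. f t x" "%t. f' t x"] d by blast
   thus ?thesis by (intro that[of z]) auto
  qed
  have "t - 1 <= z" "z <= t + 1" "\<bar>z - t\<bar> < r" using z(1) s(2) by linarith+
  hence "dist (f' z x) (f' t x) < e"
   using r(2)[of "(t, x)" "(z, x)"] x by (simp add: dist_Pair_Pair dist_real_def)
  thus "\<bar>(f s x - f t x) / (s - t) - f' t x\<bar> < e" using z(2) s by (simp add: dist_real_def)
 qed
qed

text \<open>Convergence of difference quotients in weighted \<open>L2\<close>, from uniform convergence on compact intervals; it
  supplies the limits in the energy norm.\<close>
lemma dq_integral: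
 fixes f f' :: "real => real => real"
 assumes d: "!!t x. has_d (%t. f t x) (f' t x) t"
  and c: "jcont f'" "jcont f" and q: "continuous_on UNIV q" "!!x. q x >= 0" and ab: "a <= b"
 shows "((%s. integral {a..b} (%x. q x * ((f s x - f t x) / (s - t) - f' t x)^2)) \<longlongrightarrow> (0::real)) (at t)"
proof (rule tendstoI)
 fix e :: real assume e: "e > 0"
 obtain B where B: "B > 0" "\<forall>x\<in>{a..b}. norm (q x) <= B"
  using compact_continuous_bound[of "{a..b}" q] continuous_on_subset[OF q(1)] by auto
 define r where "r = sqrt (e / (2 * B * (b - a + 1)))"
 have p: "e / (2 * B * (b - a + 1)) > 0" using e B ab by simp
 have r: "r > 0" "r^2 = e / (2 * B * (b - a + 1))" using p by (auto simp: r_def)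
 obtain \<eta> where \<eta>: "\<eta> > 0" "!!s x. s ~= t ==> \<bar>s - t\<bar> < \<eta> ==> x : {a..b} ==> \<bar>(f s x - f t x) / (s - t) - f' t x\<bar> < r"
  using dq_uniform[OF d c(1) r(1), of t a b] by blast
 show "\<forall>\<^sub>F s in at t. dist (integral {a..b} (%x. q x * ((f s x - f t x) / (s - t) - f' t x)^2)) 0 < e"
  unfolding eventually_at
 proof (intro exI conjI ballI impI)
  fix s assume s: "s ~= t & dist s t < \<eta>"
  let ?h = "%x. q x * ((f s x - f t x) / (s - t) - f' t x)^2"
  have i: "?h integrable_on {a..b}"
   by (intro integrable_continuous_real continuous_intros continuous_on_subset[OF q(1)] continuous_on_subset[OF cont_slice[OF c(1)]]
     continuous_on_subset[OF cont_slice[OF c(2)]] subset_UNIV) (use s in auto)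
  have "integral {a..b} ?h <= integral {a..b} (%x. B * r^2)"
  proof (rule integral_le[OF i])
   fix x assume x: "x : {a..b}"
   have "\<bar>(f s x - f t x) / (s - t) - f' t x\<bar>^2 <= r^2"
    using \<eta>(2)[of s x] s x by (intro power_mono) (auto simp: dist_real_def)
   moreover have "q x <= B" using B(2) x by fastforce
   ultimately show "?h x <= B * r^2" using B(1) by (intro mult_mono) auto
  qed (rule integrable_continuous_real[OF continuous_on_const])
  also have "... = (b - a) * (e / (2 * (b - a + 1)))" using B ab by (simp add: r(2))
  also have "... < e" using e ab by (simp add: field_simps) (use mult_right_mono[OF ab, of e] e in linarith)
  finally show "dist (integral {a..b} ?h) 0 < e"
   using integral_nonneg[OF i] q(2) by (simp add: dist_real_def)
 qed (rule \<eta>(1))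
qed

section \<open>States built from modes\<close>

text \<open>States are determined up to null sets only: applying the generator replaces classical Laplacians by chosen
  representatives.\<close>
definition mode_state :: "nat => nat => real => state => complex => (real => real) => complex => (real => real) => bool" where
 "mode_state m n x0 U c g d h \<longleftrightarrow>
   fst U : borel_measurable (volM m x0) & (AE p in volM m x0. fst U p = mode m n c g p) &
   snd U : borel_measurable (volM m x0) & (AE p in volM m x0. snd U p = mode m n d h p)"

lemma mode_measurable: "m >= 1 ==> continuous_on UNIV g ==> mode m n c g : borel_measurable (vol m I)"
 by (intro continuous_measurable_vol continuous_mode_M)

lemma in_L2_mode:
 assumes "m >= 1" "continuous_on UNIV g" "!!x. x > X ==> g x = 0"
 shows "in_L2 (volM m x0) (mode m n c g)"
 by (rule in_L2_vanishing[OF assms(1) continuous_mode_M[OF assms(1,2)], where X=X]) (use assms(3) in "simp add: mode_def")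

lemma in_L2_cong_AE:
 fixes f g :: "'a => complex"
 assumes "in_L2 M f" "g : borel_measurable M" "AE p in M. g p = f p"
 shows "in_L2 M g"
proof -
 have "integrable M (%p. (norm (g p))^2) \<longleftrightarrow> integrable M (%p. (norm (f p))^2)"
  using assms(3) in_L2_meas[OF assms(1)] assms(2) by (intro integrable_cong_AE) auto
 thus ?thesis using assms by (simp add: in_L2_def)
qed

lemma H1_0_mode:
 assumes m: "m >= 1" and n: "n >= 1" and f: "f : borel_measurable (volM m x0)" "AE p in volM m x0. f p = mode m n c g p"
  and g: "!!x. has_d g (g1 x) x" "continuous_on UNIV g1"
  and X: "x0 < X" "!!x. x >= X ==> g x = 0" and g0: "g x0 = 0"
 shows "has_grad m x0 f (gmode m n c g g1)"
 by (rule has_grad_cong[OF m has_grad_mode[OF m n g X(1) _ g0] f(1)]) (use f X in auto)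

lemma has_laplacian_mode_state:
 assumes m: "m >= 1" and n: "n >= 1" and f: "f : borel_measurable (volM m x0)" "AE p in volM m x0. f p = mode m n c g p"
  and g: "!!x. has_d g (g1 x) x" "!!x. has_d g1 (g2 x) x" "continuous_on UNIV g2"
  and X: "!!x. x > X ==> g x = 0"
 shows "has_laplacian m x0 f (mode m n c (%x. g2 x - pot m n x * g x))"
proof -
 have cg: "continuous_on UNIV g" by (intro continuous_at_imp_continuous_on ballI DERIV_isCont[OF g(1)])
 show ?thesis
  by (rule has_laplacian_cong[OF m has_laplacian_mode[OF m n g X] mode_measurable[OF m cg] f(1)])
    (use f in "auto intro!: mode_measurable m continuous_intros g cg pot_continuous")
qed

lemma mode_state_energy:
 assumes m: "m >= 1" and n: "n >= 1" and U: "mode_state m n x0 U c g d h"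
  and g: "!!x. has_d g (g1 x) x" "continuous_on UNIV g1"
  and X: "x0 < X" "!!x. x >= X ==> g x = 0" and g0: "g x0 = 0"
  and h: "continuous_on UNIV h" "!!x. x > X ==> h x = 0"
 shows "U : energy_space m x0"
  "energy_norm m x0 U = sqrt (NY n * ((cmod c)^2 * integral {x0..X} (%x. (g1 x)^2 + pot m n x * (g x)^2)
    + (cmod d)^2 * integral {x0..X} (%x. (h x)^2)))"
proof -
 obtain f s where fs: "U = (f, s)" by (cases U)
 have fm: "f : borel_measurable (volM m x0)" "AE p in volM m x0. f p = mode m n c g p"
  and sm: "s : borel_measurable (volM m x0)" "AE p in volM m x0. s p = mode m n d h p"
  using U by (auto simp: mode_state_def fs)
 note G = H1_0_mode[OF m n fm g X g0]
 show "U : energy_space m x0"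
  using G in_L2_cong_AE[OF in_L2_mode[OF m h] sm] by (auto simp: energy_space_def H1_0_def fs)
 have "L2_norm (volM m x0) s = L2_norm (volM m x0) (mode m n d h)"
  by (rule L2_norm_cong_AE[OF sm(1) mode_measurable[OF m h(1)] sm(2)])
 hence "(L2_norm (volM m x0) s)^2 = (cmod d)^2 * NY n * integral {x0..X} (%x. (h x)^2)"
  using L2_mode[OF m _ h(2) h(1), of x0 X] X by auto
 moreover have "(L2_norm (volM m x0) (weak_grad m x0 f))^2 = (cmod c)^2 * NY n * integral {x0..X} (%x. (g1 x)^2 + pot m n x * (g x)^2)"
 proof -
  have "L2_norm (volM m x0) (weak_grad m x0 f) = L2_norm (volM m x0) (gmode m n c g g1)" by (rule weak_grad_norm[OF m G])
  thus ?thesis using L2_gmode[OF m n less_imp_le[OF X(1)] X(2) g0 g] by simp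
 qed
 ultimately show "energy_norm m x0 U = sqrt (NY n * ((cmod c)^2 * integral {x0..X} (%x. (g1 x)^2 + pot m n x * (g x)^2)
    + (cmod d)^2 * integral {x0..X} (%x. (h x)^2)))"
  by (simp add: energy_norm_def fs algebra_simps)
qed

section \<open>The wave generated by a mode\<close>

text \<open>The difference quotient minus its limit is again a pair of modes, whose energy norm is a one-dimensional integral.\<close>
lemma wave_solution_mode:
 assumes m: "m >= 1" and n: "n >= 1" and x0: "x0 < 0" and W: "c2_wave (pot m n) x0 w v vt vx vtt vtx vxx"
 shows "wave_solution m x0 (mode m n 1 w) (%_. 0) (%t. mode m n 1 (v t)) (%t. mode m n 1 (vt t))"
proof -
 note D = c2_waveD[OF W]
 have cv: "continuous_on A (v s)" "continuous_on A (vt s)" "continuous_on A (vx s)" "continuous_on A (vtt s)" "continuous_on A (vtx s)" "continuous_on A (vxx s)" for A s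
  by (rule continuous_on_subset[OF cont_slice[OF D(7)] subset_UNIV] continuous_on_subset[OF cont_slice[OF D(8)] subset_UNIV]
    continuous_on_subset[OF cont_slice[OF D(9)] subset_UNIV] continuous_on_subset[OF cont_slice[OF D(10)] subset_UNIV]
    continuous_on_subset[OF cont_slice[OF D(11)] subset_UNIV] continuous_on_subset[OF cont_slice[OF D(12)] subset_UNIV])+
 show ?thesis
  unfolding wave_solution_def
 proof (intro conjI allI impI)
  show "AE p in volM m x0. mode m n 1 (v 0) p = mode m n 1 w p & mode m n 1 (vt 0) p = 0"
   by (rule AE_I2) (auto simp: mode_def D(15) D(16))
  fix t :: real assume t: "t >= 0"
  have vm: "mode m n 1 (v t) : borel_measurable (volM m x0)" by (rule mode_measurable[OF m cv(1)])
  have grad_v: "has_grad m x0 (mode m n 1 (v t)) (gmode m n 1 (v t) (vx t))"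
   by (rule H1_0_mode[OF m n vm _ D(4) cv(3), where X="t + 1"]) (use t x0 D(14)[OF t] D(17)[OF t] in auto)
  have grad_vt: "has_grad m x0 (mode m n 1 (vt t)) (gmode m n 1 (vt t) (vtx t))"
   by (rule H1_0_mode[OF m n mode_measurable[OF m cv(2)] _ D(6) cv(5), where X="t + 1"])
     (use t x0 c2_wave_boundary[OF W t] in auto)
  have lap: "has_laplacian m x0 (mode m n 1 (v t)) (mode m n 1 (%x. vxx t x - pot m n x * v t x))"
   by (rule has_laplacian_mode[OF m n D(4) D(5) cv(6), where X=t]) (use D(17)[OF t] in auto)
  have vL: "in_L2 (volM m x0) (mode m n 1 (vt t))"
   by (rule in_L2_mode[OF m cv(2), where X=t]) (use c2_wave_boundary[OF W t] in auto)
  show "(mode m n 1 (v t), mode m n 1 (vt t)) : dom_B m x0"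
   using grad_v grad_vt lap vL unfolding dom_B_def energy_space_def H1_0_def by blast
  let ?S = "%s. ((%p. (mode m n 1 (v s) p - mode m n 1 (v t) p) /\<^sub>R (s - t) - mode m n 1 (vt t) p),
       (%p. (mode m n 1 (vt s) p - mode m n 1 (vt t) p) /\<^sub>R (s - t) - laplacian m x0 (mode m n 1 (v t)) p))"
  let ?g = "%s x. (v s x - v t x) / (s - t) - vt t x"
  let ?g1 = "%s x. (vx s x - vx t x) / (s - t) - vtx t x"
  let ?h = "%s x. (vt s x - vt t x) / (s - t) - vtt t x"
  let ?X = "t + 2"
  have mq: "(mode m n 1 a p - mode m n 1 b p) /\<^sub>R r - mode m n 1 c p = mode m n 1 (%x. (a x - b x) / r - c x) p" for a b c r p
   by (simp add: mode_def scaleR_conv_of_real divide_inverse algebra_simps)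
  have vtt0: "vtt t x = 0" if x: "x > t" for x
  proof -
   have z: "vx t y = 0" if "y > t" for y
    by (rule DERIV_const_on_open[where S="{t<..}" and c=0, OF D(4)]) (use that D(17)[OF t] in auto)
   have "vxx t x = 0"
    by (rule DERIV_const_on_open[where S="{t<..}" and c=0, OF D(5)]) (use x z in auto)
   thus ?thesis using D(13)[OF t, of x] D(17)[OF t, of x] x x0 t by simp
  qed
  have state: "mode_state m n x0 (?S s) 1 (?g s) 1 (?h s)" if s: "s ~= t" for s
   unfolding mode_state_def fst_conv snd_conv mq
  proof (intro conjI)
   show "mode m n 1 (?g s) : borel_measurable (volM m x0)"
    by (intro mode_measurable m continuous_intros cv) (use s in auto)
   have L: "laplacian m x0 (mode m n 1 (v t)) : borel_measurable (volM m x0)"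
    using laplacian_AE(1)[OF m lap] by (auto simp: has_laplacian_def in_L2_def)
   show "(%p. (mode m n 1 (vt s) p - mode m n 1 (vt t) p) /\<^sub>R (s - t) - laplacian m x0 (mode m n 1 (v t)) p) : borel_measurable (volM m x0)"
    by (intro borel_measurable_diff borel_measurable_scaleR borel_measurable_const mode_measurable m cv L)
   have "AE p in volM m x0. p : {x0<..} \<times> S2" using AE_space[of "volM m x0"] by simp
   thus "AE p in volM m x0. (mode m n 1 (vt s) p - mode m n 1 (vt t) p) /\<^sub>R (s - t) - laplacian m x0 (mode m n 1 (v t)) p = mode m n 1 (?h s) p"
    using laplacian_AE(2)[OF m lap]
   proof eventually_elim
    case (elim p)
    have "mode m n 1 (%x. vxx t x - pot m n x * v t x) p = mode m n 1 (vtt t) p"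
     using elim(1) D(13)[OF t, of "fst p"] by (auto simp: mode_def)
    thus ?case unfolding elim(2) by (simp add: mq)
   qed
  qed simp
  have en: "energy_norm m x0 (?S s) = sqrt (NY n * (integral {x0..?X} (%x. (?g1 s x)^2 + pot m n x * (?g s x)^2) + integral {x0..?X} (%x. (?h s x)^2)))"
   if s: "s ~= t" "s >= 0" "s < t + 1" for s
  proof -
   have "energy_norm m x0 (?S s) = sqrt (NY n * ((cmod 1)^2 * integral {x0..?X} (%x. (?g1 s x)^2 + pot m n x * (?g s x)^2)
     + (cmod 1)^2 * integral {x0..?X} (%x. (?h s x)^2)))"
   proof (rule mode_state_energy(2)[OF m n state[OF s(1)]])
    show "has_d (?g s) (?g1 s x) x" for x by (intro DERIV_diff DERIV_cdivide D)
    show "continuous_on UNIV (?g1 s)" "continuous_on UNIV (?h s)" by (intro continuous_intros cv; use s in simp)+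
    show "x0 < ?X" using x0 t by simp
    show "?g s x = 0" if "x >= ?X" for x using that s D(17)[OF t] D(17)[OF s(2)] c2_wave_boundary(2)[OF W t] by simp
    show "?g s x0 = 0" using D(14)[OF t] D(14)[OF s(2)] c2_wave_boundary(1)[OF W t] by simp
    show "?h s x = 0" if "x > ?X" for x
     using that s vtt0[of x] c2_wave_boundary(2)[OF W t] c2_wave_boundary(2)[OF W s(2)] by simp
   qed
   thus ?thesis by simp
  qed
  have pn: "pot m n x >= 0" for x
   using curv_bounds[OF m, of x] Lam_ge(2)[of n] by (simp add: pot_def)
  note lim = dq_integral[where t=t and a=x0 and b="?X"]
  have l1: "((%s. integral {x0..?X} (%x. 1 * (?g1 s x)^2)) \<longlongrightarrow> 0) (at t)"
   by (rule lim[OF D(3) D(11) D(9)]) (use x0 t in auto)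
  have l2: "((%s. integral {x0..?X} (%x. pot m n x * (?g s x)^2)) \<longlongrightarrow> 0) (at t)"
   by (rule lim[OF D(1) D(8) D(7)]) (use x0 t pn pot_continuous[OF m] in auto)
  have l3: "((%s. integral {x0..?X} (%x. 1 * (?h s x)^2)) \<longlongrightarrow> 0) (at t)"
   by (rule lim[OF D(2) D(10) D(8)]) (use x0 t in auto)
  have "((%s. sqrt (NY n * ((integral {x0..?X} (%x. 1 * (?g1 s x)^2) + integral {x0..?X} (%x. pot m n x * (?g s x)^2))
    + integral {x0..?X} (%x. 1 * (?h s x)^2)))) \<longlongrightarrow> sqrt (NY n * ((0 + 0) + 0))) (at t within {0..})"
   by (intro tendsto_intros tendsto_within_subset[OF l1] tendsto_within_subset[OF l2] tendsto_within_subset[OF l3]) auto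
  hence "((%s. sqrt (NY n * ((integral {x0..?X} (%x. 1 * (?g1 s x)^2) + integral {x0..?X} (%x. pot m n x * (?g s x)^2))
    + integral {x0..?X} (%x. 1 * (?h s x)^2)))) \<longlongrightarrow> 0) (at t within {0..})" by simp
  thus "((%s. energy_norm m x0 (?S s)) \<longlongrightarrow> 0) (at t within {0..})"
  proof (rule Lim_transform_eventually)
   have "\<forall>\<^sub>F s in at t within {0..}. s ~= t & s >= 0 & s < t + 1"
    unfolding eventually_at by (rule exI[of _ 1]) (auto simp: dist_real_def)
   thus "\<forall>\<^sub>F s in at t within {0..}. sqrt (NY n * ((integral {x0..?X} (%x. 1 * (?g1 s x)^2) + integral {x0..?X} (%x. pot m n x * (?g s x)^2))
    + integral {x0..?X} (%x. 1 * (?h s x)^2))) = energy_norm m x0 (?S s)"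
   proof eventually_elim
    case (elim s)
    have "integral {x0..?X} (%x. (?g1 s x)^2 + pot m n x * (?g s x)^2) = integral {x0..?X} (%x. (?g1 s x)^2) + integral {x0..?X} (%x. pot m n x * (?g s x)^2)"
     by (rule HK_add)
       (intro integrable_continuous_real continuous_intros cv pot_continuous m; use elim in simp)+
    thus ?case using en[of s] elim by simp
   qed
  qed
 qed
qed

section \<open>Powers of the generator\<close>

lemma core_funD:
 assumes "core_fun m n x0 g"
 shows "smooth g" "g x0 = 0" "x >= 0 ==> g x = 0" "has_d g (deriv g x) x"
  "has_d (deriv g) (deriv (deriv g) x) x" "continuous_on A g" "continuous_on A (deriv g)" "continuous_on A (deriv (deriv g))"
proof -
 have s: "smooth g" and z: "!!j. (Aop m n ^^ j) g x0 = 0" "!!j x. x >= 0 ==> (Aop m n ^^ j) g x = 0"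
  using assms by (auto simp: core_fun_def)
 show "smooth g" by fact
 show "g x0 = 0" "x >= 0 ==> g x = 0" using z(1)[of 0] z(2)[of x 0] by auto
 show "has_d g (deriv g x) x" "has_d (deriv g) (deriv (deriv g) x) x"
  "continuous_on A g" "continuous_on A (deriv g)" "continuous_on A (deriv (deriv g))"
  by (intro smooth_deriv(1) smooth_continuous smooth_intros s)+
qed

lemma core_fun_Aop: "m >= 1 ==> core_fun m n x0 g ==> core_fun m n x0 (Aop m n g)"
proof -
 assume m: "m >= 1" and g: "core_fun m n x0 g"
 have e: "(Aop m n ^^ j) (Aop m n g) = (Aop m n ^^ Suc j) g" for j by (simp add: funpow_swap1)
 show ?thesis using g smooth_Aop[OF m] unfolding core_fun_def e by blast
qed

lemma core_fun_pow: "m >= 1 ==> core_fun m n x0 g ==> core_fun m n x0 ((Aop m n ^^ j) g)"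
 by (induction j) (auto intro: core_fun_Aop)

text \<open>The generator exchanges the two components up to factors \<open>i\<close> and applies \<open>A\<close> to one profile;
  two applications act as \<open>A\<close>.\<close>
lemma mode_state_B:
 assumes m: "m >= 1" and n: "n >= 1" and x0: "x0 < 0" and U: "mode_state m n x0 U c g d h"
  and g: "core_fun m n x0 g" and h: "core_fun m n x0 h"
 shows "U : dom_B m x0" "mode_state m n x0 (B_op m x0 U) (\<i> * d) h (- \<i> * c) (Aop m n g)"
proof -
 obtain f s where fs: "U = (f, s)" by (cases U)
 have fm: "f : borel_measurable (volM m x0)" "AE p in volM m x0. f p = mode m n c g p"
  and sm: "s : borel_measurable (volM m x0)" "AE p in volM m x0. s p = mode m n d h p"
  using U by (auto simp: mode_state_def fs)
 note Dg = core_funD[OF g] and Dh = core_funD[OF h]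
 have lap: "has_laplacian m x0 f (mode m n c (%x. deriv (deriv g) x - pot m n x * g x))"
  by (rule has_laplacian_mode_state[OF m n fm Dg(4,5,8), where X=0]) (simp add: Dg)
 have "has_grad m x0 s (gmode m n d h (deriv h))"
  by (rule H1_0_mode[OF m n sm Dh(4,7) x0]) (simp_all add: Dh)
 moreover have "U : energy_space m x0"
  by (rule mode_state_energy(1)[OF m n U Dg(4,7) x0]) (simp_all add: Dg Dh)
 ultimately show "U : dom_B m x0" using lap unfolding dom_B_def H1_0_def fs by blast
 have "laplacian m x0 f : borel_measurable (volM m x0)"
  using laplacian_AE(1)[OF m lap] by (auto simp: has_laplacian_def in_L2_def)
 moreover have "AE p in volM m x0. \<i> * laplacian m x0 f p = mode m n (- \<i> * c) (Aop m n g) p"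
  using laplacian_AE(2)[OF m lap]
 proof eventually_elim
  case (elim p)
  show ?case unfolding elim by (simp add: mode_def Aop_def diff_divide_distrib algebra_simps)
 qed
 moreover have "AE p in volM m x0. \<i> * s p = mode m n (\<i> * d) h p"
  using sm(2) by eventually_elim (simp add: mode_def)
 ultimately show "mode_state m n x0 (B_op m x0 U) (\<i> * d) h (- \<i> * c) (Aop m n g)"
  using sm(1) unfolding mode_state_def B_op_def fs by simp
qed

lemma mode_state_dom_B_pow:
 assumes m: "m >= 1" and n: "n >= 1" and x0: "x0 < 0"
 shows "mode_state m n x0 U c g d h ==> core_fun m n x0 g ==> core_fun m n x0 h ==> U : dom_B_pow m x0 k"
proof (induction k arbitrary: U c g d h)
 case 0
 note Dg = core_funD[OF 0(2)] and Dh = core_funD[OF 0(3)]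
 have "U : energy_space m x0"
  by (rule mode_state_energy(1)[OF m n 0(1) Dg(4,7) x0]) (simp_all add: Dg Dh)
 thus ?case by simp
next
 case (Suc k)
 note B = mode_state_B[OF m n x0 Suc.prems]
 show ?case using B(1) Suc.IH[OF B(2) Suc.prems(3) core_fun_Aop[OF m Suc.prems(2)]] by simp
qed

lemma mode_state_B_pow:
 assumes m: "m >= 1" and n: "n >= 1" and x0: "x0 < 0" and U: "mode_state m n x0 U 1 w 0 w" and w: "core_fun m n x0 w"
 shows "mode_state m n x0 ((B_op m x0 ^^ (2 * j)) U) 1 ((Aop m n ^^ j) w) 0 ((Aop m n ^^ j) w)" (is ?even)
  "mode_state m n x0 ((B_op m x0 ^^ Suc (2 * j)) U) 0 ((Aop m n ^^ j) w) (- \<i>) ((Aop m n ^^ Suc j) w)" (is ?odd)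
proof -
 note wj = core_fun_pow[OF m w]
 have odd: "mode_state m n x0 ((B_op m x0 ^^ Suc (2 * j)) U) 0 ((Aop m n ^^ j) w) (- \<i>) ((Aop m n ^^ Suc j) w)"
  if "mode_state m n x0 ((B_op m x0 ^^ (2 * j)) U) 1 ((Aop m n ^^ j) w) 0 ((Aop m n ^^ j) w)" for j
  using mode_state_B(2)[OF m n x0 that wj wj] by simp
 show e: ?even
 proof (induction j)
  case (Suc j)
  have "(B_op m x0 ^^ (2 * Suc j)) U = B_op m x0 ((B_op m x0 ^^ Suc (2 * j)) U)" by simp
  moreover have "mode_state m n x0 (B_op m x0 ((B_op m x0 ^^ Suc (2 * j)) U)) 1 ((Aop m n ^^ Suc j) w) 0 (Aop m n ((Aop m n ^^ j) w))"
   using mode_state_B(2)[OF m n x0 odd[OF Suc.IH] wj wj[of "Suc j"]] by simp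
  ultimately show ?case by simp
 qed (use U in simp)
 show ?odd by (rule odd[OF e])
qed

lemma dirichlet_by_parts:
 assumes m: "m >= 1" and x0: "x0 < 0" and g: "core_fun m n x0 g"
 shows "integral {x0..0} (%x. (deriv g x)^2 + pot m n x * (g x)^2) = integral {x0..0} (%x. g x * Aop m n g x)"
proof -
 note D = core_funD[OF g]
 have "((%x. deriv g x * deriv g x + deriv (deriv g) x * g x) has_integral (g 0 * deriv g 0 - g x0 * deriv g x0)) {x0..0}"
  by (rule has_integral_deriv[OF less_imp_le[OF x0] DERIV_mult[OF D(4,5)]])
 moreover have "((%x. g x * Aop m n g x) has_integral integral {x0..0} (%x. g x * Aop m n g x)) {x0..0}"
  unfolding Aop_def by (intro integrable_integral integrable_continuous_real continuous_intros pot_continuous m D)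
 ultimately have "((%x. (deriv g x * deriv g x + deriv (deriv g) x * g x) + g x * Aop m n g x) has_integral
  (g 0 * deriv g 0 - g x0 * deriv g x0) + integral {x0..0} (%x. g x * Aop m n g x)) {x0..0}" by (rule has_integral_add)
 moreover have "(%x. (deriv g x * deriv g x + deriv (deriv g) x * g x) + g x * Aop m n g x) = (%x. (deriv g x)^2 + pot m n x * (g x)^2)"
  by (rule ext) (simp add: Aop_def power2_eq_square algebra_simps)
 ultimately show ?thesis using D(2) D(3)[of 0] by (simp add: integral_unique)
qed

text \<open>For \<open>k = 2j\<close> the energy norm of \<open>B^k U\<close> is the form \<open><A^j w, A^(j+1) w>\<close>, for
  \<open>k = 2j + 1\<close> it is the norm of \<open>A^(j+1) w\<close>; both are of order \<open>E^((k+1)/2)\<close>.\<close>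
lemma graph_norm_bound:
 assumes m: "m >= 1" and n: "n >= 1" and x0: "x0 < 0" and U: "mode_state m n x0 U 1 w 0 w" and w: "core_fun m n x0 w"
  and E: "E >= 1" and D: "!!j. D j >= 0" and N: "N >= 0"
  and b: "!!j. integral {x0..0} (%x. ((Aop m n ^^ j) w x)^2) <= D j * E ^ (2 * j) * N"
 shows "graph_norm m x0 k U <= ennreal ((sqrt (1 + D 0 + D 1) + sqrt (1 + D (k div 2) + D (Suc (k div 2)))) * sqrt (NY n * N) * sqrt (E ^ Suc k))"
proof -
 note wj = core_fun_pow[OF m w]
 have ac: "(d * a * r) * (d' * b * r) = (d * d') * ((a * b) * r^2)" for d a d' b r :: real
  by (simp add: power2_eq_square mult_ac)
 have sq: "(d * d') * (a^2 * r^2) <= ((1 + d + d') * a * r)^2" if "d >= 0" "d' >= 0" for d d' a r :: real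
 proof -
  have "d * d' <= (1 + d + d')^2" using that by (simp add: power2_eq_square algebra_simps)
  hence "(d * d') * (a * r)^2 <= (1 + d + d')^2 * (a * r)^2" by (rule mult_right_mono) simp
  thus ?thesis by (simp add: power_mult_distrib mult.assoc)
 qed
 have en: "energy_norm m x0 ((B_op m x0 ^^ k) U) <= sqrt (1 + D (k div 2) + D (Suc (k div 2))) * sqrt (NY n * N) * sqrt (E ^ Suc k)" for k
 proof -
  define j where "j = k div 2"
  let ?g = "(Aop m n ^^ j) w" and ?h = "(Aop m n ^^ Suc j) w"
  note Dg = core_funD[OF wj[of j]] and Dh = core_funD[OF wj[of "Suc j"]]
  have E0: "E >= 0" using E by simp
  have NY: "NY n >= 0" using NY_pos[of n] by simp
  have K: "1 + D j + D (Suc j) >= 0" using D[of j] D[of "Suc j"] by simp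
  have "energy_norm m x0 ((B_op m x0 ^^ k) U) <= sqrt (NY n * ((1 + D j + D (Suc j)) * E ^ Suc k * N))"
  proof (cases "even k")
   case True
   hence k: "k = 2 * j" by (simp add: j_def)
   have "energy_norm m x0 ((B_op m x0 ^^ k) U) = sqrt (NY n * ((cmod 1)^2 * integral {x0..0} (%x. (deriv ?g x)^2 + pot m n x * (?g x)^2)
     + (cmod 0)^2 * integral {x0..0} (%x. (?g x)^2)))"
    unfolding k
    by (rule mode_state_energy(2)[OF m n mode_state_B_pow(1)[OF m n x0 U w] Dg(4,7) x0]) (simp_all add: Dg)
   also have "... = sqrt (NY n * integral {x0..0} (%x. ?g x * ?h x))"
    using dirichlet_by_parts[OF m x0 wj[of j]] by simp
   also have "... <= sqrt (NY n * ((1 + D j + D (Suc j)) * E ^ Suc k * N))"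
   proof (intro real_sqrt_le_mono mult_left_mono NY)
    have "(integral {x0..0} (%x. ?g x * ?h x))^2 <= integral {x0..0} (%x. (?g x)^2) * integral {x0..0} (%x. (?h x)^2)"
     by (rule integral_Cauchy_Schwarz[OF Dg(6) Dh(6)])
    also have "... <= (D j * E ^ (2 * j) * N) * (D (Suc j) * E ^ (2 * Suc j) * N)"
    proof (rule mult_mono[OF b b])
     show "0 <= D j * E ^ (2 * j) * N" using D[of j] E0 N by simp
     show "0 <= integral {x0..0} (%x. (?h x)^2)"
      by (rule integral_nonneg[OF integrable_continuous_real[OF continuous_on_power[OF Dh(6)]]]) simp
    qed
    also have "... = (D j * D (Suc j)) * ((E ^ (2 * j) * E ^ (2 * Suc j)) * N^2)" by (rule ac)
    also have "E ^ (2 * j) * E ^ (2 * Suc j) = (E ^ Suc k)^2"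
    proof -
     have "2 * j + 2 * Suc j = Suc k * 2" by (simp add: k)
     thus ?thesis by (simp only: power_add[symmetric] power_mult[symmetric])
    qed
    also have "(D j * D (Suc j)) * ((E ^ Suc k)^2 * N^2) <= ((1 + D j + D (Suc j)) * E ^ Suc k * N)^2"
     by (rule sq[OF D D])
    finally show "integral {x0..0} (%x. ?g x * ?h x) <= (1 + D j + D (Suc j)) * E ^ Suc k * N"
     by (rule power2_le_imp_le) (intro mult_nonneg_nonneg K zero_le_power E0 N)
   qed
   finally show ?thesis .
  next
   case False
   hence k: "k = Suc (2 * j)" unfolding j_def by (metis odd_two_times_div_two_succ Suc_eq_plus1)
   have "energy_norm m x0 ((B_op m x0 ^^ k) U) = sqrt (NY n * ((cmod 0)^2 * integral {x0..0} (%x. (deriv ?g x)^2 + pot m n x * (?g x)^2)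
     + (cmod (- \<i>))^2 * integral {x0..0} (%x. (?h x)^2)))"
    unfolding k
    by (rule mode_state_energy(2)[OF m n mode_state_B_pow(2)[OF m n x0 U w] Dg(4,7) x0 _ _ Dh(6)])
      (use Dg(2,3) Dh(3) in auto)
   also have "... = sqrt (NY n * integral {x0..0} (%x. (?h x)^2))" by simp
   also have "... <= sqrt (NY n * ((1 + D j + D (Suc j)) * E ^ Suc k * N))"
   proof (intro real_sqrt_le_mono mult_left_mono NY)
    have "integral {x0..0} (%x. (?h x)^2) <= D (Suc j) * E ^ (2 * Suc j) * N" by (rule b)
    also have "... <= (1 + D j + D (Suc j)) * E ^ (2 * Suc j) * N"
     using D[of j] E0 N by (intro mult_right_mono) auto
    finally show "integral {x0..0} (%x. (?h x)^2) <= (1 + D j + D (Suc j)) * E ^ Suc k * N" by (simp add: k)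
   qed
   finally show ?thesis .
  qed
  moreover have "NY n * ((1 + D j + D (Suc j)) * E ^ Suc k * N) = (1 + D j + D (Suc j)) * (NY n * N) * E ^ Suc k"
   by (simp only: mult.assoc mult.left_commute mult.commute)
  ultimately have "energy_norm m x0 ((B_op m x0 ^^ k) U) <= sqrt ((1 + D j + D (Suc j)) * (NY n * N) * E ^ Suc k)" by (simp only:)
  thus ?thesis unfolding j_def real_sqrt_mult .
 qed
 have dom: "U : dom_B_pow m x0 k" by (rule mode_state_dom_B_pow[OF m n x0 U w w])
 have "energy_norm m x0 U <= sqrt (1 + D 0 + D 1) * sqrt (NY n * N) * sqrt (E ^ Suc k)"
 proof -
  have "energy_norm m x0 U <= sqrt (1 + D 0 + D 1) * sqrt (NY n * N) * sqrt (E ^ Suc 0)" using en[of 0] by simp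
  also have "... <= sqrt (1 + D 0 + D 1) * sqrt (NY n * N) * sqrt (E ^ Suc k)"
   using E NY_pos[of n] N D[of 0] D[of 1] by (intro mult_left_mono real_sqrt_le_mono power_increasing) auto
  finally show ?thesis .
 qed
 hence "energy_norm m x0 U + energy_norm m x0 ((B_op m x0 ^^ k) U)
  <= (sqrt (1 + D 0 + D 1) + sqrt (1 + D (k div 2) + D (Suc (k div 2)))) * sqrt (NY n * N) * sqrt (E ^ Suc k)"
  using en[of k] by (simp add: algebra_simps)
 thus ?thesis using dom by (simp add: graph_norm_def ennreal_leI)
qed

section \<open>Local energy and lower bound of the quotient\<close>

text \<open>Of the gradient only the angular part on \<open>x0 < x <= 0\<close> is kept; for a quasimode it controls \<open>E
  v^2\<close>.\<close>
lemma local_energy_mode: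
 assumes m: "m >= 1" and n: "n >= 1" and x0: "x0 < 0" and R: "R > 0" and W: "c2_wave (pot m n) x0 w v vt vx vtt vtx vxx" and t: "t >= 0"
 shows "1 / 2 * NY n * (integral {x0..0} (%x. (vt t x)^2) + integral {x0..0} (%x. Lam n / (warp m x)^2 * (v t x)^2))
  <= local_energy m x0 R (mode m n 1 (v t)) (mode m n 1 (vt t))"
proof -
 note D = c2_waveD[OF W]
 have cv: "continuous_on A (v s)" "continuous_on A (vt s)" "continuous_on A (vx s)" for A s
  by (rule continuous_on_subset[OF cont_slice[OF D(7)] subset_UNIV] continuous_on_subset[OF cont_slice[OF D(8)] subset_UNIV]
    continuous_on_subset[OF cont_slice[OF D(9)] subset_UNIV])+
 let ?f = "mode m n 1 (v t)" and ?s = "mode m n 1 (vt t)" and ?G = "gmode m n 1 (v t) (vx t)"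
 have grad_v: "has_grad m x0 ?f ?G"
  by (rule H1_0_mode[OF m n mode_measurable[OF m cv(1)] _ D(4) cv(3), where X="t + 1"]) (use t x0 D(14)[OF t] D(17)[OF t] in auto)
 note wg = weak_grad_AE[OF m grad_v]
 have meas: "weak_grad m x0 ?f : borel_measurable (volM m x0)" "?G : borel_measurable (volM m x0)"
  using wg(1) grad_v by (auto simp: has_grad_def in_L2_def)
 have sub: "{x0<..R} \<subseteq> {x0<..}" "{x0<..0} \<subseteq> {x0<..R}" using R by auto
 have mR: "weak_grad m x0 ?f : borel_measurable (vol m {x0<..R})" "?G : borel_measurable (vol m {x0<..R})" "?s : borel_measurable (vol m {x0<..R})"
  using measurable_vol_mono[OF sub(1) meas(1)] measurable_vol_mono[OF sub(1) meas(2)] mode_measurable[OF m cv(2)] by auto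
 have AE: "AE p in vol m {x0<..R}. weak_grad m x0 ?f p = ?G p" by (rule AE_vol_mono[OF m _ _ sub(1) wg(2)]) auto
 let ?F = "%p. (cmod (?s p))^2 + (norm (?G p))^2"
 have s_eq: "(cmod (?s p))^2 = (vt t (fst p) / warp m (fst p))^2 * (cmod (Yl n (snd p)))^2" for p
  by (simp add: mode_norm_sq)
 have ch: "continuous_on {x0..X} (%x. (vt t x / warp m x)^2)" for X
  using m by (intro continuous_intros cv warp_continuous) auto
 have cY: "continuous_on S2 (%\<omega>. (cmod (Yl n \<omega>))^2)" by (intro continuous_intros continuous_Yl)
 have s_int: "integrable (vol m {x0<..X}) (%p. (cmod (?s p))^2)" if "x0 <= X" for X
  unfolding s_eq by (rule integral_product(2)[OF m that ch cY])
 have iF: "integrable (vol m {x0<..X}) ?F" if "x0 <= X" for X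
  by (intro BI_integrable_add s_int that integral_gmode(2)[OF m n that cv(1,3)])
 have "(\<integral>p. ?F p \<partial>vol m {x0<..0}) = (\<integral>p. indicator ({x0<..0} \<times> S2) p *\<^sub>R ?F p \<partial>vol m {x0<..R})"
  by (rule integral_vol_mono(1)[OF m _ _ sub(2)]) auto
 also have "... <= (\<integral>p. ?F p \<partial>vol m {x0<..R})"
 proof (rule integral_mono)
  have b: "{x0<..R} : sets borel" "{x0<..0} : sets borel" by auto
  show "integrable (vol m {x0<..R}) (%p. indicator ({x0<..0} \<times> S2) p *\<^sub>R ?F p)"
   using integral_vol_mono(2)[OF m b sub(2), of ?F] iF[of 0] x0 by auto
  show "integrable (vol m {x0<..R}) ?F" using iF[of R] x0 R by auto
 qed (auto simp: indicator_def)
 also have "... = (\<integral>p. (cmod (?s p))^2 + (norm (weak_grad m x0 ?f p))^2 \<partial>vol m {x0<..R})"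
 proof (rule integral_cong_AE)
  show "AE p in vol m {x0<..R}. ?F p = (cmod (?s p))^2 + (norm (weak_grad m x0 ?f p))^2" using AE by eventually_elim simp
 qed (use mR in auto)
 finally have le: "(\<integral>p. ?F p \<partial>vol m {x0<..0}) <= 2 * local_energy m x0 R ?f ?s" by (simp add: local_energy_def)
 have x00: "x0 <= 0" using x0 by simp
 have F_eq: "(\<integral>p. ?F p \<partial>vol m {x0<..0}) = (\<integral>p. (cmod (?s p))^2 \<partial>vol m {x0<..0}) + (\<integral>p. (norm (?G p))^2 \<partial>vol m {x0<..0})"
  by (intro BI_integral_add s_int x00 integral_gmode(2)[OF m n x00 cv(1,3)])
 have s_norm: "(\<integral>p. (cmod (?s p))^2 \<partial>vol m {x0<..0}) = NY n * integral {x0..0} (%x. (vt t x)^2)"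
 proof -
  have "(warp m x)^2 * (vt t x / warp m x)^2 = (vt t x)^2" for x using m by (simp add: power_divide)
  thus ?thesis unfolding s_eq integral_product(1)[OF m x00 ch cY] NY_def by simp
 qed
 have "(\<integral>p. (norm (?G p))^2 \<partial>vol m {x0<..0}) >= NY n * integral {x0..0} (%x. Lam n / (warp m x)^2 * (v t x)^2)"
 proof -
  have "integral {x0..0} (%x. (vx t x - v t x * adot m x / warp m x)^2) >= 0"
   by (intro integral_nonneg integrable_continuous_real continuous_intros cv adot_continuous warp_continuous) (use m in auto)
  thus ?thesis unfolding integral_gmode(1)[OF m n x00 cv(1,3)] using NY_pos[of n] by (simp add: distrib_left)
 qed
 hence "NY n * (integral {x0..0} (%x. (vt t x)^2) + integral {x0..0} (%x. Lam n / (warp m x)^2 * (v t x)^2))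
   <= 2 * local_energy m x0 R ?f ?s"
  using le F_eq s_norm unfolding distrib_left by linarith
 thus ?thesis by simp
qed

lemma wave_of_core_fun:
 assumes m: "m >= 1" and x0: "x0 < 0" and w: "core_fun m n x0 w"
 obtains v vt vx vtt vtx vxx where "c2_wave (pot m n) x0 w v vt vx vtt vtx vxx"
proof -
 note D = core_funD[OF w]
 have s2: "smooth (deriv (deriv w))" by (intro smooth_intros D)
 have "(Aop m n ^^ 1) w x0 = 0" using w unfolding core_fun_def by blast
 hence w2: "deriv (deriv w) x0 = 0" using D(2) by (simp add: Aop_def)
 have b: "\<bar>pot m n x\<bar> <= Lam n + (2 * real m - 1)" for x
 proof -
  have "0 <= Lam n * inverse ((warp m x)^2)" "Lam n * inverse ((warp m x)^2) <= Lam n * 1"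
   by (rule mult_nonneg_nonneg[OF Lam_ge(2) less_imp_le[OF nu_bounds(1)[OF m]]], rule mult_left_mono[OF nu_bounds(2)[OF m] Lam_ge(2)])
  thus ?thesis using curv_bounds[OF m, of x] by (simp add: pot_eq)
 qed
 show ?thesis
  by (rule wave_exists[OF smooth_deriv(1)[OF smooth_pot[OF m]] smooth_continuous[OF smooth_deriv(2)[OF smooth_pot[OF m]]] b
    D(4,5) smooth_deriv(1)[OF s2] D(2) w2 less_imp_le[OF x0] D(3) that])
qed

lemma initial_datum_mode:
 assumes m: "m >= 1" and x0: "x0 < 0" and R: "R > 0" and w: "core_fun m n x0 w"
 shows "initial_datum x0 R (mode m n 1 w)"
proof -
 note D = core_funD[OF w]
 have "{p : {x0..} \<times> S2. mode m n 1 w p ~= 0} \<subseteq> {x0..0} \<times> S2"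
 proof
  fix p assume p: "p : {p : {x0..} \<times> S2. mode m n 1 w p ~= 0}"
  hence "fst p < 0" using D(3)[of "fst p"] by (cases "fst p >= 0") (auto simp: mode_def)
  thus "p : {x0..0} \<times> S2" using p by (cases p) auto
 qed
 hence "supp_M x0 (mode m n 1 w) \<subseteq> {x0..0} \<times> S2"
  unfolding supp_M_def by (rule closure_minimal) (intro closed_Times closed_atLeastAtMost closed_sphere)
 hence "supp_M x0 (mode m n 1 w) \<subseteq> {x0..<R} \<times> S2" using R by fastforce
 moreover have "smooth_on_M x0 (mode m n 1 w)"
  unfolding smooth_on_M_def by (rule exI[of _ UNIV], rule exI[of _ "mode m n 1 w"]) (auto intro!: C_k_mode[OF m smoothD[OF D(1)]])
 moreover have "mode m n 1 w (x0, \<omega>) = 0" for \<omega> using D(2) by (simp add: mode_def)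
 ultimately show ?thesis by (simp add: initial_datum_def)
qed

lemma initial_datum_zero: "initial_datum x0 R (%_. 0)"
 unfolding initial_datum_def smooth_on_M_def supp_M_def by (auto intro!: exI[of _ UNIV] exI[of _ "%_. 0"])

lemma mode_nonzero:
 assumes m: "m >= 1" and I: "0 < integral {x0..0} (%x. (w x)^2)"
 shows "\<exists>p\<in>{x0..} \<times> S2. mode m n 1 w p ~= 0"
proof -
 have "\<exists>x\<in>{x0..0}. w x ~= 0"
 proof (rule ccontr)
  assume "\<not> (\<exists>x\<in>{x0..0}. w x ~= 0)"
  hence "integral {x0..0} (%x. (w x)^2) = integral {x0..0} (%x. 0)"
   by (intro HK_cong) auto
  thus False using I by simp
 qed
 then obtain x where x: "x : {x0..0}" "w x ~= 0" by blast
 have "Yl n (axis 1 1) = 1" by (simp add: Yl_def zz_def axis_def)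
 hence "mode m n 1 w (x, axis 1 1) ~= 0" using x m by (simp add: mode_def)
 moreover have "(x, axis 1 1) : {x0..} \<times> S2" using x by simp
 ultimately show ?thesis by blast
qed

lemma ennreal_divide_antimono:
 assumes "y <= ennreal G" "a >= 0" "G > 0"
 shows "ennreal (a / G) <= ennreal a / y"
proof -
 obtain g where g: "g >= 0" "y = ennreal g" using assms(1) by (cases y) (auto simp: top_unique)
 show ?thesis
 proof (cases "g = 0")
  case True
  thus ?thesis using g assms(2) by (cases "a = 0") (auto simp: ennreal_eq_0_iff)
 next
  case False
  hence gp: "g > 0" using g by simp
  have "g <= G" using assms g by (simp add: ennreal_le_iff)
  hence "a / G <= a / g" using gp assms by (intro divide_left_mono) auto
  thus ?thesis using g gp assms by (simp add: divide_ennreal ennreal_leI)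
 qed
qed

lemma Limsup_at_top_ge:
 fixes f :: "real => ennreal"
 assumes "!!T. \<exists>t\<ge>T. C <= f t"
 shows "C <= Limsup at_top f"
 unfolding Limsup_def
proof (rule INF_greatest)
 fix P assume "P : {P. eventually P (at_top :: real filter)}"
 then obtain T where T: "!!t. t >= T ==> P t" by (auto simp: eventually_at_top_linorder)
 obtain t where "t >= T" "C <= f t" using assms by blast
 thus "C <= Sup (f ` Collect P)" using T by (intro SUP_upper2[of t]) auto
qed

theorem theorem2:
  fixes m k :: nat and x0 R :: real
  assumes "m \<ge> 1" and "x0 < 0" and "R > 0"
  shows "Limsup at_top (\<lambda>t::real.
           ennreal (ln t ^ k) *
           (SUP (u0, u1, u, ut) \<in> data_solutions m x0 R.
              ennreal (sqrt (local_energy m x0 R (u t) (ut t))) / graph_norm m x0 k (u0, u1))) > 0"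
 (is "Limsup at_top ?f > 0")
proof -
 note m = assms(1) and x0 = assms(2) and R = assms(3)
 obtain c C :: real and D :: "nat => real" and N0 where c: "c > 0" and C: "C >= 0" and N0: "N0 >= 1" and D: "ALL j. D j >= 0"
  and qm: "\<forall>n\<ge>N0. EX E w. quasimode m x0 c C D n E w"
  by (rule quasimodes[OF m x0])
 define q where "q = inverse ((warp m x0)^2)"
 have q: "q > 0" "q <= 1" using nu_bounds[OF m, of x0] by (auto simp: q_def)
 define K where "K = sqrt (1 + D 0 + D 1) + sqrt (1 + D (k div 2) + D (Suc (k div 2)))"
 have Dpos: "1 + D i + D j > 0" for i j using D[rule_format, of i] D[rule_format, of j] by linarith
 have K: "K > 0" unfolding K_def by (rule add_pos_pos) (rule real_sqrt_gt_zero, rule Dpos)+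
 (* with Lam n <= (3 n)^2 this is a lower bound of (ln t)^k times the quotient at ln t = c n / 4 *)
 define \<kappa> where "\<kappa> = (c / 12) ^ k * (sqrt q / (2 * K))"
 have \<kappa>: "\<kappa> > 0" using c q K by (simp add: \<kappa>_def)
 have main: "ennreal \<kappa> <= ?f (exp (c * real n / 4))" if n: "n >= N0" "4 * sqrt C * sqrt (D 1 / q) <= c * real n / 4" for n
 proof -
  have n1: "n >= 1" using n N0 by simp
  obtain E w where "quasimode m x0 c C D n E w" using qm n(1) by blast
  hence cf: "core_fun m n x0 w" and E: "E <= Lam n" "1 <= E" and I: "0 < integral {x0..0} (%x. (w x)^2)"
   and A: "!!j. integral {x0..0} (%x. ((Aop m n ^^ j) w x)^2) <= D j * E ^ (2 * j) * integral {x0..0} (%x. (w x)^2)"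
   and e: "integral {x0..0} (%x. (Aop m n w x - E * w x)^2) <= C * exp (- c * real n) * integral {x0..0} (%x. (w x)^2)"
   unfolding quasimode_def by blast+
  note Dw = core_funD[OF cf]
  define N where "N = integral {x0..0} (%x. (w x)^2)"
  have N: "N > 0" using I by (simp add: N_def)
  obtain v vt vx vtt vtx vxx where W: "c2_wave (pot m n) x0 w v vt vx vtt vtx vxx" by (rule wave_of_core_fun[OF m x0 cf])
  note DW = c2_waveD[OF W]
  define t where "t = exp (c * real n / 4)"
  (* the error of the quasimode; the time exp (c n / 4) leaves a factor exp (- c n / 4) to spare *)
  define \<delta> where "\<delta> = sqrt C * exp (- c * real n / 2)"
  have t0: "t >= 0" by (simp add: t_def)
  have \<delta>: "\<delta> >= 0" "\<delta>^2 = C * exp (- c * real n)"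
   using C by (auto simp: \<delta>_def power_mult_distrib exp_double[symmetric])
  have small: "4 * t * \<delta> * sqrt (D 1 / q) <= 1"
  proof -
   have "4 * t * \<delta> * sqrt (D 1 / q) = (4 * sqrt C * sqrt (D 1 / q)) * (exp (c * real n / 4) * exp (- c * real n / 2))"
    by (simp add: t_def \<delta>_def)
   also have "exp (c * real n / 4) * exp (- c * real n / 2) = exp (- (c * real n / 4))" by (simp add: exp_add[symmetric])
   also have "(4 * sqrt C * sqrt (D 1 / q)) * exp (- (c * real n / 4)) <= exp (c * real n / 4) * exp (- (c * real n / 4))"
   proof (rule mult_right_mono)
    show "4 * sqrt C * sqrt (D 1 / q) <= exp (c * real n / 4)" using n(2) exp_ge_add_one_self[of "c * real n / 4"] by linarith
   qed simp
   also have "... = 1" by (rule exp_minus_inverse)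
   finally show ?thesis .
  qed
  have pq: "Lam n / (warp m x)^2 >= q * E" if "x : {x0..0}" for x
  proof -
   have "q <= inverse ((warp m x)^2)" using nu_le[OF m, of "- x" "- x0"] that even_warp(1)[of m x] even_warp(1)[of m x0] by (simp add: q_def)
   hence "q * E <= inverse ((warp m x)^2) * Lam n" using q E by (intro mult_mono) auto
   thus ?thesis by (simp add: divide_inverse mult.commute)
  qed
  have pn: "pot m n x >= 0" for x
   using curv_bounds[OF m, of x] Lam_ge(2)[of n] by (simp add: pot_def)
  have low: "E * N / 2 <= E * integral {x0..0} (%x. (v t x)^2) + integral {x0..0} (%x. (vt t x)^2)"
  proof (rule wave_lower_bound[OF W pot_continuous[OF m] pn x0 _ q(1) E(2) Dw(4,5,8,2,3) N_def N])
   show "q * E <= pot m n x" if "x : {x0..0}" for x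
    using pq[OF that] curv_bounds(1)[OF m, of x] by (simp add: pot_def)
   show "integral {x0..0} (%x. (pot m n x * w x - deriv (deriv w) x)^2) <= D 1 * E^2 * N"
    using A[of 1] by (simp add: N_def Aop_def)
   show "integral {x0..0} (%x. (pot m n x * w x - deriv (deriv w) x - E * w x)^2) <= \<delta>^2 * N"
    using e by (simp add: N_def Aop_def \<delta>(2))
  qed (use D \<delta>(1) t0 small in auto)
  let ?u = "%t. mode m n 1 (v t)" and ?ut = "%t. mode m n 1 (vt t)"
  have cv: "continuous_on A (v t)" for A by (rule continuous_on_subset[OF cont_slice[OF DW(7)] subset_UNIV])
  have NY: "NY n > 0" by (rule NY_pos)
  have loc: "NY n * q * E * N / 4 <= local_energy m x0 R (?u t) (?ut t)"
  proof -
   have "q * E * integral {x0..0} (%x. (v t x)^2) = integral {x0..0} (%x. q * E * (v t x)^2)" by simp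
   also have "... <= integral {x0..0} (%x. Lam n / (warp m x)^2 * (v t x)^2)"
   proof (rule integral_le)
    show "(%x. q * E * (v t x)^2) integrable_on {x0..0}" "(%x. Lam n / (warp m x)^2 * (v t x)^2) integrable_on {x0..0}"
     by (intro integrable_continuous_real continuous_intros cv warp_continuous m; use m in simp)+
    show "q * E * (v t x)^2 <= Lam n / (warp m x)^2 * (v t x)^2" if "x : {x0..0}" for x
     by (intro mult_right_mono pq that) simp
   qed
   finally have v1: "q * (E * integral {x0..0} (%x. (v t x)^2)) <= integral {x0..0} (%x. Lam n / (warp m x)^2 * (v t x)^2)"
    by (simp only: mult.assoc)
   have "integral {x0..0} (%x. (vt t x)^2) >= 0"
    by (intro integral_nonneg integrable_continuous_real continuous_on_power continuous_on_subset[OF cont_slice[OF DW(8)] subset_UNIV]) simp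
   hence v2: "q * integral {x0..0} (%x. (vt t x)^2) <= integral {x0..0} (%x. (vt t x)^2)" using mult_right_mono[OF q(2)] by simp
   have "q * (E * N / 2) <= q * (E * integral {x0..0} (%x. (v t x)^2) + integral {x0..0} (%x. (vt t x)^2))"
    using low q by (intro mult_left_mono) auto
   hence "q * (E * N / 2) <= integral {x0..0} (%x. (vt t x)^2) + integral {x0..0} (%x. Lam n / (warp m x)^2 * (v t x)^2)"
    using v1 v2 unfolding distrib_left by linarith
   hence "1 / 2 * NY n * (q * (E * N / 2)) <= 1 / 2 * NY n * (integral {x0..0} (%x. (vt t x)^2) + integral {x0..0} (%x. Lam n / (warp m x)^2 * (v t x)^2))"
    using NY by (intro mult_left_mono) auto
   also have "... <= local_energy m x0 R (?u t) (?ut t)" by (rule local_energy_mode[OF m n1 x0 R W t0])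
   finally show ?thesis by (simp add: mult_ac)
  qed
  have mem: "(mode m n 1 w, %_. 0, ?u, ?ut) : data_solutions m x0 R"
   unfolding data_solutions_def
   using initial_datum_mode[OF m x0 R cf] initial_datum_zero mode_nonzero[OF m I] wave_solution_mode[OF m n1 x0 W] by auto
  define a where "a = sqrt (NY n * N) * sqrt E * (sqrt q / 2)"
  define G where "G = K * sqrt (NY n * N) * sqrt (E ^ Suc k)"
  have a0: "a >= 0" using NY N E q by (simp add: a_def)
  have G0: "G > 0" using K NY N E by (simp add: G_def)
  have aloc: "a <= sqrt (local_energy m x0 R (?u t) (?ut t))"
  proof -
   have "a^2 = NY n * q * E * N / 4" using NY N E q by (simp add: a_def power_mult_distrib power_divide)
   hence "a = sqrt (NY n * q * E * N / 4)" using a0 by (metis real_sqrt_abs abs_of_nonneg)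
   thus ?thesis using loc by simp
  qed
  have st: "mode_state m n x0 (mode m n 1 w, %_. 0) 1 w 0 w"
   using mode_measurable[OF m Dw(6)] by (auto simp: mode_state_def mode_def[of m n 0])
  have gn: "graph_norm m x0 k (mode m n 1 w, %_. 0) <= ennreal G"
   unfolding G_def K_def
   by (rule graph_norm_bound[OF m n1 x0 st cf E(2)]) (use D A N in "auto simp: N_def")
  have aG: "sqrt q / (2 * K) / (3 * real n) ^ k <= a / G"
  proof -
   have "E ^ k <= ((3 * real n)^2) ^ k"
   proof (rule power_mono)
    have "real n <= (real n)^2" using n1 by (simp add: power2_eq_square)
    hence "Lam n <= (3 * real n)^2" by (simp add: Lam_def power2_eq_square algebra_simps)
    thus "E <= (3 * real n)^2" using E by linarith
   qed (use E in simp)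
   also have "... = ((3 * real n) ^ k)^2" by (simp only: power_mult[symmetric] mult.commute)
   finally have "sqrt (E ^ k) <= (3 * real n) ^ k" by (rule real_le_lsqrt[rotated]) simp
   moreover have "sqrt (E ^ k) > 0" using E by simp
   ultimately have "sqrt q / (2 * K) / (3 * real n) ^ k <= sqrt q / (2 * K) / sqrt (E ^ k)"
    using q K n1 by (intro divide_left_mono) auto
   also have "... = a / G"
   proof -
    have "s * r * (p / 2) / (K * s * (r * y)) = p / (2 * K) / y" if "s > 0" "r > 0" for s r p y :: real
     using that by simp
    from this[of "sqrt (NY n * N)" "sqrt E" "sqrt q" "sqrt (E ^ k)"] show ?thesis
     using NY N E by (simp add: a_def G_def real_sqrt_mult)
   qed
   finally show ?thesis .
  qed
  have "\<kappa> = (c * real n / 4) ^ k * (sqrt q / (2 * K) / (3 * real n) ^ k)"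
  proof -
   have "c / 12 = (c * real n / 4) / (3 * real n)" using n1 by simp
   thus ?thesis unfolding \<kappa>_def by (simp only: power_divide) simp
  qed
  also have "... <= (c * real n / 4) ^ k * (a / G)" using aG c by (intro mult_left_mono) auto
  finally have "ennreal \<kappa> <= ennreal ((c * real n / 4) ^ k * (a / G))" by (rule ennreal_leI)
  also have "... = ennreal (ln t ^ k) * ennreal (a / G)"
   unfolding t_def ln_exp by (rule ennreal_mult) (use c a0 G0 in auto)
  also have "... <= ennreal (ln t ^ k) * (ennreal (sqrt (local_energy m x0 R (?u t) (?ut t))) / graph_norm m x0 k (mode m n 1 w, %_. 0))"
  proof (rule mult_left_mono)
   have "ennreal (a / G) <= ennreal a / graph_norm m x0 k (mode m n 1 w, %_. 0)" by (rule ennreal_divide_antimono[OF gn a0 G0])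
   also have "... <= ennreal (sqrt (local_energy m x0 R (?u t) (?ut t))) / graph_norm m x0 k (mode m n 1 w, %_. 0)"
    by (rule divide_right_mono_ennreal[OF ennreal_leI[OF aloc]])
   finally show "ennreal (a / G) <= ennreal (sqrt (local_energy m x0 R (?u t) (?ut t))) / graph_norm m x0 k (mode m n 1 w, %_. 0)" .
  qed simp
  also have "... <= ?f t"
   by (rule mult_left_mono[OF SUP_upper2[OF mem]]) simp_all
  finally show ?thesis by (simp only: t_def)
 qed
 have "ennreal \<kappa> <= Limsup at_top ?f"
 proof (rule Limsup_at_top_ge)
  fix T :: real
  obtain n1 :: nat where n1: "4 / c * max T (4 * sqrt C * sqrt (D 1 / q)) <= real n1" using real_arch_simple by blast
  define n where "n = max N0 n1"
  have "4 / c * max T (4 * sqrt C * sqrt (D 1 / q)) <= real n" using n1 by (simp add: n_def)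
  hence b: "max T (4 * sqrt C * sqrt (D 1 / q)) <= c * real n / 4" using c by (simp add: field_simps)
  have "T <= exp (c * real n / 4)" using b exp_ge_add_one_self[of "c * real n / 4"] by linarith
  moreover have "ennreal \<kappa> <= ?f (exp (c * real n / 4))" by (rule main) (use b in "auto simp: n_def")
  ultimately show "\<exists>t\<ge>T. ennreal \<kappa> <= ?f t" by blast
 qed
 moreover have "0 < ennreal \<kappa>" using \<kappa> by simp
 ultimately show ?thesis by (rule less_le_trans[rotated])
qed

end
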